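(* Let $\pi_1,\pi_2$ be Hecke-Maass cusp forms for $SL(3,\mathbb{Z})$ with normalized Fourier coefficients $A_{\pi_1}(m,n)$, $A_{\pi_2}(m,n)$, and let $f$ be a holomorphic or Hecke-Maass cusp form for $SL(2,\mathbb{Z})$ with normalized Fourier coefficients $\lambda_f(n)$. Let $W_1,W_2$ be fixed smooth compactly supported functions, and for $H,X>0$ put $$\mathcal{D}(H,X)=\frac1H\sum_{h=1}^\infty \lambda_f(h)\,W_1\!\left(\frac hH\right)\sum_{n=1}^\infty A_{\pi_1}(1,n)\,A_{\pi_2}(1,n+h)\,W_2\!\left(\frac nX\right).$$ Then for any $\epsilon>0$, any $\delta>0$ and any $H$ with $X^{1/2+\delta}\le H<X^{1-\epsilon}$, we have $$\mathcal{D}(H,X)\ll X^{1-\delta+\epsilon},$$ where the implied constant depends only on $\pi_1,\pi_2,f,\epsilon$ (and on the fixed functions $W_1,W_2$).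
   Context: $\pi_1$ and $\pi_2$ are not necessarily distinct. The coefficients $A_\pi(m,n)$ of a Hecke-Maass cusp form $\pi$ for $SL(3,\mathbb{Z})$ are the usual Fourier-Whittaker coefficients normalized so that $A_\pi(1,1)=1$; thus the standard $L$-function is $L(s,\pi)=\sum_{n\ge1}A_\pi(1,n)n^{-s}$ for $\Re s>1$. The normalized coefficients $\lambda_f(n)$ are those for which $L(s,f)=\sum_{n\geq 1}\lambda_f(n)n^{-s}$ has functional equation relating $s$ and $1-s$: for holomorphic $f$ of weight $k$, $f(z)=\sum_{n\ge1}\lambda_f(n)n^{(k-1)/2}e^{2\pi i nz}$; for a Hecke-Maass form of Laplace eigenvalue $\frac14+t^2$, $f(x+iy)=\sqrt y\sum_{n\ne0}\lambda_f(n)K_{it}(2\pi|n|y)e^{2\pi i nx}$ with $\lambda_f(1)=1$. *)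

theory Defs
  imports "HOL-Analysis.Analysis"
begin

text \<open>Conventions follow D. Goldfeld, \<^emph>\<open>Automorphic Forms and L-Functions for the Group
  GL(n,R)\<close>, specialised to level one and degree two or three.\<close>

section \<open>Smooth functions\<close>

primrec Ck_on :: "nat \<Rightarrow> 'a::real_normed_vector set \<Rightarrow> ('a \<Rightarrow> 'b::real_normed_vector) \<Rightarrow> bool" where
  "Ck_on 0 S f \<longleftrightarrow> continuous_on S f"
| "Ck_on (Suc k) S f \<longleftrightarrow> (\<forall>x\<in>S. f differentiable (at x)) \<and>
     (\<forall>v. Ck_on k S (\<lambda>x. frechet_derivative f (at x) v))"

text \<open>Only meaningful for open \<open>S\<close>.\<close>

definition smooth_on :: "'a::real_normed_vector set \<Rightarrow> ('a \<Rightarrow> 'b::real_normed_vector) \<Rightarrow> bool" where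
  "smooth_on S f \<longleftrightarrow> (\<forall>k. Ck_on k S f)"

definition test_function :: "(real \<Rightarrow> complex) \<Rightarrow> bool" where
  "test_function W \<longleftrightarrow> smooth_on UNIV W \<and> compact (closure {x. W x \<noteq> 0})"

definition e2pi :: "complex \<Rightarrow> complex" where
  "e2pi z = exp (2 * of_real pi * \<i> * z)"

section \<open>The group GL(3,R) and the generalized upper half-plane\<close>

type_synonym mat3 = "real^3^3"

definition GL3 :: "mat3 set" where
  "GL3 = {g. det g \<noteq> 0}"

definition SL3Z :: "mat3 set" where
  "SL3Z = {g. det g = 1 \<and> (\<forall>i j. g $ i $ j \<in> \<int>)}"

definition unip3 :: "real \<Rightarrow> real \<Rightarrow> real \<Rightarrow> mat3" where
  "unip3 x1 x2 x3 = vector [vector [1, x2, x3], vector [0, 1, x1], vector [0, 0, 1]]"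

definition diag3 :: "real \<Rightarrow> real \<Rightarrow> mat3" where
  "diag3 y1 y2 = vector [vector [y1 * y2, 0, 0], vector [0, y1, 0], vector [0, 0, 1]]"

text \<open>By the Iwasawa decomposition every coset in the quotient of \<open>GL(3,R)\<close> by
  \<open>O(3) R\<^sup>\<times>\<close> has exactly one representative \<open>iwasawa p\<close> with \<open>p \<in> half_space3\<close>.\<close>

type_synonym coords3 = "real \<times> real \<times> real \<times> real \<times> real"

definition half_space3 :: "coords3 set" where
  "half_space3 = {(x1, x2, x3, y1, y2). y1 > 0 \<and> y2 > 0}"

definition iwasawa :: "coords3 \<Rightarrow> mat3" where
  "iwasawa = (\<lambda>(x1, x2, x3, y1, y2). unip3 x1 x2 x3 ** diag3 y1 y2)"

definition SL3Z_equiv :: "coords3 \<Rightarrow> coords3 \<Rightarrow> bool" where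
  "SL3Z_equiv p q \<longleftrightarrow> (\<exists>\<gamma>\<in>SL3Z. \<exists>k r. orthogonal_matrix k \<and> r \<noteq> 0 \<and>
     \<gamma> ** iwasawa p = r *\<^sub>R (iwasawa q ** k))"

definition fundamental_domain3 :: "coords3 set \<Rightarrow> bool" where
  "fundamental_domain3 F \<longleftrightarrow> F \<in> sets borel \<and> F \<subseteq> half_space3 \<and>
     (\<forall>p\<in>half_space3. \<exists>!q. q \<in> F \<and> SL3Z_equiv p q)"

text \<open>Square-integrability modulo \<open>SL(3,Z)\<close> for the invariant measure
  \<open>dx1 dx2 dx3 dy1 dy2 / (y1 y2)\<^sup>3\<close>. The choice of fundamental domain is immaterial.\<close>

definition square_integrable3 :: "(mat3 \<Rightarrow> complex) \<Rightarrow> bool" where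
  "square_integrable3 \<phi> \<longleftrightarrow> (\<exists>F. fundamental_domain3 F \<and>
     (\<integral>\<^sup>+ p. indicator F p * (case p of (x1, x2, x3, y1, y2) \<Rightarrow>
        ennreal ((norm (\<phi> (iwasawa p)))\<^sup>2 / (y1 ^ 3 * y2 ^ 3))) \<partial>lborel) < \<infinity>)"

section \<open>Bi-invariant differential operators\<close>

text \<open>Functions on \<open>GL(3,R)\<close> are total functions on matrices; their values outside \<open>GL3\<close> are
  never used. The curve \<open>g (1 + t \<alpha>)\<close> has the same tangent at \<open>t = 0\<close> as \<open>g exp(t \<alpha>)\<close>.\<close>

definition lie_deriv3 :: "mat3 \<Rightarrow> (mat3 \<Rightarrow> complex) \<Rightarrow> mat3 \<Rightarrow> complex" where
  "lie_deriv3 \<alpha> F g = vector_derivative (\<lambda>t. F (g ** (mat 1 + t *\<^sub>R \<alpha>))) (at 0)"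

inductive_set diff_ops3 :: "((mat3 \<Rightarrow> complex) \<Rightarrow> mat3 \<Rightarrow> complex) set" where
  lie: "lie_deriv3 \<alpha> \<in> diff_ops3"
| scal: "(\<lambda>F g. c * F g) \<in> diff_ops3"
| plus: "D \<in> diff_ops3 \<Longrightarrow> D' \<in> diff_ops3 \<Longrightarrow> (\<lambda>F g. D F g + D' F g) \<in> diff_ops3"
| compose: "D \<in> diff_ops3 \<Longrightarrow> D' \<in> diff_ops3 \<Longrightarrow> (\<lambda>F. D (D' F)) \<in> diff_ops3"

definition center_ops3 :: "((mat3 \<Rightarrow> complex) \<Rightarrow> mat3 \<Rightarrow> complex) set" where
  "center_ops3 = {D \<in> diff_ops3. \<forall>D'\<in>diff_ops3. \<forall>F. smooth_on GL3 F \<longrightarrow>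
     (\<forall>g\<in>GL3. D (D' F) g = D' (D F) g)}"

definition eigenfunction3 ::
  "((mat3 \<Rightarrow> complex) \<Rightarrow> mat3 \<Rightarrow> complex) \<Rightarrow> complex \<Rightarrow> (mat3 \<Rightarrow> complex) \<Rightarrow> bool" where
  "eigenfunction3 T c F \<longleftrightarrow> (\<forall>g\<in>GL3. T F g = c * F g)"

section \<open>Hecke-Maass cusp forms for SL(3,Z)\<close>

definition maass_form_SL3 :: "(mat3 \<Rightarrow> complex) \<Rightarrow> bool" where
  "maass_form_SL3 \<phi> \<longleftrightarrow>
     smooth_on GL3 \<phi> \<and>
     (\<exists>g\<in>GL3. \<phi> g \<noteq> 0) \<and>
     (\<forall>g\<in>GL3. \<forall>\<gamma>\<in>SL3Z. \<phi> (\<gamma> ** g) = \<phi> g) \<and>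
     (\<forall>g\<in>GL3. \<forall>k r. orthogonal_matrix k \<and> r \<noteq> 0 \<longrightarrow> \<phi> (r *\<^sub>R (g ** k)) = \<phi> g) \<and>
     square_integrable3 \<phi> \<and>
     (\<forall>D\<in>center_ops3. \<exists>c. eigenfunction3 D c \<phi>)"

text \<open>Vanishing of the constant terms along the unipotent radicals of the three standard
  proper parabolic subgroups, of types (2,1), (1,2) and (1,1,1).\<close>

definition cuspidal3 :: "(mat3 \<Rightarrow> complex) \<Rightarrow> bool" where
  "cuspidal3 \<phi> \<longleftrightarrow> (\<forall>g\<in>GL3.
     integral {0..1} (\<lambda>x1. integral {0..1} (\<lambda>x3. \<phi> (unip3 x1 0 x3 ** g))) = 0 \<and>
     integral {0..1} (\<lambda>x2. integral {0..1} (\<lambda>x3. \<phi> (unip3 0 x2 x3 ** g))) = 0 \<and>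
     integral {0..1} (\<lambda>x1. integral {0..1} (\<lambda>x2. integral {0..1} (\<lambda>x3.
       \<phi> (unip3 x1 x2 x3 ** g)))) = 0)"

definition hecke_op3 :: "nat \<Rightarrow> (mat3 \<Rightarrow> complex) \<Rightarrow> mat3 \<Rightarrow> complex" where
  "hecke_op3 n F g = (1 / of_nat n) *
     (\<Sum>(a, b, c) \<in> {(a, b, c). a * b * c = n}. \<Sum>b1<b. \<Sum>c1<c. \<Sum>c2<c.
        F (vector [vector [real a, real b1, real c1],
                   vector [0, real b, real c2],
                   vector [0, 0, real c]] ** g))"

definition hecke_maass_cusp_form_SL3 :: "(mat3 \<Rightarrow> complex) \<Rightarrow> bool" where
  "hecke_maass_cusp_form_SL3 \<phi> \<longleftrightarrow> maass_form_SL3 \<phi> \<and> cuspidal3 \<phi> \<and>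
     (\<forall>n\<ge>1. \<exists>c. eigenfunction3 (hecke_op3 n) c \<phi>)"

text \<open>A Whittaker function for the character \<open>e(x1 + x2)\<close> having the same infinitesimal
  character as \<open>\<phi>\<close>. By multiplicity one the moderate growth condition makes it unique up to
  a scalar (it is a multiple of Jacquet's Whittaker function).\<close>

definition whittaker_function3 :: "(mat3 \<Rightarrow> complex) \<Rightarrow> (mat3 \<Rightarrow> complex) \<Rightarrow> bool" where
  "whittaker_function3 \<phi> W \<longleftrightarrow>
     smooth_on GL3 W \<and>
     (\<exists>g\<in>GL3. W g \<noteq> 0) \<and>
     (\<forall>g\<in>GL3. \<forall>x1 x2 x3. W (unip3 x1 x2 x3 ** g) = e2pi (of_real (x1 + x2)) * W g) \<and>
     (\<forall>g\<in>GL3. \<forall>k r. orthogonal_matrix k \<and> r \<noteq> 0 \<longrightarrow> W (r *\<^sub>R (g ** k)) = W g) \<and>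
     (\<forall>D\<in>center_ops3. \<forall>c. eigenfunction3 D c \<phi> \<longrightarrow> eigenfunction3 D c W) \<and>
     (\<exists>C N::nat. \<forall>y1>0. \<forall>y2>0.
        norm (W (diag3 y1 y2)) \<le> real C * (y1 + 1 / y1 + y2 + 1 / y2) ^ N)"

definition fourier_mode3 :: "(mat3 \<Rightarrow> complex) \<Rightarrow> nat \<Rightarrow> nat \<Rightarrow> mat3 \<Rightarrow> complex" where
  "fourier_mode3 \<phi> m1 m2 g =
     integral {0..1} (\<lambda>x1. integral {0..1} (\<lambda>x2. integral {0..1} (\<lambda>x3.
       \<phi> (unip3 x1 x2 x3 ** g) * e2pi (- of_real (real m1 * x1 + real m2 * x2)))))"

text \<open>\<open>A\<close> is the array of Fourier-Whittaker coefficients of \<open>\<phi>\<close>, with the Whittaker function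
  scaled so that \<open>A 1 1 = 1\<close>. Only coefficients with positive indices are recorded; the values
  at \<open>0\<close> are unspecified.\<close>

definition normalized_coeffs_SL3 :: "(mat3 \<Rightarrow> complex) \<Rightarrow> (nat \<Rightarrow> nat \<Rightarrow> complex) \<Rightarrow> bool" where
  "normalized_coeffs_SL3 \<phi> A \<longleftrightarrow> A 1 1 = 1 \<and>
     (\<exists>W. whittaker_function3 \<phi> W \<and>
       (\<forall>m1\<ge>1. \<forall>m2\<ge>1. \<forall>g\<in>GL3. fourier_mode3 \<phi> m1 m2 g =
          A m1 m2 / (of_nat m1 * of_nat m2) * W (diag3 (real m1) (real m2) ** g)))"

section \<open>Cusp forms for SL(2,Z)\<close>

definition upper_half :: "complex set" where
  "upper_half = {z. Im z > 0}"

definition moebius2 :: "int \<Rightarrow> int \<Rightarrow> int \<Rightarrow> int \<Rightarrow> complex \<Rightarrow> complex" where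
  "moebius2 a b c d z = (of_int a * z + of_int b) / (of_int c * z + of_int d)"

definition holomorphic_cusp_form :: "nat \<Rightarrow> (complex \<Rightarrow> complex) \<Rightarrow> bool" where
  "holomorphic_cusp_form k f \<longleftrightarrow>
     f holomorphic_on upper_half \<and>
     (\<forall>a b c d. a * d - b * c = 1 \<longrightarrow> (\<forall>z\<in>upper_half.
        f (moebius2 a b c d z) = (of_int c * z + of_int d) ^ k * f z)) \<and>
     (f \<longlongrightarrow> 0) (filtercomap Im at_top)"

definition normalized_coeffs_holomorphic ::
  "nat \<Rightarrow> (complex \<Rightarrow> complex) \<Rightarrow> (nat \<Rightarrow> complex) \<Rightarrow> bool" where
  "normalized_coeffs_holomorphic k f lam \<longleftrightarrow> (\<forall>z\<in>upper_half.
     ((\<lambda>n. lam n * of_real (real n powr ((real k - 1) / 2)) * e2pi (of_nat n * z))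
        has_sum f z) {1..})"

definition hyp_laplacian :: "(complex \<Rightarrow> complex) \<Rightarrow> complex \<Rightarrow> complex" where
  "hyp_laplacian f z = - of_real ((Im z)\<^sup>2) *
     (frechet_derivative (\<lambda>w. frechet_derivative f (at w) 1) (at z) 1 +
      frechet_derivative (\<lambda>w. frechet_derivative f (at w) \<i>) (at z) \<i>)"

definition hecke_op2 :: "nat \<Rightarrow> (complex \<Rightarrow> complex) \<Rightarrow> complex \<Rightarrow> complex" where
  "hecke_op2 n f z = (1 / of_real (sqrt (real n))) *
     (\<Sum>d\<in>{d. d dvd n}. \<Sum>b<d. f ((of_nat (n div d) * z + of_nat b) / of_nat d))"

text \<open>The Laplace eigenvalue is \<open>1/4 + t\<^sup>2\<close>; \<open>t\<close> is complex so that no lower bound on the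
  eigenvalue is presupposed. Square-integrability is tested on the standard fundamental domain.\<close>

definition hecke_maass_cusp_form_SL2 :: "complex \<Rightarrow> (complex \<Rightarrow> complex) \<Rightarrow> bool" where
  "hecke_maass_cusp_form_SL2 t f \<longleftrightarrow>
     smooth_on upper_half f \<and>
     (\<exists>z\<in>upper_half. f z \<noteq> 0) \<and>
     (\<forall>a b c d. a * d - b * c = 1 \<longrightarrow> (\<forall>z\<in>upper_half. f (moebius2 a b c d z) = f z)) \<and>
     (\<forall>z\<in>upper_half. hyp_laplacian f z = (1 / 4 + t\<^sup>2) * f z) \<and>
     (\<integral>\<^sup>+ z. indicator {z. Im z > 0 \<and> \<bar>Re z\<bar> \<le> 1 / 2 \<and> norm z \<ge> 1} z *
        ennreal ((norm (f z))\<^sup>2 / (Im z)\<^sup>2) \<partial>lborel) < \<infinity> \<and>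
     (\<forall>y>0. integral {0..1} (\<lambda>x. f (Complex x y)) = 0) \<and>
     (\<forall>n\<ge>1. \<exists>c. \<forall>z\<in>upper_half. hecke_op2 n f z = c * f z)"

definition bessel_K :: "complex \<Rightarrow> real \<Rightarrow> complex" where
  "bessel_K \<nu> y = (LBINT u:{0..}. of_real (exp (- y * cosh u)) * cosh (\<nu> * of_real u))"

definition normalized_coeffs_maass_SL2 ::
  "complex \<Rightarrow> (complex \<Rightarrow> complex) \<Rightarrow> (nat \<Rightarrow> complex) \<Rightarrow> bool" where
  "normalized_coeffs_maass_SL2 t f lam \<longleftrightarrow> (\<exists>\<rho> :: int \<Rightarrow> complex.
     (\<forall>x y. y > 0 \<longrightarrow>
        ((\<lambda>n. of_real (sqrt y) * \<rho> n * bessel_K (\<i> * t) (2 * pi * \<bar>real_of_int n\<bar> * y) *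
              e2pi (of_real (real_of_int n * x))) has_sum f (Complex x y)) {n. n \<noteq> 0}) \<and>
     \<rho> 1 = 1 \<and> (\<forall>n\<ge>1. lam n = \<rho> (int n)))"

definition normalized_coeffs_SL2 :: "(complex \<Rightarrow> complex) \<Rightarrow> (nat \<Rightarrow> complex) \<Rightarrow> bool" where
  "normalized_coeffs_SL2 f lam \<longleftrightarrow>
     (\<exists>k. holomorphic_cusp_form k f \<and> normalized_coeffs_holomorphic k f lam) \<or>
     (\<exists>t. hecke_maass_cusp_form_SL2 t f \<and> normalized_coeffs_maass_SL2 t f lam)"

section \<open>The averaged shifted convolution sum\<close>

definition shifted_conv_avg ::
  "(nat \<Rightarrow> complex) \<Rightarrow> (nat \<Rightarrow> nat \<Rightarrow> complex) \<Rightarrow> (nat \<Rightarrow> nat \<Rightarrow> complex) \<Rightarrow>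
   (real \<Rightarrow> complex) \<Rightarrow> (real \<Rightarrow> complex) \<Rightarrow> real \<Rightarrow> real \<Rightarrow> complex" where
  "shifted_conv_avg lam A1 A2 W1 W2 H X = (1 / of_real H) *
     (\<Sum>\<^sub>\<infinity>h\<in>{1..}. lam h * W1 (real h / H) *
        (\<Sum>\<^sub>\<infinity>n\<in>{1..}. A1 1 n * A2 1 (n + h) * W2 (real n / X)))"

end

theory Submission
  imports Defs
begin

text \<open>
  By orthogonality, the sum is \<open>1 / H\<close> times the integral over \<open>\<alpha>\<close> in the unit interval of a product of
  three exponential sums, with coefficients \<open>lam h W1(h/H)\<close>, \<open>A1 1 n W2(n/X)\<close> and \<open>A2 1 m\<close>.
  The first is \<open>O(H\<^sup>1\<^sup>/\<^sup>2 log H)\<close> uniformly in \<open>\<alpha>\<close> (Wilton's bound) and the other two have mean square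
  \<open>O(X)\<close>. Since \<open>X\<^sup>1\<^sup>/\<^sup>2\<^sup>+\<^sup>\<delta> \<le> H \<le> X\<close>, we have \<open>H\<^sup>-\<^sup>1\<^sup>/\<^sup>2 \<le> X\<^sup>1\<^sup>/\<^sup>2 / H \<le> X\<^sup>-\<^sup>\<delta>\<close>, which gives the claim.

  For Wilton's bound, \<open>y\<^sup>k\<^sup>/\<^sup>2 \<bar>f\<bar>\<close> (respectively \<open>\<bar>f\<bar>\<close>) is bounded on the upper half-plane. Hence at height
  \<open>y\<close> of order \<open>1 / x\<close> every partial sum of the Fourier series of \<open>f\<close> is bounded by the \<open>L\<^sup>1\<close> norm of a
  Dirichlet kernel, and the weight, which is smooth and nonvanishing for \<open>n\<close> of order \<open>x\<close>, is removed by
  partial summation.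

  The mean square is bounded without Rankin-Selberg theory. The part of a Siegel set for the maximal
  parabolic subgroup where \<open>y2\<close> is of order \<open>N\<close> or less and \<open>y1\<^sup>2 y2\<close> is of order \<open>1 / N\<close> meets each orbit of
  \<open>SL(3,Z)\<close> in \<open>O(N)\<close> points, so that the integral of \<open>\<bar>\<phi>\<bar>\<^sup>2\<close> over it is \<open>O(N)\<close>. By unfolding over the
  integral points of the parabolic subgroup and by Bessel's inequality, this integral dominates the one of
  \<open>\<bar>fc3 \<phi> 1 0\<bar>\<^sup>2\<close> over the region where \<open>y1\<close> is of order 1 and \<open>y2\<close> of order \<open>1 / N\<close>. A further application of
  Bessel's inequality, in \<open>x2\<close>, bounds the latter from below by a multiple of the sum of
  \<open>\<bar>A 1 n\<bar>\<^sup>2\<close> over \<open>n\<close> of order \<open>N\<close>.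
\<close>

text \<open>The mean square bound rests on square-integrability over some fundamental domain of
  unspecified shape. Unfolding is therefore an inequality, for which a covering and an orbit count
  suffice, and the invariance of the measure is proved for all of GL(3,R). The powers of N balance:
  the weight 1 / y2^3 gives the region of integration a volume of order N^2, the Fourier mode (1, n)
  carries a factor 1 / n, so that its square loses N^(-2), and the orbit count contributes N. A
  block of coefficients is thus bounded by O(N), with no power or logarithm lost. For SL(2,Z) no
  estimate of individual coefficients is at hand, so the boundedness of the form is drawn from
  absolute convergence of its Fourier series at one fixed height. The factor 1 + ln H in Wilton's
  bound is what X^\<epsilon> pays for, and \<delta> enters only through the lower bound for H, so
  that the constant does not depend on it. The range X < 1 belongs to the statement too; there the
  compact supports of the weights replace the argument.\<close>

section \<open>The Iwasawa decomposition\<close>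

text \<open>Gram-Schmidt from the last row upwards, written in the inner products
  \<open>G i j\<close> of the rows; \<open>D\<close> is the squared area of the parallelogram
  spanned by rows 2 and 3. An orthogonal factor on the right preserves all \<open>G i j\<close>, and
  each component is homogeneous of degree 0, so the tuple depends only on the class of
  \<open>g\<close> modulo O(3) and scalars.\<close>

definition iwasawa_coords :: "mat3 \<Rightarrow> coords3" where
  "iwasawa_coords g = (let G = (\<lambda>i j. g $ i \<bullet> g $ j); D = G 2 2 * G 3 3 - (G 2 3)\<^sup>2 in
     (G 2 3 / G 3 3, (G 1 2 * G 3 3 - G 1 3 * G 2 3) / D, G 1 3 / G 3 3,
      sqrt D / G 3 3, \<bar>det g\<bar> * sqrt (G 3 3) / D))"

lemma matrix_scaleR3: "(A::mat3) ** (r *\<^sub>R B) = r *\<^sub>R (A ** B)"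
  by (simp add: vec_eq_iff matrix_matrix_mult_def sum_3 distrib_left mult.left_commute)

lemma scaleR_matrix3: "(r *\<^sub>R A) ** (B::mat3) = r *\<^sub>R (A ** B)"
  by (simp add: vec_eq_iff matrix_matrix_mult_def sum_3 distrib_left mult.assoc)

lemma iwasawa_eq:
  "iwasawa (x1, x2, x3, y1, y2) =
     vector [vector [y1 * y2, x2 * y1, x3], vector [0, y1, x1], vector [0, 0, 1]]"
  by (simp add: iwasawa_def unip3_def diag3_def matrix_matrix_mult_def vec_eq_iff sum_3 forall_3)

lemma iwasawa_rows [simp]:
  "iwasawa (x1, x2, x3, y1, y2) $ 1 = vector [y1 * y2, x2 * y1, x3]"
  "iwasawa (x1, x2, x3, y1, y2) $ 2 = vector [0, y1, x1]"
  "iwasawa (x1, x2, x3, y1, y2) $ 3 = vector [0, 0, 1]"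
  by (simp_all add: iwasawa_eq)

lemma inner_3: "(x::real^3) \<bullet> y = x$1 * y$1 + x$2 * y$2 + x$3 * y$3"
  by (simp add: inner_vec_def sum_3)

lemma det_iwasawa: "det (iwasawa (x1, x2, x3, y1, y2)) = y1\<^sup>2 * y2"
  by (simp add: iwasawa_eq det_3 power2_eq_square)

lemma iwasawa_coords_iwasawa:
  assumes "p \<in> half_space3"
  shows "iwasawa_coords (iwasawa p) = p"
proof -
  obtain x1 x2 x3 y1 y2 where p: "p = (x1, x2, x3, y1, y2)" by (metis prod_cases5)
  with assms have y: "y1 > 0" "y2 > 0" by (auto simp: half_space3_def)
  have [simp]: "y1 * y1 + x1 * x1 - x1\<^sup>2 = y1\<^sup>2" by algebra
  show ?thesis using y
    by (simp add: p iwasawa_coords_def det_iwasawa inner_3 Let_def abs_mult)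
       (simp add: field_simps power2_eq_square)
qed

lemma det_iwasawa_nz: "p \<in> half_space3 \<Longrightarrow> det (iwasawa p) \<noteq> 0"
  by (auto simp: half_space3_def det_iwasawa)

lemma iwasawa_in_GL3: "p \<in> half_space3 \<Longrightarrow> iwasawa p \<in> GL3"
  using det_iwasawa_nz by (auto simp: GL3_def)

lemma inner_rows_orthogonal:
  fixes g k :: mat3
  assumes "orthogonal_matrix k"
  shows "(g ** k) $ i \<bullet> (g ** k) $ j = g $ i \<bullet> g $ j"
proof -
  have *: "(A $ i \<bullet> A $ j) = (A ** transpose A) $ i $ j" for A :: mat3
    by (simp add: matrix_matrix_mult_def inner_vec_def transpose_def)
  have "(g ** k) ** transpose (g ** k) = g ** (k ** transpose k) ** transpose g"
    by (simp add: matrix_transpose_mul matrix_mul_assoc)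
  also have "\<dots> = g ** transpose g"
    using assms by (simp add: orthogonal_matrix_def)
  finally show ?thesis by (simp add: *)
qed

lemma det_abs_orthogonal:
  fixes g k :: mat3
  assumes "orthogonal_matrix k"
  shows "\<bar>det (g ** k)\<bar> = \<bar>det g\<bar>"
  using det_orthogonal_matrix[OF assms] by (auto simp: det_mul)

lemma det_scaleR3: "det (r *\<^sub>R (g::mat3)) = r ^ 3 * det g"
  by (simp add: det_3 power3_eq_cube algebra_simps)

text \<open>Lagrange's identity: the squares are those of the components of the cross product of the
  last two rows. Expanding the determinant along row 1 then shows that the left side vanishes only
  for singular matrices.\<close>

lemma gram_minor:
  fixes g :: mat3
  shows "(g$2 \<bullet> g$2) * (g$3 \<bullet> g$3) - (g$2 \<bullet> g$3)\<^sup>2 =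
     (g$2$1 * g$3$2 - g$2$2 * g$3$1)\<^sup>2 + (g$2$1 * g$3$3 - g$2$3 * g$3$1)\<^sup>2
     + (g$2$2 * g$3$3 - g$2$3 * g$3$2)\<^sup>2"
  by (simp add: inner_3 power2_eq_square algebra_simps)

lemma gram_minor_pos:
  fixes g :: mat3
  assumes "det g \<noteq> 0"
  shows "(g$2 \<bullet> g$2) * (g$3 \<bullet> g$3) - (g$2 \<bullet> g$3)\<^sup>2 > 0"
proof (rule ccontr)
  assume "\<not> ?thesis"
  hence "(g$2$1 * g$3$2 - g$2$2 * g$3$1)\<^sup>2 + (g$2$1 * g$3$3 - g$2$3 * g$3$1)\<^sup>2
     + (g$2$2 * g$3$3 - g$2$3 * g$3$2)\<^sup>2 \<le> 0" unfolding gram_minor by simp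
  hence *: "(g$2$1 * g$3$2 - g$2$2 * g$3$1)\<^sup>2 = 0" "(g$2$1 * g$3$3 - g$2$3 * g$3$1)\<^sup>2 = 0"
     "(g$2$2 * g$3$3 - g$2$3 * g$3$2)\<^sup>2 = 0"
    by (smt (verit) zero_le_power2)+
  have "det g = g$1$1 * (g$2$2 * g$3$3 - g$2$3 * g$3$2) - g$1$2 * (g$2$1 * g$3$3 - g$2$3 * g$3$1)
     + g$1$3 * (g$2$1 * g$3$2 - g$2$2 * g$3$1)"
    by (simp add: det_3 algebra_simps)
  with * assms show False by simp
qed

lemma gram33_pos:
  fixes g :: mat3
  assumes "det g \<noteq> 0"
  shows "g$3 \<bullet> g$3 > 0"
  using gram_minor_pos[OF assms] by (cases "g$3 = 0") auto

lemma iwasawa_coords_half_space3: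
  "det g \<noteq> 0 \<Longrightarrow> iwasawa_coords g \<in> half_space3"
  using gram_minor_pos[of g] gram33_pos[of g] by (simp add: iwasawa_coords_def Let_def half_space3_def)

text \<open>Row inner products are unchanged by \<open>k\<close> and multiplied by r^2 under
  scaling, the 2 by 2 minor by r^4, and in all five quotients the powers of r cancel. The absolute
  value of the determinant takes care of r < 0 and of det k = -1.\<close>

lemma iwasawa_coords_scale_orthogonal:
  assumes "orthogonal_matrix k" "r \<noteq> 0"
  shows "iwasawa_coords (r *\<^sub>R (g ** k)) = iwasawa_coords g"
proof -
  have D: "r * (r * a) * (r * (r * b)) - (r * (r * c))\<^sup>2 = r ^ 4 * (a * b - c\<^sup>2)" for a b c :: real
    by (simp add: power2_eq_square algebra_simps power4_eq_xxxx)
  have [simp]: "sqrt (r ^ 4) = r\<^sup>2"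
    using real_sqrt_abs[of "r\<^sup>2"] by simp
  have r: "sqrt (r * (r * b)) = \<bar>r\<bar> * sqrt b" for b
    by (simp add: real_sqrt_mult flip: mult.assoc)
  have r4: "\<bar>r ^ 3\<bar> * \<bar>r\<bar> = r ^ 4"
  proof -
    have "\<bar>r ^ 3\<bar> * \<bar>r\<bar> = \<bar>r ^ 4\<bar>" by (simp only: power4_eq_xxxx power3_eq_cube abs_mult)
    also have "r ^ 4 \<ge> 0" by simp
    hence "\<bar>r ^ 4\<bar> = r ^ 4" by (rule abs_of_nonneg)
    finally show ?thesis .
  qed
  have c1: "r * a / (r * b) = a / b" for a b
    using assms(2) by (rule mult_divide_mult_cancel_left)
  have c4: "r ^ 4 * a / (r ^ 4 * b) = a / b" for a b
    using assms(2) by (intro mult_divide_mult_cancel_left) simp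
  have frac: "(\<bar>r ^ 3\<bar> * a) * (\<bar>r\<bar> * b) / (r ^ 4 * c) = a * b / c" for a b c
  proof -
    have "(\<bar>r ^ 3\<bar> * a) * (\<bar>r\<bar> * b) = r ^ 4 * (a * b)" unfolding r4[symmetric] by (simp only: mult_ac)
    thus ?thesis by (simp only: c4)
  qed
  have q1: "r * (r * a) / (r * (r * b)) = a / b" for a b
    by (simp only: c1)
  have q2: "(r * (r * a) * (r * (r * b)) - r * (r * c) * (r * (r * d))) / (r ^ 4 * e) = (a * b - c * d) / e"
    for a b c d e
  proof -
    have "r * (r * a) * (r * (r * b)) - r * (r * c) * (r * (r * d)) = r ^ 4 * (a * b - c * d)"
      by (simp add: power4_eq_xxxx right_diff_distrib mult_ac)
    thus ?thesis by (simp only: c4)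
  qed
  have q4: "r\<^sup>2 * a / (r * (r * b)) = a / b" for a b
    by (simp only: c1 power2_eq_square mult.assoc)
  have G: "(r *\<^sub>R (g ** k)) $ i \<bullet> (r *\<^sub>R (g ** k)) $ j = r * (r * (g $ i \<bullet> g $ j))" for i j
    by (simp add: inner_rows_orthogonal[OF assms(1)])
  have d: "\<bar>det (r *\<^sub>R (g ** k))\<bar> = \<bar>r ^ 3\<bar> * \<bar>det g\<bar>"
    by (simp only: det_scaleR3 abs_mult det_abs_orthogonal[OF assms(1)])
  have r4': "sqrt (r ^ 4 * a) = r\<^sup>2 * sqrt a" for a by (simp add: real_sqrt_mult)
  let ?h = "r *\<^sub>R (g ** k)"
  define D where "D g = (g$2 \<bullet> g$2) * (g$3 \<bullet> g$3) - (g$2 \<bullet> g$3)\<^sup>2" for g :: mat3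
  have coords: "iwasawa_coords g = ((g$2 \<bullet> g$3) / (g$3 \<bullet> g$3),
      ((g$1 \<bullet> g$2) * (g$3 \<bullet> g$3) - (g$1 \<bullet> g$3) * (g$2 \<bullet> g$3)) / D g,
      (g$1 \<bullet> g$3) / (g$3 \<bullet> g$3), sqrt (D g) / (g$3 \<bullet> g$3), \<bar>det g\<bar> * sqrt (g$3 \<bullet> g$3) / D g)" for g :: mat3
    by (simp add: iwasawa_coords_def D_def Let_def)
  have Dh: "D ?h = r ^ 4 * D g" unfolding D_def G by (rule D)
  show ?thesis
    unfolding coords prod.inject
  proof (intro conjI)
    show "(?h$2 \<bullet> ?h$3) / (?h$3 \<bullet> ?h$3) = (g$2 \<bullet> g$3) / (g$3 \<bullet> g$3)"
      and "(?h$1 \<bullet> ?h$3) / (?h$3 \<bullet> ?h$3) = (g$1 \<bullet> g$3) / (g$3 \<bullet> g$3)"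
      unfolding G by (rule q1)+
    show "((?h$1 \<bullet> ?h$2) * (?h$3 \<bullet> ?h$3) - (?h$1 \<bullet> ?h$3) * (?h$2 \<bullet> ?h$3)) / D ?h =
        ((g$1 \<bullet> g$2) * (g$3 \<bullet> g$3) - (g$1 \<bullet> g$3) * (g$2 \<bullet> g$3)) / D g"
      unfolding G Dh by (rule q2)
    show "sqrt (D ?h) / (?h$3 \<bullet> ?h$3) = sqrt (D g) / (g$3 \<bullet> g$3)"
      unfolding G Dh r4' by (rule q4)
    show "\<bar>det ?h\<bar> * sqrt (?h$3 \<bullet> ?h$3) / D ?h = \<bar>det g\<bar> * sqrt (g$3 \<bullet> g$3) / D g"
      unfolding G Dh d r by (rule frac)
  qed
qed

text \<open>The expanded determinant of \<open>g ** transpose g\<close>. It recovers the inner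
  product of row 1 with itself from the determinant and the remaining inner products.\<close>

lemma det_gram:
  fixes g :: mat3
  shows "(det g)\<^sup>2 = (g$1 \<bullet> g$1) * ((g$2 \<bullet> g$2) * (g$3 \<bullet> g$3) - (g$2 \<bullet> g$3)\<^sup>2)
     - (g$1 \<bullet> g$2) * ((g$1 \<bullet> g$2) * (g$3 \<bullet> g$3) - (g$1 \<bullet> g$3) * (g$2 \<bullet> g$3))
     + (g$1 \<bullet> g$3) * ((g$1 \<bullet> g$2) * (g$2 \<bullet> g$3) - (g$1 \<bullet> g$3) * (g$2 \<bullet> g$2))"
proof -
  have *: "(g ** transpose g) $ i $ j = (g $ i \<bullet> g $ j)" for i j
    by (simp add: matrix_matrix_mult_def inner_vec_def transpose_def)
  have "(det g)\<^sup>2 = det (g ** transpose g)" by (simp add: det_mul power2_eq_square)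
  also have "\<dots> = (g$1 \<bullet> g$1) * ((g$2 \<bullet> g$2) * (g$3 \<bullet> g$3) - (g$2 \<bullet> g$3)\<^sup>2)
     - (g$1 \<bullet> g$2) * ((g$1 \<bullet> g$2) * (g$3 \<bullet> g$3) - (g$1 \<bullet> g$3) * (g$2 \<bullet> g$3))
     + (g$1 \<bullet> g$3) * ((g$1 \<bullet> g$2) * (g$2 \<bullet> g$3) - (g$1 \<bullet> g$3) * (g$2 \<bullet> g$2))"
    unfolding det_3 * by (simp add: inner_commute power2_eq_square algebra_simps)
  finally show ?thesis .
qed

text \<open>The scaled upper triangular matrix \<open>?B\<close> has the same Gram matrix of rows as
  \<open>g\<close>. Invertible matrices with equal Gram matrices differ by an orthogonal factor on
  the right, and this factor is \<open>k\<close>.\<close>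

lemma iwasawa_decomposition:
  fixes g :: mat3
  assumes "det g \<noteq> 0"
  obtains k where "orthogonal_matrix k" "g = sqrt (g$3 \<bullet> g$3) *\<^sub>R (iwasawa (iwasawa_coords g) ** k)"
proof -
  define s where "s = sqrt (g$3 \<bullet> g$3)"
  let ?s = s
  let ?B = "?s *\<^sub>R iwasawa (iwasawa_coords g)"
  define G where "G i j = g$i \<bullet> g$j" for i j
  define D where "D = G 2 2 * G 3 3 - (G 2 3)\<^sup>2"
  have D: "D > 0" using gram_minor_pos[OF assms] by (simp add: G_def D_def)
  have G33: "G 3 3 > 0" using gram33_pos[OF assms] by (simp add: G_def)
  have sym: "G 2 1 = G 1 2" "G 3 1 = G 1 3" "G 3 2 = G 2 3" by (simp_all add: G_def inner_commute)
  have d: "(det g)\<^sup>2 = G 1 1 * D - G 1 2 * (G 1 2 * G 3 3 - G 1 3 * G 2 3)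
     + G 1 3 * (G 1 2 * G 2 3 - G 1 3 * G 2 2)"
    using det_gram[of g] by (simp add: G_def D_def)
  have c: "iwasawa_coords g = (G 2 3 / G 3 3, (G 1 2 * G 3 3 - G 1 3 * G 2 3) / D, G 1 3 / G 3 3,
      sqrt D / G 3 3, \<bar>det g\<bar> * sqrt (G 3 3) / D)"
    by (simp add: iwasawa_coords_def G_def D_def Let_def)
  have s2: "?s * ?s = G 3 3" using G33 by (simp add: G_def s_def)
  have s2': "?s * (?s * x) = G 3 3 * x" for x using s2 by (metis mult.assoc)
  have DD: "sqrt D * sqrt D = D" "sqrt D * (sqrt D * x) = D * x" for x
    using D by (simp_all flip: mult.assoc)
  have rows: "?B $ i \<bullet> ?B $ j = G i j" for i j
  proof -
    have e22: "G 3 3 * (sqrt D / G 3 3 * (sqrt D / G 3 3) + G 2 3 / G 3 3 * (G 2 3 / G 3 3)) = G 2 2"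
    proof -
      have "G 3 3 * (sqrt D / G 3 3 * (sqrt D / G 3 3) + G 2 3 / G 3 3 * (G 2 3 / G 3 3)) =
          (D + (G 2 3)\<^sup>2) / G 3 3"
        using G33 DD by (simp add: field_simps power2_eq_square)
      thus ?thesis using G33 by (simp add: D_def)
    qed
    have e12: "G 3 3 * ((G 1 2 * G 3 3 - G 1 3 * G 2 3) / D * (sqrt D / G 3 3) * (sqrt D / G 3 3) +
        G 1 3 / G 3 3 * (G 2 3 / G 3 3)) = G 1 2"
    proof -
      have gen: "g * (x / (d * d) * (d / g) * (d / g) + a / g * (b / g)) = (x + a * b) / g"
        if "g > 0" "d > 0" for g d x a b :: real using that by (simp add: field_simps)
      show ?thesis
        using gen[of "G 3 3" "sqrt D" "G 1 2 * G 3 3 - G 1 3 * G 2 3"] G33 D DD(1) by simp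
    qed
    have e11: "G 3 3 * ((sqrt D / G 3 3 * (\<bar>det g\<bar> * sqrt (G 3 3) / D)) * (sqrt D / G 3 3 * (\<bar>det g\<bar> * sqrt (G 3 3) / D)) +
        ((G 1 2 * G 3 3 - G 1 3 * G 2 3) / D * (sqrt D / G 3 3)) * ((G 1 2 * G 3 3 - G 1 3 * G 2 3) / D * (sqrt D / G 3 3)) +
        G 1 3 / G 3 3 * (G 1 3 / G 3 3)) = G 1 1" (is "?L = _")
    proof -
      have gen: "g * ((d / g * (t * h / (d * d))) * (d / g * (t * h / (d * d))) +
          (x / (d * d) * (d / g)) * (x / (d * d) * (d / g)) + c / g * (c / g)) =
          (t * t * (h * h) / (d * d) + x * x / (d * d) + c * c) / g"
        if "g > 0" "d > 0" for g d x t h c :: real using that by (simp add: field_simps)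
      have "?L = ((det g)\<^sup>2 * G 3 3 / D + (G 1 2 * G 3 3 - G 1 3 * G 2 3)\<^sup>2 / D + (G 1 3)\<^sup>2) / G 3 3"
        using gen[of "G 3 3" "sqrt D" "\<bar>det g\<bar>" "sqrt (G 3 3)" "G 1 2 * G 3 3 - G 1 3 * G 2 3" "G 1 3"] G33 D DD(1)
        by (simp add: power2_eq_square)
      also have "\<dots> = ((det g)\<^sup>2 * G 3 3 + (G 1 2 * G 3 3 - G 1 3 * G 2 3)\<^sup>2 + D * (G 1 3)\<^sup>2) / (D * G 3 3)"
        using G33 D by (simp add: field_simps)
      also have "(det g)\<^sup>2 * G 3 3 + (G 1 2 * G 3 3 - G 1 3 * G 2 3)\<^sup>2 + D * (G 1 3)\<^sup>2 = G 1 1 * D * G 3 3"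
        unfolding d D_def by algebra
      finally show ?thesis using G33 D by simp
    qed
    have e13: "G 3 3 * (G 1 3 / G 3 3) = G 1 3" "G 3 3 * (G 2 3 / G 3 3) = G 2 3" using G33 by auto
    have i: "i = 1 \<or> i = 2 \<or> i = 3" and j: "j = 1 \<or> j = 2 \<or> j = 3" using exhaust_3 by blast+
    have B: "?B $ 1 $ 1 = ?s * (sqrt D / G 3 3 * (\<bar>det g\<bar> * sqrt (G 3 3) / D))"
      "?B $ 1 $ 2 = ?s * ((G 1 2 * G 3 3 - G 1 3 * G 2 3) / D * (sqrt D / G 3 3))"
      "?B $ 1 $ 3 = ?s * (G 1 3 / G 3 3)" "?B $ 2 $ 1 = ?s * 0" "?B $ 2 $ 2 = ?s * (sqrt D / G 3 3)"
      "?B $ 2 $ 3 = ?s * (G 2 3 / G 3 3)" "?B $ 3 $ 1 = ?s * 0" "?B $ 3 $ 2 = ?s * 0" "?B $ 3 $ 3 = ?s * 1"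
      by (simp_all add: c)
    have P: "(?s * a) * (?s * b) + (?s * c) * (?s * d) + (?s * e) * (?s * f) = G 3 3 * (a * b + c * d + e * f)"
      for a b c d e f by (simp only: s2[symmetric]) algebra
    have c11: "?B $ 1 \<bullet> ?B $ 1 = G 1 1" unfolding inner_3 B P using e11 .
    have c12: "?B $ 1 \<bullet> ?B $ 2 = G 1 2" unfolding inner_3 B P using e12 by (simp add: mult.assoc)
    have c13: "?B $ 1 \<bullet> ?B $ 3 = G 1 3" unfolding inner_3 B P using e13 by simp
    have c22: "?B $ 2 \<bullet> ?B $ 2 = G 2 2" unfolding inner_3 B P using e22 by simp
    have c23: "?B $ 2 \<bullet> ?B $ 3 = G 2 3" unfolding inner_3 B P using e13 by simp
    have c33: "?B $ 3 \<bullet> ?B $ 3 = G 3 3" unfolding inner_3 B P by simp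
    from i j show ?thesis
      using c11 c12 c13 c22 c23 c33 sym by (auto simp: inner_commute)
  qed
  have gram: "?B ** transpose ?B = g ** transpose g"
  proof -
    have *: "(A ** transpose A) $ i $ j = (A $ i \<bullet> A $ j)" for A :: mat3 and i j
      by (simp add: matrix_matrix_mult_def inner_vec_def transpose_def)
    show ?thesis by (simp only: vec_eq_iff * rows G_def) simp
  qed
  have "det ?B \<noteq> 0"
    using det_iwasawa_nz[OF iwasawa_coords_half_space3[OF assms]] gram33_pos[OF assms]
    by (simp add: det_scaleR3 s_def)
  hence inv: "invertible ?B" by (simp add: invertible_det_nz)
  then obtain C where C: "C ** ?B = mat 1" "?B ** C = mat 1" unfolding invertible_def by blast
  define k where "k = C ** g"
  have "k ** transpose k = C ** (g ** transpose g) ** transpose C"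
    by (simp add: k_def matrix_transpose_mul matrix_mul_assoc)
  also have "\<dots> = (C ** ?B) ** transpose (C ** ?B)"
    by (simp add: gram[symmetric] matrix_transpose_mul matrix_mul_assoc)
  also have "\<dots> = mat 1" using C by simp
  finally have "k ** transpose k = mat 1" .
  hence "orthogonal_matrix k"
    by (metis orthogonal_matrix_def matrix_left_right_inverse)
  moreover have "g = ?B ** k" using C by (simp add: k_def matrix_mul_assoc)
  hence "g = ?s *\<^sub>R (iwasawa (iwasawa_coords g) ** k)" by (simp add: scaleR_matrix3)
  ultimately show ?thesis using that unfolding s_def by blast
qed

section \<open>The left action of GL(3,R) on Iwasawa coordinates\<close>

definition act :: "mat3 \<Rightarrow> coords3 \<Rightarrow> coords3" where
  "act g p = iwasawa_coords (g ** iwasawa p)"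

lemma act_half_space3: "det g \<noteq> 0 \<Longrightarrow> p \<in> half_space3 \<Longrightarrow> act g p \<in> half_space3"
  by (simp add: act_def det_mul det_iwasawa_nz iwasawa_coords_half_space3)

lemma act_decomposition:
  assumes "det g \<noteq> 0" "p \<in> half_space3"
  obtains k r where "orthogonal_matrix k" "r > 0" "g ** iwasawa p = r *\<^sub>R (iwasawa (act g p) ** k)"
    "r\<^sup>2 = (g ** iwasawa p) $ 3 \<bullet> (g ** iwasawa p) $ 3"
proof -
  have d: "det (g ** iwasawa p) \<noteq> 0" using assms by (simp add: det_mul det_iwasawa_nz)
  let ?h = "g ** iwasawa p"
  obtain k where k: "orthogonal_matrix k" "?h = sqrt (?h$3 \<bullet> ?h$3) *\<^sub>R (iwasawa (iwasawa_coords ?h) ** k)"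
    using iwasawa_decomposition[OF d] by blast
  have pos: "?h$3 \<bullet> ?h$3 > 0" using gram33_pos[OF d] .
  show ?thesis
  proof (rule that)
    show "orthogonal_matrix k" by fact
    show "sqrt (?h$3 \<bullet> ?h$3) > 0" using pos by simp
    show "?h = sqrt (?h$3 \<bullet> ?h$3) *\<^sub>R (iwasawa (act g p) ** k)" using k(2) by (simp only: act_def)
    show "(sqrt (?h$3 \<bullet> ?h$3))\<^sup>2 = ?h$3 \<bullet> ?h$3" using pos by simp
  qed
qed

text \<open>The formulas for unipotent and diagonal matrices are verified through this rule: exhibit
  the image point, the orthogonal matrix and the scalar, and compare entries.\<close>

lemma act_unique:
  assumes "q \<in> half_space3" "orthogonal_matrix k" "r \<noteq> 0" "g ** iwasawa p = r *\<^sub>R (iwasawa q ** k)"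
  shows "act g p = q"
  using assms by (simp add: act_def iwasawa_coords_scale_orthogonal iwasawa_coords_iwasawa)

text \<open>Passing from \<open>h ** iwasawa p\<close> to its representative removes a scalar and an
  orthogonal factor on the right; both are compatible with left multiplication by \<open>g\<close>
  and invisible to \<open>iwasawa_coords\<close>.\<close>

lemma act_mult:
  assumes "det h \<noteq> 0" "p \<in> half_space3"
  shows "act (g ** h) p = act g (act h p)"
proof -
  obtain k r where *: "orthogonal_matrix k" "r > 0" "h ** iwasawa p = r *\<^sub>R (iwasawa (act h p) ** k)"
    using act_decomposition[OF assms] by blast
  have "g ** h ** iwasawa p = g ** (h ** iwasawa p)" by (simp only: matrix_mul_assoc)
  also have "\<dots> = r *\<^sub>R (g ** iwasawa (act h p) ** k)"
    unfolding *(3) by (simp only: matrix_scaleR3 matrix_mul_assoc)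
  finally have "g ** h ** iwasawa p = r *\<^sub>R (g ** iwasawa (act h p) ** k)" .
  thus ?thesis
    unfolding act_def[of "g ** h"] act_def[of g]
    using iwasawa_coords_scale_orthogonal[OF *(1) less_imp_neq[OF *(2), symmetric]] by (simp only:)
qed

lemma act_1: "p \<in> half_space3 \<Longrightarrow> act (mat 1) p = p"
  by (simp add: act_def iwasawa_coords_iwasawa)

section \<open>The invariant measure\<close>

lemma nn_integral_indicator_SUP:
  assumes [measurable]: "F \<in> borel_measurable M" "\<And>n. A n \<in> sets M" and "incseq A"
  shows "(\<integral>\<^sup>+x. F x * indicator (\<Union>n::nat. A n) x \<partial>M) = (SUP n. \<integral>\<^sup>+x. F x * indicator (A n) x \<partial>M)"
proof -
  have "(SUP n. emeasure (density M F) (A n)) = emeasure (density M F) (\<Union>n. A n)"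
    using assms by (intro SUP_emeasure_incseq) auto
  thus ?thesis by (simp add: emeasure_density)
qed

text \<open>Substitution y = exp s on the compact intervals from -(n + 1) to n + 1, followed by
  monotone convergence as they exhaust the line.\<close>

lemma nn_integral_exp_substitution:
  fixes F :: "real \<Rightarrow> ennreal"
  assumes [measurable]: "F \<in> borel_measurable borel"
  shows "(\<integral>\<^sup>+y. indicator {0<..} y * F y \<partial>lborel) = (\<integral>\<^sup>+s. F (exp s) * ennreal (exp s) \<partial>lborel)"
proof -
  have 1: "(\<integral>\<^sup>+y. F y * indicator {exp (- real (Suc n))..exp (real (Suc n))} y \<partial>lborel)
      = (\<integral>\<^sup>+s. F (exp s) * ennreal (exp s) * indicator {- real (Suc n)..real (Suc n)} s \<partial>lborel)" for n
    by (rule nn_integral_substitution_aux) (auto intro!: derivative_eq_intros continuous_intros)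
  have U: "(\<Union>n. {exp (- real (Suc n))..exp (real (Suc n))}) = {0<..}"
  proof (intro set_eqI iffI)
    fix y :: real assume "y \<in> {0<..}" hence y: "y > 0" by simp
    obtain n where n: "\<bar>ln y\<bar> \<le> real n" using real_arch_simple by blast
    have "exp (- real (Suc n)) \<le> exp (ln y)" "exp (ln y) \<le> exp (real (Suc n))"
      using n by auto
    thus "y \<in> (\<Union>n. {exp (- real (Suc n))..exp (real (Suc n))})" using y
      by (intro UN_I[of n]) auto
  next
    fix y :: real assume "y \<in> (\<Union>n. {exp (- real (Suc n))..exp (real (Suc n))})"
    thus "y \<in> {0<..}" using less_le_trans[OF exp_gt_zero] by auto
  qed
  have "(\<integral>\<^sup>+y. F y * indicator {0<..} y \<partial>lborel) =
     (SUP n. (\<integral>\<^sup>+y. F y * indicator {exp (- real (Suc n))..exp (real (Suc n))} y \<partial>lborel))"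
    unfolding U[symmetric] by (intro nn_integral_indicator_SUP) (auto simp: incseq_def)
  also have "\<dots> = (\<integral>\<^sup>+s. F (exp s) * ennreal (exp s) * indicator UNIV s \<partial>lborel)"
  proof -
    have V: "(\<Union>n. {- real (Suc n)..real (Suc n)}) = UNIV"
    proof (intro set_eqI iffI UNIV_I)
      fix y :: real
      obtain n where n: "\<bar>y\<bar> \<le> real n" using real_arch_simple by blast
      thus "y \<in> (\<Union>n. {- real (Suc n)..real (Suc n)})" by (intro UN_I[of n]) auto
    qed
    show ?thesis unfolding 1 V[symmetric]
      by (intro nn_integral_indicator_SUP[symmetric]) (auto simp: incseq_def)
  qed
  finally show ?thesis by (simp add: mult.commute)
qed

lemma nn_integral_shift:
  fixes F :: "real \<Rightarrow> ennreal"
  assumes "F \<in> borel_measurable borel"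
  shows "(\<integral>\<^sup>+x. F (x + c) \<partial>lborel) = (\<integral>\<^sup>+x. F x \<partial>lborel)"
  using nn_integral_real_affine[OF assms, of 1 c] by (simp add: add.commute)

lemma nn_integral_dilate:
  fixes F :: "real \<Rightarrow> ennreal"
  assumes "F \<in> borel_measurable borel" "c \<noteq> 0"
  shows "(\<integral>\<^sup>+x. F (c * x) \<partial>lborel) = ennreal (1 / \<bar>c\<bar>) * (\<integral>\<^sup>+x. F x \<partial>lborel)"
proof -
  have "ennreal (1 / \<bar>c\<bar>) * (ennreal \<bar>c\<bar> * (\<integral>\<^sup>+x. F (c * x) \<partial>lborel)) = (\<integral>\<^sup>+x. F (c * x) \<partial>lborel)"
    using assms(2) by (simp flip: mult.assoc ennreal_mult)
  thus ?thesis using nn_integral_real_affine[OF assms, of 0] by simp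
qed

text \<open>Substitution w = 1 / (c y), for which c dy corresponds to dw / w^2. After a dilation by
  c the inversion becomes the reflection s -> -s in the variable s = ln y.\<close>

lemma nn_integral_reciprocal:
  fixes G :: "real \<Rightarrow> ennreal"
  assumes [measurable]: "G \<in> borel_measurable borel" and "c > 0"
  shows "(\<integral>\<^sup>+y. indicator {0<..} y * (ennreal c * G (1 / (c * y))) \<partial>lborel)
    = (\<integral>\<^sup>+y. indicator {0<..} y * (ennreal (1 / y\<^sup>2) * G y) \<partial>lborel)"
proof -
  have *: "(\<integral>\<^sup>+y. indicator {0<..} y * G (1 / y) \<partial>lborel)
     = (\<integral>\<^sup>+y. indicator {0<..} y * (ennreal (1 / y\<^sup>2) * G y) \<partial>lborel)"
  proof -
    have "(\<integral>\<^sup>+y. indicator {0<..} y * G (1 / y) \<partial>lborel) = (\<integral>\<^sup>+s. G (1 / exp s) * ennreal (exp s) \<partial>lborel)"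
      by (rule nn_integral_exp_substitution) simp
    also have "\<dots> = (\<integral>\<^sup>+s. G (exp (- s)) * ennreal (exp s) \<partial>lborel)"
      by (simp add: exp_minus divide_inverse)
    also have "\<dots> = (\<integral>\<^sup>+s. G (exp s) * ennreal (exp (- s)) \<partial>lborel)"
      by (subst nn_integral_real_affine[where c = "-1" and t = 0]) auto
    also have "\<dots> = (\<integral>\<^sup>+s. (ennreal (1 / (exp s)\<^sup>2) * G (exp s)) * ennreal (exp s) \<partial>lborel)"
    proof (intro nn_integral_cong)
      fix s :: real
      have "ennreal (1 / (exp s)\<^sup>2) * ennreal (exp s) = ennreal (exp (- s))"
        by (subst ennreal_mult[symmetric]) (auto simp: power2_eq_square exp_minus divide_inverse)
      thus "G (exp s) * ennreal (exp (- s)) = ennreal (1 / (exp s)\<^sup>2) * G (exp s) * ennreal (exp s)"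
        by (metis mult.assoc mult.commute)
    qed
    also have "\<dots> = (\<integral>\<^sup>+y. indicator {0<..} y * (ennreal (1 / y\<^sup>2) * G y) \<partial>lborel)"
      by (rule nn_integral_exp_substitution[symmetric]) simp
    finally show ?thesis .
  qed
  have "(\<integral>\<^sup>+y. indicator {0<..} y * (ennreal c * G (1 / (c * y))) \<partial>lborel) =
     (\<integral>\<^sup>+y. ennreal c * (indicator {0<..} (c * y) * G (1 / (c * y))) \<partial>lborel)"
    using assms(2) by (intro nn_integral_cong) (auto simp: indicator_def zero_less_mult_iff)
  also have "\<dots> = ennreal c * (\<integral>\<^sup>+y. indicator {0<..} (c * y) * G (1 / (c * y)) \<partial>lborel)"
    by (rule nn_integral_cmult) simp
  also have "(\<integral>\<^sup>+y. indicator {0<..} (c * y) * G (1 / (c * y)) \<partial>lborel) =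
      ennreal (1 / \<bar>c\<bar>) * (\<integral>\<^sup>+y. indicator {0<..} y * G (1 / y) \<partial>lborel)"
    using assms(2) by (intro nn_integral_dilate) auto
  finally show ?thesis using assms(2) * by (simp flip: mult.assoc ennreal_mult)
qed

text \<open>The measure \<open>dx dy / y\<^sup>2\<close> is invariant under \<open>z \<mapsto> 1 / cnj z\<close>: in the coordinates
  \<open>u = x / y\<close>, \<open>y\<close> the map fixes \<open>u\<close> and sends \<open>y\<close> to \<open>1 / ((1 + u\<^sup>2) y)\<close>.\<close>

lemma nn_integral_inversion:
  fixes \<Phi> :: "real \<times> real \<Rightarrow> ennreal"
  assumes [measurable]: "\<Phi> \<in> borel_measurable borel"
  shows "(\<integral>\<^sup>+y. \<integral>\<^sup>+x. indicator {0<..} y * (ennreal ((x\<^sup>2 + y\<^sup>2) / y ^ 3)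
        * \<Phi> (x / (x\<^sup>2 + y\<^sup>2), y / (x\<^sup>2 + y\<^sup>2))) \<partial>lborel \<partial>lborel)
    = (\<integral>\<^sup>+y. \<integral>\<^sup>+x. indicator {0<..} y * (ennreal (1 / y ^ 3) * \<Phi> (x, y)) \<partial>lborel \<partial>lborel)"
proof -
  have scale: "(\<integral>\<^sup>+y. \<integral>\<^sup>+x. indicator {0<..} y * F x y \<partial>lborel \<partial>lborel)
     = (\<integral>\<^sup>+u. \<integral>\<^sup>+y. indicator {0<..} y * (ennreal y * F (u * y) y) \<partial>lborel \<partial>lborel)"
    if [measurable]: "case_prod F \<in> borel_measurable (borel \<Otimes>\<^sub>M borel)" for F :: "real \<Rightarrow> real \<Rightarrow> ennreal"
  proof -
    have "(\<integral>\<^sup>+x. indicator {0<..} y * F x y \<partial>lborel)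
        = (\<integral>\<^sup>+u. indicator {0<..} y * (ennreal y * F (u * y) y) \<partial>lborel)" for y :: real
    proof (cases "y > 0")
      case True
      have "(\<integral>\<^sup>+x. indicator {0<..} y * F x y \<partial>lborel)
          = ennreal \<bar>y\<bar> * (\<integral>\<^sup>+u. indicator {0<..} y * F (0 + y * u) y \<partial>lborel)"
        using True by (intro nn_integral_real_affine) auto
      also have "\<dots> = (\<integral>\<^sup>+u. ennreal \<bar>y\<bar> * (indicator {0<..} y * F (0 + y * u) y) \<partial>lborel)"
        by (rule nn_integral_cmult[symmetric]) simp
      finally show ?thesis using True by (simp add: mult.commute)
    qed simp
    hence "(\<integral>\<^sup>+y. \<integral>\<^sup>+x. indicator {0<..} y * F x y \<partial>lborel \<partial>lborel)
       = (\<integral>\<^sup>+y. \<integral>\<^sup>+u. indicator {0<..} y * (ennreal y * F (u * y) y) \<partial>lborel \<partial>lborel)"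
      by simp
    also have "\<dots> = (\<integral>\<^sup>+u. \<integral>\<^sup>+y. indicator {0<..} y * (ennreal y * F (u * y) y) \<partial>lborel \<partial>lborel)"
      by (rule lborel_pair.Fubini') measurable
    finally show ?thesis .
  qed
  have "(\<integral>\<^sup>+y. \<integral>\<^sup>+x. indicator {0<..} y * (ennreal ((x\<^sup>2 + y\<^sup>2) / y ^ 3)
        * \<Phi> (x / (x\<^sup>2 + y\<^sup>2), y / (x\<^sup>2 + y\<^sup>2))) \<partial>lborel \<partial>lborel)
     = (\<integral>\<^sup>+u. \<integral>\<^sup>+y. indicator {0<..} y * (ennreal y * (ennreal (((u * y)\<^sup>2 + y\<^sup>2) / y ^ 3)
        * \<Phi> (u * y / ((u * y)\<^sup>2 + y\<^sup>2), y / ((u * y)\<^sup>2 + y\<^sup>2)))) \<partial>lborel \<partial>lborel)"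
    by (rule scale) measurable
  also have "\<dots> = (\<integral>\<^sup>+u. \<integral>\<^sup>+y. indicator {0<..} y * (ennreal (1 + u\<^sup>2)
        * \<Phi> (u * (1 / ((1 + u\<^sup>2) * y)), 1 / ((1 + u\<^sup>2) * y))) \<partial>lborel \<partial>lborel)"
  proof (intro nn_integral_cong)
    fix u y :: real
    show "indicator {0<..} y * (ennreal y * (ennreal (((u * y)\<^sup>2 + y\<^sup>2) / y ^ 3)
        * \<Phi> (u * y / ((u * y)\<^sup>2 + y\<^sup>2), y / ((u * y)\<^sup>2 + y\<^sup>2)))) =
      indicator {0<..} y * (ennreal (1 + u\<^sup>2) * \<Phi> (u * (1 / ((1 + u\<^sup>2) * y)), 1 / ((1 + u\<^sup>2) * y)))"
    proof (cases "y > 0")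
      case True
      have s: "(u * y)\<^sup>2 + y\<^sup>2 = y * (y * (1 + u\<^sup>2))"
        by (simp add: algebra_simps power2_eq_square)
      have "y * (((u * y)\<^sup>2 + y\<^sup>2) / y ^ 3) = 1 + u\<^sup>2"
        unfolding s using True by (simp add: power3_eq_cube)
      hence a: "ennreal y * ennreal (((u * y)\<^sup>2 + y\<^sup>2) / y ^ 3) = ennreal (1 + u\<^sup>2)"
        using True by (subst ennreal_mult[symmetric]) auto
      have b: "u * y / ((u * y)\<^sup>2 + y\<^sup>2) = u * (1 / ((1 + u\<^sup>2) * y))"
        "y / ((u * y)\<^sup>2 + y\<^sup>2) = 1 / ((1 + u\<^sup>2) * y)"
        unfolding s using True by (simp_all add: mult_ac)
      show ?thesis unfolding b mult.assoc[symmetric] by (simp only: a mult.assoc)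
    qed simp
  qed
  also have "\<dots> = (\<integral>\<^sup>+u. \<integral>\<^sup>+y. indicator {0<..} y * (ennreal (1 / y\<^sup>2) * \<Phi> (u * y, y)) \<partial>lborel \<partial>lborel)"
  proof (rule nn_integral_cong)
    fix u :: real
    have "0 < 1 + u\<^sup>2" by (smt (verit) zero_le_power2)
    thus "(\<integral>\<^sup>+y. indicator {0<..} y * (ennreal (1 + u\<^sup>2)
        * \<Phi> (u * (1 / ((1 + u\<^sup>2) * y)), 1 / ((1 + u\<^sup>2) * y))) \<partial>lborel) =
        (\<integral>\<^sup>+y. indicator {0<..} y * (ennreal (1 / y\<^sup>2) * \<Phi> (u * y, y)) \<partial>lborel)"
      by (intro nn_integral_reciprocal[of "\<lambda>y. \<Phi> (u * y, y)"]) measurable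
  qed
  also have "\<dots> = (\<integral>\<^sup>+u. \<integral>\<^sup>+y. indicator {0<..} y * (ennreal y * (ennreal (1 / y ^ 3) * \<Phi> (u * y, y))) \<partial>lborel \<partial>lborel)"
  proof (intro nn_integral_cong)
    fix u y :: real
    have "ennreal y * ennreal (1 / y ^ 3) = ennreal (1 / y\<^sup>2)" if "y > 0"
      using that by (subst ennreal_mult[symmetric]) (auto simp: power3_eq_cube power2_eq_square)
    thus "indicator {0<..} y * (ennreal (1 / y\<^sup>2) * \<Phi> (u * y, y)) =
        indicator {0<..} y * (ennreal y * (ennreal (1 / y ^ 3) * \<Phi> (u * y, y)))"
      by (cases "y > 0") (simp_all flip: mult.assoc)
  qed
  also have "\<dots> = (\<integral>\<^sup>+y. \<integral>\<^sup>+x. indicator {0<..} y * (ennreal (1 / y ^ 3) * \<Phi> (x, y)) \<partial>lborel \<partial>lborel)"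
  proof (rule sym, rule scale[of "\<lambda>x y. ennreal (1 / y ^ 3) * \<Phi> (x, y)"])
    show "(\<lambda>(x, y). ennreal (1 / y ^ 3) * \<Phi> (x, y)) \<in> borel_measurable (borel \<Otimes>\<^sub>M borel)" by measurable
  qed
  finally show ?thesis .
qed

section \<open>The measure \<open>haar3\<close> and coordinate changes that preserve it\<close>

definition haar3 :: "coords3 measure" where
  "haar3 = density lborel (\<lambda>(x1, x2, x3, y1, y2).
     indicator {0<..} y1 * indicator {0<..} y2 * ennreal (1 / (y1 ^ 3 * y2 ^ 3)))"

lemma sets_haar3 [measurable_cong, simp]: "sets haar3 = sets borel"
  by (simp add: haar3_def)

lemma space_haar3 [simp]: "space haar3 = UNIV"
  by (simp add: haar3_def)

lemma borel_measurable_5 [measurable]: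
  "(\<lambda>p::coords3. fst p) \<in> borel_measurable borel"
  "(\<lambda>p::coords3. fst (snd p)) \<in> borel_measurable borel"
  "(\<lambda>p::coords3. fst (snd (snd p))) \<in> borel_measurable borel"
  "(\<lambda>p::coords3. fst (snd (snd (snd p)))) \<in> borel_measurable borel"
  "(\<lambda>p::coords3. snd (snd (snd (snd p)))) \<in> borel_measurable borel"
  by (intro borel_measurable_continuous_onI continuous_intros)+

lemma nn_integral_haar3_density:
  assumes [measurable]: "h \<in> borel_measurable borel"
  shows "(\<integral>\<^sup>+p. h p \<partial>haar3) = (\<integral>\<^sup>+p. (case p of (x1, x2, x3, y1, y2) \<Rightarrow>
     indicator {0<..} y1 * indicator {0<..} y2 * ennreal (1 / (y1 ^ 3 * y2 ^ 3))) * h p \<partial>lborel)"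
  unfolding haar3_def split_beta' by (rule nn_integral_density; measurable)

lemma nn_integral_haar3:
  assumes [measurable]: "h \<in> borel_measurable borel"
  shows "(\<integral>\<^sup>+p. h p \<partial>haar3) = (\<integral>\<^sup>+x1. \<integral>\<^sup>+x2. \<integral>\<^sup>+x3. \<integral>\<^sup>+y1. \<integral>\<^sup>+y2.
     indicator {0<..} y1 * indicator {0<..} y2 * ennreal (1 / (y1 ^ 3 * y2 ^ 3)) * h (x1, x2, x3, y1, y2)
     \<partial>lborel \<partial>lborel \<partial>lborel \<partial>lborel \<partial>lborel)"
proof -
  have prod: "(\<integral>\<^sup>+p. F p \<partial>lborel) = (\<integral>\<^sup>+x. \<integral>\<^sup>+y. F (x, y) \<partial>lborel \<partial>lborel)"
    if "F \<in> borel_measurable borel" for F :: "'b::euclidean_space \<times> 'c::euclidean_space \<Rightarrow> ennreal"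
  proof -
    have "F \<in> borel_measurable (lborel \<Otimes>\<^sub>M lborel)" unfolding lborel_prod using that by simp
    from lborel.nn_integral_fst[OF this] show ?thesis by (simp add: lborel_prod)
  qed
  define H where "H p = (case p of (x1, x2, x3, y1, y2) \<Rightarrow>
     indicator {0<..} y1 * indicator {0<..} y2 * ennreal (1 / (y1 ^ 3 * y2 ^ 3))) * h p" for p :: coords3
  have H [measurable]: "H \<in> borel_measurable borel"
    unfolding H_def split_beta' by measurable
  have "(\<integral>\<^sup>+p. h p \<partial>haar3) = (\<integral>\<^sup>+p. H p \<partial>lborel)"
    by (simp add: nn_integral_haar3_density H_def)
  also have "\<dots> = (\<integral>\<^sup>+x1. \<integral>\<^sup>+x2. \<integral>\<^sup>+x3. \<integral>\<^sup>+y1. \<integral>\<^sup>+y2. H (x1, x2, x3, y1, y2)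
     \<partial>lborel \<partial>lborel \<partial>lborel \<partial>lborel \<partial>lborel)"
    by (subst prod, measurable, intro nn_integral_cong)+ (subst prod, measurable)
  finally show ?thesis by (simp add: H_def)
qed

lemma measurable_iwasawa_entry [measurable]:
  "(\<lambda>p. iwasawa p $ i $ j) \<in> borel_measurable borel"
proof -
  have i: "i = 1 \<or> i = 2 \<or> i = 3" and j: "j = 1 \<or> j = 2 \<or> j = 3" using exhaust_3 by blast+
  have eqs: "iwasawa p $ 1 = vector [fst (snd (snd (snd p))) * snd (snd (snd (snd p))),
       fst (snd p) * fst (snd (snd (snd p))), fst (snd (snd p))]"
    "iwasawa p $ 2 = vector [0, fst (snd (snd (snd p))), fst p]"
    "iwasawa p $ 3 = vector [0, 0, 1]" for p
    by (cases p, simp)+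
  from i j show ?thesis by (elim disjE) (simp_all add: eqs)
qed

lemma measurable_act [measurable]: "act g \<in> borel_measurable borel"
proof -
  have e [measurable]: "(\<lambda>p. (g ** iwasawa p) $ i $ j) \<in> borel_measurable borel" for i j
    unfolding matrix_matrix_mult_def by simp
  show ?thesis
    unfolding act_def iwasawa_coords_def Let_def inner_3 det_3 by measurable
qed

abbreviation w3 :: "real \<Rightarrow> ennreal" where "w3 y \<equiv> indicator {0<..} y * ennreal (1 / y ^ 3)"

lemma nn_integral_haar3_w3:
  assumes [measurable]: "h \<in> borel_measurable borel"
  shows "(\<integral>\<^sup>+p. h p \<partial>haar3) = (\<integral>\<^sup>+x1. \<integral>\<^sup>+x2. \<integral>\<^sup>+x3. \<integral>\<^sup>+y1. \<integral>\<^sup>+y2.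
     w3 y1 * (w3 y2 * h (x1, x2, x3, y1, y2))
     \<partial>lborel \<partial>lborel \<partial>lborel \<partial>lborel \<partial>lborel)"
  unfolding nn_integral_haar3[OF assms]
proof (intro nn_integral_cong)
  fix x1 x2 x3 y1 y2 :: real
  have "ennreal (1 / (y1 ^ 3 * y2 ^ 3)) = ennreal (1 / y1 ^ 3) * ennreal (1 / y2 ^ 3)" if "y1 > 0" "y2 > 0"
    using that by (subst ennreal_mult[symmetric]) auto
  thus "indicator {0<..} y1 * indicator {0<..} y2 * ennreal (1 / (y1 ^ 3 * y2 ^ 3)) * h (x1, x2, x3, y1, y2)
     = w3 y1 * (w3 y2 * h (x1, x2, x3, y1, y2))"
    by (cases "y1 > 0"; cases "y2 > 0") (simp_all add: mult_ac)
qed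

text \<open>The measure dy / y^3 is homogeneous of degree -2, whence c^2. For the two transpositions
  below, this factor becomes the numerator in \<open>nn_integral_inversion\<close>.\<close>

lemma nn_integral_w3_dilate:
  fixes F :: "real \<Rightarrow> ennreal"
  assumes [measurable]: "F \<in> borel_measurable borel" and c: "c > 0"
  shows "(\<integral>\<^sup>+y. w3 y * F (c * y) \<partial>lborel) = ennreal (c\<^sup>2) * (\<integral>\<^sup>+y. w3 y * F y \<partial>lborel)"
proof -
  have "(\<integral>\<^sup>+y. w3 y * F (c * y) \<partial>lborel) = (\<integral>\<^sup>+y. ennreal (c ^ 3) * (w3 (c * y) * F (c * y)) \<partial>lborel)"
  proof (intro nn_integral_cong)
    fix y :: real
    have "ennreal (c ^ 3) * ennreal (1 / (c * y) ^ 3) = ennreal (1 / y ^ 3)" if "y > 0"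
      using that c by (subst ennreal_mult[symmetric]) (auto simp: power_mult_distrib)
    thus "w3 y * F (c * y) = ennreal (c ^ 3) * (w3 (c * y) * F (c * y))"
      using c by (cases "y > 0") (simp_all add: zero_less_mult_iff flip: mult.assoc)
  qed
  also have "\<dots> = ennreal (c ^ 3) * (\<integral>\<^sup>+y. w3 (c * y) * F (c * y) \<partial>lborel)"
    by (rule nn_integral_cmult) measurable
  also have "(\<integral>\<^sup>+y. w3 (c * y) * F (c * y) \<partial>lborel) = ennreal (1 / \<bar>c\<bar>) * (\<integral>\<^sup>+y. w3 y * F y \<partial>lborel)"
    using c by (intro nn_integral_dilate[of "\<lambda>y. w3 y * F y"]) auto
  also have "ennreal (c ^ 3) * (ennreal (1 / \<bar>c\<bar>) * (\<integral>\<^sup>+y. w3 y * F y \<partial>lborel))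
     = ennreal (c\<^sup>2) * (\<integral>\<^sup>+y. w3 y * F y \<partial>lborel)"
    using c by (simp add: power2_eq_square power3_eq_cube flip: mult.assoc ennreal_mult)
  finally show ?thesis .
qed

text \<open>Stated for an arbitrary map rather than for \<open>act g\<close>, so that explicit
  coordinate formulas can be used: they agree with the action on \<open>half_space3\<close>, which
  carries the whole mass of \<open>haar3\<close>.\<close>

definition haar3_invariant :: "(coords3 \<Rightarrow> coords3) \<Rightarrow> bool" where
  "haar3_invariant T \<longleftrightarrow> (\<forall>h\<in>borel_measurable borel. (\<integral>\<^sup>+p. h (T p) \<partial>haar3) = (\<integral>\<^sup>+p. h p \<partial>haar3))"

lemma AE_haar3_half_space3: "AE p in haar3. p \<in> half_space3"
  unfolding haar3_def split_beta'
  by (subst AE_density, measurable) (auto simp: half_space3_def indicator_def split_beta')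

lemma haar3_invariant_cong:
  assumes "haar3_invariant T" "\<And>p. p \<in> half_space3 \<Longrightarrow> T' p = T p"
  shows "haar3_invariant T'"
  unfolding haar3_invariant_def
proof
  fix h :: "coords3 \<Rightarrow> ennreal" assume "h \<in> borel_measurable borel"
  moreover have "(\<integral>\<^sup>+p. h (T' p) \<partial>haar3) = (\<integral>\<^sup>+p. h (T p) \<partial>haar3)"
    using AE_haar3_half_space3 by (intro nn_integral_cong_AE) (auto simp: assms(2))
  ultimately show "(\<integral>\<^sup>+p. h (T' p) \<partial>haar3) = (\<integral>\<^sup>+p. h p \<partial>haar3)"
    using assms(1) by (simp add: haar3_invariant_def)
qed

text \<open>The coordinate form of left multiplication by \<open>unip3 a b c\<close>. The change of
  variables is triangular with unit diagonal; the shift of \<open>x3\<close>, which depends on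
  \<open>x1\<close>, is removed first in the innermost of the three x-integrals.\<close>

lemma haar3_invariant_shear:
  "haar3_invariant (\<lambda>(x1, x2, x3, y1, y2). (x1 + a, x2 + b, x3 + c + b * x1, y1, y2))"
  unfolding haar3_invariant_def
proof
  fix h :: "coords3 \<Rightarrow> ennreal" assume [measurable]: "h \<in> borel_measurable borel"
  define J where "J x1 x2 x3 = (\<integral>\<^sup>+y1. \<integral>\<^sup>+y2. w3 y1 * (w3 y2 * h (x1, x2, x3, y1, y2)) \<partial>lborel \<partial>lborel)"
    for x1 x2 x3
  have [measurable]: "(\<lambda>(x1, x2, x3). J x1 x2 x3) \<in> borel_measurable (borel \<Otimes>\<^sub>M borel \<Otimes>\<^sub>M borel)"
    unfolding J_def split_beta' by measurable
  have [measurable]: "(\<lambda>x. J (fst (fst x)) (snd (fst x)) (snd x)) \<in> borel_measurable ((borel \<Otimes>\<^sub>M borel) \<Otimes>\<^sub>M borel)"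
    "\<And>x1. (\<lambda>x. J x1 (fst x) (snd x)) \<in> borel_measurable (borel \<Otimes>\<^sub>M borel)"
    unfolding J_def by measurable
  have "(\<integral>\<^sup>+p. h (case p of (x1, x2, x3, y1, y2) \<Rightarrow> (x1 + a, x2 + b, x3 + c + b * x1, y1, y2)) \<partial>haar3)
     = (\<integral>\<^sup>+x1. \<integral>\<^sup>+x2. \<integral>\<^sup>+x3. J (x1 + a) (x2 + b) (x3 + (c + b * x1)) \<partial>lborel \<partial>lborel \<partial>lborel)"
    by (subst nn_integral_haar3_w3) (unfold split_beta', measurable, simp add: J_def add.assoc)
  also have "\<dots> = (\<integral>\<^sup>+x1. \<integral>\<^sup>+x2. \<integral>\<^sup>+x3. J (x1 + a) (x2 + b) x3 \<partial>lborel \<partial>lborel \<partial>lborel)"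
    by (intro nn_integral_cong nn_integral_shift[of "J _ _"]) measurable
  also have "\<dots> = (\<integral>\<^sup>+x1. \<integral>\<^sup>+x2. \<integral>\<^sup>+x3. J (x1 + a) x2 x3 \<partial>lborel \<partial>lborel \<partial>lborel)"
    by (intro nn_integral_cong nn_integral_shift[of "\<lambda>x2. \<integral>\<^sup>+x3. J _ x2 x3 \<partial>lborel"]) measurable
  also have "\<dots> = (\<integral>\<^sup>+x1. \<integral>\<^sup>+x2. \<integral>\<^sup>+x3. J x1 x2 x3 \<partial>lborel \<partial>lborel \<partial>lborel)"
    by (rule nn_integral_shift[of "\<lambda>x1. \<integral>\<^sup>+x2. \<integral>\<^sup>+x3. J x1 x2 x3 \<partial>lborel \<partial>lborel"]) measurable
  also have "\<dots> = (\<integral>\<^sup>+p. h p \<partial>haar3)"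
    by (subst nn_integral_haar3_w3) (simp_all add: J_def[abs_def])
  finally show "(\<integral>\<^sup>+p. h (case p of (x1, x2, x3, y1, y2) \<Rightarrow> (x1 + a, x2 + b, x3 + c + b * x1, y1, y2)) \<partial>haar3)
     = (\<integral>\<^sup>+p. h p \<partial>haar3)" .
qed

text \<open>The integrals over y1 and y2 contribute a^2 b^2, the dilations of x1, x2, x3 contribute
  1 / |a|, 1 / |b| and 1 / |a b|, and the product is 1.\<close>

lemma haar3_invariant_diag:
  assumes "a \<noteq> 0" "b \<noteq> 0"
  shows "haar3_invariant (\<lambda>(x1, x2, x3, y1, y2). (a * x1, b * x2, a * b * x3, \<bar>a\<bar> * y1, \<bar>b\<bar> * y2))"
  unfolding haar3_invariant_def
proof
  fix h :: "coords3 \<Rightarrow> ennreal" assume [measurable]: "h \<in> borel_measurable borel"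
  define J where "J x1 x2 x3 = (\<integral>\<^sup>+y1. \<integral>\<^sup>+y2. w3 y1 * (w3 y2 * h (x1, x2, x3, y1, y2)) \<partial>lborel \<partial>lborel)"
    for x1 x2 x3
  have Jm [measurable]: "(\<lambda>(x1, x2, x3). J x1 x2 x3) \<in> borel_measurable (borel \<Otimes>\<^sub>M borel \<Otimes>\<^sub>M borel)"
    unfolding J_def split_beta' by measurable
  have [measurable]: "(\<lambda>x. J (fst (fst x)) (snd (fst x)) (snd x)) \<in> borel_measurable ((borel \<Otimes>\<^sub>M borel) \<Otimes>\<^sub>M borel)"
    "\<And>x1. (\<lambda>x. J x1 (fst x) (snd x)) \<in> borel_measurable (borel \<Otimes>\<^sub>M borel)"
    unfolding J_def by measurable
  have J: "(\<integral>\<^sup>+y1. \<integral>\<^sup>+y2. w3 y1 * (w3 y2 * h (x1, x2, x3, \<bar>a\<bar> * y1, \<bar>b\<bar> * y2)) \<partial>lborel \<partial>lborel)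
     = ennreal (a\<^sup>2 * b\<^sup>2) * J x1 x2 x3" for x1 x2 x3
  proof -
    have "(\<integral>\<^sup>+y1. \<integral>\<^sup>+y2. w3 y1 * (w3 y2 * h (x1, x2, x3, \<bar>a\<bar> * y1, \<bar>b\<bar> * y2)) \<partial>lborel \<partial>lborel)
       = (\<integral>\<^sup>+y1. w3 y1 * (\<integral>\<^sup>+y2. w3 y2 * h (x1, x2, x3, \<bar>a\<bar> * y1, \<bar>b\<bar> * y2) \<partial>lborel) \<partial>lborel)"
      by (intro nn_integral_cong nn_integral_cmult) measurable
    also have "\<dots> = (\<integral>\<^sup>+y1. w3 y1 * (ennreal (\<bar>b\<bar>\<^sup>2) * (\<integral>\<^sup>+y2. w3 y2 * h (x1, x2, x3, \<bar>a\<bar> * y1, y2) \<partial>lborel)) \<partial>lborel)"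
      using assms by (subst nn_integral_w3_dilate) auto
    also have "\<dots> = ennreal (\<bar>a\<bar>\<^sup>2) * (\<integral>\<^sup>+y1. w3 y1 * (ennreal (\<bar>b\<bar>\<^sup>2) * (\<integral>\<^sup>+y2. w3 y2 * h (x1, x2, x3, y1, y2) \<partial>lborel)) \<partial>lborel)"
      using assms by (intro nn_integral_w3_dilate) auto
    also have "\<dots> = ennreal (\<bar>a\<bar>\<^sup>2) * (\<integral>\<^sup>+y1. ennreal (\<bar>b\<bar>\<^sup>2) * (\<integral>\<^sup>+y2. w3 y1 * (w3 y2 * h (x1, x2, x3, y1, y2)) \<partial>lborel) \<partial>lborel)"
      by (subst nn_integral_cmult, measurable) (simp add: mult_ac)
    also have "\<dots> = ennreal (\<bar>a\<bar>\<^sup>2) * (ennreal (\<bar>b\<bar>\<^sup>2) * J x1 x2 x3)"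
      unfolding J_def by (subst nn_integral_cmult) auto
    finally show ?thesis by (simp add: ennreal_mult mult.assoc)
  qed
  have "(\<integral>\<^sup>+p. h (case p of (x1, x2, x3, y1, y2) \<Rightarrow> (a * x1, b * x2, a * b * x3, \<bar>a\<bar> * y1, \<bar>b\<bar> * y2)) \<partial>haar3)
     = (\<integral>\<^sup>+x1. \<integral>\<^sup>+x2. \<integral>\<^sup>+x3. ennreal (a\<^sup>2 * b\<^sup>2) * J (a * x1) (b * x2) (a * b * x3) \<partial>lborel \<partial>lborel \<partial>lborel)"
    by (subst nn_integral_haar3_w3) (unfold split_beta', measurable, simp add: J)
  also have "\<dots> = (\<integral>\<^sup>+x1. \<integral>\<^sup>+x2. ennreal (1 / \<bar>a * b\<bar>) * (\<integral>\<^sup>+x3. ennreal (a\<^sup>2 * b\<^sup>2) * J (a * x1) (b * x2) x3 \<partial>lborel) \<partial>lborel \<partial>lborel)"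
    using assms by (intro nn_integral_cong nn_integral_dilate[of "\<lambda>x3. ennreal (a\<^sup>2 * b\<^sup>2) * J _ _ x3"]) auto
  also have "\<dots> = (\<integral>\<^sup>+x1. ennreal (1 / \<bar>b\<bar>) * (\<integral>\<^sup>+x2. ennreal (1 / \<bar>a * b\<bar>) * (\<integral>\<^sup>+x3. ennreal (a\<^sup>2 * b\<^sup>2) * J (a * x1) x2 x3 \<partial>lborel) \<partial>lborel) \<partial>lborel)"
    using assms by (intro nn_integral_cong nn_integral_dilate[of "\<lambda>x2. ennreal (1 / \<bar>a * b\<bar>) * (\<integral>\<^sup>+x3. ennreal (a\<^sup>2 * b\<^sup>2) * J _ x2 x3 \<partial>lborel)"]) auto
  also have "\<dots> = ennreal (1 / \<bar>a\<bar>) * (\<integral>\<^sup>+x1. ennreal (1 / \<bar>b\<bar>) * (\<integral>\<^sup>+x2. ennreal (1 / \<bar>a * b\<bar>) * (\<integral>\<^sup>+x3. ennreal (a\<^sup>2 * b\<^sup>2) * J x1 x2 x3 \<partial>lborel) \<partial>lborel) \<partial>lborel)"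
    using assms by (intro nn_integral_dilate[of "\<lambda>x1. ennreal (1 / \<bar>b\<bar>) * (\<integral>\<^sup>+x2. ennreal (1 / \<bar>a * b\<bar>) * (\<integral>\<^sup>+x3. ennreal (a\<^sup>2 * b\<^sup>2) * J x1 x2 x3 \<partial>lborel) \<partial>lborel)"]) auto
  also have "\<dots> = ennreal (1 / \<bar>a\<bar>) * (ennreal (1 / \<bar>b\<bar>) * (ennreal (1 / \<bar>a * b\<bar>) * (ennreal (a\<^sup>2 * b\<^sup>2) *
      (\<integral>\<^sup>+x1. \<integral>\<^sup>+x2. \<integral>\<^sup>+x3. J x1 x2 x3 \<partial>lborel \<partial>lborel \<partial>lborel))))"
    by (simp add: nn_integral_cmult)
  also have "\<dots> = (\<integral>\<^sup>+x1. \<integral>\<^sup>+x2. \<integral>\<^sup>+x3. J x1 x2 x3 \<partial>lborel \<partial>lborel \<partial>lborel)"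
  proof -
    have "1 / \<bar>a\<bar> * (1 / \<bar>b\<bar> * (1 / \<bar>a * b\<bar> * (a\<^sup>2 * b\<^sup>2))) = 1"
    proof -
      have g: "1 / u * (1 / v * (1 / (u * v) * (u * u * (v * v)))) = 1" if "u > 0" "v > 0" for u v :: real
        using that by simp
      have "a\<^sup>2 = \<bar>a\<bar> * \<bar>a\<bar>" "b\<^sup>2 = \<bar>b\<bar> * \<bar>b\<bar>" by (simp_all add: power2_eq_square)
      thus ?thesis using g[of "\<bar>a\<bar>" "\<bar>b\<bar>"] assms by (simp only: abs_mult zero_less_abs_iff not_False_eq_True)
    qed
    hence "ennreal (1 / \<bar>a\<bar>) * (ennreal (1 / \<bar>b\<bar>) * (ennreal (1 / \<bar>a * b\<bar>) * ennreal (a\<^sup>2 * b\<^sup>2))) = 1"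
      by (simp flip: ennreal_mult)
    hence "ennreal (1 / \<bar>a\<bar>) * (ennreal (1 / \<bar>b\<bar>) * (ennreal (1 / \<bar>a * b\<bar>) * ennreal (a\<^sup>2 * b\<^sup>2))) * I = I" for I
      by (simp only: mult_1)
    thus ?thesis by (simp only: mult.assoc)
  qed
  also have "\<dots> = (\<integral>\<^sup>+p. h p \<partial>haar3)"
    by (subst nn_integral_haar3_w3) (simp_all add: J_def[abs_def])
  finally show "(\<integral>\<^sup>+p. h (case p of (x1, x2, x3, y1, y2) \<Rightarrow> (a * x1, b * x2, a * b * x3, \<bar>a\<bar> * y1, \<bar>b\<bar> * y2)) \<partial>haar3)
     = (\<integral>\<^sup>+p. h p \<partial>haar3)" .
qed

text \<open>Interchange of the first two rows: z = x2 + i y2 goes to 1 / cnj z, y1 is multiplied by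
  the modulus of z, and x1, x3 are exchanged. The dilation of y1 yields the factor |z|^2 that
  \<open>nn_integral_inversion\<close> absorbs.\<close>

lemma haar3_invariant_swap12:
  "haar3_invariant (\<lambda>(x1, x2, x3, y1, y2).
     (x3, x2 / (x2\<^sup>2 + y2\<^sup>2), x1, sqrt (x2\<^sup>2 + y2\<^sup>2) * y1, y2 / (x2\<^sup>2 + y2\<^sup>2)))"
  (is "haar3_invariant ?T")
  unfolding haar3_invariant_def
proof
  fix h :: "coords3 \<Rightarrow> ennreal" assume [measurable]: "h \<in> borel_measurable borel"
  define J where "J x1 x3 z = (\<integral>\<^sup>+y1. w3 y1 * h (x1, fst z, x3, y1, snd z) \<partial>lborel)" for x1 x3 and z :: "real \<times> real"
  have [measurable]: "(\<lambda>(x1, x3, z). J x1 x3 z) \<in> borel_measurable (borel \<Otimes>\<^sub>M borel \<Otimes>\<^sub>M borel)"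
    unfolding J_def split_beta' borel_prod[symmetric] by measurable
  have [measurable]: "(\<lambda>((x1, x3), z). J x1 x3 z) \<in> borel_measurable ((borel \<Otimes>\<^sub>M borel) \<Otimes>\<^sub>M borel)"
    unfolding J_def split_beta' borel_prod[symmetric] by measurable
  have [measurable]: "(\<lambda>x. J (fst (fst (fst x))) (snd (fst (fst x))) (snd x, snd (fst x)))
      \<in> borel_measurable (((borel \<Otimes>\<^sub>M borel) \<Otimes>\<^sub>M borel) \<Otimes>\<^sub>M borel)"
    unfolding J_def by measurable
  have expand: "(\<integral>\<^sup>+p. g p \<partial>haar3) = (\<integral>\<^sup>+x1. \<integral>\<^sup>+x3. \<integral>\<^sup>+y2. \<integral>\<^sup>+x2. \<integral>\<^sup>+y1. w3 y1 * (w3 y2 * g (x1, x2, x3, y1, y2))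
      \<partial>lborel \<partial>lborel \<partial>lborel \<partial>lborel \<partial>lborel)"
    if [measurable]: "g \<in> borel_measurable borel" for g
  proof -
    have "(\<integral>\<^sup>+p. g p \<partial>haar3) = (\<integral>\<^sup>+x1. \<integral>\<^sup>+x2. \<integral>\<^sup>+x3. \<integral>\<^sup>+y2. \<integral>\<^sup>+y1. w3 y1 * (w3 y2 * g (x1, x2, x3, y1, y2))
      \<partial>lborel \<partial>lborel \<partial>lborel \<partial>lborel \<partial>lborel)"
      unfolding nn_integral_haar3_w3[OF that]
      by (intro nn_integral_cong lborel_pair.Fubini') measurable
    also have "\<dots> = (\<integral>\<^sup>+x1. \<integral>\<^sup>+x3. \<integral>\<^sup>+x2. \<integral>\<^sup>+y2. \<integral>\<^sup>+y1. w3 y1 * (w3 y2 * g (x1, x2, x3, y1, y2))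
      \<partial>lborel \<partial>lborel \<partial>lborel \<partial>lborel \<partial>lborel)"
      by (intro nn_integral_cong lborel_pair.Fubini') measurable
    also have "\<dots> = (\<integral>\<^sup>+x1. \<integral>\<^sup>+x3. \<integral>\<^sup>+y2. \<integral>\<^sup>+x2. \<integral>\<^sup>+y1. w3 y1 * (w3 y2 * g (x1, x2, x3, y1, y2))
      \<partial>lborel \<partial>lborel \<partial>lborel \<partial>lborel \<partial>lborel)"
      by (intro nn_integral_cong lborel_pair.Fubini') measurable
    finally show ?thesis .
  qed
  have Tm [measurable]: "?T \<in> borel_measurable borel"
    unfolding split_beta' by measurable
  have "(\<integral>\<^sup>+p. h (?T p) \<partial>haar3) = (\<integral>\<^sup>+x1. \<integral>\<^sup>+x3. \<integral>\<^sup>+y2. \<integral>\<^sup>+x2. indicator {0<..} y2 * (ennreal ((x2\<^sup>2 + y2\<^sup>2) / y2 ^ 3) *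
      J x3 x1 (x2 / (x2\<^sup>2 + y2\<^sup>2), y2 / (x2\<^sup>2 + y2\<^sup>2))) \<partial>lborel \<partial>lborel \<partial>lborel \<partial>lborel)"
    unfolding expand[of "\<lambda>p. h (?T p)", OF measurable_compose[OF Tm \<open>h \<in> borel_measurable borel\<close>]]
  proof (intro nn_integral_cong)
    fix x1 x3 y2 x2 :: real
    let ?s = "x2\<^sup>2 + y2\<^sup>2"
    show "(\<integral>\<^sup>+y1. w3 y1 * (w3 y2 * h (?T (x1, x2, x3, y1, y2))) \<partial>lborel) =
       indicator {0<..} y2 * (ennreal (?s / y2 ^ 3) * J x3 x1 (x2 / ?s, y2 / ?s))"
    proof (cases "y2 > 0")
      case True
      hence s: "?s > 0" by (simp add: add_nonneg_pos)
      have "(\<integral>\<^sup>+y1. w3 y1 * (w3 y2 * h (?T (x1, x2, x3, y1, y2))) \<partial>lborel) =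
         (\<integral>\<^sup>+y1. w3 y2 * (w3 y1 * h (x3, x2 / ?s, x1, sqrt ?s * y1, y2 / ?s)) \<partial>lborel)"
        by (simp add: mult_ac)
      also have "\<dots> = w3 y2 * (\<integral>\<^sup>+y1. w3 y1 * h (x3, x2 / ?s, x1, sqrt ?s * y1, y2 / ?s) \<partial>lborel)"
        by (rule nn_integral_cmult) measurable
      also have "(\<integral>\<^sup>+y1. w3 y1 * h (x3, x2 / ?s, x1, sqrt ?s * y1, y2 / ?s) \<partial>lborel) =
          ennreal ((sqrt ?s)\<^sup>2) * (\<integral>\<^sup>+y1. w3 y1 * h (x3, x2 / ?s, x1, y1, y2 / ?s) \<partial>lborel)"
        using s by (intro nn_integral_w3_dilate[of "\<lambda>y1. h (x3, x2 / ?s, x1, y1, y2 / ?s)"]) auto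
      also have "\<dots> = ennreal ?s * J x3 x1 (x2 / ?s, y2 / ?s)"
        using s by (simp add: J_def)
      also have "w3 y2 * (ennreal ?s * J x3 x1 (x2 / ?s, y2 / ?s)) =
          ennreal (?s / y2 ^ 3) * J x3 x1 (x2 / ?s, y2 / ?s)"
      proof -
        have "ennreal (1 / y2 ^ 3) * ennreal ?s = ennreal (?s / y2 ^ 3)"
          using True s by (subst ennreal_mult[symmetric]) auto
        thus ?thesis using True by (simp flip: mult.assoc)
      qed
      finally show ?thesis using True by simp
    qed simp
  qed
  also have "\<dots> = (\<integral>\<^sup>+x1. \<integral>\<^sup>+x3. \<integral>\<^sup>+y2. \<integral>\<^sup>+x2. indicator {0<..} y2 * (ennreal (1 / y2 ^ 3) *
      J x3 x1 (x2, y2)) \<partial>lborel \<partial>lborel \<partial>lborel \<partial>lborel)"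
    by (intro nn_integral_cong nn_integral_inversion) measurable
  also have "\<dots> = (\<integral>\<^sup>+x3. \<integral>\<^sup>+x1. \<integral>\<^sup>+y2. \<integral>\<^sup>+x2. indicator {0<..} y2 * (ennreal (1 / y2 ^ 3) *
      J x3 x1 (x2, y2)) \<partial>lborel \<partial>lborel \<partial>lborel \<partial>lborel)"
    by (rule lborel_pair.Fubini') measurable
  also have "\<dots> = (\<integral>\<^sup>+p. h p \<partial>haar3)"
    unfolding expand[OF \<open>h \<in> borel_measurable borel\<close>]
  proof (intro nn_integral_cong)
    fix x1 x3 y2 x2 :: real
    have "(\<integral>\<^sup>+y1. w3 y1 * (w3 y2 * h (x1, x2, x3, y1, y2)) \<partial>lborel) =
       (\<integral>\<^sup>+y1. w3 y2 * (w3 y1 * h (x1, x2, x3, y1, y2)) \<partial>lborel)" by (simp add: mult_ac)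
    also have "\<dots> = w3 y2 * (\<integral>\<^sup>+y1. w3 y1 * h (x1, x2, x3, y1, y2) \<partial>lborel)"
      by (rule nn_integral_cmult) measurable
    finally show "indicator {0<..} y2 * (ennreal (1 / y2 ^ 3) * J x1 x3 (x2, y2)) =
      (\<integral>\<^sup>+y1. w3 y1 * (w3 y2 * h (x1, x2, x3, y1, y2)) \<partial>lborel)"
      by (simp add: J_def mult.assoc)
  qed
  finally show "(\<integral>\<^sup>+p. h (?T p) \<partial>haar3) = (\<integral>\<^sup>+p. h p \<partial>haar3)" .
qed

text \<open>Interchange of the last two rows: z = x1 + i y1 goes to 1 / cnj z and y2 is multiplied
  by the modulus of z. For fixed z the pair (x2, x3) undergoes a linear map of determinant -1,
  resolved below into two shears and an exchange of the integrations.\<close>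

lemma haar3_invariant_swap23:
  "haar3_invariant (\<lambda>(x1, x2, x3, y1, y2).
     (x1 / (x1\<^sup>2 + y1\<^sup>2), x3 - x1 * x2, (x2 * y1\<^sup>2 + x3 * x1) / (x1\<^sup>2 + y1\<^sup>2),
      y1 / (x1\<^sup>2 + y1\<^sup>2), sqrt (x1\<^sup>2 + y1\<^sup>2) * y2))"
  (is "haar3_invariant ?T")
  unfolding haar3_invariant_def
proof
  fix h :: "coords3 \<Rightarrow> ennreal" assume hm [measurable]: "h \<in> borel_measurable borel"
  define J where "J x2 x3 z = (\<integral>\<^sup>+y2. w3 y2 * h (fst z, x2, x3, snd z, y2) \<partial>lborel)" for x2 x3 and z :: "real \<times> real"
  have [measurable]: "(\<lambda>((x2, x3), z). J x2 x3 z) \<in> borel_measurable ((borel \<Otimes>\<^sub>M borel) \<Otimes>\<^sub>M borel)"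
    unfolding J_def split_beta' borel_prod[symmetric] by measurable
  have [measurable]: "(\<lambda>x. J (snd (fst x)) (snd x) (fst (fst x))) \<in> borel_measurable ((borel \<Otimes>\<^sub>M borel) \<Otimes>\<^sub>M borel)"
    unfolding J_def borel_prod[symmetric] by measurable
  have expand: "(\<integral>\<^sup>+p. g p \<partial>haar3) = (\<integral>\<^sup>+y1. \<integral>\<^sup>+x1. \<integral>\<^sup>+x2. \<integral>\<^sup>+x3. \<integral>\<^sup>+y2. w3 y1 * (w3 y2 * g (x1, x2, x3, y1, y2))
      \<partial>lborel \<partial>lborel \<partial>lborel \<partial>lborel \<partial>lborel)"
    if [measurable]: "g \<in> borel_measurable borel" for g
  proof -
    have "(\<integral>\<^sup>+p. g p \<partial>haar3) = (\<integral>\<^sup>+x1. \<integral>\<^sup>+x2. \<integral>\<^sup>+y1. \<integral>\<^sup>+x3. \<integral>\<^sup>+y2. w3 y1 * (w3 y2 * g (x1, x2, x3, y1, y2))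
      \<partial>lborel \<partial>lborel \<partial>lborel \<partial>lborel \<partial>lborel)"
      unfolding nn_integral_haar3_w3[OF that]
      by (intro nn_integral_cong lborel_pair.Fubini') measurable
    also have "\<dots> = (\<integral>\<^sup>+x1. \<integral>\<^sup>+y1. \<integral>\<^sup>+x2. \<integral>\<^sup>+x3. \<integral>\<^sup>+y2. w3 y1 * (w3 y2 * g (x1, x2, x3, y1, y2))
      \<partial>lborel \<partial>lborel \<partial>lborel \<partial>lborel \<partial>lborel)"
      by (intro nn_integral_cong lborel_pair.Fubini') measurable
    also have "\<dots> = (\<integral>\<^sup>+y1. \<integral>\<^sup>+x1. \<integral>\<^sup>+x2. \<integral>\<^sup>+x3. \<integral>\<^sup>+y2. w3 y1 * (w3 y2 * g (x1, x2, x3, y1, y2))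
      \<partial>lborel \<partial>lborel \<partial>lborel \<partial>lborel \<partial>lborel)"
      by (intro lborel_pair.Fubini') measurable
    finally show ?thesis .
  qed
  have Tm: "?T \<in> borel_measurable borel"
    unfolding split_beta' by measurable
  have hT: "(\<lambda>p. h (?T p)) \<in> borel_measurable borel"
    by (rule measurable_compose[OF Tm hm])
  define K where "K z = (\<integral>\<^sup>+x2. \<integral>\<^sup>+x3. J x2 x3 z \<partial>lborel \<partial>lborel)" for z
  have [measurable]: "K \<in> borel_measurable borel" unfolding K_def by measurable
  have "(\<integral>\<^sup>+p. h (?T p) \<partial>haar3) = (\<integral>\<^sup>+y1. \<integral>\<^sup>+x1. \<integral>\<^sup>+x2. \<integral>\<^sup>+x3. \<integral>\<^sup>+y2.
      w3 y1 * (w3 y2 * h (?T (x1, x2, x3, y1, y2))) \<partial>lborel \<partial>lborel \<partial>lborel \<partial>lborel \<partial>lborel)"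
    by (rule expand[OF hT])
  also have "\<dots> = (\<integral>\<^sup>+y1. \<integral>\<^sup>+x1. indicator {0<..} y1 * (ennreal ((x1\<^sup>2 + y1\<^sup>2) / y1 ^ 3) *
      K (x1 / (x1\<^sup>2 + y1\<^sup>2), y1 / (x1\<^sup>2 + y1\<^sup>2))) \<partial>lborel \<partial>lborel)"
  proof (rule nn_integral_cong, rule nn_integral_cong)
    fix x1 y1 :: real
    let ?s = "x1\<^sup>2 + y1\<^sup>2"
    let ?z = "(x1 / ?s, y1 / ?s)"
    show "(\<integral>\<^sup>+x2. \<integral>\<^sup>+x3. \<integral>\<^sup>+y2. w3 y1 * (w3 y2 * h (?T (x1, x2, x3, y1, y2))) \<partial>lborel \<partial>lborel \<partial>lborel) =
       indicator {0<..} y1 * (ennreal (?s / y1 ^ 3) * K ?z)"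
    proof (cases "y1 > 0")
      case True
      hence s: "?s > 0" by (simp add: add_nonneg_pos)
      have c: "w3 y1 * ennreal ?s = ennreal (?s / y1 ^ 3)"
      proof -
        have "ennreal (1 / y1 ^ 3) * ennreal ?s = ennreal (?s / y1 ^ 3)"
          using True s by (subst ennreal_mult[symmetric]) auto
        thus ?thesis using True by simp
      qed
      have "(\<integral>\<^sup>+y2. w3 y1 * (w3 y2 * h (?T (x1, x2, x3, y1, y2))) \<partial>lborel) =
          ennreal (?s / y1 ^ 3) * J (x3 - x1 * x2) ((x2 * y1\<^sup>2 + x3 * x1) / ?s) ?z" for x2 x3
      proof -
        define g where "g y2 = h (x1 / ?s, x3 - x1 * x2, (x2 * y1\<^sup>2 + x3 * x1) / ?s, y1 / ?s, y2)" for y2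
        have [measurable]: "g \<in> borel_measurable borel"
          unfolding g_def by (rule measurable_compose[OF _ hm]) (intro borel_measurable_continuous_onI continuous_intros)
        have "(\<integral>\<^sup>+y2. w3 y1 * (w3 y2 * h (?T (x1, x2, x3, y1, y2))) \<partial>lborel) =
           (\<integral>\<^sup>+y2. w3 y1 * (w3 y2 * g (sqrt ?s * y2)) \<partial>lborel)"
          by (simp add: g_def)
        also have "\<dots> = w3 y1 * (\<integral>\<^sup>+y2. w3 y2 * g (sqrt ?s * y2) \<partial>lborel)"
          by (rule nn_integral_cmult) measurable
        also have "(\<integral>\<^sup>+y2. w3 y2 * g (sqrt ?s * y2) \<partial>lborel) = ennreal ((sqrt ?s)\<^sup>2) * (\<integral>\<^sup>+y2. w3 y2 * g y2 \<partial>lborel)"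
          using s by (intro nn_integral_w3_dilate) auto
        also have "(sqrt ?s)\<^sup>2 = ?s" using s by simp
        also have "w3 y1 * (ennreal ?s * (\<integral>\<^sup>+y2. w3 y2 * g y2 \<partial>lborel)) =
            ennreal (?s / y1 ^ 3) * (\<integral>\<^sup>+y2. w3 y2 * g y2 \<partial>lborel)"
          by (simp only: c mult.assoc[symmetric])
        finally show ?thesis by (simp add: J_def g_def)
      qed
      hence "(\<integral>\<^sup>+x2. \<integral>\<^sup>+x3. \<integral>\<^sup>+y2. w3 y1 * (w3 y2 * h (?T (x1, x2, x3, y1, y2))) \<partial>lborel \<partial>lborel \<partial>lborel) =
        (\<integral>\<^sup>+x2. \<integral>\<^sup>+x3. ennreal (?s / y1 ^ 3) * J (x3 - x1 * x2) ((x2 * y1\<^sup>2 + x3 * x1) / ?s) ?z \<partial>lborel \<partial>lborel)"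
        by simp
      \<comment> \<open>Shifting x3 by x1 x2 turns the third coordinate into a translate of x2, so
        that after Fubini a shift of x2 finishes.\<close>
      also have "\<dots> = (\<integral>\<^sup>+x2. \<integral>\<^sup>+x3. ennreal (?s / y1 ^ 3) * J x3 (x2 + x3 * x1 / ?s) ?z \<partial>lborel \<partial>lborel)"
      proof (rule nn_integral_cong)
        fix x2 :: real
        have e: "(x2 * y1\<^sup>2 + (x3 + x1 * x2) * x1) / ?s = x2 + x3 * x1 / ?s" for x3
        proof -
          have "x2 * y1\<^sup>2 + (x3 + x1 * x2) * x1 = x2 * ?s + x3 * x1"
            by (simp add: power2_eq_square algebra_simps)
          hence "(x2 * y1\<^sup>2 + (x3 + x1 * x2) * x1) / ?s = x2 * ?s / ?s + x3 * x1 / ?s"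
            by (simp only: add_divide_distrib)
          thus ?thesis by (simp only: nonzero_mult_div_cancel_right[OF less_imp_neq[OF s, symmetric]])
        qed
        have "(\<integral>\<^sup>+x3. ennreal (?s / y1 ^ 3) * J (x3 - x1 * x2) ((x2 * y1\<^sup>2 + x3 * x1) / ?s) ?z \<partial>lborel) =
           (\<integral>\<^sup>+x3. ennreal (?s / y1 ^ 3) * J (x3 + x1 * x2 - x1 * x2) ((x2 * y1\<^sup>2 + (x3 + x1 * x2) * x1) / ?s) ?z \<partial>lborel)"
          by (rule nn_integral_shift[symmetric]) (unfold J_def, measurable)
        thus "(\<integral>\<^sup>+x3. ennreal (?s / y1 ^ 3) * J (x3 - x1 * x2) ((x2 * y1\<^sup>2 + x3 * x1) / ?s) ?z \<partial>lborel) =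
           (\<integral>\<^sup>+x3. ennreal (?s / y1 ^ 3) * J x3 (x2 + x3 * x1 / ?s) ?z \<partial>lborel)"
          by (simp only: e add_diff_cancel_right')
      qed
      also have "\<dots> = (\<integral>\<^sup>+x3. \<integral>\<^sup>+x2. ennreal (?s / y1 ^ 3) * J x3 (x2 + x3 * x1 / ?s) ?z \<partial>lborel \<partial>lborel)"
        by (rule lborel_pair.Fubini') (unfold J_def, measurable)
      also have "\<dots> = (\<integral>\<^sup>+x3. \<integral>\<^sup>+x2. ennreal (?s / y1 ^ 3) * J x3 x2 ?z \<partial>lborel \<partial>lborel)"
        by (intro nn_integral_cong nn_integral_shift[of "\<lambda>x2. ennreal (?s / y1 ^ 3) * J _ x2 ?z"]) (unfold J_def, measurable)
      also have "\<dots> = ennreal (?s / y1 ^ 3) * K ?z"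
      proof -
        have "(\<lambda>b. J a b ?z) \<in> borel_measurable borel" for a unfolding J_def by measurable
        moreover have "(\<lambda>a. \<integral>\<^sup>+b. J a b ?z \<partial>lborel) \<in> borel_measurable borel" unfolding J_def by measurable
        ultimately show ?thesis unfolding K_def by (simp add: nn_integral_cmult)
      qed
      finally show ?thesis using True by simp
    qed simp
  qed
  also have "\<dots> = (\<integral>\<^sup>+y1. \<integral>\<^sup>+x1. indicator {0<..} y1 * (ennreal (1 / y1 ^ 3) * K (x1, y1)) \<partial>lborel \<partial>lborel)"
    by (rule nn_integral_inversion) measurable
  also have "\<dots> = (\<integral>\<^sup>+p. h p \<partial>haar3)"
    unfolding expand[OF hm]
  proof (rule nn_integral_cong, rule nn_integral_cong)
    fix x1 y1 :: real
    have "(\<integral>\<^sup>+y2. w3 y1 * (w3 y2 * h (x1, x2, x3, y1, y2)) \<partial>lborel) = w3 y1 * J x2 x3 (x1, y1)" for x2 x3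
    proof -
      have "(\<integral>\<^sup>+y2. w3 y1 * (w3 y2 * h (x1, x2, x3, y1, y2)) \<partial>lborel) =
         w3 y1 * (\<integral>\<^sup>+y2. w3 y2 * h (x1, x2, x3, y1, y2) \<partial>lborel)"
        by (rule nn_integral_cmult) measurable
      thus ?thesis by (simp only: J_def fst_conv snd_conv)
    qed
    moreover have "(\<lambda>b. J a b (x1, y1)) \<in> borel_measurable borel" for a unfolding J_def by measurable
    moreover have "(\<lambda>a. \<integral>\<^sup>+b. J a b (x1, y1) \<partial>lborel) \<in> borel_measurable borel" unfolding J_def by measurable
    ultimately show "indicator {0<..} y1 * (ennreal (1 / y1 ^ 3) * K (x1, y1)) =
      (\<integral>\<^sup>+x2. \<integral>\<^sup>+x3. \<integral>\<^sup>+y2. w3 y1 * (w3 y2 * h (x1, x2, x3, y1, y2)) \<partial>lborel \<partial>lborel \<partial>lborel)"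
      by (simp add: K_def nn_integral_cmult mult.assoc)
  qed
  finally show "(\<integral>\<^sup>+p. h (?T p) \<partial>haar3) = (\<integral>\<^sup>+p. h p \<partial>haar3)" .
qed

lemma haar3_invariant_compose:
  assumes "haar3_invariant S" "haar3_invariant T" "S \<in> borel_measurable borel"
  shows "haar3_invariant (\<lambda>p. S (T p))"
  unfolding haar3_invariant_def
proof
  fix h :: "coords3 \<Rightarrow> ennreal" assume h: "h \<in> borel_measurable borel"
  have "(\<lambda>p. h (S p)) \<in> borel_measurable borel" by (rule measurable_compose[OF assms(3) h])
  hence "(\<integral>\<^sup>+p. h (S (T p)) \<partial>haar3) = (\<integral>\<^sup>+p. h (S p) \<partial>haar3)"
    by (rule bspec[OF assms(2)[unfolded haar3_invariant_def]])
  also have "\<dots> = (\<integral>\<^sup>+p. h p \<partial>haar3)" using assms(1) h by (simp add: haar3_invariant_def)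
  finally show "(\<integral>\<^sup>+p. h (S (T p)) \<partial>haar3) = (\<integral>\<^sup>+p. h p \<partial>haar3)" .
qed

section \<open>Invariance under generators and under all invertible matrices\<close>

lemma haar3_invariant_act_mult:
  assumes "det A \<noteq> 0" "det B \<noteq> 0" "haar3_invariant (act A)" "haar3_invariant (act B)"
  shows "haar3_invariant (act (A ** B))"
  using haar3_invariant_compose[OF assms(3,4) measurable_act] act_mult[OF assms(2)]
  by (rule haar3_invariant_cong)

lemma half_space3_cases:
  assumes "p \<in> half_space3"
  obtains x1 x2 x3 y1 y2 where "p = (x1, x2, x3, y1, y2)" "y1 > 0" "y2 > 0"
  using assms by (auto simp: half_space3_def)

lemma mat3_eq_iff: "(A::'a^3^3) = B \<longleftrightarrow> A$1$1 = B$1$1 \<and> A$1$2 = B$1$2 \<and> A$1$3 = B$1$3 \<and>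
   A$2$1 = B$2$1 \<and> A$2$2 = B$2$2 \<and> A$2$3 = B$2$3 \<and> A$3$1 = B$3$1 \<and> A$3$2 = B$3$2 \<and> A$3$3 = B$3$3"
  by (auto simp: vec_eq_iff forall_3)

lemma matrix_mult_3: "((A::'a::semiring_1^3^3) ** B) $ i $ j = A$i$1 * B$1$j + A$i$2 * B$2$j + A$i$3 * B$3$j"
  by (simp add: matrix_matrix_mult_def sum_3)

lemma unip3_entries [simp]:
  "unip3 a b c $ 1 = vector [1, b, c]" "unip3 a b c $ 2 = vector [0, 1, a]" "unip3 a b c $ 3 = vector [0, 0, 1]"
  by (simp_all add: unip3_def)

lemma orthogonal_mat1_3: "orthogonal_matrix (mat 1 :: mat3)"
  by (simp add: orthogonal_matrix_def)

lemma act_unip3: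
  assumes "y1 > 0" "y2 > 0"
  shows "act (unip3 a b c) (x1, x2, x3, y1, y2) = (x1 + a, x2 + b, x3 + c + b * x1, y1, y2)"
proof (rule act_unique[where k = "mat 1" and r = 1])
  show "unip3 a b c ** iwasawa (x1, x2, x3, y1, y2) =
      1 *\<^sub>R (iwasawa (x1 + a, x2 + b, x3 + c + b * x1, y1, y2) ** mat 1)"
    by (simp add: mat3_eq_iff matrix_mult_3 algebra_simps)
qed (use assms in \<open>auto simp: half_space3_def orthogonal_mat1_3\<close>)

lemma haar3_invariant_act_unip3: "haar3_invariant (act (unip3 a b c))"
  by (rule haar3_invariant_cong[OF haar3_invariant_shear[of a b c]])
     (auto elim!: half_space3_cases simp: act_unip3)

text \<open>After division by the last entry \<open>c\<close>, a diagonal matrix rescales the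
  coordinates by b / c and a / b; the signs of the entries move into the orthogonal matrix
  \<open>k\<close>.\<close>

lemma haar3_invariant_act_diag:
  fixes A :: mat3
  assumes "\<And>i j. i \<noteq> j \<Longrightarrow> A $ i $ j = 0" "det A \<noteq> 0"
  shows "haar3_invariant (act A)"
proof -
  define a b c where "a = A$1$1" and "b = A$2$2" and "c = A$3$3"
  have 0: "A$1$2 = 0" "A$1$3 = 0" "A$2$1 = 0" "A$2$3 = 0" "A$3$1 = 0" "A$3$2 = 0"
    by (auto intro!: assms(1))
  have "det A = a * b * c" by (simp add: det_3 0 a_def b_def c_def)
  with assms(2) have nz: "a \<noteq> 0" "b \<noteq> 0" "c \<noteq> 0" by auto
  show ?thesis
  proof (rule haar3_invariant_cong[OF haar3_invariant_diag[of "b / c" "a / b"]])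
    fix p :: coords3 assume "p \<in> half_space3"
    then obtain x1 x2 x3 y1 y2 where p: "p = (x1, x2, x3, y1, y2)" "y1 > 0" "y2 > 0" by (rule half_space3_cases)
    define k :: mat3 where "k = vector [vector [sgn (a * c), 0, 0], vector [0, sgn (b * c), 0], vector [0, 0, 1]]"
    have sq: "sgn x * sgn x = 1" if "x \<noteq> 0" for x :: real using that by (simp add: sgn_if)
    have k: "orthogonal_matrix k"
      using nz sq[of "a * c"] sq[of "b * c"]
      by (simp add: orthogonal_matrix_def k_def mat3_eq_iff matrix_mult_3 transpose_def mat_def)
    define \<alpha> \<beta> \<sigma> \<tau> where "\<alpha> = \<bar>a / b\<bar>" and "\<beta> = \<bar>b / c\<bar>" and "\<sigma> = sgn (b * c)" and "\<tau> = sgn (a * c)"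
    have s1: "c * \<beta> * \<sigma> = b" unfolding \<beta>_def \<sigma>_def
      using nz by (auto simp: abs_if sgn_if divide_simps mult_less_0_iff zero_less_mult_iff)
    have s2: "c * \<beta> * \<alpha> * \<tau> = a" unfolding \<beta>_def \<alpha>_def \<tau>_def
      using nz by (auto simp: abs_if sgn_if divide_simps mult_less_0_iff zero_less_mult_iff)
    have t1: "c * (\<beta> * y1 * (\<alpha> * y2) * \<tau>) = a * (y1 * y2)"
      by (subst s2[symmetric]) (simp only: mult_ac)
    have t2: "c * (\<beta> * y1 * \<sigma>) = b * y1"
      by (subst s1[symmetric]) (simp only: mult_ac)
    have t3: "c * (a / b * x2 * (\<beta> * y1) * \<sigma>) = a * (x2 * y1)"
    proof -
      have "c * (a / b * x2 * (\<beta> * y1) * \<sigma>) = a / b * x2 * (c * (\<beta> * y1 * \<sigma>))" by (simp only: mult_ac)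
      also have "\<dots> = a * (x2 * y1)" unfolding t2 using nz by simp
      finally show ?thesis .
    qed
    show "act A p = (case p of (x1, x2, x3, y1, y2) \<Rightarrow>
       (b / c * x1, a / b * x2, b / c * (a / b) * x3, \<bar>b / c\<bar> * y1, \<bar>a / b\<bar> * y2))"
      unfolding p prod.case \<alpha>_def[symmetric] \<beta>_def[symmetric]
    proof (rule act_unique[where k = k and r = c])
      show "A ** iwasawa (x1, x2, x3, y1, y2) = c *\<^sub>R
        (iwasawa (b / c * x1, a / b * x2, b / c * (a / b) * x3, \<beta> * y1, \<alpha> * y2) ** k)"
        unfolding mat3_eq_iff matrix_mult_3 vector_scaleR_component iwasawa_rows k_def vector_3
          0 a_def[symmetric] b_def[symmetric] c_def[symmetric] real_scaleR_def \<sigma>_def[symmetric] \<tau>_def[symmetric]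
          mult_zero_left mult_zero_right add_0_left add_0_right mult_1_right mult_1_left t1 t2 t3
        using nz by simp
      show "(b / c * x1, a / b * x2, b / c * (a / b) * x3, \<beta> * y1, \<alpha> * y2) \<in> half_space3"
        using p nz by (simp add: half_space3_def \<alpha>_def \<beta>_def)
    qed (use nz k in auto)
  qed (use nz in auto)
qed

text \<open>Written in the form in which the induction rule for elementary matrices presents an
  interchange of rows.\<close>

abbreviation swap3 :: "3 \<Rightarrow> 3 \<Rightarrow> mat3" where
  "swap3 m n \<equiv> (\<chi> i j. mat 1 $ i $ Transposition.transpose m n j)"

lemma coords_swap12:
  assumes "y1 > 0" "y2 > 0"
  shows "act (swap3 1 2) (x1, x2, x3, y1, y2) =
    (x3, x2 / (x2\<^sup>2 + y2\<^sup>2), x1, sqrt (x2\<^sup>2 + y2\<^sup>2) * y1, y2 / (x2\<^sup>2 + y2\<^sup>2))"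
proof -
  let ?s = "x2\<^sup>2 + y2\<^sup>2"
  have s: "?s > 0" using assms by (simp add: add_nonneg_pos)
  let ?g = "swap3 1 2 ** iwasawa (x1, x2, x3, y1, y2)"
  have g: "?g $ 1 = vector [0, y1, x1]" "?g $ 2 = vector [y1 * y2, x2 * y1, x3]" "?g $ 3 = vector [0, 0, 1]"
    by (simp_all add: vec_eq_iff forall_3 matrix_mult_3 mat_def Transposition.transpose_def)
  have d: "\<bar>det ?g\<bar> = y1\<^sup>2 * y2"
    using assms by (simp add: det_3 g power2_eq_square)
  have i: "?g$3 \<bullet> ?g$3 = 1" "?g$2 \<bullet> ?g$3 = x3" "?g$1 \<bullet> ?g$3 = x1"
    "?g$2 \<bullet> ?g$2 = y1\<^sup>2 * ?s + x3\<^sup>2" "?g$1 \<bullet> ?g$2 = x2 * y1\<^sup>2 + x1 * x3"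
    by (simp_all only: g inner_3) (simp_all add: power2_eq_square algebra_simps)
  have q: "sqrt (y1\<^sup>2 * ?s) = sqrt ?s * y1" using assms by (simp add: real_sqrt_mult)
  have e: "(y1\<^sup>2 * ?s + x3\<^sup>2) - x3\<^sup>2 = y1\<^sup>2 * ?s" by simp
  have f: "(x2 * y1\<^sup>2 + x1 * x3) - x1 * x3 = y1\<^sup>2 * x2" by simp
  have c: "y1\<^sup>2 * a / (y1\<^sup>2 * b) = a / b" for a b using assms by simp
  show ?thesis
    unfolding act_def iwasawa_coords_def Let_def i d real_sqrt_one mult_1_right div_by_1 e f c q by (rule refl)
qed

lemma coords_swap23:
  assumes "y1 > 0" "y2 > 0"
  shows "act (swap3 2 3) (x1, x2, x3, y1, y2) =
     (x1 / (x1\<^sup>2 + y1\<^sup>2), x3 - x1 * x2, (x2 * y1\<^sup>2 + x3 * x1) / (x1\<^sup>2 + y1\<^sup>2),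
      y1 / (x1\<^sup>2 + y1\<^sup>2), sqrt (x1\<^sup>2 + y1\<^sup>2) * y2)"
proof -
  let ?s = "x1\<^sup>2 + y1\<^sup>2"
  have s: "?s > 0" using assms by (simp add: add_nonneg_pos)
  let ?g = "swap3 2 3 ** iwasawa (x1, x2, x3, y1, y2)"
  have g: "?g $ 1 = vector [y1 * y2, x2 * y1, x3]" "?g $ 2 = vector [0, 0, 1]" "?g $ 3 = vector [0, y1, x1]"
    by (simp_all add: vec_eq_iff forall_3 matrix_mult_3 mat_def Transposition.transpose_def)
  have d: "\<bar>det ?g\<bar> = y1\<^sup>2 * y2"
    using assms by (simp add: det_3 g power2_eq_square)
  have i: "?g$3 \<bullet> ?g$3 = ?s" "?g$2 \<bullet> ?g$3 = x1" "?g$1 \<bullet> ?g$3 = x2 * y1\<^sup>2 + x3 * x1"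
    "?g$2 \<bullet> ?g$2 = 1" "?g$1 \<bullet> ?g$2 = x3"
    by (simp_all only: g inner_3) (simp_all add: power2_eq_square algebra_simps)
  have e: "1 * ?s - x1\<^sup>2 = y1\<^sup>2" by simp
  have f: "x3 * ?s - (x2 * y1\<^sup>2 + x3 * x1) * x1 = (x3 - x1 * x2) * y1\<^sup>2" by (simp add: power2_eq_square algebra_simps)
  show ?thesis
    unfolding act_def iwasawa_coords_def Let_def i d e f using assms s by simp
qed

lemma haar3_invariant_act_swap12: "haar3_invariant (act (swap3 1 2))"
  by (rule haar3_invariant_cong[OF haar3_invariant_swap12])
     (auto elim!: half_space3_cases simp: coords_swap12)

lemma haar3_invariant_act_swap23: "haar3_invariant (act (swap3 2 3))"
  by (rule haar3_invariant_cong[OF haar3_invariant_swap23])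
     (auto elim!: half_space3_cases simp: coords_swap23)

text \<open>Induction over products of elementary matrices; a zero row is excluded by the
  determinant. Two adjacent transpositions, the diagonal matrices and the upper unipotent matrices
  have been computed, and the remaining generators arise from them by products and
  conjugation.\<close>

lemma haar3_invariant_act:
  fixes g :: mat3
  shows "det g \<noteq> 0 \<Longrightarrow> haar3_invariant (act g)"
proof (induction g rule: induct_matrix_elementary)
  case (1 A B)
  from 1(3) have "det A \<noteq> 0" "det B \<noteq> 0" by (auto simp: det_mul)
  with 1 show ?case by (intro haar3_invariant_act_mult)
next
  case (2 A i)
  thus ?case by (simp add: det_zero_row)
next
  case (3 A)
  thus ?case by (intro haar3_invariant_act_diag)
next
  case (4 m n)
  have d: "det (swap3 1 2) \<noteq> 0" "det (swap3 2 3) \<noteq> 0"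
    by (simp_all add: det_3 mat_def Transposition.transpose_def)
  have 13: "swap3 1 3 = swap3 1 2 ** (swap3 2 3 ** swap3 1 2)"
    by (simp add: mat3_eq_iff matrix_mult_3 mat_def Transposition.transpose_def)
  have "haar3_invariant (act (swap3 1 3))" unfolding 13
    by (intro haar3_invariant_act_mult haar3_invariant_act_swap12 haar3_invariant_act_swap23)
       (simp_all add: det_mul d)
  moreover have "swap3 a b = swap3 b a" for a b by (simp add: transpose_commute)
  ultimately have "\<lbrakk>m = 1; n = 3\<rbrakk> \<Longrightarrow> ?case" "\<lbrakk>m = 3; n = 1\<rbrakk> \<Longrightarrow> ?case"
     "\<lbrakk>m = 1; n = 2\<rbrakk> \<Longrightarrow> ?case" "\<lbrakk>m = 2; n = 1\<rbrakk> \<Longrightarrow> ?case"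
     "\<lbrakk>m = 2; n = 3\<rbrakk> \<Longrightarrow> ?case" "\<lbrakk>m = 3; n = 2\<rbrakk> \<Longrightarrow> ?case"
    using haar3_invariant_act_swap12 haar3_invariant_act_swap23 by metis+
  thus ?case using 4(1) exhaust_3[of m] exhaust_3[of n] by metis
next
  case (5 m n c)
  let ?E = "\<lambda>m n. (\<chi> i j. if i = m \<and> j = n then c else of_bool (i = j)) :: mat3"
  have d: "det (swap3 1 2) \<noteq> 0" "det (swap3 2 3) \<noteq> 0" "det (swap3 1 3) \<noteq> 0"
    by (simp_all add: det_3 mat_def Transposition.transpose_def)
  have s13: "haar3_invariant (act (swap3 1 3))"
  proof -
    have 13: "swap3 1 3 = swap3 1 2 ** (swap3 2 3 ** swap3 1 2)"
      by (simp add: mat3_eq_iff matrix_mult_3 mat_def Transposition.transpose_def)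
    show ?thesis unfolding 13
      by (intro haar3_invariant_act_mult haar3_invariant_act_swap12 haar3_invariant_act_swap23)
         (simp_all add: det_mul d)
  qed
  have up: "?E 1 2 = unip3 0 c 0" "?E 1 3 = unip3 0 0 c" "?E 2 3 = unip3 c 0 0"
    by (simp_all add: mat3_eq_iff)
  \<comment> \<open>Conjugation by the interchange of 1 and 3 reverses the order of the indices and
    turns upper shears into lower ones.\<close>
  have lo: "?E 2 1 = swap3 1 3 ** (unip3 c 0 0 ** swap3 1 3)" "?E 3 1 = swap3 1 3 ** (unip3 0 0 c ** swap3 1 3)"
    "?E 3 2 = swap3 1 3 ** (unip3 0 c 0 ** swap3 1 3)"
    by (simp_all add: mat3_eq_iff matrix_mult_3 mat_def Transposition.transpose_def)
  have du: "det (unip3 a b c) \<noteq> 0" for a b c by (simp add: det_3)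
  have conj: "haar3_invariant (act (swap3 1 3 ** (unip3 a b c ** swap3 1 3)))" for a b c
    by (intro haar3_invariant_act_mult s13 haar3_invariant_act_unip3) (simp_all add: det_mul d du)
  have E: "haar3_invariant (act (?E 1 2))" "haar3_invariant (act (?E 1 3))" "haar3_invariant (act (?E 2 3))"
    "haar3_invariant (act (?E 2 1))" "haar3_invariant (act (?E 3 1))" "haar3_invariant (act (?E 3 2))"
    unfolding up lo by (rule haar3_invariant_act_unip3 conj)+
  have "(m = 1 \<and> n = 2) \<or> (m = 1 \<and> n = 3) \<or> (m = 2 \<and> n = 3) \<or>
      (m = 2 \<and> n = 1) \<or> (m = 3 \<and> n = 1) \<or> (m = 3 \<and> n = 2)"
    using 5(1) exhaust_3[of m] exhaust_3[of n] by auto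
  thus ?case by (elim disjE conjE) (simp_all only: E)
qed

section \<open>Reduction theory of \<open>SL(3,Z)\<close>\<close>

lemma SL3Z_det: "\<gamma> \<in> SL3Z \<Longrightarrow> det \<gamma> = 1"
  by (simp add: SL3Z_def)

lemma SL3Z_mult: "\<gamma> \<in> SL3Z \<Longrightarrow> \<gamma>' \<in> SL3Z \<Longrightarrow> \<gamma> ** \<gamma>' \<in> SL3Z"
  by (auto simp: SL3Z_def det_mul matrix_mult_3)

text \<open>The inverse is the adjugate, whose entries are integer polynomials in those of
  \<gamma>.\<close>

lemma SL3Z_inverse:
  assumes "\<gamma> \<in> SL3Z"
  obtains \<gamma>' where "\<gamma>' \<in> SL3Z" "\<gamma> ** \<gamma>' = mat 1" "\<gamma>' ** \<gamma> = mat 1"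
proof -
  let ?a = "\<lambda>i j. \<gamma> $ i $ j"
  define \<gamma>' :: mat3 where "\<gamma>' = vector
    [vector [?a 2 2 * ?a 3 3 - ?a 2 3 * ?a 3 2, ?a 1 3 * ?a 3 2 - ?a 1 2 * ?a 3 3, ?a 1 2 * ?a 2 3 - ?a 1 3 * ?a 2 2],
     vector [?a 2 3 * ?a 3 1 - ?a 2 1 * ?a 3 3, ?a 1 1 * ?a 3 3 - ?a 1 3 * ?a 3 1, ?a 1 3 * ?a 2 1 - ?a 1 1 * ?a 2 3],
     vector [?a 2 1 * ?a 3 2 - ?a 2 2 * ?a 3 1, ?a 1 2 * ?a 3 1 - ?a 1 1 * ?a 3 2, ?a 1 1 * ?a 2 2 - ?a 1 2 * ?a 2 1]]"
  have d: "det \<gamma> = 1" and z: "\<And>i j. ?a i j \<in> \<int>" using assms by (auto simp: SL3Z_def)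
  have 1: "\<gamma> ** \<gamma>' = mat 1"
    using d unfolding det_3 by (simp add: mat3_eq_iff matrix_mult_3 \<gamma>'_def mat_def algebra_simps)
  hence 2: "\<gamma>' ** \<gamma> = mat 1" by (metis matrix_left_right_inverse)
  have "det (\<gamma> ** \<gamma>') = 1" by (simp add: 1)
  hence "det \<gamma>' = 1" by (simp add: det_mul d)
  moreover have "\<gamma>' $ i $ j \<in> \<int>" for i j
    using exhaust_3[of i] exhaust_3[of j] z by (auto simp: \<gamma>'_def)
  ultimately have "\<gamma>' \<in> SL3Z" by (simp add: SL3Z_def)
  with 1 2 that show ?thesis by blast
qed

lemma countable_SL3Z: "countable SL3Z"
proof -
  have "SL3Z \<subseteq> range (\<lambda>A::int^3^3. (\<chi> i j. real_of_int (A $ i $ j)))"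
  proof
    fix \<gamma> :: mat3 assume "\<gamma> \<in> SL3Z"
    hence "\<gamma> $ i $ j = real_of_int \<lfloor>\<gamma> $ i $ j\<rfloor>" for i j by (auto simp: SL3Z_def elim!: Ints_cases)
    hence "\<gamma> = (\<chi> i j. real_of_int ((\<chi> i j. \<lfloor>\<gamma> $ i $ j\<rfloor>) $ i $ j))" by (simp add: vec_eq_iff)
    thus "\<gamma> \<in> range (\<lambda>A::int^3^3. (\<chi> i j. real_of_int (A $ i $ j)))" by (rule range_eqI)
  qed
  thus ?thesis by (rule countable_subset) simp
qed

text \<open>Each point of \<open>S\<close> is counted at least once among the translates of
  \<open>F\<close>, and invariance of \<open>haar3\<close> moves every translate back to
  \<open>F\<close>. Only a covering is asked for, so the result is an inequality; it serves for
  \<open>SL3Z\<close> with a fundamental domain and for \<open>parabZ\<close> with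
  \<open>core3\<close>.\<close>

lemma nn_integral_haar3_unfold:
  fixes G :: "coords3 \<Rightarrow> ennreal"
  assumes \<Gamma>: "countable \<Gamma>" "\<And>\<gamma>. \<gamma> \<in> \<Gamma> \<Longrightarrow> det \<gamma> \<noteq> 0"
    and [measurable]: "S \<in> sets borel" "F \<in> sets borel" "G \<in> borel_measurable borel"
    and F: "F \<subseteq> half_space3"
    and cover: "\<And>p. p \<in> S \<Longrightarrow> \<exists>\<gamma>\<in>\<Gamma>. \<exists>q\<in>F. p = act \<gamma> q"
  shows "(\<integral>\<^sup>+p. indicator S p * G p \<partial>haar3) \<le>
    (\<integral>\<^sup>+q. indicator F q * (\<integral>\<^sup>+\<gamma>. indicator S (act \<gamma> q) * G (act \<gamma> q) \<partial>count_space \<Gamma>) \<partial>haar3)"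
proof -
  \<comment> \<open>The translate of \<open>F\<close> by \<gamma>, written as a preimage under the
    inverse so that it is Borel.\<close>
  define F' where "F' \<gamma> = {p \<in> half_space3. act (matrix_inv \<gamma>) p \<in> F}" for \<gamma>
  have "open half_space3"
    unfolding half_space3_def split_beta' by (intro open_Collect_conj open_Collect_less continuous_intros)
  hence [measurable]: "half_space3 \<in> sets borel" by simp
  have [measurable]: "F' \<gamma> \<in> sets borel" for \<gamma>
    unfolding F'_def using measurable_sets[OF measurable_act, of F "matrix_inv \<gamma>"]
    by (simp add: vimage_def Collect_conj_eq)
  have inv: "matrix_inv \<gamma> ** \<gamma> = mat 1" if "\<gamma> \<in> \<Gamma>" for \<gamma>
    using \<Gamma>(2)[OF that] unfolding invertible_det_nz[symmetric] invertible_def matrix_inv_def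
    by (rule someI2_ex) auto
  have act_inv: "act (matrix_inv \<gamma>) (act \<gamma> q) = q" if "\<gamma> \<in> \<Gamma>" "q \<in> half_space3" for \<gamma> q
    using act_mult[OF \<Gamma>(2)[OF that(1)] that(2), of "matrix_inv \<gamma>"] inv[OF that(1)] act_1[OF that(2)] by simp
  have "(\<integral>\<^sup>+p. indicator S p * G p \<partial>haar3) \<le>
     (\<integral>\<^sup>+p. (\<integral>\<^sup>+\<gamma>. indicator S p * G p * indicator (F' \<gamma>) p \<partial>count_space \<Gamma>) \<partial>haar3)"
  proof (rule nn_integral_mono)
    fix p
    show "indicator S p * G p \<le> (\<integral>\<^sup>+\<gamma>. indicator S p * G p * indicator (F' \<gamma>) p \<partial>count_space \<Gamma>)"
    proof (cases "p \<in> S")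
      case True
      then obtain \<gamma> q where g: "\<gamma> \<in> \<Gamma>" "q \<in> F" "p = act \<gamma> q" using cover by blast
      have "p \<in> half_space3" using g F \<Gamma>(2) act_half_space3 by blast
      moreover have qh: "q \<in> half_space3" using g F by blast
      ultimately have "p \<in> F' \<gamma>" using act_inv[OF g(1) qh] g(2,3) by (simp add: F'_def)
      hence "indicator S p * G p = (\<integral>\<^sup>+\<gamma>'. indicator S p * G p * indicator (F' \<gamma>) p * indicator {\<gamma>} \<gamma>' \<partial>count_space \<Gamma>)"
        using g(1) by (subst nn_integral_indicator_singleton) auto
      also have "\<dots> \<le> (\<integral>\<^sup>+\<gamma>. indicator S p * G p * indicator (F' \<gamma>) p \<partial>count_space \<Gamma>)"
        by (intro nn_integral_mono) (auto simp: indicator_def)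
      finally show ?thesis .
    qed simp
  qed
  also have "\<dots> = (\<integral>\<^sup>+\<gamma>. (\<integral>\<^sup>+p. indicator S p * G p * indicator (F' \<gamma>) p \<partial>haar3) \<partial>count_space \<Gamma>)"
    by (rule nn_integral_count_space_nn_integral[OF \<Gamma>(1)]) measurable
  also have "\<dots> = (\<integral>\<^sup>+\<gamma>. (\<integral>\<^sup>+q. indicator F q * (indicator S (act \<gamma> q) * G (act \<gamma> q)) \<partial>haar3) \<partial>count_space \<Gamma>)"
  proof (rule nn_integral_cong)
    fix \<gamma> assume "\<gamma> \<in> space (count_space \<Gamma>)"
    hence \<gamma>: "\<gamma> \<in> \<Gamma>" by simp
    have "(\<lambda>p. indicator S p * G p * indicator (F' \<gamma>) p) \<in> borel_measurable borel" by measurable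
    from bspec[OF haar3_invariant_act[OF \<Gamma>(2)[OF \<gamma>], unfolded haar3_invariant_def] this]
    have "(\<integral>\<^sup>+p. indicator S p * G p * indicator (F' \<gamma>) p \<partial>haar3) =
       (\<integral>\<^sup>+q. indicator S (act \<gamma> q) * G (act \<gamma> q) * indicator (F' \<gamma>) (act \<gamma> q) \<partial>haar3)"
      by (rule sym)
    also have "\<dots> = (\<integral>\<^sup>+q. indicator F q * (indicator S (act \<gamma> q) * G (act \<gamma> q)) \<partial>haar3)"
    proof (intro nn_integral_cong_AE)
      show "AE q in haar3. indicator S (act \<gamma> q) * G (act \<gamma> q) * indicator (F' \<gamma>) (act \<gamma> q) =
          indicator F q * (indicator S (act \<gamma> q) * G (act \<gamma> q))"
        using AE_haar3_half_space3
      proof (rule AE_mp, intro AE_I2 impI)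
        fix q assume q: "q \<in> half_space3"
        hence "act \<gamma> q \<in> F' \<gamma> \<longleftrightarrow> q \<in> F"
          using act_inv[OF \<gamma> q] act_half_space3[OF \<Gamma>(2)[OF \<gamma>] q] by (simp add: F'_def)
        thus "indicator S (act \<gamma> q) * G (act \<gamma> q) * indicator (F' \<gamma>) (act \<gamma> q) =
          indicator F q * (indicator S (act \<gamma> q) * G (act \<gamma> q))"
          by (simp add: indicator_def)
      qed
    qed
    finally show "(\<integral>\<^sup>+p. indicator S p * G p * indicator (F' \<gamma>) p \<partial>haar3) =
      (\<integral>\<^sup>+q. indicator F q * (indicator S (act \<gamma> q) * G (act \<gamma> q)) \<partial>haar3)" .
  qed
  also have "\<dots> = (\<integral>\<^sup>+q. (\<integral>\<^sup>+\<gamma>. indicator F q * (indicator S (act \<gamma> q) * G (act \<gamma> q)) \<partial>count_space \<Gamma>) \<partial>haar3)"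
    by (rule nn_integral_count_space_nn_integral[OF \<Gamma>(1), symmetric]) measurable
  also have "\<dots> = (\<integral>\<^sup>+q. indicator F q * (\<integral>\<^sup>+\<gamma>. indicator S (act \<gamma> q) * G (act \<gamma> q) \<partial>count_space \<Gamma>) \<partial>haar3)"
    by (intro nn_integral_cong nn_integral_cmult) auto
  finally show ?thesis .
qed

text \<open>The maximal parabolic subgroup acts on \<open>z = x2 + i y2\<close> through Moebius transformations.\<close>

definition parab :: "real \<Rightarrow> real \<Rightarrow> real \<Rightarrow> real \<Rightarrow> real \<Rightarrow> real \<Rightarrow> mat3" where
  "parab a b c d e f = vector [vector [a, b, e], vector [c, d, f], vector [0, 0, 1]]"

lemma parab_entries [simp]:
  "parab a b c d e f $ 1 = vector [a, b, e]" "parab a b c d e f $ 2 = vector [c, d, f]"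
  "parab a b c d e f $ 3 = vector [0, 0, 1]"
  by (simp_all add: parab_def)

lemma det_parab: "det (parab a b c d e f) = a * d - b * c"
  by (simp add: det_3)

text \<open>\<open>S\<close> is the squared modulus of c z + d. As y1 is multiplied by its square
  root and y2 is divided by it, y1^2 y2 is invariant, which confines a parabolic orbit to one value
  of the determinant.\<close>

lemma act_parab:
  fixes a b c d e f x1 x2 x3 y1 y2 :: real
  assumes y: "y1 > 0" "y2 > 0" and det: "a * d - b * c = 1"
  defines "S \<equiv> (c * x2 + d)\<^sup>2 + (c * y2)\<^sup>2"
  shows "act (parab a b c d e f) (x1, x2, x3, y1, y2) =
    (c * x3 + d * x1 + f, ((a * x2 + b) * (c * x2 + d) + a * c * y2\<^sup>2) / S, a * x3 + b * x1 + e,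
     sqrt S * y1, y2 / S)" and "S > 0"
proof -
  have "c \<noteq> 0 \<or> d \<noteq> 0" using det by auto
  thus S: "S > 0" unfolding S_def using y
    by (cases "c = 0") (auto simp: add_nonneg_pos)
  let ?g = "parab a b c d e f ** iwasawa (x1, x2, x3, y1, y2)"
  define u v where "u = a * x3 + b * x1 + e" and "v = c * x3 + d * x1 + f"
  have g: "?g $ 1 = vector [a * (y1 * y2), (a * x2 + b) * y1, u]" "?g $ 2 = vector [c * (y1 * y2), (c * x2 + d) * y1, v]"
    "?g $ 3 = vector [0, 0, 1]"
    by (simp_all add: vec_eq_iff forall_3 matrix_mult_3 u_def v_def algebra_simps)
  have "det ?g = y1\<^sup>2 * y2" by (simp add: det_mul det_parab det det_iwasawa)
  hence d: "\<bar>det ?g\<bar> = y1\<^sup>2 * y2" using y by simp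
  have i: "?g$3 \<bullet> ?g$3 = 1" "?g$2 \<bullet> ?g$3 = v" "?g$1 \<bullet> ?g$3 = u"
    "?g$2 \<bullet> ?g$2 = y1\<^sup>2 * S + v\<^sup>2"
    "?g$1 \<bullet> ?g$2 = y1\<^sup>2 * ((a * x2 + b) * (c * x2 + d) + a * c * y2\<^sup>2) + u * v"
    by (simp_all only: g inner_3) (simp_all add: power2_eq_square algebra_simps S_def)
  have q: "sqrt (y1\<^sup>2 * S) = sqrt S * y1" using y by (simp add: real_sqrt_mult)
  have c: "y1\<^sup>2 * s / (y1\<^sup>2 * t) = s / t" for s t using y by simp
  have e: "s + t - t = s" for s t :: real by simp
  show "act (parab a b c d e f) (x1, x2, x3, y1, y2) =
    (c * x3 + d * x1 + f, ((a * x2 + b) * (c * x2 + d) + a * c * y2\<^sup>2) / S, a * x3 + b * x1 + e,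
     sqrt S * y1, y2 / S)"
    unfolding act_def iwasawa_coords_def Let_def i d real_sqrt_one mult_1_right div_by_1 e c q
    by (simp only: u_def v_def)
qed

text \<open>The conditions on x2 and y2 contain those of the standard fundamental domain of SL(2,Z),
  and y1^2 y2 is the determinant of the representative. The bound 2 for x1 and x3, wider than a
  period, leaves room to translate points with these coordinates in [0,1) by up to 1.\<close>

definition siegel3 :: "real \<Rightarrow> real \<Rightarrow> real \<Rightarrow> coords3 set" where
  "siegel3 Y t T = {(x1, x2, x3, y1, y2). \<bar>x1\<bar> \<le> 2 \<and> \<bar>x3\<bar> \<le> 2 \<and> \<bar>x2\<bar> \<le> 1 / 2 \<and> 1 \<le> x2\<^sup>2 + y2\<^sup>2 \<and>
     0 < y1 \<and> 0 < y2 \<and> y2 \<le> Y \<and> t \<le> y1\<^sup>2 * y2 \<and> y1\<^sup>2 * y2 \<le> T}"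

lemma siegel3_iff: "(x1, x2, x3, y1, y2) \<in> siegel3 Y t T \<longleftrightarrow> \<bar>x1\<bar> \<le> 2 \<and> \<bar>x3\<bar> \<le> 2 \<and> \<bar>x2\<bar> \<le> 1 / 2 \<and>
     1 \<le> x2\<^sup>2 + y2\<^sup>2 \<and> 0 < y1 \<and> 0 < y2 \<and> y2 \<le> Y \<and> t \<le> y1\<^sup>2 * y2 \<and> y1\<^sup>2 * y2 \<le> T"
  by (simp add: siegel3_def)

lemma siegel3_subset: "siegel3 Y t T \<subseteq> half_space3"
  by (auto simp: siegel3_def half_space3_def)

lemma reduced_height:
  fixes x y :: real
  assumes "\<bar>x\<bar> \<le> 1 / 2" "1 \<le> x\<^sup>2 + y\<^sup>2"
  shows "y\<^sup>2 \<ge> 3 / 4"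
proof -
  have "x\<^sup>2 \<le> (1 / 2)\<^sup>2" using assms(1) by (subst abs_le_square_iff[symmetric]) auto
  thus ?thesis using assms(2) by (simp add: power2_eq_square)
qed

text \<open>The equation says y' = y / |c z + d|^2. Both heights are at least sqrt 3 / 2, so c^2 y
  y' \<le> 1 forces |c| \<le> 1, and the real part of c z + d then bounds d. Of the image only its
  height enters, which makes the lemma applicable to the inverse transformation as well.\<close>

lemma reduced_moebius_bound:
  fixes c d :: int and x y y' :: real
  assumes x: "\<bar>x\<bar> \<le> 1 / 2" and y: "y > 0" "y\<^sup>2 \<ge> 3 / 4" and y': "y' > 0" "y'\<^sup>2 \<ge> 3 / 4"
    and S: "y' * ((c * x + d)\<^sup>2 + (c * y)\<^sup>2) = y" and "c = 0 \<longrightarrow> \<bar>d\<bar> \<le> 1"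
  shows "\<bar>c\<bar> \<le> 1" "\<bar>d\<bar> \<le> 1"
proof -
  have yy: "y * y' \<ge> 3 / 4"
  proof (rule power2_le_imp_le)
    have "(3 / 4) * (3 / 4) \<le> y\<^sup>2 * y'\<^sup>2" using y y' by (intro mult_mono) auto
    thus "(3 / 4)\<^sup>2 \<le> (y * y')\<^sup>2" by (simp add: power2_eq_square mult_ac)
  qed (use y y' in simp)
  have "y' * (c * y)\<^sup>2 \<le> y"
    using y'(1) by (subst S[symmetric]) (intro mult_left_mono, auto)
  hence "(real_of_int c)\<^sup>2 * (y * y') * y \<le> 1 * y" by (simp add: power2_eq_square mult_ac)
  hence c1: "(real_of_int c)\<^sup>2 * (y * y') \<le> 1" using y(1) by (rule mult_right_le_imp_le)
  have "(real_of_int c)\<^sup>2 * (3 / 4) \<le> (real_of_int c)\<^sup>2 * (y * y')" using yy by (intro mult_left_mono) auto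
  hence "(real_of_int c)\<^sup>2 \<le> 4 / 3" using c1 by simp
  hence "(real_of_int c)\<^sup>2 < 2\<^sup>2" by simp
  hence "\<bar>real_of_int c\<bar> < 2" using abs_le_square_iff[of 2 "real_of_int c"] by linarith
  thus c: "\<bar>c\<bar> \<le> 1" by linarith
  show "\<bar>d\<bar> \<le> 1"
  proof (cases "c = 0")
    case False
    hence "\<bar>c\<bar> = 1" using c by linarith
    hence "c * c = 1" by (auto simp: abs_if split: if_splits)
    hence cc: "(real_of_int c)\<^sup>2 = 1" by (simp add: power2_eq_square flip: of_int_mult)
    have y'y: "y * y' \<le> 1" using c1 cc by simp
    have "y' * (c * x + d)\<^sup>2 \<le> y"
      using y'(1) by (subst S[symmetric]) (intro mult_left_mono, auto)
    hence "y'\<^sup>2 * (c * x + d)\<^sup>2 \<le> y * y'" using y'(1)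
      by (metis mult.assoc mult.commute mult_le_cancel_left_pos power2_eq_square)
    hence "y'\<^sup>2 * (c * x + d)\<^sup>2 \<le> 1" using y'y by linarith
    moreover have "(3 / 4) * (c * x + d)\<^sup>2 \<le> y'\<^sup>2 * (c * x + d)\<^sup>2" using y'(2) by (intro mult_right_mono) auto
    ultimately have "(c * x + d)\<^sup>2 < (3 / 2)\<^sup>2" by (simp add: power2_eq_square)
    hence "\<bar>c * x + d\<bar> < 3 / 2" using abs_le_square_iff[of "3/2" "c * x + d"] by linarith
    moreover have "\<bar>c * x\<bar> \<le> 1 * (1 / 2)"
      unfolding abs_mult using \<open>\<bar>c\<bar> = 1\<close> x by (intro mult_mono) auto
    ultimately have "\<bar>real_of_int d\<bar> < 2" by linarith
    thus ?thesis by linarith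
  qed (use assms(7) in simp)
qed

text \<open>The lower row is bounded by \<open>reduced_moebius_bound\<close>, \<open>a\<close> by
  the same lemma for the inverse, whose lower row is (-c, a), \<open>b\<close> by the determinant
  or, if c = 0, by the window for x2, and \<open>e\<close>, \<open>f\<close> by the windows for x1
  and x3. The value 20 is generous; what matters is its independence of \<open>Y\<close>,
  \<open>t\<close>, \<open>T\<close>.\<close>

lemma siegel3_parab_bound:
  fixes a b c d e f :: int
  assumes p: "p \<in> siegel3 Y t T" and p': "act (parab a b c d e f) p \<in> siegel3 Y t T"
    and det: "a * d - b * c = 1"
  shows "\<bar>a\<bar> \<le> 20 \<and> \<bar>b\<bar> \<le> 20 \<and> \<bar>c\<bar> \<le> 20 \<and> \<bar>d\<bar> \<le> 20 \<and> \<bar>e\<bar> \<le> 20 \<and> \<bar>f\<bar> \<le> 20"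
proof -
  obtain x1 x2 x3 y1 y2 where p_eq: "p = (x1, x2, x3, y1, y2)" by (cases p)
  note P = p[unfolded p_eq siegel3_iff]
  have y: "y1 > 0" "y2 > 0" using P by auto
  have rdet: "real_of_int a * d - real_of_int b * c = 1"
    using det by (metis of_int_1 of_int_diff of_int_mult)
  define S where "S = (c * x2 + d)\<^sup>2 + (c * y2)\<^sup>2"
  have act: "act (parab a b c d e f) (x1, x2, x3, y1, y2) = (c * x3 + d * x1 + f,
      ((real_of_int a * x2 + b) * (c * x2 + d) + real_of_int a * real_of_int c * y2\<^sup>2) / S,
      a * x3 + b * x1 + e, sqrt S * y1, y2 / S)"
    unfolding S_def by (rule act_parab(1)[OF y rdet])
  have S: "S > 0" unfolding S_def by (rule act_parab(2)[OF y rdet])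
  define u where "u = ((real_of_int a * x2 + b) * (c * x2 + d) + real_of_int a * real_of_int c * y2\<^sup>2) / S"
  have P': "\<bar>c * x3 + d * x1 + f\<bar> \<le> 2" "\<bar>a * x3 + b * x1 + e\<bar> \<le> 2" "\<bar>u\<bar> \<le> 1 / 2" "1 \<le> u\<^sup>2 + (y2 / S)\<^sup>2"
    using p'[unfolded p_eq act siegel3_iff] unfolding u_def by blast+
  have h: "y2\<^sup>2 \<ge> 3 / 4" "(y2 / S)\<^sup>2 \<ge> 3 / 4" using reduced_height P P' by auto
  have unit: "c = 0 \<longrightarrow> \<bar>d\<bar> \<le> 1 \<and> \<bar>a\<bar> \<le> 1"
    using det by (auto simp: zmult_eq_1_iff)
  have e1: "y2 / S * ((c * x2 + d)\<^sup>2 + (c * y2)\<^sup>2) = y2"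
    unfolding S_def[symmetric] using S by simp
  have pos: "y2 / S > 0" using S y by simp
  have x2: "\<bar>x2\<bar> \<le> 1 / 2" using P by blast
  have cd: "\<bar>c\<bar> \<le> 1" "\<bar>d\<bar> \<le> 1"
    using reduced_moebius_bound[OF x2 y(2) h(1) pos h(2) e1] unit by blast+
  have a: "\<bar>a\<bar> \<le> 1"
  proof -
    \<comment> \<open>The real part of a - c z' = 1 / (c z + d), where z' = u + i y2 / S is the
      image of z = x2 + i y2.\<close>
    have "(- c * u + a) * S = c * x2 + d"
    proof -
      have "(- c * u + a) * S = - c * ((real_of_int a * x2 + b) * (c * x2 + d) + real_of_int a * real_of_int c * y2\<^sup>2) + a * S"
      proof -
        have "u * S = (real_of_int a * x2 + b) * (c * x2 + d) + real_of_int a * real_of_int c * y2\<^sup>2"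
          using S by (simp add: u_def)
        moreover have "(- c * u + a) * S = - c * (u * S) + a * S" by (simp add: algebra_simps)
        ultimately show ?thesis by simp
      qed
      also have "\<dots> = (c * x2 + d) * (real_of_int a * d - real_of_int b * c)"
        by (simp add: S_def power2_eq_square algebra_simps)
      finally show ?thesis using rdet by simp
    qed
    hence eq: "- c * u + a = (c * x2 + d) / S" using S by (simp add: field_simps)
    have gen: "(z / S)\<^sup>2 + w / S\<^sup>2 = (z\<^sup>2 + w) / S\<^sup>2" for z w :: real
      by (simp add: power_divide add_divide_distrib)
    have "(- c * (y2 / S))\<^sup>2 = (c * y2)\<^sup>2 / S\<^sup>2" by (simp add: power_divide power_mult_distrib)
    hence "(- c * u + a)\<^sup>2 + (- c * (y2 / S))\<^sup>2 = ((c * x2 + d)\<^sup>2 + (c * y2)\<^sup>2) / S\<^sup>2"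
      unfolding eq using gen by simp
    also have "\<dots> = 1 / S" unfolding S_def[symmetric] using S by (simp add: power2_eq_square)
    finally have e2: "y2 * ((real_of_int (- c) * u + a)\<^sup>2 + (real_of_int (- c) * (y2 / S))\<^sup>2) = y2 / S" by simp
    show ?thesis
      using reduced_moebius_bound(2)[OF P'(3) pos h(2) y(2) h(1) e2] unit by auto
  qed
  have b: "\<bar>b\<bar> \<le> 2"
  proof (cases "c = 0")
    case True
    hence "S = d\<^sup>2" "a * d = 1" using det by (simp_all add: S_def)
    hence ad: "(a = 1 \<and> d = 1) \<or> (a = -1 \<and> d = -1)" by (simp add: zmult_eq_1_iff)
    hence "u = x2 + b * d" using True by (auto simp: u_def S_def)
    hence "u = x2 + real_of_int b * real_of_int d" by simp
    hence "\<bar>real_of_int b * real_of_int d\<bar> \<le> 1" using P'(3) x2 by linarith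
    thus ?thesis using ad by auto
  next
    case False
    hence "\<bar>c\<bar> = 1" using cd by linarith
    hence "\<bar>b\<bar> = \<bar>b * c\<bar>" by (simp add: abs_mult)
    also have "b * c = a * d - 1" using det by simp
    also have "\<bar>a * d - 1\<bar> \<le> \<bar>a\<bar> * \<bar>d\<bar> + 1" by (simp add: flip: abs_mult)
    also have "\<bar>a\<bar> * \<bar>d\<bar> \<le> 1 * 1" using a cd by (intro mult_mono) auto
    finally show ?thesis by simp
  qed
  have m: "\<bar>real_of_int k * z\<bar> \<le> 4" if "\<bar>k\<bar> \<le> 2" "\<bar>z\<bar> \<le> 2" for k :: int and z :: real
  proof -
    have "\<bar>real_of_int k * z\<bar> \<le> 2 * 2" unfolding abs_mult using that by (intro mult_mono) auto
    thus ?thesis by simp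
  qed
  have ab2: "\<bar>a\<bar> \<le> 2" "\<bar>c\<bar> \<le> 2" "\<bar>d\<bar> \<le> 2" using a cd by auto
  have x13: "\<bar>x1\<bar> \<le> 2" "\<bar>x3\<bar> \<le> 2" using P by blast+
  have "\<bar>real_of_int f\<bar> \<le> 20"
    using P'(1) m[OF ab2(2) x13(2)] m[OF ab2(3) x13(1)] by linarith
  moreover have "\<bar>real_of_int e\<bar> \<le> 20"
    using P'(2) m[OF ab2(1) x13(2)] m[OF b x13(1)] by linarith
  ultimately have "\<bar>f\<bar> \<le> 20" "\<bar>e\<bar> \<le> 20" by linarith+
  thus ?thesis using a b cd by linarith
qed

section \<open>Counting the points of an orbit in a Siegel set\<close>

lemma card_int_interval:
  fixes a b :: real
  assumes "b \<ge> 0"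
  shows "finite {n::int. \<bar>a + n\<bar> \<le> b}" "real (card {n::int. \<bar>a + n\<bar> \<le> b}) \<le> 2 * b + 1"
proof -
  have sub: "{n::int. \<bar>a + n\<bar> \<le> b} = {\<lceil>- b - a\<rceil>..\<lfloor>b - a\<rfloor>}"
    by (auto simp: le_floor_iff ceiling_le_iff)
  show "finite {n::int. \<bar>a + n\<bar> \<le> b}" unfolding sub by simp
  show "real (card {n::int. \<bar>a + n\<bar> \<le> b}) \<le> 2 * b + 1"
    unfolding sub using assms by (simp add: of_nat_nat) linarith
qed

lemma finite_bounded_int_mat3: "finite {\<beta>::mat3. \<forall>i j. \<beta> $ i $ j \<in> \<int> \<and> \<bar>\<beta> $ i $ j\<bar> \<le> K}"
proof -
  let ?I = "{k::int. \<bar>0 + real_of_int k\<bar> \<le> K}"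
  let ?f = "\<lambda>(a, b, c, d, e, f, g, h, i). vector [vector [real_of_int a, real_of_int b, real_of_int c],
     vector [real_of_int d, real_of_int e, real_of_int f], vector [real_of_int g, real_of_int h, real_of_int i]] :: mat3"
  have fin: "finite ?I"
    using card_int_interval(1)[of K 0] by (cases "K \<ge> 0") (auto intro: finite_subset[of _ "{}"])
  have "{\<beta>::mat3. \<forall>i j. \<beta> $ i $ j \<in> \<int> \<and> \<bar>\<beta> $ i $ j\<bar> \<le> K} \<subseteq> ?f ` (?I \<times> ?I \<times> ?I \<times> ?I \<times> ?I \<times> ?I \<times> ?I \<times> ?I \<times> ?I)"
  proof
    fix \<beta> :: mat3 assume "\<beta> \<in> {\<beta>. \<forall>i j. \<beta> $ i $ j \<in> \<int> \<and> \<bar>\<beta> $ i $ j\<bar> \<le> K}"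
    hence b: "\<beta> $ i $ j = real_of_int \<lfloor>\<beta> $ i $ j\<rfloor>" "\<bar>\<beta> $ i $ j\<bar> \<le> K" for i j
      by (auto elim!: Ints_cases)
    let ?b = "\<lambda>i j. \<lfloor>\<beta> $ i $ j\<rfloor>"
    have "\<beta> = ?f (?b 1 1, ?b 1 2, ?b 1 3, ?b 2 1, ?b 2 2, ?b 2 3, ?b 3 1, ?b 3 2, ?b 3 3)"
      by (simp add: mat3_eq_iff flip: b)
    moreover have "?b i j \<in> ?I" for i j using b[of i j] by simp
    hence "(?b 1 1, ?b 1 2, ?b 1 3, ?b 2 1, ?b 2 2, ?b 2 3, ?b 3 1, ?b 3 2, ?b 3 3)
        \<in> ?I \<times> ?I \<times> ?I \<times> ?I \<times> ?I \<times> ?I \<times> ?I \<times> ?I \<times> ?I" by (intro SigmaI)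
    ultimately show "\<beta> \<in> ?f ` (?I \<times> ?I \<times> ?I \<times> ?I \<times> ?I \<times> ?I \<times> ?I \<times> ?I \<times> ?I)"
      by (rule image_eqI)
  qed
  thus ?thesis by (rule finite_subset) (intro finite_imageI finite_cartesian_product fin)
qed

text \<open>The three quantities are the entries of the row vector v times the Iwasawa matrix. This
  matrix being upper triangular, the entries of v are confined in turn to intervals of length 2R /
  (y1 y2), 2R / y1 and 2R.\<close>

lemma card_integer_vectors:
  fixes x1 x2 x3 y1 y2 R :: real
  assumes "y1 > 0" "y2 > 0" "R \<ge> 0"
  defines "V \<equiv> {v::real^3. (\<forall>i. v $ i \<in> \<int>) \<and> \<bar>v$1 * (y1 * y2)\<bar> \<le> R \<and> \<bar>(v$1 * x2 + v$2) * y1\<bar> \<le> R \<and>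
     \<bar>v$1 * x3 + v$2 * x1 + v$3\<bar> \<le> R}"
  shows "finite V" "real (card V) \<le> (2 * (R / (y1 * y2)) + 1) * ((2 * (R / y1) + 1) * (2 * R + 1))"
proof -
  define I where "I = {i::int. \<bar>0 + real_of_int i\<bar> \<le> R / (y1 * y2)}"
  define J where "J i = {j::int. \<bar>real_of_int i * x2 + real_of_int j\<bar> \<le> R / y1}" for i :: int
  define K where "K i j = {k::int. \<bar>(real_of_int i * x3 + real_of_int j * x1) + real_of_int k\<bar> \<le> R}" for i j :: int
  have nn: "R / (y1 * y2) \<ge> 0" "R / y1 \<ge> 0" using assms by auto
  have fin: "finite I" "finite (J i)" "finite (K i j)" for i j
    unfolding I_def J_def K_def using card_int_interval(1) nn assms(3) by blast+
  have cd: "real (card I) \<le> 2 * (R / (y1 * y2)) + 1" "real (card (J i)) \<le> 2 * (R / y1) + 1"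
    "real (card (K i j)) \<le> 2 * R + 1" for i j
    unfolding I_def J_def K_def using card_int_interval(2) nn assms(3) by blast+
  let ?S = "SIGMA i:I. SIGMA j:J i. K i j"
  let ?f = "\<lambda>(i, j, k). vector [real_of_int i, real_of_int j, real_of_int k] :: real^3"
  have sub: "V \<subseteq> ?f ` ?S"
  proof
    fix v assume v: "v \<in> V"
    hence b: "v $ i = real_of_int \<lfloor>v $ i\<rfloor>" for i by (auto simp: V_def elim!: Ints_cases)
    have "v = ?f (\<lfloor>v$1\<rfloor>, \<lfloor>v$2\<rfloor>, \<lfloor>v$3\<rfloor>)" by (simp add: vec_eq_iff forall_3 flip: b)
    moreover have "(\<lfloor>v$1\<rfloor>, \<lfloor>v$2\<rfloor>, \<lfloor>v$3\<rfloor>) \<in> ?S"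
      using v assms(1,2) by (simp add: I_def J_def K_def V_def abs_mult flip: b) (simp add: field_simps)
    ultimately show "v \<in> ?f ` ?S" by (rule image_eqI)
  qed
  have finS: "finite ?S" by (intro finite_SigmaI fin)
  show "finite V" by (rule finite_subset[OF sub finite_imageI[OF finS]])
  have "card V \<le> card ?S"
    by (rule order_trans[OF card_mono[OF finite_imageI[OF finS] sub] card_image_le[OF finS]])
  hence "real (card V) \<le> real (card ?S)" by simp
  also have "real (card ?S) = (\<Sum>i\<in>I. \<Sum>j\<in>J i. real (card (K i j)))"
    by (simp add: card_SigmaI fin finite_SigmaI)
  also have "\<dots> \<le> (\<Sum>i\<in>I. \<Sum>j\<in>J i. 2 * R + 1)" by (intro sum_mono cd)
  also have "\<dots> = (\<Sum>i\<in>I. real (card (J i)) * (2 * R + 1))" by simp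
  also have "\<dots> \<le> (\<Sum>i\<in>I. (2 * (R / y1) + 1) * (2 * R + 1))"
    using assms(3) by (intro sum_mono mult_right_mono cd) auto
  also have "\<dots> = real (card I) * ((2 * (R / y1) + 1) * (2 * R + 1))" by simp
  also have "\<dots> \<le> (2 * (R / (y1 * y2)) + 1) * ((2 * (R / y1) + 1) * (2 * R + 1))"
    using assms(3) nn by (intro mult_right_mono cd) auto
  finally show "real (card V) \<le> (2 * (R / (y1 * y2)) + 1) * ((2 * (R / y1) + 1) * (2 * R + 1))" .
qed

lemma abs_det_orthogonal3: "orthogonal_matrix k \<Longrightarrow> \<bar>det (k::mat3)\<bar> = 1"
  using det_orthogonal_matrix[of k] by auto

text \<open>The bottom row of \<gamma> times the Iwasawa matrix has norm r, where r^3 is a quotient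
  of two determinants in [t, T] and hence at most T / t; \<open>card_integer_vectors\<close> counts
  such rows. Matrices with equal bottom row differ by an integral parabolic element between two
  points of the Siegel set, for which there are at most \<open>card B\<close> possibilities.\<close>

lemma SL3Z_orbit_siegel3:
  assumes t: "t > 0" and p: "p \<in> siegel3 Y t T"
  defines "R \<equiv> 1 + T / t" and "\<Gamma> \<equiv> {\<gamma>\<in>SL3Z. act \<gamma> p \<in> siegel3 Y t T}"
    and "B \<equiv> {\<beta>::mat3. \<forall>i j. \<beta> $ i $ j \<in> \<int> \<and> \<bar>\<beta> $ i $ j\<bar> \<le> 20}"
  shows "finite \<Gamma>" "real (card \<Gamma>) \<le> real (card B) * ((2 * R + sqrt (T * Y)) * ((2 * R + sqrt (2 * T)) * (2 * R + 1)) / t)"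
proof -
  obtain x1 x2 x3 y1 y2 where p_eq: "p = (x1, x2, x3, y1, y2)" by (cases p)
  note P = p[unfolded p_eq siegel3_iff]
  have y: "y1 > 0" "y2 > 0" using P by auto
  have T: "T > 0" using P t by linarith
  have R: "R \<ge> 1" using T t by (simp add: R_def)
  define V where "V = {v::real^3. (\<forall>i. v $ i \<in> \<int>) \<and> \<bar>v$1 * (y1 * y2)\<bar> \<le> R \<and> \<bar>(v$1 * x2 + v$2) * y1\<bar> \<le> R \<and>
     \<bar>v$1 * x3 + v$2 * x1 + v$3\<bar> \<le> R}"
  have V: "finite V" "real (card V) \<le> (2 * (R / (y1 * y2)) + 1) * ((2 * (R / y1) + 1) * (2 * R + 1))"
    using card_integer_vectors[OF y, of R x2 x3 x1] R unfolding V_def by auto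
  have row: "\<gamma> $ 3 \<in> V" if "\<gamma> \<in> \<Gamma>" for \<gamma>
  proof -
    have \<gamma>: "\<gamma> \<in> SL3Z" "act \<gamma> p \<in> siegel3 Y t T" using that by (auto simp: \<Gamma>_def)
    have ph: "p \<in> half_space3" using p siegel3_subset by blast
    have "det \<gamma> \<noteq> 0" using SL3Z_det[OF \<gamma>(1)] by simp
    from act_decomposition[OF this ph] obtain k r where kr: "orthogonal_matrix k" "r > 0"
      "\<gamma> ** iwasawa p = r *\<^sub>R (iwasawa (act \<gamma> p) ** k)" "r\<^sup>2 = (\<gamma> ** iwasawa p) $ 3 \<bullet> (\<gamma> ** iwasawa p) $ 3"
      by blast
    obtain x1' x2' x3' y1' y2' where q: "act \<gamma> p = (x1', x2', x3', y1', y2')" by (cases "act \<gamma> p")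
    note Q = \<gamma>(2)[unfolded q siegel3_iff]
    have "\<bar>det (\<gamma> ** iwasawa p)\<bar> = r ^ 3 * (y1'\<^sup>2 * y2')"
      unfolding kr(3) using kr(2) Q
      by (simp add: det_scaleR3 det_mul q det_iwasawa abs_mult abs_det_orthogonal3[OF kr(1)] power_abs)
    hence "r ^ 3 * (y1'\<^sup>2 * y2') = y1\<^sup>2 * y2"
      using y by (simp add: det_mul SL3Z_det[OF \<gamma>(1)] p_eq det_iwasawa abs_mult)
    moreover have "r ^ 3 * t \<le> r ^ 3 * (y1'\<^sup>2 * y2')" using Q kr(2) by (intro mult_left_mono) auto
    ultimately have "r ^ 3 * t \<le> T" using P by linarith
    hence r3: "r ^ 3 \<le> T / t" using t by (simp add: field_simps)
    \<comment> \<open>R = 1 + T / t exceeds both 1 and T / t, and r \<le> r^3 as soon as r >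
      1.\<close>
    have r: "r \<le> R"
    proof (cases "r \<le> 1")
      case False
      hence "r ^ 1 \<le> r ^ 3" by (intro power_increasing) auto
      thus ?thesis using r3 by (simp add: R_def)
    qed (use R in simp)
    let ?w = "(\<gamma> ** iwasawa p) $ 3"
    have "norm ?w = r" using kr(2,4) by (simp add: norm_eq_sqrt_inner flip: kr(4))
    hence w: "\<bar>?w $ i\<bar> \<le> R" for i using component_le_norm_cart[of ?w i] r by linarith
    have e: "?w $ 1 = \<gamma>$3$1 * (y1 * y2)" "?w $ 2 = (\<gamma>$3$1 * x2 + \<gamma>$3$2) * y1"
      "?w $ 3 = \<gamma>$3$1 * x3 + \<gamma>$3$2 * x1 + \<gamma>$3$3"
      by (simp_all add: p_eq matrix_mult_3 algebra_simps)
    have "\<gamma> $ 3 $ i \<in> \<int>" for i using \<gamma>(1) by (simp add: SL3Z_def)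
    with w[of 1] w[of 2] w[of 3] show ?thesis unfolding V_def e by blast
  qed
  have finB: "finite B" unfolding B_def by (rule finite_bounded_int_mat3)
  have fib: "finite {\<gamma>\<in>\<Gamma>. \<gamma> $ 3 = v}" "card {\<gamma>\<in>\<Gamma>. \<gamma> $ 3 = v} \<le> card B" for v
  proof -
    have "\<exists>\<gamma>1. {\<gamma>\<in>\<Gamma>. \<gamma> $ 3 = v} \<subseteq> (\<lambda>\<beta>. \<beta> ** \<gamma>1) ` B"
    proof (cases "{\<gamma>\<in>\<Gamma>. \<gamma> $ 3 = v} = {}")
      case False
      then obtain \<gamma>1 where \<gamma>1: "\<gamma>1 \<in> \<Gamma>" "\<gamma>1 $ 3 = v" by blast
      hence s1: "\<gamma>1 \<in> SL3Z" "act \<gamma>1 p \<in> siegel3 Y t T" by (auto simp: \<Gamma>_def)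
      obtain \<gamma>' where \<gamma>': "\<gamma>' \<in> SL3Z" "\<gamma>1 ** \<gamma>' = mat 1" "\<gamma>' ** \<gamma>1 = mat 1" using SL3Z_inverse[OF s1(1)] .
      have "{\<gamma>\<in>\<Gamma>. \<gamma> $ 3 = v} \<subseteq> (\<lambda>\<beta>. \<beta> ** \<gamma>1) ` B"
      proof
        fix \<gamma> assume "\<gamma> \<in> {\<gamma>\<in>\<Gamma>. \<gamma> $ 3 = v}"
        hence \<gamma>: "\<gamma> \<in> SL3Z" "act \<gamma> p \<in> siegel3 Y t T" "\<gamma> $ 3 = v" by (auto simp: \<Gamma>_def)
        define \<beta> where "\<beta> = \<gamma> ** \<gamma>'"
        have \<beta>: "\<beta> \<in> SL3Z" "\<beta> ** \<gamma>1 = \<gamma>"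
          using SL3Z_mult[OF \<gamma>(1) \<gamma>'(1)] \<gamma>'(3) by (auto simp: \<beta>_def simp flip: matrix_mul_assoc)
        have "\<beta> $ 3 $ j = (\<gamma>1 ** \<gamma>') $ 3 $ j" for j
          using \<gamma>(3) \<gamma>1(2) by (simp add: \<beta>_def matrix_mult_3)
        hence row3: "\<beta> $ 3 $ 1 = 0" "\<beta> $ 3 $ 2 = 0" "\<beta> $ 3 $ 3 = 1" by (simp_all add: \<gamma>'(2) mat_def)
        define b where "b i j = \<lfloor>\<beta> $ i $ j\<rfloor>" for i j
        have b: "real_of_int (b i j) = \<beta> $ i $ j" for i j
          using \<beta>(1) by (auto simp: SL3Z_def b_def elim!: Ints_cases)
        have par: "\<beta> = parab (b 1 1) (b 1 2) (b 2 1) (b 2 2) (b 1 3) (b 2 3)"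
          by (simp add: mat3_eq_iff b row3)
        have "real_of_int (b 1 1 * b 2 2 - b 1 2 * b 2 1) = det \<beta>" by (simp add: det_3 b row3)
        hence d: "b 1 1 * b 2 2 - b 1 2 * b 2 1 = 1" using SL3Z_det[OF \<beta>(1)] by linarith
        have "p \<in> half_space3" using p siegel3_subset by blast
        hence "act \<beta> (act \<gamma>1 p) = act \<gamma> p"
          using act_mult[of \<gamma>1 p \<beta>] SL3Z_det[OF s1(1)] \<beta>(2) by simp
        hence "act \<beta> (act \<gamma>1 p) \<in> siegel3 Y t T" using \<gamma>(2) by simp
        from siegel3_parab_bound[OF s1(2) this[unfolded par] d]
        have bd: "\<bar>b 1 1\<bar> \<le> 20" "\<bar>b 1 2\<bar> \<le> 20" "\<bar>b 2 1\<bar> \<le> 20" "\<bar>b 2 2\<bar> \<le> 20" "\<bar>b 1 3\<bar> \<le> 20" "\<bar>b 2 3\<bar> \<le> 20"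
          by blast+
        have r20: "\<bar>real_of_int n\<bar> \<le> 20" if "\<bar>n\<bar> \<le> 20" for n using that by linarith
        have "\<bar>\<beta> $ i $ j\<bar> \<le> 20" for i j
          using exhaust_3[of i] exhaust_3[of j] bd[THEN r20] by (auto simp: row3 b)
        hence "\<beta> \<in> B" using \<beta>(1) by (simp add: B_def SL3Z_def)
        thus "\<gamma> \<in> (\<lambda>\<beta>. \<beta> ** \<gamma>1) ` B" using \<beta>(2) by (metis image_eqI)
      qed
      thus ?thesis by blast
    qed auto
    then obtain \<gamma>1 where sub: "{\<gamma>\<in>\<Gamma>. \<gamma> $ 3 = v} \<subseteq> (\<lambda>\<beta>. \<beta> ** \<gamma>1) ` B" by blast
    show "finite {\<gamma>\<in>\<Gamma>. \<gamma> $ 3 = v}" by (rule finite_subset[OF sub finite_imageI[OF finB]])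
    show "card {\<gamma>\<in>\<Gamma>. \<gamma> $ 3 = v} \<le> card B"
      by (rule order_trans[OF card_mono[OF finite_imageI[OF finB] sub] card_image_le[OF finB]])
  qed
  have U: "\<Gamma> = (\<Union>v\<in>V. {\<gamma>\<in>\<Gamma>. \<gamma> $ 3 = v})" using row by blast
  show "finite \<Gamma>" by (subst U) (intro finite_UN_I V fib)
  have "card \<Gamma> \<le> (\<Sum>v\<in>V. card {\<gamma>\<in>\<Gamma>. \<gamma> $ 3 = v})" by (subst U) (rule card_UN_le[OF V(1)])
  also have "\<dots> \<le> (\<Sum>v\<in>V. card B)" by (intro sum_mono fib)
  finally have "card \<Gamma> \<le> card B * card V" by (simp add: mult.commute)
  hence c1: "real (card \<Gamma>) \<le> real (card B) * real (card V)" by (metis of_nat_le_iff of_nat_mult)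
  have h: "y2\<^sup>2 \<ge> 3 / 4" using reduced_height P by auto
  have y2: "y2 \<ge> 1 / 2" by (rule power2_le_imp_le) (use h y in \<open>auto simp: power2_eq_square\<close>)
  have a1: "y1 * y2 \<le> sqrt (T * Y)"
  proof (rule real_le_rsqrt)
    have "(y1 * y2)\<^sup>2 = (y1\<^sup>2 * y2) * y2" by (simp add: power2_eq_square)
    also have "\<dots> \<le> T * Y" using P y T by (intro mult_mono) auto
    finally show "(y1 * y2)\<^sup>2 \<le> T * Y" .
  qed
  have a2: "y1 \<le> sqrt (2 * T)"
  proof (rule real_le_rsqrt)
    have "y1\<^sup>2 * (1 / 2) \<le> y1\<^sup>2 * y2" using y2 by (intro mult_left_mono) auto
    thus "y1\<^sup>2 \<le> 2 * T" using P by linarith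
  qed
  \<comment> \<open>Since y1 y2 and y1 are bounded on the Siegel set, the summands 1 only enlarge
    the numerators, and the denominators multiply to y1^2 y2 \<ge> t.\<close>
  have "2 * (R / (y1 * y2)) + 1 \<le> (2 * R + sqrt (T * Y)) / (y1 * y2)"
    using a1 y by (simp add: field_simps)
  moreover have "2 * (R / y1) + 1 \<le> (2 * R + sqrt (2 * T)) / y1"
    using a2 y by (simp add: field_simps)
  ultimately have "(2 * (R / (y1 * y2)) + 1) * ((2 * (R / y1) + 1) * (2 * R + 1)) \<le>
     (2 * R + sqrt (T * Y)) / (y1 * y2) * ((2 * R + sqrt (2 * T)) / y1 * (2 * R + 1))"
    using R y a1 a2 T order_trans[OF less_imp_le[OF y(2)], of Y] P by (intro mult_mono mult_nonneg_nonneg add_nonneg_nonneg divide_nonneg_pos mult_right_mono) auto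
  also have "\<dots> = (2 * R + sqrt (T * Y)) * ((2 * R + sqrt (2 * T)) * (2 * R + 1)) / (y1\<^sup>2 * y2)"
    by (simp add: power2_eq_square)
  also have "\<dots> \<le> (2 * R + sqrt (T * Y)) * ((2 * R + sqrt (2 * T)) * (2 * R + 1)) / t"
  proof (intro divide_left_mono mult_nonneg_nonneg)
    show "0 \<le> 2 * R + sqrt (T * Y)" using a1 R mult_pos_pos[OF y] by linarith
    show "0 \<le> 2 * R + sqrt (2 * T)" using a2 R y by linarith
  qed (use P t R y in auto)
  finally have "real (card V) \<le> (2 * R + sqrt (T * Y)) * ((2 * R + sqrt (2 * T)) * (2 * R + 1)) / t"
    using V(2) by linarith
  hence "real (card B) * real (card V) \<le> real (card B) * ((2 * R + sqrt (T * Y)) * ((2 * R + sqrt (2 * T)) * (2 * R + 1)) / t)"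
    by (intro mult_left_mono) auto
  with c1 show "real (card \<Gamma>) \<le> real (card B) * ((2 * R + sqrt (T * Y)) * ((2 * R + sqrt (2 * T)) * (2 * R + 1)) / t)"
    by linarith
qed

text \<open>The parameters are scaled so that T / t and T Y do not depend on N while 1 / t grows
  like N. An arbitrary q is first replaced by a point of its orbit inside the Siegel set, if there
  is one.\<close>

lemma SL3Z_orbit_siegel3_card:
  fixes \<kappa> \<tau>1 \<tau>2 :: real
  assumes "\<kappa> > 0" "\<tau>1 > 0" "\<tau>2 > 0"
  obtains C where "C > 0" "\<And>N q. N \<ge> 1 \<Longrightarrow> q \<in> half_space3 \<Longrightarrow>
     finite {\<gamma>\<in>SL3Z. act \<gamma> q \<in> siegel3 (\<kappa> * N) (\<tau>1 / N) (\<tau>2 / N)} \<and>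
     real (card {\<gamma>\<in>SL3Z. act \<gamma> q \<in> siegel3 (\<kappa> * N) (\<tau>1 / N) (\<tau>2 / N)}) \<le> C * N"
proof -
  define R where "R = 1 + \<tau>2 / \<tau>1"
  define B where "B = {\<beta>::mat3. \<forall>i j. \<beta> $ i $ j \<in> \<int> \<and> \<bar>\<beta> $ i $ j\<bar> \<le> 20}"
  define C where "C = 1 + real (card B) * ((2 * R + sqrt (\<tau>2 * \<kappa>)) * ((2 * R + sqrt (2 * \<tau>2)) * (2 * R + 1)) / \<tau>1)"
  have R: "R > 0" using assms by (simp add: R_def add_pos_pos)
  have C: "C > 0" unfolding C_def using R assms
    by (intro add_pos_nonneg mult_nonneg_nonneg divide_nonneg_pos add_nonneg_nonneg) auto
  show ?thesis
  proof (rule that[OF C])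
    fix N q assume N: "(1::real) \<le> N" and q: "q \<in> half_space3"
    let ?S = "siegel3 (\<kappa> * N) (\<tau>1 / N) (\<tau>2 / N)"
    let ?A = "\<lambda>q. {\<gamma>\<in>SL3Z. act \<gamma> q \<in> ?S}"
    show "finite (?A q) \<and> real (card (?A q)) \<le> C * N"
    proof (cases "?A q = {}")
      case True
      show ?thesis unfolding True using C N by simp
    next
      case False
      then obtain \<gamma>0 where \<gamma>0: "\<gamma>0 \<in> SL3Z" "act \<gamma>0 q \<in> ?S" by blast
      obtain \<gamma>' where \<gamma>': "\<gamma>' \<in> SL3Z" "\<gamma>0 ** \<gamma>' = mat 1" "\<gamma>' ** \<gamma>0 = mat 1" using SL3Z_inverse[OF \<gamma>0(1)] .
      have t: "\<tau>1 / N > 0" using assms N by simp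
      have Req: "1 + \<tau>2 / N / (\<tau>1 / N) = R" using N by (simp add: R_def)
      have TY: "\<tau>2 / N * (\<kappa> * N) = \<tau>2 * \<kappa>" using N by simp
      note orb = SL3Z_orbit_siegel3[OF t \<gamma>0(2), unfolded Req TY, folded B_def]
      have "?A q \<subseteq> (\<lambda>\<gamma>. \<gamma> ** \<gamma>0) ` ?A (act \<gamma>0 q)"
      proof
        fix \<gamma> assume \<gamma>: "\<gamma> \<in> ?A q"
        have e: "(\<gamma> ** \<gamma>') ** \<gamma>0 = \<gamma>" using \<gamma>'(3) by (simp flip: matrix_mul_assoc)
        have "act (\<gamma> ** \<gamma>') (act \<gamma>0 q) = act \<gamma> q"
          using act_mult[OF _ q, of \<gamma>0 "\<gamma> ** \<gamma>'"] SL3Z_det[OF \<gamma>0(1)] e by simp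
        hence "\<gamma> ** \<gamma>' \<in> ?A (act \<gamma>0 q)" using \<gamma> SL3Z_mult[OF _ \<gamma>'(1)] by simp
        with e[symmetric] show "\<gamma> \<in> (\<lambda>\<gamma>. \<gamma> ** \<gamma>0) ` ?A (act \<gamma>0 q)"
          by (rule image_eqI[where x = "\<gamma> ** \<gamma>'"])
      qed
      hence fin: "finite (?A q)" and "card (?A q) \<le> card (?A (act \<gamma>0 q))"
        using orb(1) by (auto intro: finite_subset surj_card_le)
      hence "real (card (?A q)) \<le> real (card B) *
         ((2 * R + sqrt (\<tau>2 * \<kappa>)) * ((2 * R + sqrt (2 * (\<tau>2 / N))) * (2 * R + 1)) / (\<tau>1 / N))"
        using orb(2) by linarith
      also have "\<dots> \<le> real (card B) *
         ((2 * R + sqrt (\<tau>2 * \<kappa>)) * ((2 * R + sqrt (2 * \<tau>2)) * (2 * R + 1)) / (\<tau>1 / N))"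
      proof -
        have "\<tau>2 / N \<le> \<tau>2" using assms N by (simp add: field_simps)
        hence "2 * R + sqrt (2 * (\<tau>2 / N)) \<le> 2 * R + sqrt (2 * \<tau>2)" by simp
        thus ?thesis using R assms N t
          by (intro mult_left_mono divide_right_mono mult_right_mono) auto
      qed
      also have "\<dots> = real (card B) * ((2 * R + sqrt (\<tau>2 * \<kappa>)) * ((2 * R + sqrt (2 * \<tau>2)) * (2 * R + 1)) / \<tau>1) * N"
        by simp
      also have "\<dots> \<le> C * N" unfolding C_def using N by (intro mult_right_mono) auto
      finally show ?thesis using fin by simp
    qed
  qed
qed

section \<open>The form on a Siegel set\<close>

text \<open>The indicator discards the unspecified values of \<phi> at singular matrices, so that
  the function is Borel on the whole coordinate space.\<close>

definition norm_sq3 :: "(mat3 \<Rightarrow> complex) \<Rightarrow> coords3 \<Rightarrow> ennreal" where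
  "norm_sq3 \<phi> p = indicator half_space3 p * ennreal ((norm (\<phi> (iwasawa p)))\<^sup>2)"

lemma open_half_space3: "open half_space3"
  unfolding half_space3_def split_beta' by (intro open_Collect_conj open_Collect_less continuous_intros)

lemma continuous_on_mat3I:
  fixes f :: "'a::topological_space \<Rightarrow> mat3"
  assumes "\<And>i j. continuous_on S (\<lambda>x. f x $ i $ j)"
  shows "continuous_on S f"
proof -
  have "continuous_on S (\<lambda>x. \<chi> i j. f x $ i $ j)" by (intro continuous_on_vec_lambda assms)
  thus ?thesis by simp
qed

lemma continuous_on_iwasawa: "continuous_on S iwasawa"
proof (rule continuous_on_mat3I)
  fix i j :: 3
  have i: "i = 1 \<or> i = 2 \<or> i = 3" and j: "j = 1 \<or> j = 2 \<or> j = 3" using exhaust_3 by blast+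
  have eqs: "iwasawa p $ 1 = vector [fst (snd (snd (snd p))) * snd (snd (snd (snd p))),
       fst (snd p) * fst (snd (snd (snd p))), fst (snd (snd p))]"
    "iwasawa p $ 2 = vector [0, fst (snd (snd (snd p))), fst p]"
    "iwasawa p $ 3 = vector [0, 0, 1]" for p
    by (cases p, simp)+
  from i j show "continuous_on S (\<lambda>p. iwasawa p $ i $ j)"
    by (elim disjE) (simp_all add: eqs continuous_intros)
qed

lemma measurable_norm_sq3:
  assumes "continuous_on GL3 \<phi>"
  shows "norm_sq3 \<phi> \<in> borel_measurable borel"
proof -
  have "continuous_on half_space3 (\<lambda>p. (norm (\<phi> (iwasawa p)))\<^sup>2)"
    using iwasawa_in_GL3
    by (intro continuous_intros continuous_on_compose2[OF assms continuous_on_iwasawa]) auto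
  hence "(\<lambda>p. indicator half_space3 p *\<^sub>R (norm (\<phi> (iwasawa p)))\<^sup>2) \<in> borel_measurable borel"
    using open_half_space3 by (intro borel_measurable_continuous_on_indicator) auto
  hence "(\<lambda>p. ennreal (indicator half_space3 p *\<^sub>R (norm (\<phi> (iwasawa p)))\<^sup>2)) \<in> borel_measurable borel"
    by simp
  also have "(\<lambda>p. ennreal (indicator half_space3 p *\<^sub>R (norm (\<phi> (iwasawa p)))\<^sup>2)) = norm_sq3 \<phi>"
    by (auto simp: norm_sq3_def indicator_def)
  finally show ?thesis .
qed

lemma siegel3_borel [measurable]: "siegel3 Y t T \<in> sets borel"
  unfolding siegel3_def split_beta' by measurable

lemma maass_form_iwasawa_act:
  assumes "maass_form_SL3 \<phi>" "\<gamma> \<in> SL3Z" "p \<in> half_space3"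
  shows "\<phi> (iwasawa (act \<gamma> p)) = \<phi> (iwasawa p)"
proof -
  have d: "det \<gamma> \<noteq> 0" using SL3Z_det[OF assms(2)] by simp
  obtain k r where kr: "orthogonal_matrix k" "r > 0" "\<gamma> ** iwasawa p = r *\<^sub>R (iwasawa (act \<gamma> p) ** k)"
    using act_decomposition[OF d assms(3)] by blast
  have "iwasawa (act \<gamma> p) \<in> GL3" by (intro iwasawa_in_GL3 act_half_space3 d assms)
  hence "\<phi> (iwasawa (act \<gamma> p)) = \<phi> (r *\<^sub>R (iwasawa (act \<gamma> p) ** k))"
    using assms(1) kr(1,2) unfolding maass_form_SL3_def by simp
  also have "\<dots> = \<phi> (iwasawa p)"
    unfolding kr(3)[symmetric] using assms iwasawa_in_GL3[OF assms(3)] unfolding maass_form_SL3_def by simp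
  finally show ?thesis .
qed

lemma maass_form_continuous: "maass_form_SL3 \<phi> \<Longrightarrow> continuous_on GL3 \<phi>"
  unfolding maass_form_SL3_def smooth_on_def by (metis Ck_on.simps(1))

text \<open>Unfolding over a fundamental domain: each of its points has at most C N translates in
  the Siegel set, all with the same value of |\<phi>|^2, and the integral over the domain is
  finite.\<close>

lemma maass_form_siegel3_bound:
  fixes \<kappa> \<tau>1 \<tau>2 :: real
  assumes \<phi>: "maass_form_SL3 \<phi>" and pos: "\<kappa> > 0" "\<tau>1 > 0" "\<tau>2 > 0"
  obtains C where "C > 0" "\<And>N. N \<ge> 1 \<Longrightarrow>
     (\<integral>\<^sup>+p. indicator (siegel3 (\<kappa> * N) (\<tau>1 / N) (\<tau>2 / N)) p * norm_sq3 \<phi> p \<partial>haar3) \<le> ennreal (C * N)"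
proof -
  from \<phi> obtain F where F: "fundamental_domain3 F" and fin: "(\<integral>\<^sup>+ p. indicator F p * (case p of (x1, x2, x3, y1, y2) \<Rightarrow>
        ennreal ((norm (\<phi> (iwasawa p)))\<^sup>2 / (y1 ^ 3 * y2 ^ 3))) \<partial>lborel) < \<infinity>"
    unfolding maass_form_SL3_def square_integrable3_def by blast
  have Fm [measurable]: "F \<in> sets borel" and Fh: "F \<subseteq> half_space3"
    and Fq: "\<And>p. p \<in> half_space3 \<Longrightarrow> \<exists>q. q \<in> F \<and> SL3Z_equiv p q"
    using F unfolding fundamental_domain3_def by blast+
  note [measurable] = measurable_norm_sq3[OF maass_form_continuous[OF \<phi>]]
  have "(\<integral>\<^sup>+q. indicator F q * norm_sq3 \<phi> q \<partial>haar3) = (\<integral>\<^sup>+ p. indicator F p * (case p of (x1, x2, x3, y1, y2) \<Rightarrow>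
        ennreal ((norm (\<phi> (iwasawa p)))\<^sup>2 / (y1 ^ 3 * y2 ^ 3))) \<partial>lborel)"
    unfolding nn_integral_haar3_density[of "\<lambda>q. indicator F q * norm_sq3 \<phi> q", simplified]
  proof (intro nn_integral_cong)
    fix p :: coords3
    obtain x1 x2 x3 y1 y2 where p: "p = (x1, x2, x3, y1, y2)" by (cases p)
    show "(case p of (x1, x2, x3, y1, y2) \<Rightarrow> indicator {0<..} y1 * indicator {0<..} y2 * ennreal (1 / (y1 ^ 3 * y2 ^ 3))) *
       (indicator F p * norm_sq3 \<phi> p) = indicator F p * (case p of (x1, x2, x3, y1, y2) \<Rightarrow>
        ennreal ((norm (\<phi> (iwasawa p)))\<^sup>2 / (y1 ^ 3 * y2 ^ 3)))"
    proof (cases "p \<in> F")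
      case True
      hence h: "p \<in> half_space3" using Fh by blast
      hence y: "y1 > 0" "y2 > 0" by (auto simp: p half_space3_def)
      have "ennreal (1 / (y1 ^ 3 * y2 ^ 3)) * ennreal ((norm (\<phi> (iwasawa p)))\<^sup>2) =
         ennreal ((norm (\<phi> (iwasawa p)))\<^sup>2 / (y1 ^ 3 * y2 ^ 3))"
        using y by (subst ennreal_mult[symmetric]) auto
      thus ?thesis using True h y by (simp add: p norm_sq3_def)
    qed simp
  qed
  with fin have "(\<integral>\<^sup>+q. indicator F q * norm_sq3 \<phi> q \<partial>haar3) < \<infinity>" by simp
  then obtain I where I: "I \<ge> 0" "(\<integral>\<^sup>+q. indicator F q * norm_sq3 \<phi> q \<partial>haar3) = ennreal I"
    by (cases "\<integral>\<^sup>+q. indicator F q * norm_sq3 \<phi> q \<partial>haar3") auto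
  obtain C where C: "C > 0" "\<And>N q. N \<ge> 1 \<Longrightarrow> q \<in> half_space3 \<Longrightarrow>
     finite {\<gamma>\<in>SL3Z. act \<gamma> q \<in> siegel3 (\<kappa> * N) (\<tau>1 / N) (\<tau>2 / N)} \<and>
     real (card {\<gamma>\<in>SL3Z. act \<gamma> q \<in> siegel3 (\<kappa> * N) (\<tau>1 / N) (\<tau>2 / N)}) \<le> C * N"
    using SL3Z_orbit_siegel3_card[OF pos] by blast
  show ?thesis
  proof (rule that[of "C * (I + 1)"])
    show "C * (I + 1) > 0" using C I by simp
    fix N assume N: "(1::real) \<le> N"
    let ?S = "siegel3 (\<kappa> * N) (\<tau>1 / N) (\<tau>2 / N)"
    have "(\<integral>\<^sup>+p. indicator ?S p * norm_sq3 \<phi> p \<partial>haar3) \<le>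
       (\<integral>\<^sup>+q. indicator F q * (\<integral>\<^sup>+\<gamma>. indicator ?S (act \<gamma> q) * norm_sq3 \<phi> (act \<gamma> q) \<partial>count_space SL3Z) \<partial>haar3)"
    proof (rule nn_integral_haar3_unfold[OF countable_SL3Z _ siegel3_borel Fm _ Fh])
      show "det \<gamma> \<noteq> 0" if "\<gamma> \<in> SL3Z" for \<gamma> using SL3Z_det[OF that] by simp
      fix p assume p: "p \<in> ?S"
      hence ph: "p \<in> half_space3" using siegel3_subset by blast
      from Fq[OF this] obtain q \<gamma> k r where q: "q \<in> F" "\<gamma> \<in> SL3Z" "orthogonal_matrix k" "r \<noteq> 0"
         "\<gamma> ** iwasawa p = r *\<^sub>R (iwasawa q ** k)" unfolding SL3Z_equiv_def by blast
      have a: "act \<gamma> p = q" using act_unique[OF _ q(3,4,5)] q(1) Fh by blast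
      obtain \<gamma>' where \<gamma>': "\<gamma>' \<in> SL3Z" "\<gamma> ** \<gamma>' = mat 1" "\<gamma>' ** \<gamma> = mat 1" using SL3Z_inverse[OF q(2)] .
      have "act \<gamma>' q = p" using act_mult[of \<gamma> p \<gamma>'] SL3Z_det[OF q(2)] ph act_1[OF ph] \<gamma>'(3) a by simp
      thus "\<exists>\<gamma>\<in>SL3Z. \<exists>q\<in>F. p = act \<gamma> q" using q(1) \<gamma>'(1) by blast
    qed measurable
    also have "\<dots> \<le> (\<integral>\<^sup>+q. ennreal (C * N) * (indicator F q * norm_sq3 \<phi> q) \<partial>haar3)"
    proof (rule nn_integral_mono)
      fix q
      show "indicator F q * (\<integral>\<^sup>+\<gamma>. indicator ?S (act \<gamma> q) * norm_sq3 \<phi> (act \<gamma> q) \<partial>count_space SL3Z)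
         \<le> ennreal (C * N) * (indicator F q * norm_sq3 \<phi> q)"
      proof (cases "q \<in> F")
        case True
        hence q: "q \<in> half_space3" using Fh by blast
        let ?A = "{\<gamma>\<in>SL3Z. act \<gamma> q \<in> ?S}"
        note A = C(2)[OF N q]
        have "(\<integral>\<^sup>+\<gamma>. indicator ?S (act \<gamma> q) * norm_sq3 \<phi> (act \<gamma> q) \<partial>count_space SL3Z) =
           (\<integral>\<^sup>+\<gamma>. norm_sq3 \<phi> q * indicator ?A \<gamma> \<partial>count_space SL3Z)"
        proof (rule nn_integral_cong)
          fix \<gamma> assume "\<gamma> \<in> space (count_space SL3Z)"
          hence \<gamma>: "\<gamma> \<in> SL3Z" by simp
          have "norm_sq3 \<phi> (act \<gamma> q) = norm_sq3 \<phi> q"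
            using maass_form_iwasawa_act[OF \<phi> \<gamma> q] act_half_space3[of \<gamma> q] SL3Z_det[OF \<gamma>] q
            by (simp add: norm_sq3_def)
          thus "indicator ?S (act \<gamma> q) * norm_sq3 \<phi> (act \<gamma> q) = norm_sq3 \<phi> q * indicator ?A \<gamma>"
            using \<gamma> by (simp add: indicator_def)
        qed
        also have "\<dots> = norm_sq3 \<phi> q * emeasure (count_space SL3Z) ?A"
          by (rule nn_integral_cmult_indicator) simp
        also have "emeasure (count_space SL3Z) ?A = ennreal (real (card ?A))"
          using A by (subst emeasure_count_space_finite) (auto simp: ennreal_of_nat_eq_real_of_nat)
        also have "norm_sq3 \<phi> q * ennreal (real (card ?A)) \<le> norm_sq3 \<phi> q * ennreal (C * N)"
          using A by (intro mult_left_mono ennreal_leI) auto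
        finally show ?thesis using True by (simp add: mult.commute)
      qed simp
    qed
    also have "\<dots> = ennreal (C * N) * ennreal I"
      by (subst nn_integral_cmult) (measurable, simp add: I)
    also have "\<dots> = ennreal (C * N * I)" using C N I by (simp add: ennreal_mult)
    also have "\<dots> \<le> ennreal (C * (I + 1) * N)" using C N I by (intro ennreal_leI) (simp add: algebra_simps)
    finally show "(\<integral>\<^sup>+p. indicator ?S p * norm_sq3 \<phi> p \<partial>haar3) \<le> ennreal (C * (I + 1) * N)" .
  qed
qed

section \<open>Fourier analysis on the unit interval\<close>

lemma e2pi_add: "e2pi (x + y) = e2pi x * e2pi y"
  by (simp add: e2pi_def distrib_left exp_add)

lemma e2pi_0 [simp]: "e2pi 0 = 1"
  by (simp add: e2pi_def)

lemma e2pi_of_real: "e2pi (of_real x) = cis (2 * pi * x)"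
  by (simp add: e2pi_def cis_conv_exp mult_ac)

lemma norm_e2pi_of_real [simp]: "norm (e2pi (of_real x)) = 1"
  by (simp add: e2pi_of_real)

lemma cnj_e2pi_of_real: "cnj (e2pi (of_real x)) = e2pi (- of_real x)"
  using e2pi_of_real[of "- x"] by (simp add: e2pi_of_real cis_cnj)

lemma e2pi_of_int [simp]: "e2pi (of_int n) = 1"
proof -
  have "e2pi (of_real (real_of_int n)) = 1" unfolding e2pi_of_real by (rule cis_multiple_2pi) simp
  thus ?thesis by simp
qed

lemma e2pi_add_int: "e2pi (x + of_int n) = e2pi x"
  by (simp add: e2pi_add)

lemma continuous_on_e2pi [continuous_intros]:
  "continuous_on S f \<Longrightarrow> continuous_on S (\<lambda>x. e2pi (f x))"
  unfolding e2pi_def by (intro continuous_intros)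

lemma integral_e2pi:
  fixes n :: int
  shows "integral {0..1} (\<lambda>x::real. e2pi (of_int n * of_real x)) = (if n = 0 then 1 else 0)"
proof (cases "n = 0")
  case False
  define F where "F x = e2pi (of_int n * of_real x) / (2 * of_real pi * \<i> * of_int n)" for x :: real
  have "((\<lambda>x. e2pi (of_int n * of_real x)) has_integral F 1 - F 0) {0..1}"
  proof (rule fundamental_theorem_of_calculus)
    fix x :: real
    have "((\<lambda>z. exp (2 * of_real pi * \<i> * (of_int n * z)) / (2 * of_real pi * \<i> * of_int n)) has_field_derivative
       exp (2 * of_real pi * \<i> * (of_int n * of_real x))) (at (of_real x))"
      using False by (auto intro!: derivative_eq_intros)
    hence "(F has_vector_derivative e2pi (of_int n * of_real x)) (at x)"
      unfolding F_def e2pi_def by (rule has_vector_derivative_real_field)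
    thus "(F has_vector_derivative e2pi (of_int n * of_real x)) (at x within {0..1})"
      by (rule has_vector_derivative_at_within)
  qed simp
  moreover have "F 1 = F 0" by (simp add: F_def)
  ultimately show ?thesis using False by (simp add: integral_unique)
qed simp

text \<open>The integral of the squared distance from \<open>h\<close> to its projection
  \<open>P\<close> is nonnegative. The box makes the interval and the square instances of one
  statement.\<close>

lemma bessel_cbox:
  fixes h :: "'a::euclidean_space \<Rightarrow> complex" and e :: "'i \<Rightarrow> 'a \<Rightarrow> complex"
  assumes fin: "finite I" and h: "continuous_on (cbox a b) h" and e: "\<And>i. i \<in> I \<Longrightarrow> continuous_on (cbox a b) (e i)"
    and orth: "\<And>i j. i \<in> I \<Longrightarrow> j \<in> I \<Longrightarrow> integral (cbox a b) (\<lambda>x. e i x * cnj (e j x)) = (if i = j then 1 else 0)"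
  shows "(\<Sum>i\<in>I. (norm (integral (cbox a b) (\<lambda>x. h x * cnj (e i x))))\<^sup>2) \<le> integral (cbox a b) (\<lambda>x. (norm (h x))\<^sup>2)"
proof -
  let ?S = "cbox a b"
  have int: "f integrable_on ?S" if "continuous_on ?S f" for f :: "'a \<Rightarrow> complex"
    using that by (rule integrable_continuous)
  define c where "c i = integral ?S (\<lambda>x. h x * cnj (e i x))" for i
  define P where "P x = (\<Sum>i\<in>I. c i * e i x)" for x
  have P: "continuous_on ?S P" unfolding P_def by (intro continuous_intros e)
  have cn: "continuous_on ?S (\<lambda>x. cnj (f x))" if "continuous_on ?S f" for f :: "'a \<Rightarrow> complex"
    using that by (rule continuous_on_cnj)
  have hP: "integral ?S (\<lambda>x. h x * cnj (P x)) = (\<Sum>i\<in>I. cnj (c i) * c i)"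
  proof -
    have "integral ?S (\<lambda>x. h x * cnj (P x)) = integral ?S (\<lambda>x. \<Sum>i\<in>I. cnj (c i) * (h x * cnj (e i x)))"
      by (simp add: P_def sum_distrib_left mult_ac)
    also have "\<dots> = (\<Sum>i\<in>I. integral ?S (\<lambda>x. cnj (c i) * (h x * cnj (e i x))))"
      by (intro integral_sum fin int continuous_intros h cn e)
    finally show ?thesis by (simp add: c_def)
  qed
  have eP: "integral ?S (\<lambda>x. e i x * cnj (P x)) = cnj (c i)" if i: "i \<in> I" for i
  proof -
    have "integral ?S (\<lambda>x. e i x * cnj (P x)) = integral ?S (\<lambda>x. \<Sum>j\<in>I. cnj (c j) * (e i x * cnj (e j x)))"
      by (simp add: P_def sum_distrib_left mult_ac)
    also have "\<dots> = (\<Sum>j\<in>I. integral ?S (\<lambda>x. cnj (c j) * (e i x * cnj (e j x))))"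
      by (intro integral_sum fin int continuous_intros cn e i)
    also have "\<dots> = (\<Sum>j\<in>I. if i = j then cnj (c j) else 0)"
      by (intro sum.cong refl) (simp add: orth i)
    finally show ?thesis using i fin by simp
  qed
  have PP: "integral ?S (\<lambda>x. P x * cnj (P x)) = (\<Sum>i\<in>I. c i * cnj (c i))"
  proof -
    have "integral ?S (\<lambda>x. P x * cnj (P x)) = integral ?S (\<lambda>x. \<Sum>i\<in>I. c i * (e i x * cnj (P x)))"
    proof -
      have "P x * z = (\<Sum>i\<in>I. c i * (e i x * z))" for x z
        by (simp add: P_def sum_distrib_right mult.assoc)
      thus ?thesis by (simp only:)
    qed
    also have "\<dots> = (\<Sum>i\<in>I. integral ?S (\<lambda>x. c i * (e i x * cnj (P x))))"
      by (intro integral_sum fin int continuous_intros cn e P)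
    finally show ?thesis by (simp add: eP)
  qed
  let ?N = "\<Sum>i\<in>I. (norm (c i))\<^sup>2"
  have cc: "(\<Sum>i\<in>I. c i * cnj (c i)) = of_real ?N"
    by (simp only: of_real_sum complex_norm_square)
  have cc': "(\<Sum>i\<in>I. cnj (c i) * c i) = of_real ?N" using cc by (simp add: mult.commute)
  have pt: "of_real ((norm (h x - P x))\<^sup>2) = of_real ((norm (h x))\<^sup>2) - h x * cnj (P x) - cnj (h x * cnj (P x)) + P x * cnj (P x)" for x
    unfolding complex_norm_square by (simp add: algebra_simps)
  have ofr: "integral ?S (\<lambda>x. complex_of_real (f x)) = of_real (integral ?S f)" if "continuous_on ?S f" for f :: "'a \<Rightarrow> real"
    using integral_linear[OF integrable_continuous[OF that] bounded_linear_of_real[where ?'a = complex]] by (simp add: o_def)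
  have I2: "integral ?S (\<lambda>x. complex_of_real ((norm (h x))\<^sup>2)) = of_real (integral ?S (\<lambda>x. (norm (h x))\<^sup>2))"
    by (rule ofr) (intro continuous_intros h)
  have "complex_of_real (integral ?S (\<lambda>x. (norm (h x - P x))\<^sup>2)) = integral ?S (\<lambda>x. of_real ((norm (h x - P x))\<^sup>2))"
    by (rule ofr[symmetric]) (intro continuous_intros h P)
  also have "\<dots> = integral ?S (\<lambda>x. of_real ((norm (h x))\<^sup>2)) - integral ?S (\<lambda>x. h x * cnj (P x))
      - integral ?S (\<lambda>x. cnj (h x * cnj (P x))) + integral ?S (\<lambda>x. P x * cnj (P x))"
    unfolding pt
    by (subst Henstock_Kurzweil_Integration.integral_add Henstock_Kurzweil_Integration.integral_diff;
        (intro int continuous_intros cn h P)?)+ simp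
  also have "integral ?S (\<lambda>x. cnj (h x * cnj (P x))) = cnj (integral ?S (\<lambda>x. h x * cnj (P x)))"
    by (rule integral_cnj[symmetric])
  also have "integral ?S (\<lambda>x. of_real ((norm (h x))\<^sup>2)) - integral ?S (\<lambda>x. h x * cnj (P x))
      - cnj (integral ?S (\<lambda>x. h x * cnj (P x))) + integral ?S (\<lambda>x. P x * cnj (P x)) =
      of_real (integral ?S (\<lambda>x. (norm (h x))\<^sup>2) - ?N)"
    unfolding hP PP cc cc' I2 by simp
  finally have "integral ?S (\<lambda>x. (norm (h x - P x))\<^sup>2) = integral ?S (\<lambda>x. (norm (h x))\<^sup>2) - ?N"
    by (simp only: of_real_eq_iff)
  moreover have "integral ?S (\<lambda>x. (norm (h x - P x))\<^sup>2) \<ge> 0"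
    by (rule Henstock_Kurzweil_Integration.integral_nonneg) (auto intro!: integrable_continuous continuous_intros h P)
  ultimately show ?thesis by (simp add: c_def)
qed

lemma bessel_interval:
  fixes h :: "real \<Rightarrow> complex"
  assumes "finite I" "continuous_on {0..1} h"
  shows "(\<Sum>n\<in>I. (norm (integral {0..1} (\<lambda>x. h x * e2pi (- (of_int n * of_real x)))))\<^sup>2)
    \<le> integral {0..1} (\<lambda>x. (norm (h x))\<^sup>2)"
proof -
  let ?e = "\<lambda>n x. e2pi (of_int n * of_real x) :: complex"
  have cnj: "cnj (?e n x) = e2pi (- (of_int n * of_real x))" for n :: int and x :: real
    using cnj_e2pi_of_real[of "of_int n * x"] by simp
  have "(\<Sum>n\<in>I. (norm (integral (cbox 0 1) (\<lambda>x. h x * cnj (?e n x))))\<^sup>2) \<le> integral (cbox 0 1) (\<lambda>x. (norm (h x))\<^sup>2)"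
  proof (rule bessel_cbox)
    fix i j :: int
    have "integral {0..1} (\<lambda>x. ?e i x * cnj (?e j x)) = integral {0..1} (\<lambda>x. ?e (i - j) x)"
      by (simp add: cnj left_diff_distrib flip: e2pi_add)
    also have "\<dots> = (if i - j = 0 then 1 else 0)" by (rule integral_e2pi)
    finally show "integral (cbox 0 1) (\<lambda>x. ?e i x * cnj (?e j x)) = (if i = j then 1 else 0)"
      by simp
  qed (use assms in \<open>auto intro!: continuous_intros\<close>)
  thus ?thesis by (simp add: cnj)
qed

lemma bessel_square:
  fixes h :: "real \<Rightarrow> real \<Rightarrow> complex"
  assumes "finite I" "continuous_on UNIV (\<lambda>(x, y). h x y)"
  shows "(\<Sum>(m, n)\<in>I. (norm (integral {0..1} (\<lambda>x. integral {0..1} (\<lambda>y.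
       h x y * e2pi (- (of_int m * of_real x + of_int n * of_real y))))))\<^sup>2)
    \<le> integral {0..1} (\<lambda>x. integral {0..1} (\<lambda>y. (norm (h x y))\<^sup>2))"
proof -
  let ?S = "cbox (0, 0) (1, 1) :: (real \<times> real) set"
  have prod: "integral ?S f = integral {0..1} (\<lambda>x. integral {0..1} (\<lambda>y. f (x, y)))"
    if "continuous_on ?S f" for f :: "real \<times> real \<Rightarrow> 'z::euclidean_space"
    using integral_prod_continuous[OF that] by simp
  define e where "e m p = e2pi (of_int (fst m) * of_real (fst p) + of_int (snd m) * of_real (snd p))"
    for m :: "int \<times> int" and p :: "real \<times> real"
  have e: "continuous_on ?S (e m)" for m unfolding e_def by (intro continuous_intros)
  have cnj: "cnj (e m (x, y)) = e2pi (- (of_int (fst m) * of_real x + of_int (snd m) * of_real y))" for m x y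
    using cnj_e2pi_of_real[of "of_int (fst m) * x + of_int (snd m) * y"] by (simp add: e_def)
  define H where "H p = h (fst p) (snd p)" for p
  have H: "continuous_on ?S H" unfolding H_def
    by (rule continuous_on_subset[OF assms(2)[unfolded split_beta'] subset_UNIV])
  have "(\<Sum>m\<in>I. (norm (integral ?S (\<lambda>p. H p * cnj (e m p))))\<^sup>2) \<le> integral ?S (\<lambda>p. (norm (H p))\<^sup>2)"
  proof (rule bessel_cbox[OF assms(1) H e])
    fix i j :: "int \<times> int"
    have "integral ?S (\<lambda>p. e i p * cnj (e j p)) = integral {0..1} (\<lambda>x. integral {0..1} (\<lambda>y. e i (x, y) * cnj (e j (x, y))))"
      by (rule prod) (intro continuous_intros e continuous_on_cnj)
    also have "\<dots> = integral {0..1} (\<lambda>x. integral {0..1} (\<lambda>y. e2pi (of_int (fst i - fst j) * of_real x) *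
        e2pi (of_int (snd i - snd j) * of_real y)))"
      unfolding cnj unfolding e_def by (simp add: algebra_simps flip: e2pi_add)
    also have "\<dots> = integral {0..1} (\<lambda>x. e2pi (of_int (fst i - fst j) * of_real x) * (if snd i - snd j = 0 then 1 else 0))"
      by (simp only: integral_e2pi integral_mult_right)
    also have "\<dots> = (if fst i - fst j = 0 then 1 else 0) * (if snd i - snd j = 0 then 1 else 0)"
      by (simp only: integral_e2pi integral_mult_left)
    also have "\<dots> = (if i = j then 1 else 0)" by (auto simp: prod_eq_iff)
    finally show "integral ?S (\<lambda>p. e i p * cnj (e j p)) = (if i = j then 1 else 0)" .
  qed
  also have "integral ?S (\<lambda>p. (norm (H p))\<^sup>2) = integral {0..1} (\<lambda>x. integral {0..1} (\<lambda>y. (norm (h x y))\<^sup>2))"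
    by (subst prod, intro continuous_intros H) (simp add: H_def)
  also have "(\<Sum>m\<in>I. (norm (integral ?S (\<lambda>p. H p * cnj (e m p))))\<^sup>2) =
     (\<Sum>(m, n)\<in>I. (norm (integral {0..1} (\<lambda>x. integral {0..1} (\<lambda>y.
       h x y * e2pi (- (of_int m * of_real x + of_int n * of_real y))))))\<^sup>2)"
  proof (intro sum.cong refl)
    fix m :: "int \<times> int"
    show "(norm (integral ?S (\<lambda>p. H p * cnj (e m p))))\<^sup>2 = (case m of (m, n) \<Rightarrow> (norm (integral {0..1} (\<lambda>x. integral {0..1} (\<lambda>y.
       h x y * e2pi (- (of_int m * of_real x + of_int n * of_real y))))))\<^sup>2)"
      by (subst prod, intro continuous_intros H e continuous_on_cnj) (auto simp: H_def cnj split: prod.split)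
  qed
  finally show ?thesis .
qed

section \<open>Periodic functions and automorphisms of the torus\<close>

lemma integral_periodic_shift:
  fixes f :: "real \<Rightarrow> complex"
  assumes f: "continuous_on UNIV f" and per: "\<And>x. f (x + 1) = f x"
  shows "integral {0..1} (\<lambda>x. f (x + c)) = integral {0..1} f"
proof -
  have int: "f integrable_on {a..b}" for a b
    by (intro integrable_continuous_real continuous_on_subset[OF f]) auto
  have perz: "f (x + of_int n) = f x" for x and n :: int
  proof -
    have nat: "f (x + of_nat k) = f x" for x k
    proof (induction k)
      case (Suc k)
      have "f (x + of_nat (Suc k)) = f ((x + of_nat k) + 1)" by (simp add: add_ac)
      thus ?case using per Suc by simp
    qed simp
    show ?thesis
    proof (cases "n \<ge> 0")
      case True
      thus ?thesis using nat[of x "nat n"] by simp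
    next
      case False
      thus ?thesis using nat[of "x + of_int n" "nat (- n)"] by simp
    qed
  qed
  define d where "d = frac c"
  have d: "0 \<le> d" "d \<le> 1" using frac_ge_0[of c] frac_lt_1[of c] by (auto simp: d_def)
  have "integral {0..1} (\<lambda>x. f (x + c)) = integral {0..1} (\<lambda>x. f (x + d))"
    using perz[of "_ + d" "\<lfloor>c\<rfloor>"] by (simp add: d_def frac_def)
  also have "\<dots> = integral {d..1 + d} f"
    using integral_shift_real_ivl[of d d "1 + d" f] by simp
  also have "\<dots> = integral {d..1} f + integral {1..1 + d} f"
    using d by (intro Henstock_Kurzweil_Integration.integral_combine[symmetric] int) auto
  also have "integral {1..1 + d} f = integral {0..d} (\<lambda>x. f (x + 1))"
    using integral_shift_real_ivl[of 1 1 "1 + d" f] by simp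
  also have "\<dots> = integral {0..d} f" by (simp add: per)
  also have "integral {d..1} f + integral {0..d} f = integral {0..1} f"
    using d Henstock_Kurzweil_Integration.integral_combine[of 0 d 1 f] int by (simp add: add.commute)
  finally show ?thesis .
qed

lemma integral_periodic_reflect:
  fixes f :: "real \<Rightarrow> complex"
  assumes f: "continuous_on UNIV f" and per: "\<And>x. f (x + 1) = f x"
  shows "integral {0..1} (\<lambda>x. f (- x)) = integral {0..1} f"
proof -
  have "integral {0..1} (\<lambda>x. f (- x)) = integral {-1..0} f"
    using Henstock_Kurzweil_Integration.integral_reflect_real[of 0 "-1" f] by simp
  also have "\<dots> = integral {0..1} (\<lambda>x. f (x + - 1))"
    using integral_shift_real_ivl[of "-1" "-1" 0 f] by simp
  also have "\<dots> = integral {0..1} f" by (rule integral_periodic_shift[OF f per])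
  finally show ?thesis .
qed

lemma integral_square_swap:
  fixes k :: "real \<Rightarrow> real \<Rightarrow> complex"
  assumes k: "continuous_on UNIV (\<lambda>(x, y). k x y)"
  shows "integral {0..1} (\<lambda>x. integral {0..1} (\<lambda>y. k x y)) = integral {0..1} (\<lambda>y. integral {0..1} (\<lambda>x. k x y))"
  using integral_swap_continuous[of 0 0 1 1 k] continuous_on_subset[OF k] by simp

lemma continuous_on_pairD:
  assumes k: "continuous_on UNIV (\<lambda>(x::real, y::real). k x y)"
    and "continuous_on S f" "continuous_on S g"
  shows "continuous_on S (\<lambda>z. k (f z) (g z))"
proof -
  have "continuous_on S (\<lambda>z. (\<lambda>(x, y). k x y) (f z, g z))"
    by (intro continuous_on_compose2[OF k] continuous_intros assms) auto
  thus ?thesis by simp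
qed

text \<open>The matrix is reduced by the Euclidean algorithm on its lower left entry.\<close>

lemma torus_automorphism:
  fixes k :: "real \<Rightarrow> real \<Rightarrow> complex" and a b c d :: int
  assumes "continuous_on UNIV (\<lambda>(x, y). k x y)" "\<And>x y. k (x + 1) y = k x y" "\<And>x y. k x (y + 1) = k x y"
    and "a * d - b * c = 1"
  shows "integral {0..1} (\<lambda>x. integral {0..1} (\<lambda>y. k (a * x + b * y) (c * x + d * y)))
    = integral {0..1} (\<lambda>x. integral {0..1} (\<lambda>y. k x y))"
  using assms
proof (induction "nat \<bar>c\<bar>" arbitrary: a b c d k rule: less_induct)
  case less
  note k = less.prems(1) and per1 = less.prems(2) and per2 = less.prems(3) and det = less.prems(4)
  note ck = continuous_on_pairD[OF k]
  show ?case
  proof (cases "c = 0")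
    case True
    hence "a * d = 1" using det by simp
    hence "(a = 1 \<and> d = 1) \<or> (a = -1 \<and> d = -1)" by (simp add: zmult_eq_1_iff)
    thus ?thesis
    proof (elim disjE conjE)
      assume ad: "a = 1" "d = 1"
      have "integral {0..1} (\<lambda>x. integral {0..1} (\<lambda>y. k (x + b * y) y)) =
        integral {0..1} (\<lambda>y. integral {0..1} (\<lambda>x. k (x + b * y) y))"
        by (rule integral_square_swap) (auto simp: split_beta' intro!: ck continuous_intros)
      also have "\<dots> = integral {0..1} (\<lambda>y. integral {0..1} (\<lambda>x. k x y))"
        by (subst integral_periodic_shift) (auto intro!: ck continuous_intros simp: per1)
      also have "\<dots> = integral {0..1} (\<lambda>x. integral {0..1} (\<lambda>y. k x y))"
        by (rule integral_square_swap[OF k, symmetric])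
      finally show ?thesis using ad True by simp
    next
      assume ad: "a = -1" "d = -1"
      have r: "integral {0..1} (\<lambda>x. k (- x + b * y) z) = integral {0..1} (\<lambda>x. k x z)" for y z :: real
      proof -
        have "integral {0..1} (\<lambda>x. k (- x + b * y) z) = integral {0..1} (\<lambda>x. k (x + b * y) z)"
        proof (rule integral_periodic_reflect[of "\<lambda>x. k (x + b * y) z"])
          show "continuous_on UNIV (\<lambda>x. k (x + b * y) z)" by (intro ck continuous_intros)
          show "k (x + 1 + b * y) z = k (x + b * y) z" for x using per1[of "x + b * y" z] by (simp add: add_ac)
        qed
        also have "\<dots> = integral {0..1} (\<lambda>x. k x z)"
          by (rule integral_periodic_shift) (auto intro!: ck continuous_intros simp: per1)
        finally show ?thesis .
      qed
      have cont: "continuous_on UNIV (\<lambda>y. integral {0..1} (\<lambda>x. k x y))"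
      proof -
        have "continuous_on UNIV (\<lambda>y. integral (cbox 0 1) (\<lambda>x. k x y))"
          by (rule integral_continuous_on_param) (unfold split_beta', intro ck continuous_intros)
        thus ?thesis by simp
      qed
      have "integral {0..1} (\<lambda>x. integral {0..1} (\<lambda>y. k (- x + b * y) (- y))) =
        integral {0..1} (\<lambda>y. integral {0..1} (\<lambda>x. k (- x + b * y) (- y)))"
        by (rule integral_square_swap) (auto simp: split_beta' intro!: ck continuous_intros)
      also have "\<dots> = integral {0..1} (\<lambda>y. integral {0..1} (\<lambda>x. k x (- y)))" by (simp only: r)
      also have "\<dots> = integral {0..1} (\<lambda>y. integral {0..1} (\<lambda>x. k x y))"
        by (rule integral_periodic_reflect[of "\<lambda>y. integral {0..1} (\<lambda>x. k x y)"]) (auto simp: per2 cont)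
      also have "\<dots> = integral {0..1} (\<lambda>x. integral {0..1} (\<lambda>y. k x y))"
        by (rule integral_square_swap[OF k, symmetric])
      finally show ?thesis using ad True by simp
    qed
  next
    case False
    \<comment> \<open>One Euclidean step: \<open>k'\<close> is k after a unimodular substitution
      chosen so that the remaining matrix has rows (-c, -d) and (r, s), with the lower left entry r
      = a mod c of smaller absolute value than c.\<close>
    define q r s where "q = a div c" and "r = a - q * c" and "s = b - q * d"
    have "r = a mod c" by (simp add: r_def q_def minus_div_mult_eq_mod)
    hence r: "\<bar>r\<bar> < \<bar>c\<bar>" using False abs_mod_less by blast
    define k' where "k' x y = k (y - q * x) (- x)" for x y :: real
    have k': "continuous_on UNIV (\<lambda>(x, y). k' x y)"
      unfolding k'_def split_beta' by (intro ck continuous_intros)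
    have perz: "k (x + of_int n) y = k x y" for x y and n :: int
    proof -
      have nat: "k (x + of_nat m) y = k x y" for x m
      proof (induction m)
        case (Suc m)
        have "k (x + of_nat (Suc m)) y = k ((x + of_nat m) + 1) y" by (simp add: add_ac)
        thus ?case using per1 Suc by simp
      qed simp
      show ?thesis
      proof (cases "n \<ge> 0")
        case True
        thus ?thesis using nat[of x "nat n"] by simp
      next
        case False
        thus ?thesis using nat[of "x + of_int n" "nat (- n)"] by simp
      qed
    qed
    have per1': "k' (x + 1) y = k' x y" for x y
    proof -
      have e: "y - q * (x + 1) = y - q * x + of_int (- q)" "- (x + 1) = - x - 1"
        by (simp_all add: algebra_simps)
      have "k' (x + 1) y = k (y - q * x + of_int (- q)) (- x - 1)" unfolding k'_def e ..
      also have "\<dots> = k (y - q * x) (- x - 1)" by (rule perz)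
      also have "\<dots> = k (y - q * x) (- x - 1 + 1)" by (rule per2[symmetric])
      finally show ?thesis by (simp add: k'_def)
    qed
    have per2': "k' x (y + 1) = k' x y" for x y
      using per1[of "y - q * x" "- x"] by (simp add: k'_def algebra_simps)
    have det': "(- c) * s - (- d) * r = 1"
      using det by (simp add: r_def s_def algebra_simps)
    have "integral {0..1} (\<lambda>x. integral {0..1} (\<lambda>y. k (a * x + b * y) (c * x + d * y))) =
       integral {0..1} (\<lambda>x. integral {0..1} (\<lambda>y. k' (of_int (- c) * x + of_int (- d) * y) (r * x + s * y)))"
      by (simp add: k'_def r_def s_def algebra_simps)
    also have "\<dots> = integral {0..1} (\<lambda>x. integral {0..1} (\<lambda>y. k' x y))"
      by (rule less.hyps) (use r k' per1' per2' det' in auto)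
    also have "\<dots> = integral {0..1} (\<lambda>x. integral {0..1} (\<lambda>y. k y (- x)))"
    proof -
      have "integral {0..1} (\<lambda>y. k (y + - (q * x)) (- x)) = integral {0..1} (\<lambda>y. k y (- x))" for x :: real
        by (rule integral_periodic_shift) (auto intro!: ck continuous_intros simp: per1)
      thus ?thesis by (simp add: k'_def)
    qed
    also have "\<dots> = integral {0..1} (\<lambda>x. integral {0..1} (\<lambda>y. k y x))"
    proof (rule integral_periodic_reflect[of "\<lambda>x. integral {0..1} (\<lambda>y. k y x)"])
      show "continuous_on UNIV (\<lambda>x. integral {0..1} (\<lambda>y. k y x))"
      proof -
        have "continuous_on UNIV (\<lambda>y. integral (cbox 0 1) (\<lambda>x. k x y))"
          by (rule integral_continuous_on_param) (unfold split_beta', intro ck continuous_intros)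
        thus ?thesis by simp
      qed
    qed (simp add: per2)
    also have "\<dots> = integral {0..1} (\<lambda>x. integral {0..1} (\<lambda>y. k x y))"
      by (rule integral_square_swap[OF k, symmetric])
    finally show ?thesis .
  qed
qed

section \<open>Reduction theory of \<open>SL(2,Z)\<close>\<close>

text \<open>Choose a coprime pair (c, d) with |c z + d| minimal, complete it to a matrix by Bezout,
  and translate to make the real part at most 1/2 in modulus. If the image z' had modulus below 1,
  then |a z + b| = |z'| |c z + d| would make (a, b) a better pair. Real coordinates are used to
  match \<open>act_parab\<close>.\<close>

lemma SL2Z_reduction:
  fixes x y :: real
  assumes y: "y > 0"
  obtains a b c d :: int where "a * d - b * c = 1"
    "\<bar>((a * x + b) * (c * x + d) + real_of_int a * real_of_int c * y\<^sup>2) / ((c * x + d)\<^sup>2 + (c * y)\<^sup>2)\<bar> \<le> 1 / 2"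
    "1 \<le> (((a * x + b) * (c * x + d) + real_of_int a * real_of_int c * y\<^sup>2) / ((c * x + d)\<^sup>2 + (c * y)\<^sup>2))\<^sup>2
      + (y / ((c * x + d)\<^sup>2 + (c * y)\<^sup>2))\<^sup>2"
proof -
  define S where "S p = (real_of_int (fst p) * x + of_int (snd p))\<^sup>2 + (of_int (fst p) * y)\<^sup>2" for p :: "int \<times> int"
  \<comment> \<open>Values up to 1 suffice because (0, 1) attains 1; the restriction makes the set
    of pairs finite.\<close>
  define K where "K = {p. coprime (fst p) (snd p) \<and> S p \<le> 1}"
  have finK: "finite K"
  proof (rule finite_subset)
    define B where "B = \<lceil>1 / y\<rceil> + \<lceil>1 + \<bar>x\<bar> / y\<rceil>"
    show "K \<subseteq> {-B..B} \<times> {-B..B}"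
    proof
      fix p assume "p \<in> K"
      hence p: "S p \<le> 1" by (simp add: K_def)
      have "(of_int (fst p) * y)\<^sup>2 \<le> 1\<^sup>2" "(real_of_int (fst p) * x + of_int (snd p))\<^sup>2 \<le> 1\<^sup>2"
        using p unfolding S_def by (smt (verit) power_one zero_le_power2)+
      hence 1: "\<bar>of_int (fst p) * y\<bar> \<le> 1" and 2: "\<bar>real_of_int (fst p) * x + of_int (snd p)\<bar> \<le> 1"
        by (simp_all only: abs_le_square_iff[symmetric] abs_one)
      from 1 have c: "\<bar>real_of_int (fst p)\<bar> \<le> 1 / y" using y by (simp add: abs_mult field_simps)
      have "\<bar>real_of_int (fst p) * x\<bar> \<le> 1 / y * \<bar>x\<bar>" unfolding abs_mult using c by (intro mult_right_mono) auto
      hence d: "\<bar>real_of_int (snd p)\<bar> \<le> 1 + \<bar>x\<bar> / y" using 2 by simp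
      have nn: "0 \<le> \<lceil>1 / y\<rceil>" "0 \<le> \<lceil>1 + \<bar>x\<bar> / y\<rceil>" 
      proof -
        have "0 \<le> 1 / y" "0 \<le> 1 + \<bar>x\<bar> / y" using y by simp_all
        from this[THEN ceiling_mono] show "0 \<le> \<lceil>1 / y\<rceil>" "0 \<le> \<lceil>1 + \<bar>x\<bar> / y\<rceil>" by simp_all
      qed
      have "real_of_int \<bar>fst p\<bar> \<le> 1 / y" "real_of_int \<bar>snd p\<bar> \<le> 1 + \<bar>x\<bar> / y" using c d by simp_all
      hence "\<bar>fst p\<bar> \<le> \<lceil>1 / y\<rceil>" "\<bar>snd p\<bar> \<le> \<lceil>1 + \<bar>x\<bar> / y\<rceil>" by linarith+
      hence "\<bar>fst p\<bar> \<le> B" "\<bar>snd p\<bar> \<le> B" using nn by (simp_all add: B_def)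
      thus "p \<in> {-B..B} \<times> {-B..B}" by (cases p) auto
    qed
  qed simp
  have "(0, 1) \<in> K" by (simp add: K_def S_def)
  hence "K \<noteq> {}" by blast
  hence "Min (S ` K) \<in> S ` K" using finK by (intro Min_in) auto
  then obtain p where p: "p \<in> K" "S p = Min (S ` K)" by auto
  have pmin: "S p \<le> S q" if "q \<in> K" for q
    unfolding p(2) using that finK by (intro Min_le) auto
  obtain c d where cd: "p = (c, d)" by (cases p)
  have cop: "coprime c d" using p(1) by (simp add: K_def cd)
  then obtain a0 b0 where ab0: "a0 * d - b0 * c = 1"
  proof -
    from cop obtain u v where "u * c + v * d = 1" using bezout_int[of c d] by (auto simp: coprime_iff_gcd_eq_1)
    hence "v * d - (- u) * c = 1" by (simp add: algebra_simps)
    thus ?thesis by (rule that)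
  qed
  define X where "X a b = ((of_int a * x + of_int b) * (of_int c * x + of_int d) + of_int a * of_int c * y\<^sup>2) / S p"
    for a b :: int
  have Spos: "S p > 0"
  proof (cases "c = 0")
    case True
    hence "d \<noteq> 0" using cop by auto
    thus ?thesis using True by (simp add: S_def cd)
  next
    case False
    thus ?thesis using y by (simp add: S_def cd add_nonneg_pos)
  qed
  define n where "n = - round (X a0 b0)"
  define a b where "a = a0 + n * c" and "b = b0 + n * d"
  have det: "a * d - b * c = 1" using ab0 by (simp add: a_def b_def algebra_simps)
  have "X a b = X a0 b0 + n"
  proof -
    have "(of_int a * x + of_int b) * (of_int c * x + of_int d) + of_int a * of_int c * y\<^sup>2 =
      (of_int a0 * x + of_int b0) * (of_int c * x + of_int d) + of_int a0 * of_int c * y\<^sup>2 + n * S p"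
      by (simp add: a_def b_def S_def cd algebra_simps power2_eq_square)
    thus ?thesis using Spos by (simp add: X_def add_divide_distrib)
  qed
  hence X1: "\<bar>X a b\<bar> \<le> 1 / 2" using of_int_round_abs_le[of "X a0 b0"] by (simp add: n_def abs_minus_commute)
  have rdet: "real_of_int a * d - real_of_int b * c = 1"
    using det by (metis of_int_1 of_int_diff of_int_mult)
  have key: "S (a, b) = ((X a b)\<^sup>2 + (y / S p)\<^sup>2) * S p"
  proof -
    let ?u = "real_of_int a * x + b" and ?v = "real_of_int c * x + d"
    have "?u * (real_of_int c * y) - ?v * (real_of_int a * y) = - y * (real_of_int a * d - real_of_int b * c)"
      by (simp add: algebra_simps)
    hence y2: "(?u * (real_of_int c * y) - ?v * (real_of_int a * y))\<^sup>2 = y\<^sup>2" by (simp add: rdet)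
    have "S (a, b) * S p = (?u * ?v + real_of_int a * real_of_int c * y\<^sup>2)\<^sup>2 + (?u * (real_of_int c * y) - ?v * (real_of_int a * y))\<^sup>2"
      by (simp add: S_def cd power2_eq_square algebra_simps)
    also have "\<dots> = (X a b * S p)\<^sup>2 + y\<^sup>2" using Spos y2 by (simp add: X_def)
    also have "\<dots> = ((X a b)\<^sup>2 + (y / S p)\<^sup>2) * S p * S p" using Spos by (simp add: field_simps power2_eq_square)
    finally show ?thesis using Spos by simp
  qed
  have X2: "1 \<le> (X a b)\<^sup>2 + (y / S p)\<^sup>2"
  proof (rule ccontr)
    assume "\<not> ?thesis"
    hence less: "S (a, b) < S p" unfolding key using Spos by (simp add: mult_less_cancel_right1)
    have "coprime a b"
    proof (rule coprimeI)
      fix l assume "l dvd a" "l dvd b"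
      hence "l dvd a * d - b * c" by (intro dvd_diff dvd_mult2)
      thus "is_unit l" by (simp only: det)
    qed
    hence "(a, b) \<in> K" using less p(1) by (simp add: K_def)
    with pmin less show False by fastforce
  qed
  show ?thesis
    by (rule that[OF det]) (use X1 X2 in \<open>simp_all add: X_def S_def cd\<close>)
qed

section \<open>Mean squares of the coefficients of a form for \<open>SL(3,Z)\<close>\<close>

text \<open>Fourier coefficients along the abelian unipotent radical with coordinates \<open>x1\<close> and \<open>x3\<close>.\<close>

definition fc3 :: "(mat3 \<Rightarrow> complex) \<Rightarrow> int \<Rightarrow> int \<Rightarrow> mat3 \<Rightarrow> complex" where
  "fc3 \<phi> m n g = integral {0..1} (\<lambda>x1. integral {0..1} (\<lambda>x3.
     \<phi> (unip3 x1 0 x3 ** g) * e2pi (- (of_int m * of_real x1 + of_int n * of_real x3))))"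

lemma unip3_mult: "unip3 a b c ** unip3 a' b' c' = unip3 (a + a') (b + b') (c + c' + b * a')"
  by (simp add: mat3_eq_iff matrix_mult_3)

lemma det_unip3 [simp]: "det (unip3 a b c) = 1"
  by (simp add: det_3)

lemma unip3_GL3: "g \<in> GL3 \<Longrightarrow> unip3 a b c ** g \<in> GL3"
  by (simp add: GL3_def det_mul)

lemma unip3_SL3Z: "unip3 (of_int a) (of_int b) (of_int c) \<in> SL3Z"
proof -
  have "unip3 (of_int a) (of_int b) (of_int c) $ i $ j \<in> \<int>" for i j
    using exhaust_3[of i] exhaust_3[of j] by auto
  thus ?thesis by (simp add: SL3Z_def)
qed

definition parabZ :: "mat3 set" where
  "parabZ = {parab a b c d e f | a b c d e f. a * d - b * c = 1 \<and>
     a \<in> \<int> \<and> b \<in> \<int> \<and> c \<in> \<int> \<and> d \<in> \<int> \<and> e \<in> \<int> \<and> f \<in> \<int>}"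

lemma parabZ_I:
  "a * d - b * c = 1 \<Longrightarrow> a \<in> \<int> \<Longrightarrow> b \<in> \<int> \<Longrightarrow> c \<in> \<int> \<Longrightarrow> d \<in> \<int> \<Longrightarrow> e \<in> \<int> \<Longrightarrow> f \<in> \<int> \<Longrightarrow>
    parab a b c d e f \<in> parabZ"
  unfolding parabZ_def by blast

lemma parabZ_SL3Z: "parabZ \<subseteq> SL3Z"
proof
  fix \<beta> assume "\<beta> \<in> parabZ"
  then obtain a b c d e f where b: "\<beta> = parab a b c d e f" "a * d - b * c = 1"
    "a \<in> \<int>" "b \<in> \<int>" "c \<in> \<int>" "d \<in> \<int>" "e \<in> \<int>" "f \<in> \<int>" unfolding parabZ_def by blast
  have "\<beta> $ i $ j \<in> \<int>" for i j
    using exhaust_3[of i] exhaust_3[of j] b by auto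
  thus "\<beta> \<in> SL3Z" using b by (simp add: SL3Z_def det_parab)
qed

text \<open>The parabolic subgroup normalises its unipotent radical and acts on the coordinates (x1,
  x3) with determinant 1; e and f drop out because the radical is abelian.\<close>

lemma parab_unip3: "unip3 x1 0 x3 ** parab a b c d e f = parab a b c d e f ** unip3 (a * x1 - c * x3) 0 (d * x3 - b * x1)"
  if "a * d - b * c = 1"
proof -
  have "a * (d * x3 - b * x1) + b * (a * x1 - c * x3) = (a * d - b * c) * x3"
    "c * (d * x3 - b * x1) + d * (a * x1 - c * x3) = (a * d - b * c) * x1"
    by (simp_all add: algebra_simps)
  hence *: "a * (d * x3 - b * x1) + b * (a * x1 - c * x3) = x3"
    "c * (d * x3 - b * x1) + d * (a * x1 - c * x3) = x1" using that by simp_all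
  show ?thesis by (simp add: mat3_eq_iff matrix_mult_3 *)
qed

locale maass3 =
  fixes \<phi> :: "mat3 \<Rightarrow> complex"
  assumes maass: "maass_form_SL3 \<phi>"
begin

lemma cont: "continuous_on GL3 \<phi>"
  by (rule maass_form_continuous[OF maass])

lemma invariant: "\<gamma> \<in> SL3Z \<Longrightarrow> g \<in> GL3 \<Longrightarrow> \<phi> (\<gamma> ** g) = \<phi> g"
  using maass by (simp add: maass_form_SL3_def)

lemma spherical: "g \<in> GL3 \<Longrightarrow> orthogonal_matrix k \<Longrightarrow> r \<noteq> 0 \<Longrightarrow> \<phi> (r *\<^sub>R (g ** k)) = \<phi> g"
  using maass by (simp add: maass_form_SL3_def)

lemma continuous_on_mult_unip3:
  "continuous_on S f \<Longrightarrow> continuous_on S a \<Longrightarrow> continuous_on S b \<Longrightarrow> continuous_on S c \<Longrightarrow>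
   (\<And>z. z \<in> S \<Longrightarrow> f z \<in> GL3) \<Longrightarrow> continuous_on S (\<lambda>z. \<phi> (unip3 (a z) (b z) (c z) ** f z))"
proof (rule continuous_on_compose2[OF cont])
  assume a: "continuous_on S f" "continuous_on S a" "continuous_on S b" "continuous_on S c"
  show "continuous_on S (\<lambda>z. unip3 (a z) (b z) (c z) ** f z)"
  proof (rule continuous_on_mat3I)
    fix i j :: 3
    have u: "continuous_on S (\<lambda>z. unip3 (a z) (b z) (c z) $ i $ k)" for k
      using exhaust_3[of i] exhaust_3[of k] a by (auto simp: continuous_on_const)
    show "continuous_on S (\<lambda>z. (unip3 (a z) (b z) (c z) ** f z) $ i $ j)"
      unfolding matrix_mult_3 by (intro continuous_intros u a)
  qed
qed (auto intro: unip3_GL3)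

text \<open>The first variable is a function of the parameter, so that the lemma also yields
  continuity of the integrand of the outer integral.\<close>

lemma fc3_continuous_inner:
  assumes f: "continuous_on S f" "\<And>z. z \<in> S \<Longrightarrow> f z \<in> GL3" and a: "continuous_on S a"
  shows "continuous_on S (\<lambda>z. integral {0..1} (\<lambda>x3.
     \<phi> (unip3 (a z) 0 x3 ** f z) * e2pi (- (of_int m * of_real (a z) + of_int n * of_real x3))))"
proof -
  have fst: "continuous_on (S \<times> cbox 0 1) (\<lambda>z. h (fst z))" if "continuous_on S h" for h :: "'b::topological_space \<Rightarrow> 'c::topological_space" and S
    by (rule continuous_on_compose2[OF that]) (auto intro: continuous_intros)
  have "continuous_on S (\<lambda>z. integral (cbox 0 1) (\<lambda>x3.
     \<phi> (unip3 (a z) 0 x3 ** f z) * e2pi (- (of_int m * of_real (a z) + of_int n * of_real x3))))"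
  proof (rule integral_continuous_on_param)
    show "continuous_on (S \<times> cbox 0 1) (\<lambda>(z, x3). \<phi> (unip3 (a z) 0 x3 ** f z) *
        e2pi (- (of_int m * of_real (a z) + of_int n * of_real x3)))"
      unfolding split_beta'
      by (intro continuous_intros continuous_on_mult_unip3 fst f a) (use f in auto)
  qed
  thus ?thesis by simp
qed

lemma fc3_continuous:
  assumes f: "continuous_on S f" "\<And>z. z \<in> S \<Longrightarrow> f z \<in> GL3"
  shows "continuous_on S (\<lambda>z. fc3 \<phi> m n (f z))"
proof -
  have "continuous_on S (\<lambda>z. integral (cbox 0 1) (\<lambda>x1. integral {0..1} (\<lambda>x3.
     \<phi> (unip3 x1 0 x3 ** f z) * e2pi (- (of_int m * of_real x1 + of_int n * of_real x3)))))"
  proof (rule integral_continuous_on_param, unfold split_beta', rule fc3_continuous_inner)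
    show "continuous_on (S \<times> cbox 0 1) (\<lambda>z. f (fst z))"
      by (rule continuous_on_compose2[OF f(1)]) (auto intro: continuous_intros)
  qed (use f in \<open>auto intro: continuous_intros\<close>)
  thus ?thesis by (simp add: fc3_def)
qed

lemma fc3_spherical:
  assumes "g \<in> GL3" "orthogonal_matrix k" "r \<noteq> 0"
  shows "fc3 \<phi> m n (r *\<^sub>R (g ** k)) = fc3 \<phi> m n g"
proof -
  have "\<phi> (unip3 x1 0 x3 ** (r *\<^sub>R (g ** k))) = \<phi> (unip3 x1 0 x3 ** g)" for x1 x3
  proof -
    have "unip3 x1 0 x3 ** (r *\<^sub>R (g ** k)) = r *\<^sub>R ((unip3 x1 0 x3 ** g) ** k)"
      by (simp only: matrix_scaleR3 matrix_mul_assoc)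
    thus ?thesis using spherical[OF unip3_GL3[OF assms(1)] assms(2,3)] by simp
  qed
  thus ?thesis by (simp add: fc3_def)
qed

lemma periodic:
  assumes "g \<in> GL3"
  shows "\<phi> (unip3 (x1 + 1) 0 x3 ** g) = \<phi> (unip3 x1 0 x3 ** g)" "\<phi> (unip3 x1 0 (x3 + 1) ** g) = \<phi> (unip3 x1 0 x3 ** g)"
proof -
  have "unip3 (x1 + 1) 0 x3 ** g = unip3 (of_int 1) (of_int 0) (of_int 0) ** (unip3 x1 0 x3 ** g)"
    by (simp add: matrix_mul_assoc unip3_mult add.commute)
  moreover have "\<phi> (unip3 (of_int 1) (of_int 0) (of_int 0) ** (unip3 x1 0 x3 ** g)) = \<phi> (unip3 x1 0 x3 ** g)"
    by (rule invariant[OF unip3_SL3Z unip3_GL3[OF assms]])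
  ultimately show "\<phi> (unip3 (x1 + 1) 0 x3 ** g) = \<phi> (unip3 x1 0 x3 ** g)" by (simp only:)
  have "unip3 x1 0 (x3 + 1) ** g = unip3 (of_int 0) (of_int 0) (of_int 1) ** (unip3 x1 0 x3 ** g)"
    by (simp add: matrix_mul_assoc unip3_mult add.commute)
  moreover have "\<phi> (unip3 (of_int 0) (of_int 0) (of_int 1) ** (unip3 x1 0 x3 ** g)) = \<phi> (unip3 x1 0 x3 ** g)"
    by (rule invariant[OF unip3_SL3Z unip3_GL3[OF assms]])
  ultimately show "\<phi> (unip3 x1 0 (x3 + 1) ** g) = \<phi> (unip3 x1 0 x3 ** g)" by (simp only:)
qed

text \<open>Conjugation by the parabolic element is an automorphism of the torus of pairs (x1, x3)
  that carries the frequency (1, 0) to (d, c). Coefficients of different frequencies at one point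
  thus become values of the single function \<open>fc3 \<phi> 1 0\<close> at translates of that
  point, which links orbit sums to Bessel's inequality.\<close>

lemma fc3_parabZ:
  fixes a b c d e f :: int
  assumes g: "g \<in> GL3" and det: "a * d - b * c = 1"
  shows "fc3 \<phi> 1 0 (parab a b c d e f ** g) = fc3 \<phi> d c g"
proof -
  define k where "k x1 x3 = \<phi> (unip3 x1 0 x3 ** g) * e2pi (- (of_int d * of_real x1 + of_int c * of_real x3))" for x1 x3 :: real
  have rdet: "real_of_int a * d - real_of_int b * c = 1"
    using det by (metis of_int_1 of_int_diff of_int_mult)
  have "parab a b c d e f \<in> parabZ" by (intro parabZ_I rdet Ints_of_int)
  hence P: "parab a b c d e f \<in> SL3Z" using parabZ_SL3Z by blast
  have "\<phi> (unip3 x1 0 x3 ** (parab a b c d e f ** g)) * e2pi (- (of_int 1 * of_real x1 + of_int 0 * of_real x3))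
      = k (a * x1 + of_int (- c) * x3) (of_int (- b) * x1 + d * x3)" for x1 x3 :: real
  proof -
    have "unip3 x1 0 x3 ** (parab a b c d e f ** g) = parab a b c d e f ** (unip3 (a * x1 - c * x3) 0 (d * x3 - b * x1) ** g)"
      using parab_unip3[OF rdet] by (simp only: matrix_mul_assoc)
    hence 1: "\<phi> (unip3 x1 0 x3 ** (parab a b c d e f ** g)) = \<phi> (unip3 (a * x1 - c * x3) 0 (d * x3 - b * x1) ** g)"
      using invariant[OF P unip3_GL3[OF g]] by simp
    have "d * (a * x1 - c * x3) + c * (d * x3 - b * x1) = (real_of_int a * d - real_of_int b * c) * x1"
      by (simp add: algebra_simps)
    hence "x1 = d * (a * x1 - c * x3) + c * (d * x3 - b * x1)" using rdet by simp
    hence "complex_of_real x1 = of_int d * of_real (a * x1 - c * x3) + of_int c * of_real (d * x3 - b * x1)"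
      by (metis of_real_add of_real_mult of_real_of_int_eq)
    thus ?thesis using 1 by (simp add: k_def add.commute)
  qed
  hence "fc3 \<phi> 1 0 (parab a b c d e f ** g) = integral {0..1} (\<lambda>x1. integral {0..1} (\<lambda>x3.
      k (a * x1 + of_int (- c) * x3) (of_int (- b) * x1 + d * x3)))"
    unfolding fc3_def by simp
  also have "\<dots> = integral {0..1} (\<lambda>x1. integral {0..1} (\<lambda>x3. k x1 x3))"
  proof (rule torus_automorphism)
    show "continuous_on UNIV (\<lambda>(x, y). k x y)"
      unfolding k_def split_beta' by (intro continuous_intros continuous_on_mult_unip3 g)
    have e: "e2pi (z - of_int n) = e2pi z" for z n using e2pi_add_int[of z "- n"] by simp
    show "k (x + 1) y = k x y" for x y
    proof -
      have "- (of_int d * complex_of_real (x + 1) + of_int c * of_real y) =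
          - (of_int d * of_real x + of_int c * of_real y) - of_int d" by (simp add: algebra_simps)
      thus ?thesis unfolding k_def periodic(1)[OF g] by (simp only: e)
    qed
    show "k x (y + 1) = k x y" for x y
    proof -
      have "- (of_int d * complex_of_real x + of_int c * of_real (y + 1)) =
          - (of_int d * of_real x + of_int c * of_real y) - of_int c" by (simp add: algebra_simps)
      thus ?thesis unfolding k_def periodic(2)[OF g] by (simp only: e)
    qed
    show "a * d - - c * - b = 1" using det by (simp add: mult.commute)
  qed
  finally show ?thesis by (simp add: fc3_def k_def)
qed

lemma fc3_bessel:
  assumes "g \<in> GL3" "finite I"
  shows "(\<Sum>(m, n)\<in>I. (norm (fc3 \<phi> m n g))\<^sup>2) \<le>
    integral {0..1} (\<lambda>x1. integral {0..1} (\<lambda>x3. (norm (\<phi> (unip3 x1 0 x3 ** g)))\<^sup>2))"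
  unfolding fc3_def
proof (rule bessel_square[OF assms(2)])
  show "continuous_on UNIV (\<lambda>(x1, x3). \<phi> (unip3 x1 0 x3 ** g))"
    unfolding split_beta' by (intro continuous_intros continuous_on_mult_unip3 assms(1))
qed

text \<open>A translation multiplies the coefficient by a number of modulus 1. The integrand over
  the strip is therefore constant in x1 and x3.\<close>

lemma norm_fc3_unip3:
  assumes g: "g \<in> GL3"
  shows "norm (fc3 \<phi> 1 0 (unip3 s 0 t ** g)) = norm (fc3 \<phi> 1 0 g)"
proof -
  define k where "k x1 x3 = \<phi> (unip3 x1 0 x3 ** g) * e2pi (- of_real x1)" for x1 x3
  have k: "continuous_on UNIV (\<lambda>(x, y). k x y)"
    unfolding k_def split_beta' by (intro continuous_intros continuous_on_mult_unip3 g)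
  have kc: "continuous_on UNIV (\<lambda>y. k x y)" for x
    unfolding k_def by (intro continuous_intros continuous_on_mult_unip3 g)
  have k1: "k (x + 1) y = k x y" for x y
    using periodic(1)[OF g, of x y] e2pi_add_int[of "- of_real x" "-1"] by (simp add: k_def algebra_simps)
  have k2: "k x (y + 1) = k x y" for x y
    using periodic(2)[OF g, of x y] by (simp add: k_def)
  have "\<phi> (unip3 x1 0 x3 ** (unip3 s 0 t ** g)) * e2pi (- (of_int 1 * of_real x1 + of_int 0 * of_real x3)) =
      e2pi (of_real s) * k (x1 + s) (x3 + t)" for x1 x3
  proof -
    have "e2pi (- of_real x1) = e2pi (of_real s) * e2pi (- of_real (x1 + s))"
      by (simp flip: e2pi_add)
    thus ?thesis by (simp add: k_def matrix_mul_assoc unip3_mult)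
  qed
  hence "fc3 \<phi> 1 0 (unip3 s 0 t ** g) = e2pi (of_real s) * integral {0..1} (\<lambda>x1. integral {0..1} (\<lambda>x3. k (x1 + s) (x3 + t)))"
    by (simp add: fc3_def)
  also have "integral {0..1} (\<lambda>x1. integral {0..1} (\<lambda>x3. k (x1 + s) (x3 + t))) =
      integral {0..1} (\<lambda>x1. integral {0..1} (\<lambda>x3. k (x1 + s) x3))"
    by (subst integral_periodic_shift[OF kc]) (auto simp: k2)
  also have "\<dots> = integral {0..1} (\<lambda>x1. integral {0..1} (\<lambda>x3. k x1 x3))"
  proof (rule integral_periodic_shift[of "\<lambda>x1. integral {0..1} (\<lambda>x3. k x1 x3)"])
    have "continuous_on UNIV (\<lambda>x1. integral (cbox 0 1) (\<lambda>x3. k x1 x3))"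
      by (rule integral_continuous_on_param) (rule continuous_on_subset[OF k subset_UNIV])
    thus "continuous_on UNIV (\<lambda>x1. integral {0..1} (\<lambda>x3. k x1 x3))" by simp
  qed (simp add: k1)
  also have "\<dots> = fc3 \<phi> 1 0 g" by (simp add: fc3_def k_def)
  finally show ?thesis by (simp add: norm_mult)
qed

text \<open>As \<open>unip3 x1 x2 x3\<close> factors into
  \<open>unip3 x1 0 x3 ** unip3 0 x2 0\<close>, the mode (1, n) is the n-th Fourier coefficient in
  x2 of \<open>fc3 \<phi> 1 0\<close>, once the integrals over x1 and x2 are interchanged.\<close>

lemma fourier_mode3_bessel:
  assumes g: "g \<in> GL3" and "finite I"
  shows "(\<Sum>n\<in>I. (norm (fourier_mode3 \<phi> 1 n g))\<^sup>2) \<le> integral {0..1} (\<lambda>x2. (norm (fc3 \<phi> 1 0 (unip3 0 x2 0 ** g)))\<^sup>2)"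
proof -
  have mode: "fourier_mode3 \<phi> 1 n g = integral {0..1} (\<lambda>x2. fc3 \<phi> 1 0 (unip3 0 x2 0 ** g) * e2pi (- (of_int (int n) * of_real x2)))" for n
  proof -
    define K where "K x1 x2 = integral {0..1} (\<lambda>x3. \<phi> (unip3 x1 0 x3 ** (unip3 0 x2 0 ** g)) * e2pi (- (of_int 1 * of_real x1 + of_int 0 * of_real x3)))" for x1 x2
    have inner: "integral {0..1} (\<lambda>x3. \<phi> (unip3 x1 x2 x3 ** g) * e2pi (- of_real (real 1 * x1 + real n * x2)))
        = K x1 x2 * e2pi (- (of_int (int n) * of_real x2))" for x1 x2
    proof -
      have "\<phi> (unip3 x1 x2 x3 ** g) * e2pi (- of_real (real 1 * x1 + real n * x2)) =
        (\<phi> (unip3 x1 0 x3 ** (unip3 0 x2 0 ** g)) * e2pi (- (of_int 1 * of_real x1 + of_int 0 * of_real x3))) *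
          e2pi (- (of_int (int n) * of_real x2))" for x3
        by (simp add: matrix_mul_assoc unip3_mult mult.assoc flip: e2pi_add)
      thus ?thesis by (simp add: K_def)
    qed
    have ug: "continuous_on S (\<lambda>z. unip3 0 (h z) 0 ** g)" if "continuous_on S h" for S and h :: "real \<times> real \<Rightarrow> real"
    proof (rule continuous_on_mat3I)
      fix i j :: 3
      have u: "continuous_on S (\<lambda>z. unip3 0 (h z) 0 $ i $ k)" for k
        using exhaust_3[of i] exhaust_3[of k] that by (auto simp: continuous_on_const)
      show "continuous_on S (\<lambda>z. (unip3 0 (h z) 0 ** g) $ i $ j)"
        unfolding matrix_mult_3 by (intro continuous_intros u)
    qed
    have K: "continuous_on UNIV (\<lambda>(x1, x2). K x1 x2 * e2pi (- (of_int (int n) * of_real x2)))"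
      unfolding K_def split_beta'
      by (intro continuous_intros fc3_continuous_inner ug unip3_GL3 g)
    have "fourier_mode3 \<phi> 1 n g = integral {0..1} (\<lambda>x1. integral {0..1} (\<lambda>x2. K x1 x2 * e2pi (- (of_int (int n) * of_real x2))))"
      unfolding fourier_mode3_def inner ..
    also have "\<dots> = integral {0..1} (\<lambda>x2. integral {0..1} (\<lambda>x1. K x1 x2 * e2pi (- (of_int (int n) * of_real x2))))"
      by (rule integral_square_swap[OF K])
    finally show ?thesis by (simp add: fc3_def K_def)
  qed
  have inj: "inj_on int I" by simp
  have "(\<Sum>n\<in>int ` I. (norm (integral {0..1} (\<lambda>x2. fc3 \<phi> 1 0 (unip3 0 x2 0 ** g) * e2pi (- (of_int n * of_real x2)))))\<^sup>2)
     \<le> integral {0..1} (\<lambda>x2. (norm (fc3 \<phi> 1 0 (unip3 0 x2 0 ** g)))\<^sup>2)"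
  proof (rule bessel_interval)
    show "continuous_on {0..1} (\<lambda>x2. fc3 \<phi> 1 0 (unip3 0 x2 0 ** g))"
    proof (rule fc3_continuous)
      show "continuous_on {0..1} (\<lambda>x2. unip3 0 x2 0 ** g)"
      proof (rule continuous_on_mat3I)
        fix i j :: 3
        have u: "continuous_on {0..1} (\<lambda>x. unip3 0 x 0 $ i $ k)" for k
          using exhaust_3[of i] exhaust_3[of k] by (auto simp: continuous_on_const continuous_on_id)
        show "continuous_on {0..1} (\<lambda>z. (unip3 0 z 0 ** g) $ i $ j)"
          unfolding matrix_mult_3 by (intro continuous_intros u)
      qed
    qed (rule unip3_GL3[OF g])
  qed (use assms(2) in simp)
  thus ?thesis by (simp only: sum.reindex[OF inj] o_def mode)
qed

end

section \<open>Integration over a strip near the boundary\<close>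

lemma nn_integral_count_space_finite_le:
  fixes f :: "'a \<Rightarrow> ennreal"
  assumes A: "countable A" and le: "\<And>X. finite X \<Longrightarrow> X \<subseteq> A \<Longrightarrow> sum f X \<le> b"
  shows "(\<integral>\<^sup>+x. f x \<partial>count_space A) \<le> b"
proof -
  define g where "g i = (if i \<in> to_nat_on A ` A then f (from_nat_into A i) else 0)" for i
  have inj: "inj_on (to_nat_on A) A" using A by (rule inj_on_to_nat_on)
  have "(\<integral>\<^sup>+x. f x \<partial>count_space A) = (\<integral>\<^sup>+x. g (to_nat_on A x) \<partial>count_space A)"
    by (intro nn_integral_cong) (simp add: g_def A from_nat_into_to_nat_on)
  also have "\<dots> = (\<integral>\<^sup>+i. g i \<partial>count_space (to_nat_on A ` A))"
    by (rule nn_integral_bij_count_space) (use inj in \<open>simp add: bij_betw_def\<close>)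
  also have "\<dots> = (\<integral>\<^sup>+i. g i * indicator (to_nat_on A ` A) i \<partial>count_space UNIV)"
    by (rule nn_integral_count_space_indicator) auto
  also have "\<dots> = (\<integral>\<^sup>+i. g i \<partial>count_space UNIV)"
    by (intro nn_integral_cong) (auto simp: g_def)
  also have "\<dots> = (\<Sum>i. g i)" by (rule nn_integral_count_space_nat)
  also have "\<dots> = (SUP n. sum g {..<n})" by (rule suminf_eq_SUP)
  also have "\<dots> \<le> b"
  proof (rule SUP_least)
    fix n
    define X where "X = {x \<in> A. to_nat_on A x < n}"
    have injX: "inj_on (to_nat_on A) X" by (rule inj_on_subset[OF inj]) (auto simp: X_def)
    have finX: "finite X" by (rule finite_imageD[OF _ injX]) (rule finite_subset[of _ "{..<n}"], auto simp: X_def)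
    have "sum g {..<n} = sum g (to_nat_on A ` X)"
      by (rule sum.mono_neutral_right) (auto simp: g_def X_def)
    also have "\<dots> = sum (\<lambda>x. g (to_nat_on A x)) X" by (simp add: sum.reindex[OF injX])
    also have "\<dots> = sum f X" by (intro sum.cong refl) (auto simp: g_def X_def A)
    also have "\<dots> \<le> b" by (rule le[OF finX]) (auto simp: X_def)
    finally show "sum g {..<n} \<le> b" .
  qed
  finally show ?thesis .
qed

text \<open>The closed version is used for Bessel's inequality in the orbit sum, the half-open one
  for the strip.\<close>

lemma ennreal_integral_unit_interval:
  fixes k :: "real \<Rightarrow> real"
  assumes "continuous_on {0..1} k" "\<And>x. k x \<ge> 0"
  shows "ennreal (integral {0..1} k) = (\<integral>\<^sup>+x. indicator {0..1} x * ennreal (k x) \<partial>lborel)"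
    and "ennreal (integral {0..1} k) = (\<integral>\<^sup>+x. indicator {0..<1} x * ennreal (k x) \<partial>lborel)"
proof -
  let ?f = "\<lambda>x. indicator {0..1} x *\<^sub>R k x"
  have m: "?f \<in> borel_measurable borel"
    using assms(1) by (intro borel_measurable_continuous_on_indicator) auto
  have "(k has_integral integral {0..1} k) {0..1}"
    using assms(1) by (intro integrable_integral integrable_continuous_real)
  hence "((\<lambda>x. if x \<in> {0..1} then k x else 0) has_integral integral {0..1} k) UNIV"
    by (simp only: has_integral_restrict_UNIV)
  also have "(\<lambda>x. if x \<in> {0..1} then k x else 0) = ?f" by (auto simp: indicator_def)
  finally have "integral\<^sup>N lborel ?f = ennreal (integral {0..1} k)"
    using assms(2) by (intro nn_integral_has_integral_lborel m) auto
  moreover have "ennreal (?f x) = indicator {0..1} x * ennreal (k x)" for x by (auto simp: indicator_def)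
  ultimately show 1: "ennreal (integral {0..1} k) = (\<integral>\<^sup>+x. indicator {0..1} x * ennreal (k x) \<partial>lborel)" by simp
  show "ennreal (integral {0..1} k) = (\<integral>\<^sup>+x. indicator {0..<1} x * ennreal (k x) \<partial>lborel)"
    unfolding 1
  proof (rule nn_integral_cong_AE)
    show "AE x in lborel. indicator {0..1} x * ennreal (k x) = indicator {0..<1} x * ennreal (k x)"
      using AE_lborel_singleton[of "1::real"] by eventually_elim (auto simp: indicator_def)
  qed
qed

lemma sigma_finite_haar3: "sigma_finite_measure haar3"
  unfolding haar3_def
  by (subst sigma_finite_measure.sigma_finite_iff_density_finite[OF sigma_finite_lborel])
     (auto simp: split_beta' indicator_def ennreal_mult_eq_top_iff)

text \<open>One period in each of x1, x2, x3, half-open so that two different translates of a point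
  by integral unipotent matrices cannot both lie in it. The corner (\<alpha>, \<beta>) and the ratio
  \<rho> will come from a region where the Whittaker function stays away from 0.\<close>

definition strip3 :: "real \<Rightarrow> real \<Rightarrow> real \<Rightarrow> real \<Rightarrow> coords3 set" where
  "strip3 \<alpha> \<beta> \<rho> N = {(x1, x2, x3, y1, y2). 0 \<le> x1 \<and> x1 < 1 \<and> 0 \<le> x2 \<and> x2 < 1 \<and> 0 \<le> x3 \<and> x3 < 1 \<and>
     \<alpha> \<le> y1 \<and> y1 \<le> \<alpha> * \<rho> \<and> \<beta> / N \<le> y2 \<and> y2 \<le> \<beta> * \<rho> / N}"

lemma strip3_iff: "(x1, x2, x3, y1, y2) \<in> strip3 \<alpha> \<beta> \<rho> N \<longleftrightarrow> 0 \<le> x1 \<and> x1 < 1 \<and> 0 \<le> x2 \<and> x2 < 1 \<and> 0 \<le> x3 \<and> x3 < 1 \<and>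
     \<alpha> \<le> y1 \<and> y1 \<le> \<alpha> * \<rho> \<and> \<beta> / N \<le> y2 \<and> y2 \<le> \<beta> * \<rho> / N"
  by (simp add: strip3_def)

lemma strip3_borel [measurable]: "strip3 \<alpha> \<beta> \<rho> N \<in> sets borel"
  unfolding strip3_def split_beta' by measurable

text \<open>A period box in x1 and x3 inside the Siegel set; translating it by
  \<open>unip3 s 0 t\<close> with s, t in [0,1] does not leave \<open>siegel3\<close>.\<close>

definition core3 :: "real \<Rightarrow> real \<Rightarrow> real \<Rightarrow> coords3 set" where
  "core3 Y t T = siegel3 Y t T \<inter> {(x1, x2, x3, y1, y2). 0 \<le> x1 \<and> x1 < 1 \<and> 0 \<le> x3 \<and> x3 < 1}"

lemma core3_borel [measurable]: "core3 Y t T \<in> sets borel"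
  unfolding core3_def split_beta' by measurable

lemma core3_subset: "core3 Y t T \<subseteq> half_space3"
  using siegel3_subset by (auto simp: core3_def)

text \<open>Reduce z = x2 + i y2 by SL(2,Z), then x1 and x3 by integers. The product y1^2 y2 is
  unchanged, and multiplying the ranges of y1 and y2 gives its window. The new height is at most 1 /
  y2 \<le> N / \<beta> if c is nonzero and equals y2 otherwise, which explains 1 / \<beta> + \<beta>
  \<rho>.\<close>

lemma strip3_covered:
  assumes pos: "\<alpha> > 0" "\<beta> > 0" "\<rho> > 1" "N \<ge> 1" and p: "p \<in> strip3 \<alpha> \<beta> \<rho> N"
  shows "\<exists>\<gamma>\<in>parabZ. \<exists>q\<in>core3 ((1 / \<beta> + \<beta> * \<rho>) * N) (\<alpha>\<^sup>2 * \<beta> / N) (\<alpha>\<^sup>2 * \<beta> * \<rho> ^ 3 / N). p = act \<gamma> q"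
proof -
  obtain x1 x2 x3 y1 y2 where p_eq: "p = (x1, x2, x3, y1, y2)" by (cases p)
  note P = p[unfolded p_eq strip3_iff]
  have bN: "\<beta> / N > 0" using pos by simp
  have y: "y1 > 0" "y2 > 0" using P pos bN by linarith+
  obtain a b c d :: int where det: "a * d - b * c = 1" and
    r: "\<bar>((a * x2 + b) * (c * x2 + d) + real_of_int a * real_of_int c * y2\<^sup>2) / ((c * x2 + d)\<^sup>2 + (c * y2)\<^sup>2)\<bar> \<le> 1 / 2"
    "1 \<le> (((a * x2 + b) * (c * x2 + d) + real_of_int a * real_of_int c * y2\<^sup>2) / ((c * x2 + d)\<^sup>2 + (c * y2)\<^sup>2))\<^sup>2
      + (y2 / ((c * x2 + d)\<^sup>2 + (c * y2)\<^sup>2))\<^sup>2"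
    by (rule SL2Z_reduction[OF y(2)])
  have rdet: "real_of_int a * d - real_of_int b * c = 1"
    using det by (metis of_int_1 of_int_diff of_int_mult)
  define S where "S = (c * x2 + d)\<^sup>2 + (c * y2)\<^sup>2"
  define u where "u = ((a * x2 + b) * (c * x2 + d) + real_of_int a * real_of_int c * y2\<^sup>2) / S"
  define e f where "e = - \<lfloor>a * x3 + b * x1\<rfloor>" and "f = - \<lfloor>c * x3 + d * x1\<rfloor>"
  have act: "act (parab a b c d e f) p = (c * x3 + d * x1 + f, u, a * x3 + b * x1 + e, sqrt S * y1, y2 / S)"
    unfolding p_eq u_def S_def by (rule act_parab(1)[OF y rdet])
  have S: "S > 0" unfolding S_def by (rule act_parab(2)[OF y rdet])
  have ef: "0 \<le> c * x3 + d * x1 + f" "c * x3 + d * x1 + f < 1" "0 \<le> a * x3 + b * x1 + e" "a * x3 + b * x1 + e < 1"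
    unfolding e_def f_def by linarith+
  have u: "\<bar>u\<bar> \<le> 1 / 2" "1 \<le> u\<^sup>2 + (y2 / S)\<^sup>2" using r unfolding u_def S_def by blast+
  have height: "y2 / S \<le> (1 / \<beta> + \<beta> * \<rho>) * N"
  proof (cases "c = 0")
    case True
    hence "a * d = 1" using det by simp
    hence "d * d = 1" by (auto simp: zmult_eq_1_iff)
    hence "S = 1" using True by (simp add: S_def power2_eq_square flip: of_int_mult)
    hence "y2 / S \<le> \<beta> * \<rho> / N" using P by simp
    also have "\<dots> \<le> \<beta> * \<rho> * 1" using pos by (simp add: field_simps)
    also have "\<dots> \<le> \<beta> * \<rho> * N" using pos by (intro mult_left_mono) auto
    also have "\<dots> \<le> (1 / \<beta> + \<beta> * \<rho>) * N" using pos by (simp add: algebra_simps)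
    finally show ?thesis .
  next
    case False
    hence "1 \<le> \<bar>c\<bar>" by simp
    hence "1 * 1 \<le> \<bar>c\<bar> * \<bar>c\<bar>" by (intro mult_mono) auto
    hence "1 \<le> c * c" by simp
    hence "1 \<le> real_of_int c * real_of_int c" by (metis of_int_1_le_iff of_int_mult)
    hence "1 * y2\<^sup>2 \<le> (real_of_int c * real_of_int c) * y2\<^sup>2" by (intro mult_right_mono) auto
    hence "y2\<^sup>2 \<le> (c * y2)\<^sup>2" by (simp add: power2_eq_square mult_ac)
    also have "\<dots> \<le> S" by (simp add: S_def)
    finally have "y2 / S \<le> y2 / y2\<^sup>2" using y S by (intro divide_left_mono mult_pos_pos) auto
    also have "\<dots> = 1 / y2" using y by (simp add: power2_eq_square)
    also have "\<dots> \<le> 1 / (\<beta> / N)" using P by (intro divide_left_mono mult_pos_pos bN y) auto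
    also have "\<dots> \<le> (1 / \<beta> + \<beta> * \<rho>) * N" using pos by (simp add: algebra_simps)
    finally show ?thesis .
  qed
  have t: "(sqrt S * y1)\<^sup>2 * (y2 / S) = y1\<^sup>2 * y2" using S by (simp add: power_mult_distrib)
  have "\<alpha>\<^sup>2 * (\<beta> / N) \<le> y1\<^sup>2 * y2" using P pos bN by (intro mult_mono power_mono) auto
  moreover have "y1\<^sup>2 * y2 \<le> (\<alpha> * \<rho>)\<^sup>2 * (\<beta> * \<rho> / N)" using P pos y by (intro mult_mono power_mono) auto
  ultimately have "\<alpha>\<^sup>2 * \<beta> / N \<le> y1\<^sup>2 * y2" "y1\<^sup>2 * y2 \<le> \<alpha>\<^sup>2 * \<beta> * \<rho> ^ 3 / N"
    by (simp_all add: power2_eq_square power3_eq_cube mult_ac)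
  hence q: "act (parab a b c d e f) p \<in> core3 ((1 / \<beta> + \<beta> * \<rho>) * N) (\<alpha>\<^sup>2 * \<beta> / N) (\<alpha>\<^sup>2 * \<beta> * \<rho> ^ 3 / N)"
    unfolding act core3_def siegel3_iff Int_iff mem_Collect_eq prod.case t using ef u height S y by auto
  \<comment> \<open>The explicit inverse of the reducing matrix, since p is wanted as a translate of
    the reduced point.\<close>
  define \<gamma> where "\<gamma> = parab d (- b) (- c) a (- (d * e - b * f)) (- (a * f - c * e))"
  have "\<gamma> \<in> parabZ" unfolding \<gamma>_def
    by (intro parabZ_I) (use rdet in \<open>simp_all add: mult.commute\<close>)
  have "\<gamma> ** parab a b c d e f = mat 1"
    using rdet unfolding \<gamma>_def by (simp add: mat3_eq_iff matrix_mult_3 mat_def algebra_simps)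
  moreover have ph: "p \<in> half_space3" using y by (simp add: p_eq half_space3_def)
  moreover have "det (parab a b c d e f) \<noteq> 0" using rdet by (simp add: det_parab)
  ultimately have "act \<gamma> (act (parab a b c d e f) p) = p"
    using act_mult[of "parab a b c d e f" p \<gamma>] act_1[OF ph] by simp
  thus ?thesis using q \<open>\<gamma> \<in> parabZ\<close> by metis
qed

lemma parabZ_cases:
  assumes "\<beta> \<in> parabZ"
  obtains a b c d e f :: int where "\<beta> = parab a b c d e f" "a * d - b * c = 1"
proof -
  from assms obtain a b c d e f where b: "\<beta> = parab a b c d e f" "a * d - b * c = 1"
    "a \<in> \<int>" "b \<in> \<int>" "c \<in> \<int>" "d \<in> \<int>" "e \<in> \<int>" "f \<in> \<int>" unfolding parabZ_def by blast
  from b(3-8) obtain a' b' c' d' e' f' :: int where i: "a = a'" "b = b'" "c = c'" "d = d'" "e = e'" "f = f'"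
    by (auto elim!: Ints_cases)
  have "real_of_int (a' * d' - b' * c') = 1" using b(2) by (simp add: i)
  hence "a' * d' - b' * c' = 1" by linarith
  with b(1) i that show ?thesis by blast
qed

text \<open>Elements with the same lower row differ by an integral unipotent factor on the left,
  which shifts x2 and then x1, x3 of the image by integers; two points of a half-open strip allow
  only the shift 0.\<close>

lemma strip3_parab_inj:
  fixes a b c d e f a' b' e' f' :: int
  assumes q: "q \<in> half_space3" and det: "a * d - b * c = 1" "a' * d - b' * c = 1"
    and s: "act (parab a b c d e f) q \<in> strip3 \<alpha> \<beta> \<rho> N" "act (parab a' b' c d e' f') q \<in> strip3 \<alpha> \<beta> \<rho> N"
  shows "a = a' \<and> b = b' \<and> e = e' \<and> f = f'"
proof -
  obtain x1 x2 x3 y1 y2 where q_eq: "q = (x1, x2, x3, y1, y2)" and y: "y1 > 0" "y2 > 0"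
    using half_space3_cases[OF q] .
  have rdet: "real_of_int a * d - real_of_int b * c = 1" "real_of_int a' * d - real_of_int b' * c = 1"
    using det by (metis of_int_1 of_int_diff of_int_mult)+
  define S where "S = (c * x2 + d)\<^sup>2 + (c * y2)\<^sup>2"
  have S: "S > 0" unfolding S_def by (rule act_parab(2)[OF y rdet(1)])
  define X where "X a b = ((a * x2 + b) * (c * x2 + d) + a * real_of_int c * y2\<^sup>2) / S" for a b :: real
  have act: "act (parab a b c d e f) q = (c * x3 + d * x1 + f, X a b, a * x3 + b * x1 + e, sqrt S * y1, y2 / S)"
    "act (parab a' b' c d e' f') q = (c * x3 + d * x1 + f', X a' b', a' * x3 + b' * x1 + e', sqrt S * y1, y2 / S)"
    unfolding q_eq X_def S_def by (rule act_parab(1)[OF y rdet(1)], rule act_parab(1)[OF y rdet(2)])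
  note s' = s[unfolded act strip3_iff]
  \<comment> \<open>The integer with (a', b') = (a, b) + n (c, d).\<close>
  define n where "n = a * b' - a' * b"
  have "a + n * c = a + a * (b' * c) - a' * (b * c)" by (simp add: n_def algebra_simps)
  also have "b' * c = a' * d - 1" using det by simp
  also have "b * c = a * d - 1" using det by simp
  finally have na: "a' = a + n * c" by (simp add: algebra_simps)
  have "b + n * d = b + (a * d) * b' - (a' * d) * b" by (simp add: n_def algebra_simps)
  also have "a * d = 1 + b * c" using det by simp
  also have "a' * d = 1 + b' * c" using det by simp
  finally have nb: "b' = b + n * d" by (simp add: algebra_simps)
  have "(a' * x2 + b') * (c * x2 + d) + real_of_int a' * c * y2\<^sup>2 =
      (a * x2 + b) * (c * x2 + d) + real_of_int a * c * y2\<^sup>2 + n * S"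
    by (simp add: na nb S_def power2_eq_square algebra_simps)
  hence "X a' b' = X a b + n" using S by (simp add: X_def add_divide_distrib)
  hence "\<bar>real_of_int n\<bar> < 1" using s' by linarith
  hence "n = 0" by linarith
  hence ab: "a = a'" "b = b'" using na nb by auto
  have "\<bar>real_of_int (e - e')\<bar> < 1" "\<bar>real_of_int (f - f')\<bar> < 1" using s' ab by auto
  hence "e = e'" "f = f'" by linarith+
  with ab show ?thesis by simp
qed

context maass3
begin

definition fc3_sq :: "coords3 \<Rightarrow> ennreal" where
  "fc3_sq p = indicator half_space3 p * ennreal ((norm (fc3 \<phi> 1 0 (iwasawa p)))\<^sup>2)"

lemma measurable_fc3_sq [measurable]: "fc3_sq \<in> borel_measurable borel"
proof -
  have "continuous_on half_space3 (\<lambda>p. (norm (fc3 \<phi> 1 0 (iwasawa p)))\<^sup>2)"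
    by (intro continuous_intros fc3_continuous continuous_on_iwasawa iwasawa_in_GL3)
  hence "(\<lambda>p. indicator half_space3 p *\<^sub>R (norm (fc3 \<phi> 1 0 (iwasawa p)))\<^sup>2) \<in> borel_measurable borel"
    using open_half_space3 by (intro borel_measurable_continuous_on_indicator) auto
  hence "(\<lambda>p. ennreal (indicator half_space3 p *\<^sub>R (norm (fc3 \<phi> 1 0 (iwasawa p)))\<^sup>2)) \<in> borel_measurable borel"
    by simp
  also have "(\<lambda>p. ennreal (indicator half_space3 p *\<^sub>R (norm (fc3 \<phi> 1 0 (iwasawa p)))\<^sup>2)) = fc3_sq"
    by (auto simp: fc3_sq_def indicator_def)
  finally show ?thesis .
qed

lemma measurable_norm_sq3' [measurable]: "norm_sq3 \<phi> \<in> borel_measurable borel"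
  by (rule measurable_norm_sq3[OF cont])

lemma unip3_iwasawa:
  assumes "q \<in> half_space3"
  shows "unip3 a b c ** iwasawa q = iwasawa (act (unip3 a b c) q)"
proof -
  obtain x1 x2 x3 y1 y2 where q: "q = (x1, x2, x3, y1, y2)" "y1 > 0" "y2 > 0" using half_space3_cases[OF assms] .
  show ?thesis by (simp add: q act_unip3 mat3_eq_iff matrix_mult_3 algebra_simps)
qed

text \<open>The elements of \<open>parabZ\<close> moving \<open>q\<close> into the strip have distinct lower rows \<open>(c, d)\<close>, and \<open>fc3 \<phi> 1 0\<close> at
  the translate is the coefficient of \<open>\<phi>\<close> at \<open>q\<close> of a frequency determined by that row: the sum is
  bounded by Bessel's inequality.\<close>

lemma fc3_sq_orbit_sum:
  assumes q: "q \<in> half_space3"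
  shows "(\<integral>\<^sup>+\<beta>. indicator (strip3 \<alpha> b \<rho> N) (act \<beta> q) * fc3_sq (act \<beta> q) \<partial>count_space parabZ) \<le>
    (\<integral>\<^sup>+s. \<integral>\<^sup>+t. indicator {0..1} s * (indicator {0..1} t * norm_sq3 \<phi> (act (unip3 s 0 t) q)) \<partial>lborel \<partial>lborel)"
proof (rule nn_integral_count_space_finite_le)
  show "countable parabZ" by (rule countable_subset[OF parabZ_SL3Z countable_SL3Z])
next
  fix X assume X: "finite X" "X \<subseteq> parabZ"
  let ?S = "strip3 \<alpha> b \<rho> N"
  define D where "D = {\<beta>\<in>X. act \<beta> q \<in> ?S}"
  have finD: "finite D" using X by (simp add: D_def)
  \<comment> \<open>The frequency (d, c) that \<open>fc3_parabZ\<close> attaches to \<beta>; the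
    floors merely turn integral reals into integers.\<close>
  define \<pi> where "\<pi> \<beta> = (\<lfloor>\<beta> $ 2 $ 2\<rfloor>, \<lfloor>\<beta> $ 2 $ 1\<rfloor>)" for \<beta> :: mat3
  have g: "iwasawa q \<in> GL3" by (rule iwasawa_in_GL3[OF q])
  have inj: "inj_on \<pi> D"
  proof (rule inj_onI)
    fix \<beta> \<beta>' assume bb: "\<beta> \<in> D" "\<beta>' \<in> D" "\<pi> \<beta> = \<pi> \<beta>'"
    have "\<beta> \<in> parabZ" "\<beta>' \<in> parabZ" using bb X by (auto simp: D_def)
    then obtain a b c d e f a' b' c' d' e' f' :: int where
      1: "\<beta> = parab a b c d e f" "a * d - b * c = 1" and 2: "\<beta>' = parab a' b' c' d' e' f'" "a' * d' - b' * c' = 1"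
      by (elim parabZ_cases) blast
    have cd: "c' = c" "d' = d" using bb(3) by (simp_all add: \<pi>_def 1 2)
    show "\<beta> = \<beta>'"
      using strip3_parab_inj[OF q 1(2) 2(2)[unfolded cd], of e f \<alpha> _ \<rho> N e' f'] bb(1,2)
      unfolding D_def 1 2 cd by auto
  qed
  have val: "fc3_sq (act \<beta> q) = ennreal (case \<pi> \<beta> of (m, n) \<Rightarrow> (norm (fc3 \<phi> m n (iwasawa q)))\<^sup>2)" if "\<beta> \<in> D" for \<beta>
  proof -
    have "\<beta> \<in> parabZ" using that X by (auto simp: D_def)
    then obtain a b c d e f :: int where 1: "\<beta> = parab a b c d e f" "a * d - b * c = 1" by (rule parabZ_cases)
    have rdet: "real_of_int a * d - real_of_int b * c = 1" using 1(2) by (metis of_int_1 of_int_diff of_int_mult)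
    have d: "det \<beta> \<noteq> 0" using rdet by (simp add: 1 det_parab)
    have h: "act \<beta> q \<in> half_space3" by (rule act_half_space3[OF d q])
    obtain k r where kr: "orthogonal_matrix k" "r > 0" "\<beta> ** iwasawa q = r *\<^sub>R (iwasawa (act \<beta> q) ** k)"
      using act_decomposition[OF d q] by blast
    have "fc3 \<phi> 1 0 (iwasawa (act \<beta> q)) = fc3 \<phi> 1 0 (\<beta> ** iwasawa q)"
      unfolding kr(3) using kr by (intro fc3_spherical[symmetric] iwasawa_in_GL3[OF h]) auto
    also have "\<dots> = fc3 \<phi> d c (iwasawa q)" unfolding 1(1) by (rule fc3_parabZ[OF g 1(2)])
    finally show ?thesis using h by (simp add: fc3_sq_def \<pi>_def 1)
  qed
  have "(\<Sum>\<beta>\<in>X. indicator ?S (act \<beta> q) * fc3_sq (act \<beta> q)) = (\<Sum>\<beta>\<in>D. fc3_sq (act \<beta> q))"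
  proof -
    have "(\<Sum>\<beta>\<in>X. indicator ?S (act \<beta> q) * fc3_sq (act \<beta> q)) = (\<Sum>\<beta>\<in>D. indicator ?S (act \<beta> q) * fc3_sq (act \<beta> q))"
      using X(1) by (intro sum.mono_neutral_right) (auto simp: D_def)
    also have "\<dots> = (\<Sum>\<beta>\<in>D. fc3_sq (act \<beta> q))" by (intro sum.cong refl) (simp add: D_def)
    finally show ?thesis .
  qed
  also have "\<dots> = (\<Sum>\<beta>\<in>D. ennreal (case \<pi> \<beta> of (m, n) \<Rightarrow> (norm (fc3 \<phi> m n (iwasawa q)))\<^sup>2))"
    by (intro sum.cong refl val)
  also have "\<dots> = ennreal (\<Sum>\<beta>\<in>D. case \<pi> \<beta> of (m, n) \<Rightarrow> (norm (fc3 \<phi> m n (iwasawa q)))\<^sup>2)"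
    by (rule sum_ennreal) (auto split: prod.split)
  also have "(\<Sum>\<beta>\<in>D. case \<pi> \<beta> of (m, n) \<Rightarrow> (norm (fc3 \<phi> m n (iwasawa q)))\<^sup>2) =
     (\<Sum>(m, n)\<in>\<pi> ` D. (norm (fc3 \<phi> m n (iwasawa q)))\<^sup>2)"
    by (simp add: sum.reindex[OF inj])
  also have "ennreal \<dots> \<le> ennreal (integral {0..1} (\<lambda>s. integral {0..1} (\<lambda>t. (norm (\<phi> (unip3 s 0 t ** iwasawa q)))\<^sup>2)))"
    by (intro ennreal_leI fc3_bessel g finite_imageI finD)
  also have "\<dots> = (\<integral>\<^sup>+s. \<integral>\<^sup>+t. indicator {0..1} s * (indicator {0..1} t * norm_sq3 \<phi> (act (unip3 s 0 t) q)) \<partial>lborel \<partial>lborel)"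
  proof -
    let ?k = "\<lambda>s t. (norm (\<phi> (unip3 s 0 t ** iwasawa q)))\<^sup>2"
    have c: "continuous_on S (\<lambda>z. ?k (h1 z) (h2 z))" if "continuous_on S h1" "continuous_on S h2" for S and h1 h2 :: "'z::topological_space \<Rightarrow> real"
      by (intro continuous_intros continuous_on_mult_unip3 that) (use g in auto)
    have "continuous_on {0..1} (\<lambda>s. integral (cbox 0 1) (?k s))"
      by (rule integral_continuous_on_param) (unfold split_beta', intro continuous_intros continuous_on_mult_unip3, use g in auto)
    hence cs: "continuous_on {0..1} (\<lambda>s. integral {0..1} (?k s))" by simp
    have ct: "continuous_on {0..1} (?k s)" for s
      by (intro continuous_intros continuous_on_mult_unip3) (use g in auto)
    have nn: "integral {0..1} (?k s) \<ge> 0" for s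
      by (rule Henstock_Kurzweil_Integration.integral_nonneg) (auto intro: integrable_continuous_real ct)
    have "ennreal (integral {0..1} (\<lambda>s. integral {0..1} (?k s))) = (\<integral>\<^sup>+s. indicator {0..1} s * ennreal (integral {0..1} (?k s)) \<partial>lborel)"
      by (rule ennreal_integral_unit_interval(1)[OF cs nn])
    also have "\<dots> = (\<integral>\<^sup>+s. indicator {0..1} s * (\<integral>\<^sup>+t. indicator {0..1} t * ennreal (?k s t) \<partial>lborel) \<partial>lborel)"
      by (subst ennreal_integral_unit_interval(1)[OF ct]) auto
    also have "\<dots> = (\<integral>\<^sup>+s. (\<integral>\<^sup>+t. indicator {0..1} s * (indicator {0..1} t * norm_sq3 \<phi> (act (unip3 s 0 t) q)) \<partial>lborel) \<partial>lborel)"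
    proof (rule nn_integral_cong)
      fix s :: real
      have e: "norm_sq3 \<phi> (act (unip3 s 0 t) q) = ennreal (?k s t)" for t
        using act_half_space3[OF _ q, of "unip3 s 0 t"] by (simp add: norm_sq3_def unip3_iwasawa[OF q])
      have m: "(\<lambda>t. ennreal (?k s t)) \<in> borel_measurable borel"
        by (intro measurable_compose[OF _ measurable_ennreal] borel_measurable_continuous_onI continuous_intros continuous_on_mult_unip3)
          (use g in auto)
      show "indicator {0..1} s * (\<integral>\<^sup>+t. indicator {0..1} t * ennreal (?k s t) \<partial>lborel) =
         (\<integral>\<^sup>+t. indicator {0..1} s * (indicator {0..1} t * norm_sq3 \<phi> (act (unip3 s 0 t) q)) \<partial>lborel)"
      proof -
        have "indicator {0..1} s * (\<integral>\<^sup>+t. indicator {0..1} t * f t \<partial>lborel) =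
           (\<integral>\<^sup>+t. indicator {0..1} s * (indicator {0..1} t * f t) \<partial>lborel)"
          if [measurable]: "f \<in> borel_measurable borel" for f :: "real \<Rightarrow> ennreal"
          by (intro nn_integral_cmult[symmetric]) measurable
        from this[OF m] show ?thesis unfolding e .
      qed
    qed
    finally show ?thesis .
  qed
  finally show "(\<Sum>\<beta>\<in>X. indicator ?S (act \<beta> q) * fc3_sq (act \<beta> q)) \<le>
    (\<integral>\<^sup>+s. \<integral>\<^sup>+t. indicator {0..1} s * (indicator {0..1} t * norm_sq3 \<phi> (act (unip3 s 0 t) q)) \<partial>lborel \<partial>lborel)" .
qed

text \<open>Unfolding over \<open>parabZ\<close> replaces the strip by \<open>core3\<close> and,
  through the orbit sum, the coefficient by the mean of |\<phi>|^2 over unit translations in x1 and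
  x3. Exchanging the integrals and undoing each translation leaves the integral over the Siegel
  set.\<close>

lemma fc3_sq_strip3_bound:
  assumes pos: "\<alpha> > 0" "\<beta> > 0" "\<rho> > 1"
  obtains C where "C > 0" "\<And>N. N \<ge> 1 \<Longrightarrow> (\<integral>\<^sup>+p. indicator (strip3 \<alpha> \<beta> \<rho> N) p * fc3_sq p \<partial>haar3) \<le> ennreal (C * N)"
proof -
  define \<kappa> \<tau>1 \<tau>2 where "\<kappa> = 1 / \<beta> + \<beta> * \<rho>" and "\<tau>1 = \<alpha>\<^sup>2 * \<beta>" and "\<tau>2 = \<alpha>\<^sup>2 * \<beta> * \<rho> ^ 3"
  have pos': "\<kappa> > 0" "\<tau>1 > 0" "\<tau>2 > 0" using pos by (simp_all add: \<kappa>_def \<tau>1_def \<tau>2_def add_pos_pos)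
  obtain C where C: "C > 0" "\<And>N. N \<ge> 1 \<Longrightarrow>
     (\<integral>\<^sup>+p. indicator (siegel3 (\<kappa> * N) (\<tau>1 / N) (\<tau>2 / N)) p * norm_sq3 \<phi> p \<partial>haar3) \<le> ennreal (C * N)"
    using maass_form_siegel3_bound[OF maass pos'] by blast
  show ?thesis
  proof (rule that[OF C(1)])
    fix N assume N: "(1::real) \<le> N"
    define sh :: "real \<Rightarrow> real \<Rightarrow> coords3 \<Rightarrow> coords3" where
      "sh s t q = (fst q + s, fst (snd q), fst (snd (snd q)) + t, fst (snd (snd (snd q))), snd (snd (snd (snd q))))" for s t q
    interpret haar3_lborel: pair_sigma_finite haar3 lborel
      by (intro pair_sigma_finite.intro sigma_finite_haar3 sigma_finite_lborel)
    let ?S = "strip3 \<alpha> \<beta> \<rho> N" and ?K = "core3 (\<kappa> * N) (\<tau>1 / N) (\<tau>2 / N)" and ?G = "siegel3 (\<kappa> * N) (\<tau>1 / N) (\<tau>2 / N)"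
    have "(\<integral>\<^sup>+p. indicator ?S p * fc3_sq p \<partial>haar3) \<le>
      (\<integral>\<^sup>+q. indicator ?K q * (\<integral>\<^sup>+\<gamma>. indicator ?S (act \<gamma> q) * fc3_sq (act \<gamma> q) \<partial>count_space parabZ) \<partial>haar3)"
    proof (rule nn_integral_haar3_unfold)
      show "countable parabZ" by (rule countable_subset[OF parabZ_SL3Z countable_SL3Z])
      show "det \<gamma> \<noteq> 0" if "\<gamma> \<in> parabZ" for \<gamma> using SL3Z_det that parabZ_SL3Z by force
      show "?K \<subseteq> half_space3" by (rule core3_subset)
      show "\<exists>\<gamma>\<in>parabZ. \<exists>q\<in>?K. p = act \<gamma> q" if "p \<in> ?S" for p
        unfolding \<kappa>_def \<tau>1_def \<tau>2_def by (rule strip3_covered[OF pos N that])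
    qed measurable
    also have "\<dots> \<le> (\<integral>\<^sup>+q. (\<integral>\<^sup>+s. \<integral>\<^sup>+t. indicator {0..1} s * (indicator {0..1} t *
        (indicator ?G (sh s t q) * norm_sq3 \<phi> (sh s t q))) \<partial>lborel \<partial>lborel) \<partial>haar3)"
    proof (rule nn_integral_mono)
      fix q
      show "indicator ?K q * (\<integral>\<^sup>+\<gamma>. indicator ?S (act \<gamma> q) * fc3_sq (act \<gamma> q) \<partial>count_space parabZ) \<le>
        (\<integral>\<^sup>+s. \<integral>\<^sup>+t. indicator {0..1} s * (indicator {0..1} t *
        (indicator ?G (sh s t q) * norm_sq3 \<phi> (sh s t q))) \<partial>lborel \<partial>lborel)"
      proof (cases "q \<in> ?K")
        case True
        obtain x1 x2 x3 y1 y2 where q_eq: "q = (x1, x2, x3, y1, y2)" by (cases q)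
        have K: "(x1, x2, x3, y1, y2) \<in> ?G" "0 \<le> x1" "x1 < 1" "0 \<le> x3" "x3 < 1"
          using True by (auto simp: core3_def q_eq)
        note K' = K(1)[unfolded siegel3_iff]
        have h: "q \<in> half_space3" using True core3_subset by blast
        have in_G: "sh s t q \<in> ?G" if "s \<in> {0..1}" "t \<in> {0..1}" for s t
          using that K' K by (simp add: q_eq sh_def siegel3_iff)
        have sh: "act (unip3 s 0 t) q = sh s t q" for s t using K' by (simp add: q_eq sh_def act_unip3)
        have "indicator ?K q * (\<integral>\<^sup>+\<gamma>. indicator ?S (act \<gamma> q) * fc3_sq (act \<gamma> q) \<partial>count_space parabZ) \<le>
          (\<integral>\<^sup>+s. \<integral>\<^sup>+t. indicator {0..1} s * (indicator {0..1} t * norm_sq3 \<phi> (act (unip3 s 0 t) q)) \<partial>lborel \<partial>lborel)"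
          using True fc3_sq_orbit_sum[OF h] by simp
        also have "\<dots> = (\<integral>\<^sup>+s. \<integral>\<^sup>+t. indicator {0..1} s * (indicator {0..1} t *
          (indicator ?G (sh s t q) * norm_sq3 \<phi> (sh s t q))) \<partial>lborel \<partial>lborel)"
          unfolding sh by (intro nn_integral_cong) (use in_G in \<open>auto simp: indicator_def\<close>)
        finally show ?thesis .
      qed simp
    qed
    also have "\<dots> = (\<integral>\<^sup>+s. \<integral>\<^sup>+q. \<integral>\<^sup>+t. indicator {0..1} s * (indicator {0..1} t *
        (indicator ?G (sh s t q) * norm_sq3 \<phi> (sh s t q))) \<partial>lborel \<partial>haar3 \<partial>lborel)"
      by (rule haar3_lborel.Fubini'[symmetric]) (unfold sh_def, measurable)
    also have "\<dots> = (\<integral>\<^sup>+s. \<integral>\<^sup>+t. \<integral>\<^sup>+q. indicator {0..1} s * (indicator {0..1} t *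
        (indicator ?G (sh s t q) * norm_sq3 \<phi> (sh s t q))) \<partial>haar3 \<partial>lborel \<partial>lborel)"
      by (rule nn_integral_cong, rule haar3_lborel.Fubini'[symmetric]) (unfold sh_def, measurable)
    also have "\<dots> \<le> (\<integral>\<^sup>+s. \<integral>\<^sup>+t. indicator {0..1::real} s * (indicator {0..1::real} t * ennreal (C * N)) \<partial>lborel \<partial>lborel)"
    proof (rule nn_integral_mono, rule nn_integral_mono)
      fix s t :: real
      let ?h = "\<lambda>p. indicator {0..1} s * (indicator {0..1} t * (indicator ?G p * norm_sq3 \<phi> p))"
      have m: "?h \<in> borel_measurable borel" by measurable
      have sh: "sh s t = (\<lambda>(x1, x2, x3, y1, y2). (x1 + s, x2 + 0, x3 + t + 0 * x1, y1, y2))"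
        by (auto simp: sh_def)
      have "(\<integral>\<^sup>+q. ?h (sh s t q) \<partial>haar3) = (\<integral>\<^sup>+p. ?h p \<partial>haar3)"
        unfolding sh by (rule bspec[OF haar3_invariant_shear[unfolded haar3_invariant_def] m])
      also have "\<dots> = indicator {0..1} s * (indicator {0..1} t * (\<integral>\<^sup>+p. indicator ?G p * norm_sq3 \<phi> p \<partial>haar3))"
        by (subst nn_integral_cmult, measurable, subst nn_integral_cmult, measurable)
      also have "\<dots> \<le> indicator {0..1} s * (indicator {0..1} t * ennreal (C * N))"
        by (intro mult_left_mono C(2) N) auto
      finally show "(\<integral>\<^sup>+q. ?h (sh s t q) \<partial>haar3) \<le> indicator {0..1} s * (indicator {0..1} t * ennreal (C * N))" .
    qed
    also have "\<dots> = ennreal (C * N)"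
      by (simp add: nn_integral_cmult nn_integral_multc mult.commute[of "indicator _ _"] flip: mult.assoc)
    finally show "(\<integral>\<^sup>+p. indicator ?S p * fc3_sq p \<partial>haar3) \<le> ennreal (C * N)" .
  qed
qed

text \<open>The integrand is constant in x1 and x3, and its x2-integral is at least
  \<open>B\<close>. The first two factors bound the integrals of dy / y^3 over the ranges of y1 and
  y2 from below, by length over cube of the right endpoint; the second is of order N^2.\<close>

lemma fc3_sq_strip3_lower:
  assumes pos: "\<alpha> > 0" "\<beta> > 0" "\<rho> > 1" "N \<ge> 1"
    and lower: "\<And>y1 y2. \<alpha> \<le> y1 \<Longrightarrow> y1 \<le> \<alpha> * \<rho> \<Longrightarrow> \<beta> / N \<le> y2 \<Longrightarrow> y2 \<le> \<beta> * \<rho> / N \<Longrightarrow>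
      B \<le> integral {0..1} (\<lambda>x2. (norm (fc3 \<phi> 1 0 (unip3 0 x2 0 ** diag3 y1 y2)))\<^sup>2)"
    and B: "B \<ge> 0"
  shows "ennreal ((\<rho> - 1) / (\<alpha>\<^sup>2 * \<rho> ^ 3) * ((\<rho> - 1) * N\<^sup>2 / (\<beta>\<^sup>2 * \<rho> ^ 3)) * B) \<le>
    (\<integral>\<^sup>+p. indicator (strip3 \<alpha> \<beta> \<rho> N) p * fc3_sq p \<partial>haar3)"
proof -
  let ?S = "strip3 \<alpha> \<beta> \<rho> N"
  have bN: "\<beta> / N > 0" using pos by simp
  define h where "h p = indicator ?S p * fc3_sq p" for p
  have hm [measurable]: "h \<in> borel_measurable borel" unfolding h_def by measurable
  define I1 I2 where "I1 = {\<alpha>..\<alpha> * \<rho>}" and "I2 = {\<beta> / N..\<beta> * \<rho> / N}"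
  have [measurable]: "I1 \<in> sets borel" "I2 \<in> sets borel" by (simp_all add: I1_def I2_def)
  have w: "ennreal ((b - a) / b ^ 3) \<le> (\<integral>\<^sup>+y. w3 y * indicator {a..b} y \<partial>lborel)" if "0 < a" "a \<le> b" for a b :: real
  proof -
    have "ennreal ((b - a) / b ^ 3) = ennreal (1 / b ^ 3) * emeasure lborel {a..b}"
      using that by (simp flip: ennreal_mult)
    also have "\<dots> = (\<integral>\<^sup>+y. ennreal (1 / b ^ 3) * indicator {a..b} y \<partial>lborel)" by (simp add: nn_integral_cmult)
    also have "\<dots> \<le> (\<integral>\<^sup>+y. w3 y * indicator {a..b} y \<partial>lborel)"
    proof (rule nn_integral_mono)
      fix y :: real
      have "1 / b ^ 3 \<le> 1 / y ^ 3" if "a \<le> y" "y \<le> b"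
        using that \<open>0 < a\<close> by (intro divide_left_mono power_mono mult_pos_pos zero_less_power) auto
      thus "ennreal (1 / b ^ 3) * indicator {a..b} y \<le> w3 y * indicator {a..b} y"
        using that by (auto simp: indicator_def intro!: ennreal_leI)
    qed
    finally show ?thesis .
  qed
  have w1: "ennreal ((\<rho> - 1) / (\<alpha>\<^sup>2 * \<rho> ^ 3)) \<le> (\<integral>\<^sup>+y. w3 y * indicator I1 y \<partial>lborel)"
  proof -
    have "(\<rho> - 1) / (\<alpha>\<^sup>2 * \<rho> ^ 3) = (\<alpha> * \<rho> - \<alpha>) / (\<alpha> * \<rho>) ^ 3"
      using pos by (simp add: field_simps power2_eq_square power3_eq_cube)
    thus ?thesis using w[of \<alpha> "\<alpha> * \<rho>"] pos by (simp add: I1_def)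
  qed
  have w2: "ennreal ((\<rho> - 1) * N\<^sup>2 / (\<beta>\<^sup>2 * \<rho> ^ 3)) \<le> (\<integral>\<^sup>+y. w3 y * indicator I2 y \<partial>lborel)"
  proof -
    have "(\<rho> - 1) * N\<^sup>2 / (\<beta>\<^sup>2 * \<rho> ^ 3) = (\<beta> * \<rho> / N - \<beta> / N) / (\<beta> * \<rho> / N) ^ 3"
      using pos by (simp add: field_simps power2_eq_square power3_eq_cube)
    moreover have "\<beta> / N \<le> \<beta> * \<rho> / N" using pos by (intro divide_right_mono) auto
    ultimately show ?thesis using w[OF bN] by (simp add: I2_def)
  qed
  let ?U = "\<lambda>x::real. indicator {0..<1} x :: ennreal"
  have inner: "ennreal B * (?U x1 * (?U x3 * (w3 y1 * indicator I1 y1 * (w3 y2 * indicator I2 y2)))) \<le>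
     (\<integral>\<^sup>+x2. w3 y1 * (w3 y2 * h (x1, x2, x3, y1, y2)) \<partial>lborel)" for x1 x3 y1 y2
  proof (cases "x1 \<in> {0..<1} \<and> x3 \<in> {0..<1} \<and> y1 \<in> I1 \<and> y2 \<in> I2")
    case True
    hence "\<alpha> \<le> y1" "\<beta> / N \<le> y2" by (simp_all add: I1_def I2_def)
    hence y: "y1 > 0" "y2 > 0" using pos(1) bN by linarith+
    let ?k = "\<lambda>x2. (norm (fc3 \<phi> 1 0 (unip3 0 x2 0 ** diag3 y1 y2)))\<^sup>2"
    have d: "diag3 y1 y2 \<in> GL3"
      using y by (simp add: GL3_def det_3 diag3_def)
    have h: "h (x1, x2, x3, y1, y2) = ?U x2 * ennreal (?k x2)" for x2
    proof -
      have "iwasawa (x1, x2, x3, y1, y2) = unip3 x1 0 x3 ** (unip3 0 x2 0 ** diag3 y1 y2)"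
        by (simp add: iwasawa_def matrix_mul_assoc unip3_mult)
      hence "norm (fc3 \<phi> 1 0 (iwasawa (x1, x2, x3, y1, y2))) = norm (fc3 \<phi> 1 0 (unip3 0 x2 0 ** diag3 y1 y2))"
        using norm_fc3_unip3[OF unip3_GL3[OF d]] by simp
      moreover have "(x1, x2, x3, y1, y2) \<in> half_space3" using y by (simp add: half_space3_def)
      moreover have "(x1, x2, x3, y1, y2) \<in> ?S \<longleftrightarrow> x2 \<in> {0..<1}"
        using True unfolding strip3_iff I1_def I2_def by auto
      ultimately show ?thesis by (simp add: h_def fc3_sq_def indicator_def)
    qed
    have k: "continuous_on {0..1} ?k"
    proof (intro continuous_intros fc3_continuous)
      show "continuous_on {0..1} (\<lambda>x2. unip3 0 x2 0 ** diag3 y1 y2)"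
      proof (rule continuous_on_mat3I)
        fix i j :: 3
        have u: "continuous_on {0..1} (\<lambda>x. unip3 0 x 0 $ i $ k)" for k
          using exhaust_3[of i] exhaust_3[of k] by (auto simp: continuous_on_const continuous_on_id)
        show "continuous_on {0..1} (\<lambda>z. (unip3 0 z 0 ** diag3 y1 y2) $ i $ j)"
          unfolding matrix_mult_3 by (intro continuous_intros u)
      qed
    qed (rule unip3_GL3[OF d])
    have "ennreal B \<le> ennreal (integral {0..1} ?k)"
      using True by (intro ennreal_leI lower) (auto simp: I1_def I2_def)
    also have "\<dots> = (\<integral>\<^sup>+x2. ?U x2 * ennreal (?k x2) \<partial>lborel)"
      by (rule ennreal_integral_unit_interval(2)[OF k]) simp
    finally have "w3 y1 * (w3 y2 * ennreal B) \<le> w3 y1 * (w3 y2 * (\<integral>\<^sup>+x2. h (x1, x2, x3, y1, y2) \<partial>lborel))"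
      unfolding h by (intro mult_left_mono) auto
    also have "\<dots> = (\<integral>\<^sup>+x2. w3 y1 * (w3 y2 * h (x1, x2, x3, y1, y2)) \<partial>lborel)"
      by (subst nn_integral_cmult, measurable, subst nn_integral_cmult, measurable)
    finally show ?thesis using True by (simp add: mult_ac)
  qed (auto simp: indicator_def)
  have "ennreal ((\<rho> - 1) / (\<alpha>\<^sup>2 * \<rho> ^ 3) * ((\<rho> - 1) * N\<^sup>2 / (\<beta>\<^sup>2 * \<rho> ^ 3)) * B) =
     ennreal B * (ennreal ((\<rho> - 1) / (\<alpha>\<^sup>2 * \<rho> ^ 3)) * ennreal ((\<rho> - 1) * N\<^sup>2 / (\<beta>\<^sup>2 * \<rho> ^ 3)))"
  proof -
    have gen: "ennreal (u * v * B) = ennreal B * (ennreal u * ennreal v)" if "u \<ge> 0" "v \<ge> 0" for u v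
      using that B by (simp add: ennreal_mult mult_ac)
    show ?thesis by (rule gen) (use pos in simp_all)
  qed
  also have "\<dots> \<le> ennreal B * ((\<integral>\<^sup>+y. w3 y * indicator I1 y \<partial>lborel) * (\<integral>\<^sup>+y. w3 y * indicator I2 y \<partial>lborel))"
    by (intro mult_left_mono mult_mono w1 w2) auto
  also have "\<dots> = (\<integral>\<^sup>+x1. \<integral>\<^sup>+x3. \<integral>\<^sup>+y1. \<integral>\<^sup>+y2.
     ennreal B * (?U x1 * (?U x3 * (w3 y1 * indicator I1 y1 * (w3 y2 * indicator I2 y2)))) \<partial>lborel \<partial>lborel \<partial>lborel \<partial>lborel)"
    by (simp add: nn_integral_cmult nn_integral_multc)
  also have "\<dots> \<le> (\<integral>\<^sup>+x1. \<integral>\<^sup>+x3. \<integral>\<^sup>+y1. \<integral>\<^sup>+y2. \<integral>\<^sup>+x2. w3 y1 * (w3 y2 * h (x1, x2, x3, y1, y2))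
     \<partial>lborel \<partial>lborel \<partial>lborel \<partial>lborel \<partial>lborel)"
    by (rule nn_integral_mono, rule nn_integral_mono, rule nn_integral_mono, rule nn_integral_mono) (rule inner)
  also have "\<dots> = (\<integral>\<^sup>+x1. \<integral>\<^sup>+x3. \<integral>\<^sup>+y1. \<integral>\<^sup>+x2. \<integral>\<^sup>+y2. w3 y1 * (w3 y2 * h (x1, x2, x3, y1, y2))
     \<partial>lborel \<partial>lborel \<partial>lborel \<partial>lborel \<partial>lborel)"
    by (intro nn_integral_cong lborel_pair.Fubini') measurable
  also have "\<dots> = (\<integral>\<^sup>+x1. \<integral>\<^sup>+x3. \<integral>\<^sup>+x2. \<integral>\<^sup>+y1. \<integral>\<^sup>+y2. w3 y1 * (w3 y2 * h (x1, x2, x3, y1, y2))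
     \<partial>lborel \<partial>lborel \<partial>lborel \<partial>lborel \<partial>lborel)"
    by (intro nn_integral_cong lborel_pair.Fubini') measurable
  also have "\<dots> = (\<integral>\<^sup>+x1. \<integral>\<^sup>+x2. \<integral>\<^sup>+x3. \<integral>\<^sup>+y1. \<integral>\<^sup>+y2. w3 y1 * (w3 y2 * h (x1, x2, x3, y1, y2))
     \<partial>lborel \<partial>lborel \<partial>lborel \<partial>lborel \<partial>lborel)"
    by (intro nn_integral_cong lborel_pair.Fubini') measurable
  also have "\<dots> = (\<integral>\<^sup>+p. h p \<partial>haar3)" by (rule nn_integral_haar3_w3[OF hm, symmetric])
  finally show ?thesis by (simp only: h_def)
qed

end

section \<open>Nonvanishing of the Whittaker function and blocks of coefficients\<close>

lemma diag3_entries [simp]: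
  "diag3 a b $ 1 = vector [a * b, 0, 0]" "diag3 a b $ 2 = vector [0, a, 0]" "diag3 a b $ 3 = vector [0, 0, 1]"
  by (simp_all add: diag3_def)

lemma diag3_mult: "diag3 a b ** diag3 c d = diag3 (a * c) (b * d)"
  by (simp add: mat3_eq_iff matrix_mult_3)

text \<open>By the Iwasawa decomposition and equivariance, |W| at any point equals |W| at the
  diagonal part of that point.\<close>

lemma whittaker_nonzero_diag3:
  assumes "whittaker_function3 \<phi> W"
  obtains \<alpha> \<beta> where "\<alpha> > 0" "\<beta> > 0" "W (diag3 \<alpha> \<beta>) \<noteq> 0"
proof -
  from assms obtain g where g: "g \<in> GL3" "W g \<noteq> 0" unfolding whittaker_function3_def by blast
  have unip: "W (unip3 x1 x2 x3 ** h) = e2pi (of_real (x1 + x2)) * W h" if "h \<in> GL3" for h x1 x2 x3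
    using assms that unfolding whittaker_function3_def by blast
  have sph: "W (r *\<^sub>R (h ** k)) = W h" if "h \<in> GL3" "orthogonal_matrix k" "r \<noteq> 0" for h k r
    using assms that unfolding whittaker_function3_def by blast
  have d: "det g \<noteq> 0" using g by (simp add: GL3_def)
  obtain k where k: "orthogonal_matrix k" "g = sqrt (g$3 \<bullet> g$3) *\<^sub>R (iwasawa (iwasawa_coords g) ** k)"
    using iwasawa_decomposition[OF d] .
  have h: "iwasawa_coords g \<in> half_space3" by (rule iwasawa_coords_half_space3[OF d])
  have r: "sqrt (g$3 \<bullet> g$3) \<noteq> 0" using gram33_pos[OF d] by simp
  have "W g = W (sqrt (g$3 \<bullet> g$3) *\<^sub>R (iwasawa (iwasawa_coords g) ** k))" using k(2) by (rule arg_cong)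
  hence Wg: "W g = W (iwasawa (iwasawa_coords g))" using sph[OF iwasawa_in_GL3[OF h] k(1) r] by (rule trans)
  obtain x1 x2 x3 y1 y2 where q: "iwasawa_coords g = (x1, x2, x3, y1, y2)" "y1 > 0" "y2 > 0"
    using half_space3_cases[OF h] .
  have "diag3 y1 y2 \<in> GL3" using q by (simp add: GL3_def det_3 diag3_def)
  hence "W g = e2pi (of_real (x1 + x2)) * W (diag3 y1 y2)"
    unfolding Wg q(1) iwasawa_def prod.case by (rule unip)
  hence "W (diag3 y1 y2) \<noteq> 0" using g by auto
  with q(2,3) that show ?thesis by blast
qed

text \<open>Continuity at a diagonal matrix where \<open>W\<close> does not vanish. The exponent 2
  in \<beta> \<rho>^2 anticipates the argument n y2, in which n / N and N y2 / \<beta> both range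
  over [1, \<rho>].\<close>

lemma whittaker_lower_bound:
  assumes "whittaker_function3 \<phi> W"
  obtains \<alpha> \<beta> \<rho> c where "\<alpha> > 0" "\<beta> > 0" "\<rho> > 1" "c > 0"
    "\<And>y1 y2. \<alpha> \<le> y1 \<Longrightarrow> y1 \<le> \<alpha> * \<rho> \<Longrightarrow> \<beta> \<le> y2 \<Longrightarrow> y2 \<le> \<beta> * \<rho>\<^sup>2 \<Longrightarrow> c \<le> norm (W (diag3 y1 y2))"
proof -
  obtain \<alpha> \<beta> where ab: "\<alpha> > 0" "\<beta> > 0" "W (diag3 \<alpha> \<beta>) \<noteq> 0" using whittaker_nonzero_diag3[OF assms] .
  have W: "continuous_on GL3 W"
    using assms unfolding whittaker_function3_def smooth_on_def by (metis Ck_on.simps(1))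
  let ?U = "{p::real \<times> real. fst p > 0 \<and> snd p > 0}"
  have "continuous_on ?U (\<lambda>p. W (diag3 (fst p) (snd p)))"
  proof (rule continuous_on_compose2[OF W])
    show "continuous_on ?U (\<lambda>p. diag3 (fst p) (snd p))"
    proof (rule continuous_on_mat3I)
      fix i j :: 3
      show "continuous_on ?U (\<lambda>p. diag3 (fst p) (snd p) $ i $ j)"
        using exhaust_3[of i] exhaust_3[of j] by (elim disjE) (simp_all add: continuous_intros)
    qed
    show "(\<lambda>p. diag3 (fst p) (snd p)) ` ?U \<subseteq> GL3" by (auto simp: GL3_def det_3 diag3_def)
  qed
  hence "continuous_on ?U (\<lambda>p. norm (W (diag3 (fst p) (snd p))))" by (intro continuous_intros)
  moreover have "open ?U" by (intro open_Collect_conj open_Collect_less continuous_intros)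
  ultimately have "isCont (\<lambda>p. norm (W (diag3 (fst p) (snd p)))) (\<alpha>, \<beta>)"
    using ab by (simp add: continuous_on_eq_continuous_at)
  hence "((\<lambda>p. norm (W (diag3 (fst p) (snd p)))) \<longlongrightarrow> norm (W (diag3 \<alpha> \<beta>))) (at (\<alpha>, \<beta>))"
    by (simp add: isCont_def)
  hence "\<forall>\<^sub>F p in at (\<alpha>, \<beta>). norm (W (diag3 \<alpha> \<beta>)) / 2 < norm (W (diag3 (fst p) (snd p)))"
    by (rule order_tendstoD) (use ab in simp)
  then obtain e where e0: "e > 0" "\<And>p. p \<noteq> (\<alpha>, \<beta>) \<Longrightarrow> dist p (\<alpha>, \<beta>) < e \<Longrightarrow>
      norm (W (diag3 \<alpha> \<beta>)) / 2 < norm (W (diag3 (fst p) (snd p)))"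
    unfolding eventually_at by blast
  have e: "e > 0" "\<And>p. dist p (\<alpha>, \<beta>) < e \<Longrightarrow> norm (W (diag3 \<alpha> \<beta>)) / 2 < norm (W (diag3 (fst p) (snd p)))"
  proof -
    show "norm (W (diag3 \<alpha> \<beta>)) / 2 < norm (W (diag3 (fst p) (snd p)))" if "dist p (\<alpha>, \<beta>) < e" for p
      using e0(2)[of p] that ab by (cases "p = (\<alpha>, \<beta>)") auto
  qed (rule e0(1))
  \<comment> \<open>For t \<le> 1 the coordinates move by at most \<alpha> t and 3 \<beta> t,
    because (1 + t)^2 \<le> 1 + 3 t; hence t < m keeps the point within distance e.\<close>
  define m where "m = e / (1 + \<alpha> + 3 * \<beta>)"
  define t where "t = min 1 (m / 2)"
  have m: "m > 0" using e(1) ab by (simp add: m_def add_pos_pos)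
  have t: "0 < t" "t \<le> 1" "t < m" using m by (auto simp: t_def)
  show ?thesis
  proof (rule that[OF ab(1,2), of "1 + t" "norm (W (diag3 \<alpha> \<beta>)) / 2"])
    fix y1 y2 assume y: "\<alpha> \<le> y1" "y1 \<le> \<alpha> * (1 + t)" "\<beta> \<le> y2" "y2 \<le> \<beta> * (1 + t)\<^sup>2"
    have "\<bar>y1 - \<alpha>\<bar> \<le> \<alpha> * t" using y by (simp add: algebra_simps)
    moreover have "\<bar>y2 - \<beta>\<bar> \<le> 3 * \<beta> * t"
    proof -
      have "t * t \<le> 1 * t" using t by (intro mult_right_mono) auto
      hence "\<beta> * (t * t) \<le> \<beta> * t" using ab by (intro mult_left_mono) auto
      moreover have "\<beta> * (1 + t)\<^sup>2 = \<beta> + 2 * \<beta> * t + \<beta> * (t * t)" by (simp add: power2_eq_square algebra_simps)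
      ultimately show ?thesis using y by linarith
    qed
    ultimately have "\<bar>y1 - \<alpha>\<bar> + \<bar>y2 - \<beta>\<bar> \<le> (1 + \<alpha> + 3 * \<beta>) * t" using t by (simp add: algebra_simps)
    also have "\<dots> < (1 + \<alpha> + 3 * \<beta>) * m" using t ab by (intro mult_strict_left_mono) auto
    also have "\<dots> = e" using ab by (simp add: m_def)
    finally have "dist (y1, y2) (\<alpha>, \<beta>) < e"
      using sqrt_sum_squares_le_sum_abs[of "y1 - \<alpha>" "y2 - \<beta>"] by (simp add: dist_prod_def dist_real_def)
    from e(2)[OF this] show "norm (W (diag3 \<alpha> \<beta>)) / 2 \<le> norm (W (diag3 y1 y2))" by simp
  qed (use ab t in auto)
qed

text \<open>For n in the block and (y1, y2) in the strip, n y2 lies in [\<beta>, \<beta> \<rho>^2],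
  so that the mode (1, n) has modulus at least c |A 1 n| / n. Squaring costs N^(-2), the volume of
  the strip returns N^2, and the upper bound C N remains.\<close>

lemma mean_square_block:
  assumes "maass_form_SL3 \<phi>" and "normalized_coeffs_SL3 \<phi> A"
  obtains \<rho> C where "\<rho> > 1" "C > 0"
    "\<And>N. N \<ge> 1 \<Longrightarrow> (\<Sum>n\<in>{n. N \<le> real n \<and> real n \<le> \<rho> * N}. (norm (A 1 n))\<^sup>2) \<le> C * N"
proof -
  interpret maass3 \<phi> by unfold_locales fact
  from assms(2) obtain W where W: "whittaker_function3 \<phi> W" and
    modes: "\<And>m1 m2 g. m1 \<ge> 1 \<Longrightarrow> m2 \<ge> 1 \<Longrightarrow> g \<in> GL3 \<Longrightarrow> fourier_mode3 \<phi> m1 m2 g =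
          A m1 m2 / (of_nat m1 * of_nat m2) * W (diag3 (real m1) (real m2) ** g)"
    unfolding normalized_coeffs_SL3_def by blast
  obtain \<alpha> \<beta> \<rho> c where ab: "\<alpha> > 0" "\<beta> > 0" "\<rho> > 1" "c > 0" and
    low: "\<And>y1 y2. \<alpha> \<le> y1 \<Longrightarrow> y1 \<le> \<alpha> * \<rho> \<Longrightarrow> \<beta> \<le> y2 \<Longrightarrow> y2 \<le> \<beta> * \<rho>\<^sup>2 \<Longrightarrow> c \<le> norm (W (diag3 y1 y2))"
    using whittaker_lower_bound[OF W] by blast
  obtain C where C: "C > 0" "\<And>N. N \<ge> 1 \<Longrightarrow> (\<integral>\<^sup>+p. indicator (strip3 \<alpha> \<beta> \<rho> N) p * fc3_sq p \<partial>haar3) \<le> ennreal (C * N)"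
    using fc3_sq_strip3_bound[OF ab(1-3)] by blast
  define K where "K = (\<rho> - 1) / (\<alpha>\<^sup>2 * \<rho> ^ 3) * ((\<rho> - 1) / (\<beta>\<^sup>2 * \<rho> ^ 3)) * (c\<^sup>2 / \<rho>\<^sup>2)"
  have K: "K > 0" using ab by (simp add: K_def)
  show ?thesis
  proof (rule that[OF ab(3), of "C / K"])
    show "C / K > 0" using C K by simp
    fix N assume N: "(1::real) \<le> N"
    let ?I = "{n::nat. N \<le> real n \<and> real n \<le> \<rho> * N}"
    have fin: "finite ?I"
      by (rule finite_subset[of _ "{..nat \<lfloor>\<rho> * N\<rfloor>}"]) (auto simp: le_nat_floor)
    define B where "B = (c\<^sup>2 / (\<rho> * N)\<^sup>2) * (\<Sum>n\<in>?I. (norm (A 1 n))\<^sup>2)"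
    have B: "B \<ge> 0" unfolding B_def by (intro mult_nonneg_nonneg sum_nonneg) auto
    have "ennreal ((\<rho> - 1) / (\<alpha>\<^sup>2 * \<rho> ^ 3) * ((\<rho> - 1) * N\<^sup>2 / (\<beta>\<^sup>2 * \<rho> ^ 3)) * B) \<le>
      (\<integral>\<^sup>+p. indicator (strip3 \<alpha> \<beta> \<rho> N) p * fc3_sq p \<partial>haar3)"
    proof (rule fc3_sq_strip3_lower[OF ab(1-3) N _ B])
      fix y1 y2 assume y: "\<alpha> \<le> y1" "y1 \<le> \<alpha> * \<rho>" "\<beta> / N \<le> y2" "y2 \<le> \<beta> * \<rho> / N"
      have pos: "y1 > 0" "y2 > 0" using y ab N less_le_trans[of 0 "\<beta> / N" y2] by auto
      have g: "diag3 y1 y2 \<in> GL3" using pos by (simp add: GL3_def det_3 diag3_def)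
      have "B = (\<Sum>n\<in>?I. (c\<^sup>2 / (\<rho> * N)\<^sup>2) * (norm (A 1 n))\<^sup>2)" by (simp add: B_def sum_distrib_left)
      also have "\<dots> \<le> (\<Sum>n\<in>?I. (norm (fourier_mode3 \<phi> 1 n (diag3 y1 y2)))\<^sup>2)"
      proof (rule sum_mono)
        fix n assume "n \<in> ?I"
        hence n: "N \<le> real n" "real n \<le> \<rho> * N" by auto
        hence n1: "n \<ge> 1" using N by linarith
        have "\<beta> = N * (\<beta> / N)" using N by simp
        also have "\<dots> \<le> real n * y2" using n y N ab by (intro mult_mono) auto
        finally have l: "\<beta> \<le> real n * y2" .
        have "real n * y2 \<le> (\<rho> * N) * (\<beta> * \<rho> / N)" using n y N ab pos by (intro mult_mono) auto
        also have "\<dots> = \<beta> * \<rho>\<^sup>2" using N by (simp add: power2_eq_square)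
        finally have u: "real n * y2 \<le> \<beta> * \<rho>\<^sup>2" .
        have "fourier_mode3 \<phi> 1 n (diag3 y1 y2) = A 1 n / of_nat n * W (diag3 y1 (real n * y2))"
          using modes[OF _ n1 g, of 1] by (simp add: diag3_mult)
        hence e: "(norm (fourier_mode3 \<phi> 1 n (diag3 y1 y2)))\<^sup>2 = (norm (A 1 n))\<^sup>2 * ((norm (W (diag3 y1 (real n * y2))))\<^sup>2 / (real n)\<^sup>2)"
          by (simp add: norm_mult norm_divide power_mult_distrib power_divide)
        have "c\<^sup>2 / (\<rho> * N)\<^sup>2 \<le> (norm (W (diag3 y1 (real n * y2))))\<^sup>2 / (real n)\<^sup>2"
          using low[OF y(1,2) l u] ab n n1 by (intro frac_le power_mono zero_less_power) auto
        thus "c\<^sup>2 / (\<rho> * N)\<^sup>2 * (norm (A 1 n))\<^sup>2 \<le> (norm (fourier_mode3 \<phi> 1 n (diag3 y1 y2)))\<^sup>2"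
          unfolding e by (subst mult.commute) (intro mult_left_mono, auto)
      qed
      also have "\<dots> \<le> integral {0..1} (\<lambda>x2. (norm (fc3 \<phi> 1 0 (unip3 0 x2 0 ** diag3 y1 y2)))\<^sup>2)"
        by (rule fourier_mode3_bessel[OF g fin])
      finally show "B \<le> integral {0..1} (\<lambda>x2. (norm (fc3 \<phi> 1 0 (unip3 0 x2 0 ** diag3 y1 y2)))\<^sup>2)" .
    qed
    also have "\<dots> \<le> ennreal (C * N)" by (rule C(2)[OF N])
    finally have "(\<rho> - 1) / (\<alpha>\<^sup>2 * \<rho> ^ 3) * ((\<rho> - 1) * N\<^sup>2 / (\<beta>\<^sup>2 * \<rho> ^ 3)) * B \<le> C * N"
      using C N by (subst (asm) ennreal_le_iff) auto
    moreover have "(\<rho> - 1) / (\<alpha>\<^sup>2 * \<rho> ^ 3) * ((\<rho> - 1) * N\<^sup>2 / (\<beta>\<^sup>2 * \<rho> ^ 3)) * B = K * (\<Sum>n\<in>?I. (norm (A 1 n))\<^sup>2)"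
    proof -
      have e: "N\<^sup>2 * (c\<^sup>2 / (\<rho> * N)\<^sup>2) = c\<^sup>2 / \<rho>\<^sup>2" using N by (simp add: power_mult_distrib)
      have gen: "a * (b * r / d) * (q * s) = a * (b / d) * (r * q) * s" for a b r d q s :: real by simp
      show ?thesis unfolding B_def K_def gen e ..
    qed
    ultimately show "(\<Sum>n\<in>?I. (norm (A 1 n))\<^sup>2) \<le> C / K * N" using K by (simp add: field_simps)
  qed
qed

theorem mean_square_coeffs_SL3:
  assumes "maass_form_SL3 \<phi>" and "normalized_coeffs_SL3 \<phi> A"
  obtains C where "C > 0" "\<And>x. x \<ge> 1 \<Longrightarrow> (\<Sum>n\<in>{n. 1 \<le> n \<and> real n \<le> x}. (norm (A 1 n))\<^sup>2) \<le> C * x"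
proof -
  obtain \<rho> C where \<rho>: "\<rho> > 1" and C: "C > 0" and
    block: "\<And>N. N \<ge> 1 \<Longrightarrow> (\<Sum>n\<in>{n. N \<le> real n \<and> real n \<le> \<rho> * N}. (norm (A 1 n))\<^sup>2) \<le> C * N"
    using mean_square_block[OF assms] by blast
  \<comment> \<open>With this value C \<rho> = B (\<rho> - 1), so B x / \<rho> from the smaller n
    and C x / \<rho> from the last block add up to at most B x.\<close>
  define B where "B = C * \<rho> / (\<rho> - 1)"
  have B: "B > 0" using \<rho> C by (simp add: B_def)
  have BC: "C \<le> B" using \<rho> C by (simp add: B_def field_simps)
  have fin: "finite {n::nat. N \<le> real n \<and> real n \<le> x}" for N x
    by (rule finite_subset[of _ "{..nat \<lfloor>x\<rfloor>}"]) (auto simp: le_nat_floor)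
  have one: "{n::nat. 1 \<le> n \<and> real n \<le> x} = {n. 1 \<le> real n \<and> real n \<le> x}" for x by auto
  have main: "(\<Sum>n\<in>{n. 1 \<le> real n \<and> real n \<le> x}. (norm (A 1 n))\<^sup>2) \<le> B * x" if "x \<ge> 1" "x \<le> \<rho> ^ k" for x k
    using that
  proof (induction k arbitrary: x)
    case 0
    hence "x = 1" by simp
    have "(\<Sum>n\<in>{n. 1 \<le> real n \<and> real n \<le> 1}. (norm (A 1 n))\<^sup>2) \<le> (\<Sum>n\<in>{n. 1 \<le> real n \<and> real n \<le> \<rho> * 1}. (norm (A 1 n))\<^sup>2)"
      using \<rho> by (intro sum_mono2 fin) auto
    also have "\<dots> \<le> C * 1" by (rule block) simp
    finally show ?case using BC \<open>x = 1\<close> by simp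
  next
    case (Suc k)
    show ?case
    proof (cases "x \<le> \<rho>")
      case True
      have "(\<Sum>n\<in>{n. 1 \<le> real n \<and> real n \<le> x}. (norm (A 1 n))\<^sup>2) \<le> (\<Sum>n\<in>{n. 1 \<le> real n \<and> real n \<le> \<rho> * 1}. (norm (A 1 n))\<^sup>2)"
        using True by (intro sum_mono2 fin) auto
      also have "\<dots> \<le> C * 1" by (rule block) simp
      also have "\<dots> \<le> B * x" using BC Suc.prems C B by (intro mult_mono) auto
      finally show ?thesis .
    next
      case False
      hence x: "x / \<rho> \<ge> 1" using \<rho> by (simp add: field_simps)
      have "x / \<rho> \<le> \<rho> ^ k" using Suc.prems \<rho> by (simp add: field_simps)
      from Suc.IH[OF x this] have IH: "(\<Sum>n\<in>{n. 1 \<le> real n \<and> real n \<le> x / \<rho>}. (norm (A 1 n))\<^sup>2) \<le> B * (x / \<rho>)" .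
      have "(\<Sum>n\<in>{n. 1 \<le> real n \<and> real n \<le> x}. (norm (A 1 n))\<^sup>2) \<le>
         (\<Sum>n\<in>{n. 1 \<le> real n \<and> real n \<le> x / \<rho>} \<union> {n. x / \<rho> \<le> real n \<and> real n \<le> \<rho> * (x / \<rho>)}. (norm (A 1 n))\<^sup>2)"
        using \<rho> by (intro sum_mono2 finite_UnI fin) auto
      also have "\<dots> \<le> (\<Sum>n\<in>{n. 1 \<le> real n \<and> real n \<le> x / \<rho>}. (norm (A 1 n))\<^sup>2) +
         (\<Sum>n\<in>{n. x / \<rho> \<le> real n \<and> real n \<le> \<rho> * (x / \<rho>)}. (norm (A 1 n))\<^sup>2)"
        by (subst sum_Un[OF fin fin]) (auto intro!: sum_nonneg)
      also have "\<dots> \<le> B * (x / \<rho>) + C * (x / \<rho>)" using IH block[OF x] by simp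
      also have "\<dots> \<le> B * x"
      proof -
        have "C \<le> C * \<rho>" using \<rho> C by simp
        also have "\<dots> = B * (\<rho> - 1)" using \<rho> by (simp add: B_def)
        finally have "B + C \<le> B * \<rho>" by (simp add: algebra_simps)
        hence "(B + C) * (x / \<rho>) \<le> B * \<rho> * (x / \<rho>)" using x by (intro mult_right_mono) auto
        moreover have "B * \<rho> * (x / \<rho>) = B * x" using \<rho> by simp
        moreover have "(B + C) * (x / \<rho>) = B * (x / \<rho>) + C * (x / \<rho>)" by (rule distrib_right)
        ultimately show ?thesis by linarith
      qed
      finally show ?thesis .
    qed
  qed
  show ?thesis
  proof (rule that[OF B])
    fix x :: real assume x: "x \<ge> 1"
    obtain k where "x < \<rho> ^ k" using real_arch_pow[OF \<rho>] by blast
    thus "(\<Sum>n\<in>{n. 1 \<le> n \<and> real n \<le> x}. (norm (A 1 n))\<^sup>2) \<le> B * x"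
      unfolding one by (intro main[of x k] x) simp
  qed
qed

section \<open>Partial sums of Fourier series\<close>

text \<open>Up to pi / 3 the derivative cos t - 1/2 is nonnegative; beyond, sin y is at least sqrt 3
  / 2, which exceeds pi / 4.\<close>

lemma sin_ge_half:
  fixes y :: real
  assumes "0 \<le> y" "y \<le> pi / 2"
  shows "y / 2 \<le> sin y"
proof (cases "y \<le> pi / 3")
  case True
  have "sin 0 - 0 / 2 \<le> sin y - y / 2"
  proof (rule DERIV_nonneg_imp_nondecreasing[OF assms(1)])
    fix t assume t: "0 \<le> t" "t \<le> y"
    have "cos (pi / 3) \<le> cos t" using t True by (intro cos_monotone_0_pi_le) (use pi_gt_zero in linarith)+
    hence "cos t - 1 / 2 \<ge> 0" by (simp add: cos_60)
    moreover have "((\<lambda>t. sin t - t / 2) has_real_derivative cos t - 1 / 2) (at t)"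
      by (auto intro!: derivative_eq_intros)
    ultimately show "\<exists>d. ((\<lambda>t. sin t - t / 2) has_real_derivative d) (at t) \<and> 0 \<le> d" by blast
  qed
  thus ?thesis by simp
next
  case False
  have "sin (pi / 3) \<le> sin y" using False assms by (intro sin_monotone_2pi_le) (use pi_gt_zero in linarith)+
  moreover have "sqrt 3 \<ge> 1.7" by (rule real_le_rsqrt) (simp add: power2_eq_square)
  moreover have "y / 2 \<le> 0.8" using assms pi_less_4 pi_approx by simp
  ultimately show ?thesis by (simp add: sin_60)
qed

lemma norm_e2pi_minus_1:
  fixes x :: real
  assumes "0 \<le> x" "x \<le> 1 / 2"
  shows "x \<le> norm (e2pi (- of_real x) - 1) / 2"
proof -
  have "norm (e2pi (- of_real x) - 1) = norm (cis (2 * pi * (- x)) - 1)"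
    using e2pi_of_real[of "- x"] by (simp add: mult_ac)
  also have "\<dots> = norm (cis (- (pi * x)) * (cis (- (pi * x)) - cis (pi * x)))"
    by (simp add: right_diff_distrib cis_mult mult_ac)
  also have "\<dots> = norm (cis (- (pi * x)) - cis (pi * x))" by (simp add: norm_mult)
  also have "cis (- (pi * x)) - cis (pi * x) = - 2 * \<i> * of_real (sin (pi * x))"
    by (simp add: complex_eq_iff)
  also have "norm \<dots> = 2 * \<bar>sin (pi * x)\<bar>" by (simp add: norm_mult)
  finally have e: "norm (e2pi (- of_real x) - 1) = 2 * \<bar>sin (pi * x)\<bar>" .
  have "pi * x / 2 \<le> sin (pi * x)" 
  proof (rule sin_ge_half)
    have "pi * x \<le> pi * (1 / 2)" using assms by (intro mult_left_mono) auto
    thus "pi * x \<le> pi / 2" by simp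
  qed (use assms in simp)
  moreover have "3 * x \<le> pi * x" using pi_gt3 assms by (intro mult_right_mono) auto
  ultimately show ?thesis unfolding e using assms by linarith
qed

definition dirichlet_sum :: "int \<Rightarrow> nat \<Rightarrow> real \<Rightarrow> complex" where
  "dirichlet_sum a k x = (\<Sum>j<k. e2pi (- (of_int (a + int j) * of_real x)))"

lemma norm_dirichlet_sum_le: "norm (dirichlet_sum a k x) \<le> real k"
proof -
  have "norm (dirichlet_sum a k x) \<le> (\<Sum>j<k. norm (e2pi (- (of_int (a + int j) * of_real x))))"
    unfolding dirichlet_sum_def by (rule norm_sum)
  also have "\<dots> = (\<Sum>j<k. 1)"
  proof (intro sum.cong refl)
    fix j show "norm (e2pi (- (of_int (a + int j) * of_real x))) = 1"
      using norm_e2pi_of_real[of "- (of_int (a + int j) * x)"] by simp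
  qed
  finally show ?thesis by simp
qed

lemma dirichlet_sum_geometric:
  "(e2pi (- of_real x) - 1) * dirichlet_sum a k x = e2pi (- (of_int a * of_real x)) * (e2pi (- of_real x) ^ k - 1)"
proof -
  have "e2pi (- (of_int (a + int j) * of_real x)) = e2pi (- (of_int a * of_real x)) * e2pi (- of_real x) ^ j" for j
  proof (induction j)
    case (Suc j)
    have "e2pi (- (of_int (a + int (Suc j)) * of_real x)) = e2pi (- (of_int (a + int j) * of_real x)) * e2pi (- of_real x)"
      by (simp add: algebra_simps flip: e2pi_add)
    thus ?case unfolding Suc by simp
  qed simp
  hence "dirichlet_sum a k x = e2pi (- (of_int a * of_real x)) * (\<Sum>j<k. e2pi (- of_real x) ^ j)"
    by (simp add: dirichlet_sum_def sum_distrib_left)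
  thus ?thesis using power_diff_1_eq[of "e2pi (- of_real x)" k] by (simp add: mult_ac)
qed

lemma dirichlet_sum_mult_le:
  assumes "0 \<le> x" "x \<le> 1 / 2"
  shows "x * norm (dirichlet_sum a k x) \<le> 1"
proof -
  have n1: "norm (e2pi (- of_real x)) = 1" using norm_e2pi_of_real[of "- x"] by simp
  have n2: "norm (e2pi (- (of_int a * of_real x))) = 1" using norm_e2pi_of_real[of "- (of_int a * x)"] by simp
  have "norm (e2pi (- of_real x) - 1) * norm (dirichlet_sum a k x) = norm (e2pi (- of_real x) ^ k - 1)"
    using arg_cong[OF dirichlet_sum_geometric, of norm x a k] by (simp only: norm_mult n2 mult_1)
  also have "\<dots> \<le> norm (e2pi (- of_real x) ^ k) + norm (1::complex)" by (rule norm_triangle_ineq4)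
  also have "\<dots> = 2" by (simp add: norm_power n1)
  finally have "norm (e2pi (- of_real x) - 1) * norm (dirichlet_sum a k x) \<le> 2" .
  moreover have "x * norm (dirichlet_sum a k x) \<le> norm (e2pi (- of_real x) - 1) / 2 * norm (dirichlet_sum a k x)"
    by (intro mult_right_mono norm_e2pi_minus_1 assms) auto
  ultimately show ?thesis by simp
qed

lemma dirichlet_sum_reflect: "norm (dirichlet_sum a k (1 - x)) = norm (dirichlet_sum a k x)"
proof -
  have "dirichlet_sum a k (1 - x) = cnj (dirichlet_sum a k x)"
    unfolding dirichlet_sum_def cnj_sum
  proof (intro sum.cong refl)
    fix j
    have "e2pi (- (of_int (a + int j) * of_real (1 - x))) = e2pi (of_int (a + int j) * of_real x + of_int (- (a + int j)))"
      by (simp add: algebra_simps)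
    also have "\<dots> = e2pi (of_int (a + int j) * of_real x)" by (rule e2pi_add_int)
    also have "\<dots> = cnj (e2pi (- (of_int (a + int j) * of_real x)))"
      using cnj_e2pi_of_real[of "- (of_int (a + int j) * x)"] by simp
    finally show "e2pi (- (of_int (a + int j) * of_real (1 - x))) = cnj (e2pi (- (of_int (a + int j) * of_real x)))" .
  qed
  thus ?thesis by simp
qed

lemma continuous_on_dirichlet_sum: "continuous_on S (dirichlet_sum a k)"
  unfolding dirichlet_sum_def by (intro continuous_intros)

text \<open>The bound min (k, 1 / x) is at most 2 k / (1 + k x), which has an elementary primitive;
  the right half of the interval is its mirror image.\<close>

lemma dirichlet_sum_L1:
  "integral {0..1} (\<lambda>x. norm (dirichlet_sum a k x)) \<le> 4 * ln (1 + real k)"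
proof -
  let ?L = "real k"
  let ?u = "\<lambda>x. 2 * ?L / (1 + ?L * x)" and ?v = "\<lambda>x. 2 * ?L / (1 + ?L * (1 - x))"
  have pt: "d \<le> 2 * ?L / (1 + ?L * x)" if "d \<le> ?L" "x * d \<le> 1" "0 \<le> x" "0 \<le> d" for d x
  proof -
    have "d * (1 + ?L * x) = d + ?L * (x * d)" by (simp add: algebra_simps)
    also have "\<dots> \<le> ?L + ?L * 1" using that by (intro add_mono mult_left_mono) auto
    finally show ?thesis using that by (simp add: pos_le_divide_eq add_pos_nonneg)
  qed
  have bound: "norm (dirichlet_sum a k x) \<le> ?u x + ?v x" if x: "x \<in> {0..1}" for x
  proof (cases "x \<le> 1 / 2")
    case True
    hence "norm (dirichlet_sum a k x) \<le> ?u x"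
      using x by (intro pt norm_dirichlet_sum_le dirichlet_sum_mult_le) auto
    moreover have "?v x \<ge> 0" using x by simp
    ultimately show ?thesis by linarith
  next
    case False
    hence "norm (dirichlet_sum a k (1 - x)) \<le> ?v x"
      using x by (intro pt norm_dirichlet_sum_le dirichlet_sum_mult_le) auto
    moreover have "?u x \<ge> 0" using x by simp
    ultimately show ?thesis by (simp add: dirichlet_sum_reflect)
  qed
  have "(?u has_integral 2 * ln (1 + ?L * 1) - 2 * ln (1 + ?L * 0)) {0..1}"
  proof (rule fundamental_theorem_of_calculus)
    fix x :: real assume x: "x \<in> {0..1}"
    have "1 + ?L * x > 0" using x by (intro add_pos_nonneg) auto
    hence "((\<lambda>x. 2 * ln (1 + ?L * x)) has_real_derivative ?u x) (at x)"
      by (auto intro!: derivative_eq_intros)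
    thus "((\<lambda>x. 2 * ln (1 + ?L * x)) has_vector_derivative ?u x) (at x within {0..1})"
      by (simp add: has_real_derivative_iff_has_vector_derivative has_vector_derivative_at_within)
  qed simp
  moreover have "(?v has_integral - 2 * ln (1 + ?L * (1 - 1)) - - 2 * ln (1 + ?L * (1 - 0))) {0..1}"
  proof (rule fundamental_theorem_of_calculus)
    fix x :: real assume x: "x \<in> {0..1}"
    have "1 + ?L * (1 - x) > 0" using x by (intro add_pos_nonneg) auto
    hence "((\<lambda>x. - 2 * ln (1 + ?L * (1 - x))) has_real_derivative ?v x) (at x)"
      by (auto intro!: derivative_eq_intros)
    thus "((\<lambda>x. - 2 * ln (1 + ?L * (1 - x))) has_vector_derivative ?v x) (at x within {0..1})"
      by (simp add: has_real_derivative_iff_has_vector_derivative has_vector_derivative_at_within)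
  qed simp
  ultimately have "((\<lambda>x. ?u x + ?v x) has_integral (2 * ln (1 + ?L * 1) - 2 * ln (1 + ?L * 0)) +
      (- 2 * ln (1 + ?L * (1 - 1)) - - 2 * ln (1 + ?L * (1 - 0)))) {0..1}"
    by (rule has_integral_add)
  hence uv: "((\<lambda>x. ?u x + ?v x) has_integral 4 * ln (1 + ?L)) {0..1}" by simp
  have "integral {0..1} (\<lambda>x. norm (dirichlet_sum a k x)) \<le> integral {0..1} (\<lambda>x. ?u x + ?v x)"
  proof (rule integral_le)
    show "(\<lambda>x. norm (dirichlet_sum a k x)) integrable_on {0..1}"
      by (intro integrable_continuous_real continuous_intros continuous_on_dirichlet_sum)
    show "(\<lambda>x. ?u x + ?v x) integrable_on {0..1}" using uv by (rule has_integral_integrable)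
  qed (rule bound)
  thus ?thesis using integral_unique[OF uv] by simp
qed

text \<open>For complex series \<open>has_sum\<close> implies absolute convergence, and the moduli
  of the terms do not depend on x, so one finite set of frequencies approximates the series
  uniformly.\<close>

lemma trig_series_truncate:
  fixes c :: "int \<Rightarrow> complex"
  assumes F: "\<And>x::real. ((\<lambda>m. c m * e2pi (of_int m * of_real x)) has_sum F x) UNIV" "\<And>x. norm (F x) \<le> M"
    and I: "finite I" and \<epsilon>: "\<epsilon> > 0"
  obtains X where "finite X" "I \<subseteq> X" "\<And>x::real. norm (\<Sum>m\<in>X. c m * e2pi (of_int m * of_real x)) \<le> M + \<epsilon>"
proof -
  let ?t = "\<lambda>x m. c m * e2pi (of_int m * of_real x)"
  have nt: "norm (?t x m) = norm (c m)" for x m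
    using norm_e2pi_of_real[of "of_int m * x"] by (simp add: norm_mult)
  have "?t 0 summable_on UNIV" using F(1)[of 0] by (rule has_sum_imp_summable)
  hence "(\<lambda>m. norm (?t 0 m)) summable_on UNIV" by (simp add: summable_on_iff_abs_summable_on_complex)
  hence S: "(\<lambda>m. norm (c m)) summable_on UNIV" by simp
  obtain X0 where X0: "finite X0" "dist (sum (\<lambda>m. norm (c m)) X0) (infsum (\<lambda>m. norm (c m)) UNIV) \<le> \<epsilon>"
    using infsum_finite_approximation[OF S \<epsilon>] by blast
  let ?X = "X0 \<union> I"
  have fin: "finite ?X" using X0 I by simp
  have tail: "infsum (\<lambda>m. norm (c m)) (- ?X) \<le> \<epsilon>"
  proof -
    have "infsum (\<lambda>m. norm (c m)) UNIV - sum (\<lambda>m. norm (c m)) ?X = infsum (\<lambda>m. norm (c m)) (UNIV - ?X)"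
      using infsum_Diff[OF S summable_on_finite[OF fin]] fin by simp
    moreover have "sum (\<lambda>m. norm (c m)) X0 \<le> sum (\<lambda>m. norm (c m)) ?X" using fin by (intro sum_mono2) auto
    ultimately show ?thesis using X0(2) by (simp add: dist_real_def Compl_eq_Diff_UNIV)
  qed
  show ?thesis
  proof (rule that[OF fin])
    fix x :: real
    have sx: "?t x summable_on UNIV" using F(1) by (rule has_sum_imp_summable)
    have "infsum (?t x) UNIV - sum (?t x) ?X = infsum (?t x) (UNIV - ?X)"
      using infsum_Diff[OF sx summable_on_finite[OF fin]] fin by simp
    hence "sum (?t x) ?X = F x - infsum (?t x) (- ?X)"
      using infsumI[OF F(1)[of x]] by (simp add: Compl_eq_Diff_UNIV algebra_simps)
    moreover have "norm (infsum (?t x) (- ?X)) \<le> \<epsilon>"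
    proof -
      have "(\<lambda>m. norm (?t x m)) summable_on (- ?X)"
        unfolding nt by (rule summable_on_subset_banach[OF S]) simp
      hence "norm (infsum (?t x) (- ?X)) \<le> infsum (\<lambda>m. norm (?t x m)) (- ?X)" by (rule norm_infsum_bound)
      thus ?thesis using tail unfolding nt by linarith
    qed
    ultimately show "norm (sum (?t x) ?X) \<le> M + \<epsilon>"
      using F(2)[of x] norm_triangle_ineq4[of "F x" "infsum (?t x) (- ?X)"] by simp
  qed simp
qed

text \<open>A partial sum is the integral of the series against a Dirichlet kernel. Orthogonality is
  applied to a finite truncation that contains the frequencies in question, and the error \<epsilon>
  is removed at the end.\<close>

lemma trig_series_partial_sum:
  fixes c :: "int \<Rightarrow> complex"
  assumes F: "\<And>x::real. ((\<lambda>m. c m * e2pi (of_int m * of_real x)) has_sum F x) UNIV" "\<And>x. norm (F x) \<le> M"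
  shows "norm (\<Sum>j<k. c (a + int j) * e2pi (of_int (a + int j) * of_real \<alpha>)) \<le> M * (4 * ln (1 + real k))"
proof -
  let ?T = "\<Sum>j<k. c (a + int j) * e2pi (of_int (a + int j) * of_real \<alpha>)"
  have "norm ?T \<le> (M + \<epsilon>) * (4 * ln (1 + real k))" if \<epsilon>: "\<epsilon> > 0" for \<epsilon>
  proof -
    have M: "M \<ge> 0" using F(2)[of 0] norm_ge_zero order_trans by blast
    obtain X where X: "finite X" "(\<lambda>j. a + int j) ` {..<k} \<subseteq> X"
      "\<And>x::real. norm (\<Sum>m\<in>X. c m * e2pi (of_int m * of_real x)) \<le> M + \<epsilon>"
      using trig_series_truncate[OF F, of "(\<lambda>j. a + int j) ` {..<k}" \<epsilon>] \<epsilon> by blast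
    define S where "S x = (\<Sum>m\<in>X. c m * e2pi (of_int m * of_real (x + \<alpha>)))" for x :: real
    have int1: "integral {0..1} (\<lambda>x. S x * e2pi (- (of_int n * of_real x))) = c n * e2pi (of_int n * of_real \<alpha>)"
      if n: "n \<in> X" for n
    proof -
      have "integral {0..1} (\<lambda>x. S x * e2pi (- (of_int n * of_real x))) =
        integral {0..1} (\<lambda>x. \<Sum>m\<in>X. c m * e2pi (of_int m * of_real \<alpha>) * e2pi (of_int (m - n) * of_real x))"
      proof -
        have "S x * e2pi (- (of_int n * of_real x)) = (\<Sum>m\<in>X. c m * e2pi (of_int m * of_real \<alpha>) * e2pi (of_int (m - n) * of_real x))" for x
          unfolding S_def sum_distrib_right
          by (intro sum.cong refl) (simp add: mult.assoc algebra_simps flip: e2pi_add)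
        thus ?thesis by simp
      qed
      also have "\<dots> = (\<Sum>m\<in>X. integral {0..1} (\<lambda>x. c m * e2pi (of_int m * of_real \<alpha>) * e2pi (of_int (m - n) * of_real x)))"
        by (intro integral_sum X(1) integrable_continuous_real continuous_intros)
      also have "\<dots> = (\<Sum>m\<in>X. c m * e2pi (of_int m * of_real \<alpha>) * (if m - n = 0 then 1 else 0))"
        by (simp only: integral_mult_right integral_e2pi)
      also have "\<dots> = (\<Sum>m\<in>X. if m = n then c m * e2pi (of_int m * of_real \<alpha>) else 0)"
        by (intro sum.cong refl) simp
      finally show ?thesis using n X(1) by simp
    qed
    have cS: "continuous_on {0..1} S" unfolding S_def by (intro continuous_intros)
    have "?T = (\<Sum>j<k. integral {0..1} (\<lambda>x. S x * e2pi (- (of_int (a + int j) * of_real x))))"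
      using X(2) by (intro sum.cong refl int1[symmetric]) auto
    also have "\<dots> = integral {0..1} (\<lambda>x. S x * dirichlet_sum a k x)"
      unfolding dirichlet_sum_def sum_distrib_left
      by (intro integral_sum[symmetric] finite_lessThan integrable_continuous_real continuous_intros cS)
    finally have "norm ?T = norm (integral {0..1} (\<lambda>x. S x * dirichlet_sum a k x))" by simp
    also have "\<dots> \<le> integral {0..1} (\<lambda>x. (M + \<epsilon>) * norm (dirichlet_sum a k x))"
    proof (rule integral_norm_bound_integral)
      show "norm (S x * dirichlet_sum a k x) \<le> (M + \<epsilon>) * norm (dirichlet_sum a k x)" for x
        unfolding norm_mult S_def by (intro mult_right_mono X(3)) auto
    qed (intro integrable_continuous_real continuous_intros cS continuous_on_dirichlet_sum)+
    also have "\<dots> = (M + \<epsilon>) * integral {0..1} (\<lambda>x. norm (dirichlet_sum a k x))" by simp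
    also have "\<dots> \<le> (M + \<epsilon>) * (4 * ln (1 + real k))"
      using M \<epsilon> by (intro mult_left_mono dirichlet_sum_L1) auto
    finally show ?thesis .
  qed
  hence "norm ?T \<le> M * (4 * ln (1 + real k)) + e" if "e > 0" for e
  proof -
    let ?l = "4 * ln (1 + real k)"
    have l: "?l \<ge> 0" by simp
    have "norm ?T \<le> (M + e / (1 + ?l)) * ?l"
      using that l \<open>\<And>\<epsilon>. \<epsilon> > 0 \<Longrightarrow> norm ?T \<le> (M + \<epsilon>) * ?l\<close> by (simp add: add_pos_nonneg)
    also have "\<dots> = M * ?l + e * (?l / (1 + ?l))" by (simp add: algebra_simps)
    also have "\<dots> \<le> M * ?l + e * 1" using that l by (intro add_left_mono mult_left_mono) (auto simp: divide_le_eq add_pos_nonneg)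
    finally show ?thesis by simp
  qed
  thus ?thesis by (rule field_le_epsilon)
qed

section \<open>Exponential sums from bounded Fourier series\<close>

lemma abel_summation_bound:
  fixes t v :: "nat \<Rightarrow> complex"
  assumes T: "\<And>m. m \<le> k \<Longrightarrow> norm (\<Sum>j<m. t j) \<le> T0" and V: "\<And>j. j < k \<Longrightarrow> norm (v j) \<le> V"
    and W: "\<And>j. Suc j < k \<Longrightarrow> norm (v j - v (Suc j)) \<le> W" and nn: "0 \<le> V" "0 \<le> W"
  shows "norm (\<Sum>j<k. t j * v j) \<le> T0 * (V + real k * W)"
proof -
  have T0: "T0 \<ge> 0" using T[of 0] by simp
  have id: "(\<Sum>j<Suc m. t j * v j) = (\<Sum>j<Suc m. t j) * v m + (\<Sum>j<m. (\<Sum>i<Suc j. t i) * (v j - v (Suc j)))" for m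
    by (induction m) (simp_all add: algebra_simps)
  show ?thesis
  proof (cases k)
    case (Suc m)
    have "norm (\<Sum>j<k. t j * v j) \<le> norm ((\<Sum>j<Suc m. t j) * v m) + norm (\<Sum>j<m. (\<Sum>i<Suc j. t i) * (v j - v (Suc j)))"
      unfolding Suc id by (rule norm_triangle_ineq)
    also have "norm ((\<Sum>j<Suc m. t j) * v m) \<le> T0 * V"
      unfolding norm_mult using Suc T0 by (intro mult_mono T V) auto
    also have "norm (\<Sum>j<m. (\<Sum>i<Suc j. t i) * (v j - v (Suc j))) \<le> (\<Sum>j<m. T0 * W)"
      unfolding norm_mult by (intro sum_norm_le) (unfold norm_mult, use Suc T0 in \<open>intro mult_mono T W; auto\<close>)
    also have "(\<Sum>j<m. T0 * W) \<le> T0 * (real k * W)" using Suc T0 nn by (simp add: mult_ac mult_right_mono algebra_simps)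
    finally show ?thesis by (simp add: algebra_simps)
  qed (use T0 nn in simp)
qed

text \<open>At height y = u1 / x the arguments n y of the block lie in the window from u0 to u1,
  where \<open>g\<close> is bounded below and Lipschitz. The reciprocal of \<open>g\<close> then has
  bounded variation over the block, and the factor 1 / sqrt y = sqrt (x / u1) gives the size of the
  bound.\<close>

lemma block_exp_sum_bound:
  fixes rho :: "int \<Rightarrow> complex" and g :: "real \<Rightarrow> complex"
  assumes F: "\<And>y. y > 0 \<Longrightarrow> \<exists>F. \<forall>x::real.
      ((\<lambda>n. of_real (sqrt y) * rho n * g (\<bar>real_of_int n\<bar> * y) * e2pi (of_int n * of_real x)) has_sum F x) UNIV
      \<and> norm (F x) \<le> M"
    and u: "0 < u0" "u0 < u1" and \<gamma>: "\<gamma> > 0" "\<And>u. u \<in> {u0..u1} \<Longrightarrow> \<gamma> \<le> norm (g u)"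
    and lip: "\<And>u v. u \<in> {u0..u1} \<Longrightarrow> v \<in> {u0..u1} \<Longrightarrow> norm (g u - g v) \<le> \<Lambda> * \<bar>u - v\<bar>" "\<Lambda> \<ge> 0"
    and x: "x \<ge> 1"
  shows "norm (\<Sum>n | x * (u0 / u1) < real n \<and> real n \<le> x. rho (int n) * e2pi (of_nat n * of_real \<alpha>))
    \<le> 4 * M / sqrt u1 * (1 / \<gamma> + u1 * \<Lambda> / \<gamma>\<^sup>2) * sqrt x * (1 + ln x)"
proof -
  define y where "y = u1 / x"
  have y: "y > 0" using u x by (simp add: y_def)
  have xy: "x * y = u1" using x by (simp add: y_def)
  obtain F where F': "\<And>x::real. ((\<lambda>n. of_real (sqrt y) * rho n * g (\<bar>real_of_int n\<bar> * y) * e2pi (of_int n * of_real x)) has_sum F x) UNIV"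
    "\<And>x. norm (F x) \<le> M" using F[OF y] by blast
  have M: "M \<ge> 0" using F'(2)[of 0] norm_ge_zero order_trans by blast
  \<comment> \<open>The least integer exceeding x u0 / u1; the added 1 reflects the strict
    inequality at the lower end of the block.\<close>
  define a where "a = nat \<lfloor>x * (u0 / u1)\<rfloor> + 1"
  define k where "k = nat \<lfloor>x\<rfloor> + 1 - a"
  have set: "{n. x * (u0 / u1) < real n \<and> real n \<le> x} = {a..<a + k}"
  proof -
    have "x * (u0 / u1) \<ge> 0" using u x by simp
    hence "x * (u0 / u1) < real n \<longleftrightarrow> a \<le> n" for n unfolding a_def by linarith
    moreover have "real n \<le> x \<longleftrightarrow> n < nat \<lfloor>x\<rfloor> + 1" for n using x by linarith
    ultimately show ?thesis unfolding k_def by auto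
  qed
  have kx: "real k \<le> x" unfolding k_def a_def using x by linarith
  have rng: "(real a + real j) * y \<in> {u0..u1}" if "j < k" for j
  proof -
    have "a + j \<in> {a..<a + k}" using that by simp
    hence n: "x * (u0 / u1) < real (a + j)" "real (a + j) \<le> x" unfolding set[symmetric] by auto
    have "x * (u0 / u1) * y \<le> real (a + j) * y" "real (a + j) * y \<le> x * y"
      using n y by (simp_all only: mult_right_mono less_imp_le)
    moreover have "x * (u0 / u1) * y = u0" using xy u by (simp add: field_simps)
    ultimately show ?thesis using xy by simp
  qed
  define t where "t j = of_real (sqrt y) * rho (int a + int j) * g ((real a + real j) * y) * e2pi (of_int (int a + int j) * of_real \<alpha>)" for j
  define v where "v j = 1 / (of_real (sqrt y) * g ((real a + real j) * y))" for j
  have gnz: "g ((real a + real j) * y) \<noteq> 0" if "j < k" for j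
    using \<gamma>(1) \<gamma>(2)[OF rng[OF that]] by auto
  have "(\<Sum>n | x * (u0 / u1) < real n \<and> real n \<le> x. rho (int n) * e2pi (of_nat n * of_real \<alpha>))
     = (\<Sum>j<k. t j * v j)"
    unfolding set
  proof (rule sum.reindex_bij_witness[of _ "\<lambda>j. a + j" "\<lambda>n. n - a"])
    fix n assume n: "n \<in> {a..<a + k}"
    then obtain j where j: "n = a + j" "j < k" by (metis add_less_cancel_left atLeastLessThan_iff le_Suc_ex)
    show "t (n - a) * v (n - a) = rho (int n) * e2pi (of_nat n * of_real \<alpha>)"
      using gnz[OF j(2)] y unfolding j(1) t_def v_def by simp
  qed auto
  also have "norm \<dots> \<le> 4 * M * (1 + ln x) * (1 / (sqrt y * \<gamma>) + real k * (\<Lambda> * y / (sqrt y * \<gamma>\<^sup>2)))"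
  proof (rule abel_summation_bound)
    fix m assume m: "m \<le> k"
    have "norm (\<Sum>j<m. t j) \<le> M * (4 * ln (1 + real m))"
      using trig_series_partial_sum[OF F', of "int a" \<alpha> m] unfolding t_def by simp
    also have "ln (1 + real m) \<le> ln (2 * x)" using m kx x by simp
    hence "M * (4 * ln (1 + real m)) \<le> M * (4 * (1 + ln x))"
      using M ln_2_less_1 x by (intro mult_left_mono) (auto simp: ln_mult)
    finally show "norm (\<Sum>j<m. t j) \<le> 4 * M * (1 + ln x)" by (simp add: algebra_simps)
  next
    fix j assume j: "j < k"
    show "norm (v j) \<le> 1 / (sqrt y * \<gamma>)"
      unfolding v_def using \<gamma>(2)[OF rng[OF j]] \<gamma>(1) y
      by (simp add: norm_divide norm_mult frac_le)
  next
    fix j assume j: "Suc j < k"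
    let ?g = "g ((real a + real j) * y)" and ?g' = "g ((real a + real (Suc j)) * y)"
    have r: "(real a + real j) * y \<in> {u0..u1}" "(real a + real (Suc j)) * y \<in> {u0..u1}"
      using j by (auto intro!: rng simp del: atLeastAtMost_iff of_nat_Suc)
    have nz: "?g \<noteq> 0" "?g' \<noteq> 0" using gnz[of j] gnz[of "Suc j"] j by auto
    have "v j - v (Suc j) = (?g' - ?g) / (of_real (sqrt y) * (?g * ?g'))"
      unfolding v_def using nz y by (simp add: field_simps del: of_nat_Suc)
    hence "norm (v j - v (Suc j)) = norm (?g' - ?g) / (sqrt y * (norm ?g * norm ?g'))"
      using y by (simp add: norm_divide norm_mult del: of_nat_Suc)
    also have "\<dots> \<le> \<Lambda> * y / (sqrt y * (\<gamma> * \<gamma>))"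
    proof (intro frac_le mult_left_mono mult_mono \<gamma>(2) r)
      have "\<bar>(real a + real (Suc j)) * y - (real a + real j) * y\<bar> = y" using y by (simp add: algebra_simps)
      thus "norm (?g' - ?g) \<le> \<Lambda> * y" using lip(1)[OF r(2,1)] by metis
    qed (use \<gamma>(1) lip(2) y in auto)
    finally show "norm (v j - v (Suc j)) \<le> \<Lambda> * y / (sqrt y * \<gamma>\<^sup>2)" by (simp add: power2_eq_square)
  qed (use \<gamma> lip y in auto)
  also have "\<dots> \<le> 4 * M * (1 + ln x) * (1 / (sqrt y * \<gamma>) + x * (\<Lambda> * y / (sqrt y * \<gamma>\<^sup>2)))"
    using kx M x lip y \<gamma> by (intro mult_left_mono add_left_mono mult_right_mono) auto
  also have "1 / (sqrt y * \<gamma>) + x * (\<Lambda> * y / (sqrt y * \<gamma>\<^sup>2)) = 1 / sqrt y * (1 / \<gamma> + (x * y) * \<Lambda> / \<gamma>\<^sup>2)"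
    by (simp add: distrib_left mult_ac)
  also have "1 / sqrt y = sqrt x / sqrt u1" by (simp add: y_def real_sqrt_divide)
  also have "4 * M * (1 + ln x) * (sqrt x / sqrt u1 * K) = 4 * M / sqrt u1 * K * sqrt x * (1 + ln x)" for K by simp
  finally show ?thesis unfolding xy .
qed

text \<open>Blocks of ratio u0 / u1 are summed geometrically. The general weight \<open>g\<close>
  covers u^((k-1)/2) exp (-2 pi u) and the Bessel function K alike; the factor sqrt y is that of the
  Maass expansion and, in the holomorphic case, completes y^((k-1)/2) to y^(k/2).\<close>

lemma exp_sum_bound_of_bounded_series:
  fixes rho :: "int \<Rightarrow> complex" and g :: "real \<Rightarrow> complex"
  assumes F: "\<And>y. y > 0 \<Longrightarrow> \<exists>F. \<forall>x::real.
      ((\<lambda>n. of_real (sqrt y) * rho n * g (\<bar>real_of_int n\<bar> * y) * e2pi (of_int n * of_real x)) has_sum F x) UNIV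
      \<and> norm (F x) \<le> M"
    and u: "0 < u0" "u0 < u1" and \<gamma>: "\<gamma> > 0" "\<And>u. u \<in> {u0..u1} \<Longrightarrow> \<gamma> \<le> norm (g u)"
    and lip: "\<And>u v. u \<in> {u0..u1} \<Longrightarrow> v \<in> {u0..u1} \<Longrightarrow> norm (g u - g v) \<le> \<Lambda> * \<bar>u - v\<bar>" "\<Lambda> \<ge> 0"
  obtains C where "C > 0" "\<And>x \<alpha>. x \<ge> 1 \<Longrightarrow>
    norm (\<Sum>n | 1 \<le> n \<and> real n \<le> x. rho (int n) * e2pi (of_nat n * of_real \<alpha>)) \<le> C * sqrt x * (1 + ln x)"
proof -
  define D where "D = 4 * M / sqrt u1 * (1 / \<gamma> + u1 * \<Lambda> / \<gamma>\<^sup>2)"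
  define r where "r = u0 / u1"
  have r: "0 < r" "r < 1" using u by (auto simp: r_def)
  have M: "M \<ge> 0" using F[of 1] norm_ge_zero order_trans by (metis zero_less_one)
  have D: "D \<ge> 0" unfolding D_def using M u \<gamma> lip by simp
  \<comment> \<open>This makes C (1 - sqrt r) = D + 1, hence C sqrt r + D \<le> C, the inequality
    that closes the induction.\<close>
  define C where "C = (D + 1) / (1 - sqrt r)"
  have sr: "sqrt r < 1" "0 < sqrt r" using r by auto
  have C: "C > 0" unfolding C_def using D sr by (intro divide_pos_pos) auto
  have CD: "C * sqrt r + D \<le> C"
  proof -
    have "C * (1 - sqrt r) = D + 1" unfolding C_def using sr by simp
    thus ?thesis by (simp add: algebra_simps)
  qed
  define T where "T x \<alpha> = (\<Sum>n | 1 \<le> n \<and> real n \<le> x. rho (int n) * e2pi (of_nat n * of_real \<alpha>))" for x \<alpha>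
  have fin: "finite {n. 1 \<le> n \<and> real n \<le> x}" for x
    by (rule finite_subset[of _ "{..nat \<lfloor>x\<rfloor>}"]) (auto simp: le_nat_floor)
  have split: "T x \<alpha> = T (x * r) \<alpha> + (\<Sum>n | x * r < real n \<and> real n \<le> x. rho (int n) * e2pi (of_nat n * of_real \<alpha>))"
    if x: "x \<ge> 1" for x \<alpha>
  proof -
    have xr: "0 < x * r" "x * r \<le> x" using x r by (auto simp: mult_le_cancel_left1)
    have A: "{n. 1 \<le> n \<and> real n \<le> x} = {n. 1 \<le> n \<and> real n \<le> x * r} \<union> {n. x * r < real n \<and> real n \<le> x}"
      using xr by (auto simp: Suc_le_eq intro: ccontr)
    have B: "finite {n. x * r < real n \<and> real n \<le> x}"
      by (rule finite_subset[of _ "{..nat \<lfloor>x\<rfloor>}"]) (auto simp: le_nat_floor)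
    have "{n. 1 \<le> n \<and> real n \<le> x * r} \<inter> {n. x * r < real n \<and> real n \<le> x} = {}" by auto
    from sum.union_disjoint[OF fin B this] show ?thesis unfolding T_def A .
  qed
  have step: "norm (T x \<alpha>) \<le> C * sqrt x * (1 + ln x)" if "1 \<le> x" "x * r ^ k < 1" for x \<alpha> k
    using that
  proof (induction k arbitrary: x)
    case (Suc k)
    have lx: "0 \<le> sqrt x * (1 + ln x)" using Suc.prems(1) by simp
    have "norm (T (x * r) \<alpha>) \<le> C * sqrt r * (sqrt x * (1 + ln x))"
    proof (cases "1 \<le> x * r")
      case True
      have "x * r * r ^ k < 1" using Suc.prems by (simp add: mult_ac)
      with True have "norm (T (x * r) \<alpha>) \<le> C * sqrt (x * r) * (1 + ln (x * r))" by (rule Suc.IH)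
      also have "\<dots> \<le> C * sqrt (x * r) * (1 + ln x)"
        using C Suc.prems(1) r True by (intro mult_left_mono) auto
      finally show ?thesis by (simp add: real_sqrt_mult mult_ac)
    next
      case False
      hence "{n. 1 \<le> n \<and> real n \<le> x * r} = {}" by auto
      hence "T (x * r) \<alpha> = 0" unfolding T_def by (simp only: sum.empty)
      thus ?thesis
        using mult_nonneg_nonneg[OF mult_nonneg_nonneg[OF less_imp_le[OF C] less_imp_le[OF sr(2)]] lx]
        by (simp only: norm_zero)
    qed
    moreover have "norm (\<Sum>n | x * r < real n \<and> real n \<le> x. rho (int n) * e2pi (of_nat n * of_real \<alpha>)) \<le> D * (sqrt x * (1 + ln x))"
      using block_exp_sum_bound[OF F u \<gamma> lip Suc.prems(1), of \<alpha>] unfolding D_def r_def by (simp add: mult.assoc)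
    ultimately have "norm (T x \<alpha>) \<le> C * sqrt r * (sqrt x * (1 + ln x)) + D * (sqrt x * (1 + ln x))"
      unfolding split[OF Suc.prems(1)] by (rule norm_triangle_mono)
    also have "\<dots> = (C * sqrt r + D) * (sqrt x * (1 + ln x))" by (simp add: distrib_right)
    also have "\<dots> \<le> C * (sqrt x * (1 + ln x))" by (rule mult_right_mono[OF CD lx])
    finally show ?case by (simp add: mult.assoc)
  qed simp
  show ?thesis
  proof (rule that[OF C])
    fix x \<alpha> :: real assume x: "x \<ge> 1"
    obtain k where "r ^ k < 1 / x" using real_arch_pow_inv[of "1 / x" r] x r by auto
    hence "x * r ^ k < 1" using x by (simp add: field_simps)
    from step[OF x this] show "norm (\<Sum>n | 1 \<le> n \<and> real n \<le> x. rho (int n) * e2pi (of_nat n * of_real \<alpha>)) \<le> C * sqrt x * (1 + ln x)"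
      unfolding T_def .
  qed
qed

section \<open>The Bessel function \<open>K\<close>\<close>

lemma set_integrable_exp_minus: "set_integrable lborel {0..} (\<lambda>s::real. exp (- s))"
  and set_integral_exp_minus: "(LBINT s:{0..}. exp (- s)) = (1::real)"
proof -
  have hi: "((\<lambda>s::real. exp (- s)) has_integral 1) {0..}"
    using has_integral_exp_minus_to_infinity[of 1 0] by simp
  hence "(\<lambda>s::real. exp (- s)) absolutely_integrable_on {0..}"
    by (intro nonnegative_absolutely_integrable_1) (auto simp: has_integral_integrable)
  moreover have bm: "(\<lambda>s::real. indicator {0..} s *\<^sub>R exp (- s)) \<in> borel_measurable borel" by measurable
  ultimately show i: "set_integrable lborel {0..} (\<lambda>s::real. exp (- s))"
    unfolding set_integrable_def by (simp add: integrable_completion)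
  show "(LBINT s:{0..}. exp (- s)) = (1::real)"
    using set_borel_integral_eq_integral(2)[OF i] integral_unique[OF hi] by simp
qed

lemma set_integral_exp_decay:
  fixes f :: "real \<Rightarrow> complex"
  assumes f: "continuous_on UNIV f" and A: "A \<in> sets borel" "A \<subseteq> {0..}"
    and B: "B \<ge> 0" "\<And>s. s \<in> A \<Longrightarrow> norm (f s) \<le> B * exp (- s)"
  shows "set_integrable lborel A f" "norm (LBINT s:A. f s) \<le> B"
proof -
  have 1: "set_integrable lborel {0..} (\<lambda>s. B * exp (- s))"
    using set_integrable_exp_minus by simp
  hence 2: "set_integrable lborel A (\<lambda>s. B * exp (- s))"
    by (rule set_integrable_subset) (use A in simp_all)
  have [measurable]: "f \<in> borel_measurable borel" using f by (rule borel_measurable_continuous_onI)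
  show 3: "set_integrable lborel A f"
    by (rule set_integrable_bound[OF 2]) (use A B in \<open>auto simp: set_borel_measurable_def\<close>)
  have "norm (LBINT s:A. f s) \<le> (\<integral>s. indicator {0..} s *\<^sub>R (B * exp (- s)) \<partial>lborel)"
    unfolding set_lebesgue_integral_def
  proof (rule Bochner_Integration.integral_norm_bound_integral)
    show "integrable lborel (\<lambda>s. indicator A s *\<^sub>R f s)" using 3 by (simp add: set_integrable_def)
    show "integrable lborel (\<lambda>s. indicator {0..} s *\<^sub>R (B * exp (- s)))" using 1 by (simp add: set_integrable_def)
  qed (use A B in \<open>auto split: split_indicator\<close>)
  also have "\<dots> = (LBINT s:{0..}. B * exp (- s))" by (simp only: set_lebesgue_integral_def)
  also have "\<dots> = B" by (simp only: set_integral_mult_right set_integral_exp_minus mult_1_right)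
  finally show "norm (LBINT s:A. f s) \<le> B" .
qed

lemma norm_cosh_le: "norm (cosh (z::complex)) \<le> exp (norm z)"
proof -
  have "norm (cosh z) \<le> (norm (exp z) + norm (exp (- z))) / 2"
    unfolding cosh_field_def using norm_triangle_ineq[of "exp z" "exp (- z)"] by (simp add: norm_divide)
  also have "\<dots> \<le> (exp (norm z) + exp (norm z)) / 2"
    using norm_exp[of z] norm_exp[of "- z"] by (intro divide_right_mono add_mono) (simp_all only: norm_minus_cancel zero_le_numeral)
  also have "\<dots> = exp (norm z)" by simp
  finally show ?thesis .
qed

text \<open>From cosh s \<ge> s^2 / 4 by completing the square: (\<kappa> s / 2 - (a + 1))^2 /
  \<kappa> is nonnegative.\<close>

lemma exp_cosh_decay:
  fixes \<kappa> a s :: real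
  assumes "\<kappa> > 0" "s \<ge> 0"
  shows "exp (- \<kappa> * cosh s + a * s) \<le> exp ((a + 1)\<^sup>2 / \<kappa>) * exp (- s)"
proof -
  have "s\<^sup>2 / 4 \<le> cosh s"
  proof -
    have "1 + s + s\<^sup>2 / 2 \<le> exp s" using exp_lower_Taylor_quadratic[of s] assms by simp
    hence "s\<^sup>2 / 2 \<le> exp s" using assms by linarith
    moreover have "exp s / 2 \<le> cosh s" by (simp add: cosh_field_def)
    ultimately show ?thesis by simp
  qed
  hence "\<kappa> * (s\<^sup>2 / 4) \<le> \<kappa> * cosh s" using assms by (intro mult_left_mono) auto
  moreover have "0 \<le> (\<kappa> * s / 2 - (a + 1))\<^sup>2 / \<kappa>" using assms by simp
  moreover have "(\<kappa> * s / 2 - (a + 1))\<^sup>2 / \<kappa> = \<kappa> * (s\<^sup>2 / 4) - (a + 1) * s + (a + 1)\<^sup>2 / \<kappa>"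
    using assms by (simp add: power2_eq_square field_simps)
  moreover have "(a + 1) * s = a * s + s" by (simp add: algebra_simps)
  ultimately have "- \<kappa> * cosh s + a * s \<le> (a + 1)\<^sup>2 / \<kappa> + - s" by simp
  thus ?thesis unfolding exp_add[symmetric] by (rule exp_le_cancel_iff[THEN iffD2])
qed

definition bessel_kernel :: "complex \<Rightarrow> real \<Rightarrow> real \<Rightarrow> complex" where
  "bessel_kernel \<nu> u s = of_real (exp (- u * cosh s)) * cosh (\<nu> * of_real s)"

lemma bessel_K_eq: "bessel_K \<nu> u = (LBINT s:{0..}. bessel_kernel \<nu> u s)"
  by (simp add: bessel_K_def bessel_kernel_def)

lemma continuous_on_bessel_kernel: "continuous_on S (bessel_kernel \<nu> u)"
  unfolding bessel_kernel_def by (intro continuous_intros)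

lemma norm_bessel_kernel_le:
  assumes "s \<ge> 0"
  shows "norm (bessel_kernel \<nu> u s) \<le> exp (- u * cosh s + norm \<nu> * s)"
proof -
  have "norm (cosh (\<nu> * of_real s)) \<le> exp (norm \<nu> * s)"
    using norm_cosh_le[of "\<nu> * of_real s"] assms by (simp add: norm_mult)
  thus ?thesis unfolding bessel_kernel_def norm_mult norm_of_real abs_exp_cancel exp_add
    by (rule mult_left_mono) simp
qed

text \<open>Split u = (u - u1) + u1. The first part is estimated at the left end d and carries the
  decay in u; the second absorbs the growth of cosh (\<nu> s) and makes the bound integrable
  uniformly in u.\<close>

lemma bessel_kernel_decay:
  assumes u: "0 < u1" "u1 \<le> u" and s: "0 \<le> d" "d \<le> s"
  shows "norm (bessel_kernel \<nu> u s) \<le> exp (- (u - u1) * cosh d) * exp ((norm \<nu> + 1)\<^sup>2 / u1) * exp (- s)"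
proof -
  have "norm (bessel_kernel \<nu> u s) \<le> exp (- u * cosh s + norm \<nu> * s)" using s by (intro norm_bessel_kernel_le) simp
  also have "\<dots> = exp (- (u - u1) * cosh s) * exp (- u1 * cosh s + norm \<nu> * s)"
    by (simp add: algebra_simps flip: exp_add)
  also have "\<dots> \<le> exp (- (u - u1) * cosh d) * (exp ((norm \<nu> + 1)\<^sup>2 / u1) * exp (- s))"
  proof (intro mult_mono exp_cosh_decay)
    have "cosh d \<le> cosh s" using s by (simp add: cosh_real_nonneg_le_iff)
    thus "exp (- (u - u1) * cosh s) \<le> exp (- (u - u1) * cosh d)" 
      using mult_left_mono_neg[of "cosh d" "cosh s" "- (u - u1)"] u by simp
  qed (use u s in auto)
  finally show ?thesis by (simp only: mult.assoc)
qed

lemma bessel_kernel_integral: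
  assumes u: "0 < u1" "u1 \<le> u" and A: "A \<in> sets borel" "A \<subseteq> {d..}" "0 \<le> d"
  shows "set_integrable lborel A (bessel_kernel \<nu> u)"
    "norm (LBINT s:A. bessel_kernel \<nu> u s) \<le> exp (- (u - u1) * cosh d) * exp ((norm \<nu> + 1)\<^sup>2 / u1)"
  using set_integral_exp_decay[OF continuous_on_bessel_kernel A(1) _ _ bessel_kernel_decay[OF u A(3)], of \<nu>] A
  by (force simp: subset_iff)+

lemma bessel_K_upper:
  assumes "0 < u1" "u1 \<le> u"
  shows "norm (bessel_K \<nu> u) \<le> exp (u1 + (norm \<nu> + 1)\<^sup>2 / u1) * exp (- u)"
  using bessel_kernel_integral(2)[OF assms, of "{0..}" 0 \<nu>] unfolding bessel_K_eq
  by (simp add: exp_add exp_diff exp_minus field_simps)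

text \<open>Differencing the exponentials produces a factor cosh s. Half of the exponent u0 cosh s
  absorbs it, because v exp (-v) \<le> 1, and the other half keeps the integral convergent.\<close>

lemma bessel_K_lipschitz:
  assumes u0: "0 < u0" "u0 \<le> u" "u0 \<le> v"
  shows "norm (bessel_K \<nu> u - bessel_K \<nu> v) \<le> 2 / u0 * exp ((norm \<nu> + 1)\<^sup>2 / (u0 / 2)) * \<bar>u - v\<bar>"
proof -
  have exp_diff_le: "\<bar>exp (- p) - exp (- q)\<bar> \<le> exp (- m) * \<bar>p - q\<bar>" if m: "m \<le> p" "m \<le> q" for p q m :: real
  proof -
    have 1: "\<bar>exp (- p) - exp (- q)\<bar> \<le> exp (- m) * \<bar>p - q\<bar>" if "m \<le> p" "p \<le> q" for p q
    proof -
      have "exp (- p) - exp (- q) = exp (- p) * (1 - exp (- (q - p)))" by (simp add: algebra_simps flip: exp_add)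
      also have "\<dots> \<le> exp (- m) * (q - p)"
        using that exp_ge_add_one_self[of "p - q"] by (intro mult_mono) (auto simp del: exp_ge_add_one_self)
      finally show ?thesis using that by simp
    qed
    show ?thesis using 1[of p q] 1[of q p] m by (cases "p \<le> q") (auto simp: abs_minus_commute)
  qed
  let ?E = "exp ((norm \<nu> + 1)\<^sup>2 / (u0 / 2))"
  have "norm (LBINT s:{0..}. bessel_kernel \<nu> u s - bessel_kernel \<nu> v s) \<le> 2 / u0 * ?E * \<bar>u - v\<bar>"
  proof (rule set_integral_exp_decay(2))
    fix s :: real assume "s \<in> {0..}" hence s: "s \<ge> 0" by simp
    let ?c = "cosh s"
    have "bessel_kernel \<nu> u s - bessel_kernel \<nu> v s = of_real (exp (- (u * ?c)) - exp (- (v * ?c))) * cosh (\<nu> * of_real s)"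
      unfolding bessel_kernel_def by (simp add: algebra_simps)
    hence "norm (bessel_kernel \<nu> u s - bessel_kernel \<nu> v s) = \<bar>exp (- (u * ?c)) - exp (- (v * ?c))\<bar> * norm (cosh (\<nu> * of_real s))"
      by (simp only: norm_mult norm_of_real)
    also have "\<dots> \<le> (exp (- (u0 * ?c)) * (?c * \<bar>u - v\<bar>)) * exp (norm \<nu> * s)"
    proof (rule mult_mono)
      have "\<bar>exp (- (u * ?c)) - exp (- (v * ?c))\<bar> \<le> exp (- (u0 * ?c)) * \<bar>u * ?c - v * ?c\<bar>"
        using u0 by (intro exp_diff_le mult_right_mono) auto
      also have "\<bar>u * ?c - v * ?c\<bar> = ?c * \<bar>u - v\<bar>" by (simp add: abs_mult flip: left_diff_distrib)
      finally show "\<bar>exp (- (u * ?c)) - exp (- (v * ?c))\<bar> \<le> exp (- (u0 * ?c)) * (?c * \<bar>u - v\<bar>)" .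
      show "norm (cosh (\<nu> * of_real s)) \<le> exp (norm \<nu> * s)"
        using norm_cosh_le[of "\<nu> * of_real s"] s by (simp add: norm_mult)
    qed auto
    also have "\<dots> = (?c * exp (- (u0 / 2 * ?c))) * exp (- (u0 / 2) * ?c + norm \<nu> * s) * \<bar>u - v\<bar>"
    proof -
      have "exp (- (u0 * ?c)) = exp (- (u0 / 2 * ?c)) * exp (- (u0 / 2) * ?c)" unfolding exp_add[symmetric] by simp
      thus ?thesis by (simp only: exp_add mult_ac)
    qed
    also have "\<dots> \<le> 2 / u0 * (?E * exp (- s)) * \<bar>u - v\<bar>"
    proof (intro mult_right_mono mult_mono)
      have "u0 / 2 * ?c \<le> exp (u0 / 2 * ?c)" using exp_ge_add_one_self[of "u0 / 2 * ?c"] by linarith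
      hence "u0 / 2 * ?c * exp (- (u0 / 2 * ?c)) \<le> 1" by (simp add: exp_minus field_simps)
      thus "?c * exp (- (u0 / 2 * ?c)) \<le> 2 / u0" using u0 by (simp add: field_simps)
      show "exp (- (u0 / 2) * ?c + norm \<nu> * s) \<le> ?E * exp (- s)"
        using exp_cosh_decay[of "u0 / 2" s "norm \<nu>"] u0 s by simp
    qed (use u0 in auto)
    finally show "norm (bessel_kernel \<nu> u s - bessel_kernel \<nu> v s) \<le> 2 / u0 * ?E * \<bar>u - v\<bar> * exp (- s)"
      by (simp only: mult_ac)
  qed (use u0 in \<open>auto intro!: continuous_intros continuous_on_bessel_kernel\<close>)
  moreover have "(LBINT s:{0..}. bessel_kernel \<nu> u s - bessel_kernel \<nu> v s) = bessel_K \<nu> u - bessel_K \<nu> v"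
    unfolding bessel_K_eq
    using bessel_kernel_integral(1)[of u0 u "{0..}" 0 \<nu>] bessel_kernel_integral(1)[of u0 v "{0..}" 0 \<nu>] u0
    by (intro set_integral_diff) auto
  ultimately show ?thesis by simp
qed

text \<open>Near \<open>s = 0\<close> the factor \<open>cosh (\<nu> s)\<close> is close to 1; the remaining part of the integral is
  exponentially smaller as \<open>u\<close> grows.\<close>

lemma bessel_K_lower:
  obtains c U where "c > 0" "U > 0" "\<And>u. u \<ge> U \<Longrightarrow> c * exp (- 2 * u) \<le> norm (bessel_K \<nu> u)"
proof -
  have near: "\<exists>d>0. \<forall>s. \<bar>s\<bar> < d \<longrightarrow> norm (h s - h 0) < e" if "isCont h 0" "e > 0" for h :: "real \<Rightarrow> complex" and e
  proof -
    have "\<exists>d>0. \<forall>s. dist s 0 < d \<longrightarrow> dist (h s) (h 0) < e" using that by (simp only: continuous_at_eps_delta dist_norm)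
    thus ?thesis by (simp only: dist_norm real_norm_def diff_zero)
  qed
  have "isCont (\<lambda>s::real. cosh (\<nu> * of_real s)) 0" by (intro continuous_intros)
  from near[OF this, of "1 / 2"] obtain d1 where d1: "d1 > 0" "\<And>s::real. \<bar>s\<bar> < d1 \<Longrightarrow> norm (cosh (\<nu> * of_real s) - 1) < 1 / 2"
    by auto
  have "isCont (\<lambda>s::real. complex_of_real (cosh s)) 0" by (intro continuous_intros)
  from near[OF this, of 1] obtain d2 where d2: "d2 > 0" "\<And>s::real. \<bar>s\<bar> < d2 \<Longrightarrow> norm (complex_of_real (cosh s) - 1) < 1"
    by auto
  \<comment> \<open>Half of the smaller radius: on [0, d] the real part of cosh (\<nu> s) is at
    least 1/2, and cosh (d / 2) \<le> 2, which is the source of exp (-2 u).\<close>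
  define d where "d = min d1 d2 / 2"
  have d: "d > 0" "d < d1" "d < d2" unfolding d_def using d1 d2 by auto
  have re: "1 / 2 \<le> Re (cosh (\<nu> * of_real s))" if "s \<in> {0..d}" for s
    using d1(2)[of s] that d abs_Re_le_cmod[of "cosh (\<nu> * of_real s) - 1"] by auto
  have ch2: "cosh (d / 2) \<le> 2"
  proof -
    have "norm (complex_of_real (cosh (d / 2) - 1)) < 1" using d2(2)[of "d / 2"] d by simp
    thus ?thesis unfolding norm_of_real by linarith
  qed
  have lt: "cosh (d / 2) < cosh d" using d by (simp add: cosh_real_nonneg_less_iff)
  define E where "E = exp (cosh d) * exp ((norm \<nu> + 1)\<^sup>2)"
  have E: "E > 0" unfolding E_def by simp
  define g where "g = cosh d - cosh (d / 2)"
  have g: "g > 0" using lt by (simp add: g_def)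
  \<comment> \<open>From this threshold on the tail is at most half of the main part d / 4 * exp (-u
    cosh (d / 2)), which leaves the constant d / 8.\<close>
  define U where "U = max 1 (8 * E / (d * g))"
  have U: "U \<ge> 1" "8 * E / (d * g) \<le> U" unfolding U_def by auto
  have lower: "d / 8 * exp (- 2 * u) \<le> norm (bessel_K \<nu> u)" if u: "u \<ge> U" for u
  proof -
    have u1: "u \<ge> 1" using u U by linarith
    let ?f = "bessel_kernel \<nu> u" and ?e = "exp (- u * cosh (d / 2))"
    have i1: "set_integrable lborel {0..d} ?f" by (rule bessel_kernel_integral[of 1 u _ 0]) (use u1 in auto)
    have i2: "set_integrable lborel {d<..} ?f" by (rule bessel_kernel_integral[of 1 u _ 0]) (use u1 d in auto)
    have "{0..} = {0..d} \<union> {d<..}" using d by auto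
    hence sum: "bessel_K \<nu> u = (LBINT s:{0..d}. ?f s) + (LBINT s:{d<..}. ?f s)"
      unfolding bessel_K_eq using set_integral_Un[OF _ i1 i2] by (simp add: disjoint_iff)
    have tail: "norm (LBINT s:{d<..}. ?f s) \<le> exp (- u * cosh d) * E"
      using bessel_kernel_integral(2)[of 1 u "{d<..}" d \<nu>] u1 d unfolding E_def
      by (simp add: algebra_simps exp_add exp_diff exp_minus field_simps subset_iff)
    have main: "d / 2 * (?e / 2) \<le> Re (LBINT s:{0..d}. ?f s)"
    proof -
      have "d / 2 * (?e / 2) = (\<integral>s. ?e / 2 * indicator {0..d / 2} s \<partial>lborel)" using d by simp
      also have "\<dots> \<le> (\<integral>s. Re (indicator {0..d} s *\<^sub>R ?f s) \<partial>lborel)"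
      proof (rule integral_mono)
        show "integrable lborel (\<lambda>s. ?e / 2 * indicator {0..d / 2} s :: real)"
          using d by (intro integrable_mult_right integrable_real_indicator) auto
        show "integrable lborel (\<lambda>s. Re (indicator {0..d} s *\<^sub>R ?f s))"
          using i1 unfolding set_integrable_def by (rule integrable_Re)
        fix s :: real
        show "?e / 2 * indicator {0..d / 2} s \<le> Re (indicator {0..d} s *\<^sub>R ?f s)"
        proof (cases "s \<in> {0..d}")
          case True
          have "?e / 2 * indicator {0..d / 2} s \<le> exp (- u * cosh s) * (1 / 2)"
          proof (cases "s \<le> d / 2")
            case s: True
            have "cosh s \<le> cosh (d / 2)" using True s by (simp add: cosh_real_nonneg_le_iff)
            hence "?e \<le> exp (- u * cosh s)" using u1 by (simp add: mult_left_mono)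
            thus ?thesis using True s by simp
          qed simp
          also have "\<dots> \<le> exp (- u * cosh s) * Re (cosh (\<nu> * of_real s))" by (intro mult_left_mono re True) simp
          finally show ?thesis using True by (simp add: bessel_kernel_def)
        next
          case False
          hence "indicator {0..d / 2} s = (0::real)" using d by (auto simp: indicator_def)
          thus ?thesis using False by simp
        qed
      qed
      also have "\<dots> = Re (LBINT s:{0..d}. ?f s)"
        using i1 unfolding set_integrable_def set_lebesgue_integral_def by (rule integral_Re)
      finally show ?thesis .
    qed
    have small: "exp (- u * cosh d) * E \<le> d / 8 * ?e"
    proof -
      have "E * 8 \<le> U * (d * g)" using U d g by (simp add: field_simps)
      also have "\<dots> \<le> u * (d * g)" using u d g by (intro mult_right_mono) auto
      also have "u * (d * g) = d * (u * g)" by simp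
      also have "u * g \<le> exp (u * g)" using exp_ge_add_one_self[of "u * g"] by linarith
      hence "d * (u * g) \<le> d * exp (u * g)" using d by (intro mult_left_mono) auto
      finally have "E \<le> d / 8 * exp (u * g)" by simp
      hence "exp (- u * cosh d) * E \<le> exp (- u * cosh d) * (d / 8 * exp (u * g))" by (intro mult_left_mono) auto
      also have "\<dots> = d / 8 * ?e" unfolding g_def by (simp add: right_diff_distrib flip: exp_add)
      finally show ?thesis .
    qed
    have "d / 8 * exp (- 2 * u) \<le> d / 8 * ?e"
      using ch2 d u1 by (intro mult_left_mono) (auto simp: mult_right_mono)
    also have "\<dots> \<le> Re (LBINT s:{0..d}. ?f s) - norm (LBINT s:{d<..}. ?f s)"
      using main tail small by simp
    also have "\<dots> \<le> norm (bessel_K \<nu> u)"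
      unfolding sum using complex_Re_le_cmod[of "LBINT s:{0..d}. ?f s"]
        norm_triangle_ineq2[of "LBINT s:{0..d}. ?f s" "- (LBINT s:{d<..}. ?f s)"] by simp
    finally show ?thesis .
  qed
  show ?thesis by (rule that[OF _ _ lower]) (use d U in auto)
qed

section \<open>Wilton's bound for forms for \<open>SL(2,Z)\<close>\<close>

lemma Im_moebius2:
  assumes "z \<in> upper_half" "a * d - b * c = 1"
  shows "of_int c * z + of_int d \<noteq> 0" "Im (moebius2 a b c d z) = Im z / (norm (of_int c * z + of_int d))\<^sup>2"
    "moebius2 a b c d z \<in> upper_half"
proof -
  let ?q = "of_int c * z + of_int d"
  have y: "Im z > 0" using assms(1) by (simp add: upper_half_def)
  show q: "?q \<noteq> 0"
  proof
    assume "?q = 0"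
    hence "Re ?q = 0" "Im ?q = 0" by simp_all
    hence "c = 0" "d = 0" using y by auto
    thus False using assms(2) by simp
  qed
  have "Im (moebius2 a b c d z) = (of_int a * Im z * (of_int c * Re z + of_int d) - (of_int a * Re z + of_int b) * (of_int c * Im z)) / (norm ?q)\<^sup>2"
    unfolding moebius2_def Im_divide cmod_power2 by simp
  also have "of_int a * Im z * (of_int c * Re z + of_int d) - (of_int a * Re z + of_int b) * (of_int c * Im z)
    = of_int (a * d - b * c) * Im z" by (simp add: algebra_simps)
  finally show "Im (moebius2 a b c d z) = Im z / (norm ?q)\<^sup>2" using assms(2) by simp
  thus "moebius2 a b c d z \<in> upper_half" using y q by (simp add: upper_half_def)
qed

text \<open>By \<open>SL2Z_reduction\<close> every orbit contains a point of height at least 1/2, so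
  an invariant function has to be bounded only there.\<close>

lemma SL2Z_invariant_bound:
  fixes \<Phi> :: "complex \<Rightarrow> real"
  assumes inv: "\<And>a b c d z. a * d - b * c = 1 \<Longrightarrow> z \<in> upper_half \<Longrightarrow> \<Phi> (moebius2 a b c d z) = \<Phi> z"
    and bd: "\<And>z. 1 / 2 \<le> Im z \<Longrightarrow> \<Phi> z \<le> M" and z: "z \<in> upper_half"
  shows "\<Phi> z \<le> M"
proof -
  have y: "Im z > 0" using z by (simp add: upper_half_def)
  obtain a b c d :: int where abcd: "a * d - b * c = 1"
    and X: "\<bar>((a * Re z + b) * (c * Re z + d) + real_of_int a * real_of_int c * (Im z)\<^sup>2) / ((c * Re z + d)\<^sup>2 + (c * Im z)\<^sup>2)\<bar> \<le> 1 / 2"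
    and Y: "1 \<le> (((a * Re z + b) * (c * Re z + d) + real_of_int a * real_of_int c * (Im z)\<^sup>2) / ((c * Re z + d)\<^sup>2 + (c * Im z)\<^sup>2))\<^sup>2
      + (Im z / ((c * Re z + d)\<^sup>2 + (c * Im z)\<^sup>2))\<^sup>2"
    by (rule SL2Z_reduction[OF y])
  have n: "(norm (of_int c * z + of_int d))\<^sup>2 = (c * Re z + d)\<^sup>2 + (c * Im z)\<^sup>2" by (simp add: cmod_power2)
  note m = Im_moebius2[OF z abcd]
  have "(1 / 2)\<^sup>2 \<le> q\<^sup>2" if "\<bar>p\<bar> \<le> 1 / 2" "1 \<le> p\<^sup>2 + q\<^sup>2" for p q :: real
    using abs_le_square_iff[of p "1 / 2"] that by (simp add: power2_eq_square)
  from this[OF X Y] have "(1 / 2)\<^sup>2 \<le> (Im (moebius2 a b c d z))\<^sup>2" unfolding m(2) n .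
  moreover have "Im (moebius2 a b c d z) \<ge> 0" using m(3) by (simp add: upper_half_def)
  ultimately have "1 / 2 \<le> Im (moebius2 a b c d z)" by (rule power2_le_imp_le)
  from bd[OF this] show ?thesis using inv[OF abcd z] by simp
qed

lemma has_sum_norm_le:
  fixes f :: "'a \<Rightarrow> complex"
  assumes "(f has_sum a) A" "g summable_on A" "\<And>n. n \<in> A \<Longrightarrow> norm (f n) \<le> g n"
  shows "norm a \<le> infsum g A"
proof -
  have s: "(\<lambda>n. norm (f n)) summable_on A"
    using has_sum_imp_summable[OF assms(1)] by (simp add: summable_on_iff_abs_summable_on_complex)
  have "norm a \<le> infsum (\<lambda>n. norm (f n)) A" using norm_infsum_bound[OF s] infsumI[OF assms(1)] by simp
  also have "\<dots> \<le> infsum g A" by (rule infsum_mono[OF s assms(2,3)])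
  finally show ?thesis .
qed

lemma e2pi_Complex: "e2pi (of_nat n * Complex x y) = of_real (exp (- 2 * pi * (real n * y))) * e2pi (of_nat n * of_real x)"
proof -
  have "2 * of_real pi * \<i> * (of_nat n * Complex x y) =
    of_real (- 2 * pi * (real n * y)) + 2 * of_real pi * \<i> * (of_nat n * of_real x)"
    by (simp add: complex_eq_iff)
  thus ?thesis unfolding e2pi_def exp_of_real[symmetric] exp_add[symmetric] by simp
qed

text \<open>For Im z \<ge> 1/2 each term is compared with the same term at i / 4, where the series
  converges absolutely. This gains exp (2 - Im z), which compensates the power of Im z, and
  invariance of the product extends the bound to the half-plane.\<close>

lemma holomorphic_cusp_form_bounded:
  assumes f: "holomorphic_cusp_form k f" and lam: "normalized_coeffs_holomorphic k f lam"
  obtains M where "\<And>z. z \<in> upper_half \<Longrightarrow> Im z powr (real k / 2) * norm (f z) \<le> M"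
proof -
  let ?p = "(real k - 1) / 2"
  let ?t = "\<lambda>z n. lam n * of_real (real n powr ?p) * e2pi (of_nat n * z)"
  have hs: "(?t z has_sum f z) {1..}" if "z \<in> upper_half" for z
    using lam that by (simp add: normalized_coeffs_holomorphic_def)
  have nt: "norm (?t z n) = norm (lam n) * real n powr ?p * exp (- 2 * pi * (real n * Im z))" for z n
    using e2pi_Complex[of n "Re z" "Im z"] norm_e2pi_of_real[of "real n * Re z"] by (simp add: norm_mult)
  define s where "s n = norm (?t (Complex 0 (1/4)) n)" for n
  have s: "s summable_on {1..}"
    unfolding s_def using has_sum_imp_summable[OF hs[of "Complex 0 (1/4)"]]
    by (simp add: upper_half_def summable_on_iff_abs_summable_on_complex)
  define S where "S = infsum s {1..}"
  have S: "S \<ge> 0" unfolding S_def s_def by (intro infsum_nonneg) simp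
  define M where "M = S * (exp 2 * exp (real k / 2 * ln (real k + 1)))"
  have bd: "Im z powr (real k / 2) * norm (f z) \<le> M" if z: "1 / 2 \<le> Im z" for z
  proof -
    let ?y = "Im z"
    have "norm (f z) \<le> infsum (\<lambda>n. exp (2 - ?y) * s n) {1..}"
    proof (rule has_sum_norm_le[OF hs])
      show "(\<lambda>n. exp (2 - ?y) * s n) summable_on {1..}" by (intro summable_on_cmult_right s)
      fix n :: nat assume n: "n \<in> {1..}"
      have "1 * (?y - 1 / 4) \<le> real n * (?y - 1 / 4)" using n z by (intro mult_right_mono) auto
      hence "2 * pi * (1 * (?y - 1 / 4)) \<le> 2 * pi * (real n * (?y - 1 / 4))" by (intro mult_left_mono) auto
      moreover have "1 * ?y \<le> 2 * pi * ?y" using z pi_gt3 by (intro mult_right_mono) auto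
      ultimately have "- 2 * pi * (real n * ?y) \<le> (2 - ?y) + (- 2 * pi * (real n * (1 / 4)))"
        using pi_less_4 by (simp add: algebra_simps)
      hence "exp (- 2 * pi * (real n * ?y)) \<le> exp (2 - ?y) * exp (- 2 * pi * (real n * (1 / 4)))"
        unfolding exp_add[symmetric] by (rule exp_le_cancel_iff[THEN iffD2])
      hence "norm (lam n) * real n powr ?p * exp (- 2 * pi * (real n * ?y)) \<le>
        norm (lam n) * real n powr ?p * (exp (2 - ?y) * exp (- 2 * pi * (real n * (1 / 4))))"
        by (intro mult_left_mono) auto
      thus "norm (?t z n) \<le> exp (2 - ?y) * s n" unfolding nt s_def by (simp add: mult_ac)
    qed (use z in \<open>simp add: upper_half_def\<close>)
    hence fz: "norm (f z) \<le> exp (2 - ?y) * S" by (simp add: infsum_cmult_right' S_def)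
    \<comment> \<open>From ln v \<le> v - 1 with v = y / (k + 1), a scaling that keeps the
      coefficient of y below 1.\<close>
    have yk: "?y powr (real k / 2) \<le> exp (?y + real k / 2 * ln (real k + 1))"
    proof -
      have "ln ?y - ln (real k + 1) = ln (?y / (real k + 1))" using z by (simp add: ln_div)
      also have "\<dots> \<le> ?y / (real k + 1) - 1" using z by (intro ln_le_minus_one) auto
      finally have "ln ?y \<le> ?y / (real k + 1) + ln (real k + 1)" by simp
      hence "real k / 2 * ln ?y \<le> real k / 2 * (?y / (real k + 1) + ln (real k + 1))" by (intro mult_left_mono) auto
      also have "\<dots> = (real k / (real k + 1)) * (?y / 2) + real k / 2 * ln (real k + 1)" by (simp add: algebra_simps)
      also have "(real k / (real k + 1)) * (?y / 2) \<le> 1 * ?y" using z by (intro mult_mono) auto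
      finally show ?thesis using z by (simp add: powr_def)
    qed
    have "?y powr (real k / 2) * norm (f z) \<le> exp (?y + real k / 2 * ln (real k + 1)) * (exp (2 - ?y) * S)"
      by (intro mult_mono yk fz) auto
    also have "\<dots> = M" unfolding M_def by (simp add: exp_add exp_diff)
    finally show ?thesis .
  qed
  have inv: "Im (moebius2 a b c d z) powr (real k / 2) * norm (f (moebius2 a b c d z)) = Im z powr (real k / 2) * norm (f z)"
    if "a * d - b * c = 1" "z \<in> upper_half" for a b c d z
  proof -
    let ?q = "norm (of_int c * z + of_int d)"
    note m = Im_moebius2[OF that(2,1)]
    have q: "?q > 0" using m(1) by simp
    have "f (moebius2 a b c d z) = (of_int c * z + of_int d) ^ k * f z"
      using f that by (simp add: holomorphic_cusp_form_def)
    hence n: "norm (f (moebius2 a b c d z)) = ?q ^ k * norm (f z)" by (simp add: norm_mult norm_power)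
    have "(?q\<^sup>2) powr (real k / 2) = ?q powr (2 * (real k / 2))"
      using q by (simp only: powr_powr powr_numeral[symmetric])
    hence "(?q\<^sup>2) powr (real k / 2) = ?q ^ k" using q by (simp add: powr_realpow)
    thus ?thesis unfolding m(2) n using that(2) q by (simp add: powr_divide upper_half_def)
  qed
  show ?thesis
    by (rule that, rule SL2Z_invariant_bound[where \<Phi> = "\<lambda>z. Im z powr (real k / 2) * norm (f z)", OF inv bd])
qed

lemma lipschitz_positive_on_interval:
  fixes h h' :: "real \<Rightarrow> real"
  assumes h: "\<And>u. u \<in> {a..b} \<Longrightarrow> (h has_real_derivative h' u) (at u)" "continuous_on {a..b} h'"
    and pos: "\<And>u. u \<in> {a..b} \<Longrightarrow> h u > 0" and ab: "a \<le> b"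
  obtains \<gamma> \<Lambda> where "\<gamma> > 0" "\<And>u. u \<in> {a..b} \<Longrightarrow> \<gamma> \<le> h u" "\<Lambda> \<ge> 0"
    "\<And>u v. u \<in> {a..b} \<Longrightarrow> v \<in> {a..b} \<Longrightarrow> \<bar>h u - h v\<bar> \<le> \<Lambda> * \<bar>u - v\<bar>"
proof -
  have "continuous_on {a..b} h"
    using h(1) by (intro continuous_at_imp_continuous_on ballI) (meson DERIV_isCont)
  then obtain u0 where u0: "u0 \<in> {a..b}" "\<forall>u\<in>{a..b}. h u0 \<le> h u"
    using continuous_attains_inf[of "{a..b}" h] ab by auto
  have "bounded (h' ` {a..b})" by (intro compact_imp_bounded compact_continuous_image h) auto
  then obtain \<Lambda> where L: "\<Lambda> > 0" "\<forall>w\<in>h' ` {a..b}. norm w \<le> \<Lambda>" unfolding bounded_pos by blast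
  have lip: "norm (h u - h v) \<le> \<Lambda> * norm (u - v)" if "u \<in> {a..b}" "v \<in> {a..b}" for u v
  proof (rule field_differentiable_bound[where S = "{a..b}" and f' = h'])
    show "(h has_field_derivative h' z) (at z within {a..b})" if "z \<in> {a..b}" for z
      using h(1)[OF that] by (rule has_field_derivative_at_within)
  qed (use L that in auto)
  show ?thesis by (rule that[of "h u0" \<Lambda>]) (use u0 pos L lip in auto)
qed

text \<open>The weight \<open>h\<close> is positive on the whole half-line, so [1, 2] can serve as
  window. Coefficients are extended by 0 to nonpositive indices, and the bounded series is y^(k/2) f
  (x + i y).\<close>

lemma holomorphic_exp_sum_bound:
  assumes f: "holomorphic_cusp_form k f" and lam: "normalized_coeffs_holomorphic k f lam"
  obtains C where "C > 0" "\<And>x \<alpha>. x \<ge> 1 \<Longrightarrow>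
    norm (\<Sum>n | 1 \<le> n \<and> real n \<le> x. lam n * e2pi (of_nat n * of_real \<alpha>)) \<le> C * sqrt x * (1 + ln x)"
proof -
  obtain M where M: "\<And>z. z \<in> upper_half \<Longrightarrow> Im z powr (real k / 2) * norm (f z) \<le> M"
    using holomorphic_cusp_form_bounded[OF f lam] by blast
  let ?p = "(real k - 1) / 2"
  define h where "h u = u powr ?p * exp (- 2 * pi * u)" for u
  define h' where "h' u = ?p * u powr (?p - 1) * exp (- 2 * pi * u) + u powr ?p * (exp (- 2 * pi * u) * (- 2 * pi))" for u
  define rho where "rho n = (if n \<ge> 1 then lam (nat n) else 0)" for n :: int
  have der: "(h has_real_derivative h' u) (at u)" if "u \<in> {1..2}" for u
    unfolding h_def[abs_def] h'_def using that
    by (auto intro!: derivative_eq_intros simp: powr_diff)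
  have cont: "continuous_on {1..2} h'" unfolding h'_def[abs_def] by (intro continuous_intros) auto
  obtain \<gamma> \<Lambda> where gL: "\<gamma> > 0" "\<And>u. u \<in> {1..2} \<Longrightarrow> \<gamma> \<le> h u" "\<Lambda> \<ge> 0"
    "\<And>u v. u \<in> {1..2} \<Longrightarrow> v \<in> {1..2} \<Longrightarrow> \<bar>h u - h v\<bar> \<le> \<Lambda> * \<bar>u - v\<bar>"
    by (rule lipschitz_positive_on_interval[OF der cont]) (auto simp: h_def)
  have F: "\<exists>F. \<forall>x::real. ((\<lambda>n. of_real (sqrt y) * rho n * complex_of_real (h (\<bar>real_of_int n\<bar> * y)) * e2pi (of_int n * of_real x)) has_sum F x) UNIV
      \<and> norm (F x) \<le> M" if y: "y > 0" for y
  proof (intro exI[of _ "\<lambda>x. of_real (y powr (real k / 2)) * f (Complex x y)"] allI conjI)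
    fix x :: real
    have up: "Complex x y \<in> upper_half" using y by (simp add: upper_half_def)
    let ?T = "\<lambda>n. of_real (sqrt y) * rho n * complex_of_real (h (\<bar>real_of_int n\<bar> * y)) * e2pi (of_int n * of_real x)"
    have sy: "sqrt y * y powr ?p = y powr (real k / 2)"
      using y by (simp add: powr_half_sqrt[symmetric] powr_add[symmetric] diff_divide_distrib)
    have T: "?T (int n) = of_real (y powr (real k / 2)) * (lam n * of_real (real n powr ?p) * e2pi (of_nat n * Complex x y))"
      if "n \<ge> 1" for n
    proof -
      have "h (\<bar>real_of_int (int n)\<bar> * y) = real n powr ?p * y powr ?p * exp (- 2 * pi * (real n * y))"
        unfolding h_def using y by (simp add: powr_mult)
      thus ?thesis unfolding e2pi_Complex sy[symmetric] using that by (simp add: rho_def mult_ac)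
    qed
    have "((\<lambda>n. lam n * of_real (real n powr ?p) * e2pi (of_nat n * Complex x y)) has_sum f (Complex x y)) {1..}"
      using lam up by (simp add: normalized_coeffs_holomorphic_def)
    hence "((\<lambda>n. ?T (int n)) has_sum (of_real (y powr (real k / 2)) * f (Complex x y))) {1..}"
      using has_sum_cong[of "{1..}" "\<lambda>n. ?T (int n)", OF T] has_sum_cmult_right by auto
    hence "((?T \<circ> int) has_sum (of_real (y powr (real k / 2)) * f (Complex x y))) {1..}" by (simp add: o_def)
    hence "(?T has_sum (of_real (y powr (real k / 2)) * f (Complex x y))) (int ` {1..})"
      by (subst has_sum_reindex) auto
    moreover have "?T n = 0" if "n \<notin> int ` {1..}" for n
    proof -
      have "\<not> n \<ge> 1"
      proof
        assume "n \<ge> 1"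
        hence "n = int (nat n)" "nat n \<in> {1..}" by auto
        thus False using that by blast
      qed
      thus ?thesis by (simp add: rho_def)
    qed
    ultimately show "(?T has_sum (of_real (y powr (real k / 2)) * f (Complex x y))) UNIV"
      by (subst has_sum_cong_neutral[where S = UNIV and T = "int ` {1..}"]) auto
    show "norm (of_real (y powr (real k / 2)) * f (Complex x y)) \<le> M"
      using M[OF up] by (simp add: norm_mult)
  qed
  obtain C where C: "C > 0" "\<And>x \<alpha>. x \<ge> 1 \<Longrightarrow>
    norm (\<Sum>n | 1 \<le> n \<and> real n \<le> x. rho (int n) * e2pi (of_nat n * of_real \<alpha>)) \<le> C * sqrt x * (1 + ln x)"
  proof (rule exp_sum_bound_of_bounded_series[where rho = rho and g = "\<lambda>u. complex_of_real (h u)" and M = M and ?u0.0 = 1 and ?u1.0 = 2 and \<gamma> = \<gamma> and \<Lambda> = \<Lambda>])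
    show "\<gamma> \<le> norm (complex_of_real (h u))" if "u \<in> {1..2}" for u using gL(2)[OF that] by simp
    show "norm (complex_of_real (h u) - complex_of_real (h v)) \<le> \<Lambda> * \<bar>u - v\<bar>" if "u \<in> {1..2}" "v \<in> {1..2}" for u v
      using gL(4)[OF that] by (simp only: of_real_diff[symmetric] norm_of_real)
  qed (use F gL in auto)
  show ?thesis
  proof (rule that[OF C(1)])
    fix x \<alpha> :: real assume "x \<ge> 1"
    have "(\<Sum>n | 1 \<le> n \<and> real n \<le> x. rho (int n) * e2pi (of_nat n * of_real \<alpha>)) =
      (\<Sum>n | 1 \<le> n \<and> real n \<le> x. lam n * e2pi (of_nat n * of_real \<alpha>))"
      by (intro sum.cong refl) (simp add: rho_def)
    thus "norm (\<Sum>n | 1 \<le> n \<and> real n \<le> x. lam n * e2pi (of_nat n * of_real \<alpha>)) \<le> C * sqrt x * (1 + ln x)"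
      using C(2)[OF \<open>x \<ge> 1\<close>, of \<alpha>] by simp
  qed
qed

text \<open>Terms at height y \<ge> 1/2 are compared with those at height 1/8. The upper bound exp
  (-u) and the lower bound exp (-2 u) for K differ by a factor 2 in the exponent, which this choice
  of height affords with a surplus. The finitely many n whose argument at height 1/8 is below
  \<open>U\<close>, where no lower bound is known, go into \<open>\<beta>2\<close>.\<close>

lemma maass_form_SL2_bounded:
  assumes f: "hecke_maass_cusp_form_SL2 t f"
    and \<rho>: "\<And>x y. y > 0 \<Longrightarrow> ((\<lambda>n. of_real (sqrt y) * \<rho> n * bessel_K \<nu> (2 * pi * \<bar>real_of_int n\<bar> * y) *
              e2pi (of_real (real_of_int n * x))) has_sum f (Complex x y)) {n. n \<noteq> 0}"
  obtains M where "\<And>z. z \<in> upper_half \<Longrightarrow> norm (f z) \<le> M"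
proof -
  let ?t = "\<lambda>x y n. of_real (sqrt y) * \<rho> n * bessel_K \<nu> (2 * pi * \<bar>real_of_int n\<bar> * y) * e2pi (of_real (real_of_int n * x))"
  have nt: "norm (?t x y n) = sqrt y * (norm (\<rho> n) * norm (bessel_K \<nu> (2 * pi * \<bar>real_of_int n\<bar> * y)))" if "y > 0" for x y n
    using that norm_e2pi_of_real[of "real_of_int n * x"] by (simp add: norm_mult)
  obtain c U where c: "c > 0" "U > 0" "\<And>u. u \<ge> U \<Longrightarrow> c * exp (- 2 * u) \<le> norm (bessel_K \<nu> u)"
    using bessel_K_lower[of \<nu>] by blast
  define B where "B = exp (1 + (norm \<nu> + 1)\<^sup>2 / 1)"
  have B: "B > 0" "\<And>u. u \<ge> 1 \<Longrightarrow> norm (bessel_K \<nu> u) \<le> B * exp (- u)"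
    using bessel_K_upper[of 1 _ \<nu>] by (auto simp: B_def)
  let ?w = "\<lambda>n. 2 * pi * \<bar>real_of_int n\<bar> * (1 / 8)"
  define \<beta>1 where "\<beta>1 n = B / c * (norm (\<rho> n) * norm (bessel_K \<nu> (?w n)))" for n
  define \<beta>2 where "\<beta>2 n = (if ?w n < U then norm (\<rho> n) * B else 0)" for n
  have s1: "\<beta>1 summable_on {n. n \<noteq> 0}"
  proof -
    have "(\<lambda>n. norm (?t 0 (1/8) n)) summable_on {n. n \<noteq> 0}"
      using has_sum_imp_summable[OF \<rho>[of "1/8" 0]] by (simp add: summable_on_iff_abs_summable_on_complex)
    hence "(\<lambda>n. sqrt (1/8) * (norm (\<rho> n) * norm (bessel_K \<nu> (?w n)))) summable_on {n. n \<noteq> 0}"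
      by (simp only: nt[of "1/8"])
    hence "(\<lambda>n. norm (\<rho> n) * norm (bessel_K \<nu> (?w n))) summable_on {n. n \<noteq> 0}"
      by (subst (asm) summable_on_cmult_right') simp_all
    thus ?thesis unfolding \<beta>1_def by (rule summable_on_cmult_right)
  qed
  have s2: "\<beta>2 summable_on {n. n \<noteq> 0}"
  proof -
    let ?I = "{- \<lceil>2 * U\<rceil>..\<lceil>2 * U\<rceil>}"
    have I: "n \<in> ?I" if "?w n < U" for n
    proof -
      have "3 * \<bar>real_of_int n\<bar> \<le> pi * \<bar>real_of_int n\<bar>" using pi_gt3 by (intro mult_right_mono) auto
      hence "\<bar>real_of_int n\<bar> \<le> 2 * U" using that by simp
      hence "\<bar>real_of_int n\<bar> \<le> of_int \<lceil>2 * U\<rceil>" using le_of_int_ceiling order_trans by blast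
      hence "\<bar>n\<bar> \<le> \<lceil>2 * U\<rceil>" by (simp only: of_int_abs[symmetric] of_int_le_iff)
      thus ?thesis by (simp only: atLeastAtMost_iff abs_le_iff minus_le_iff)
    qed
    have "\<beta>2 n = 0" if "n \<notin> ?I" for n
      using that I[of n] unfolding \<beta>2_def by metis
    hence "\<beta>2 summable_on UNIV"
      by (intro summable_on_cong_neutral[where S = UNIV and T = ?I and f = \<beta>2 and g = \<beta>2, THEN iffD2] summable_on_finite) auto
    thus ?thesis by (rule summable_on_subset_banach) simp
  qed
  define S where "S = infsum (\<lambda>n. \<beta>1 n + \<beta>2 n) {n. n \<noteq> 0}"
  have S: "S \<ge> 0" unfolding S_def \<beta>1_def \<beta>2_def using B c by (intro infsum_nonneg) auto
  have bd: "norm (f z) \<le> S" if z: "1 / 2 \<le> Im z" for z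
  proof -
    let ?y = "Im z"
    have "norm (f (Complex (Re z) ?y)) \<le> infsum (\<lambda>n. 1 * (\<beta>1 n + \<beta>2 n)) {n. n \<noteq> 0}"
    proof (rule has_sum_norm_le[OF \<rho>])
      show "(\<lambda>n. 1 * (\<beta>1 n + \<beta>2 n)) summable_on {n. n \<noteq> 0}" using summable_on_add[OF s1 s2] by simp
      fix n :: int assume "n \<in> {n. n \<noteq> 0}"
      hence "n \<noteq> 0" by simp
      hence n1: "1 \<le> \<bar>real_of_int n\<bar>" by linarith
      let ?v = "2 * pi * \<bar>real_of_int n\<bar> * ?y"
      have ny: "1 * ?y \<le> \<bar>real_of_int n\<bar> * ?y" "\<bar>real_of_int n\<bar> * (1 / 2) \<le> \<bar>real_of_int n\<bar> * ?y"
        using n1 z by (intro mult_right_mono mult_left_mono; linarith)+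
      hence v1: "pi * (1 * ?y) \<le> pi * (\<bar>real_of_int n\<bar> * ?y)"
        and v2: "pi * (\<bar>real_of_int n\<bar> * (1 / 2)) \<le> pi * (\<bar>real_of_int n\<bar> * ?y)" by (auto intro!: mult_left_mono)
      have yp: "1 * ?y \<le> pi * ?y" and yp3: "3 * ?y \<le> pi * ?y" using pi_gt3 z by (auto intro!: mult_right_mono)
      have v: "?v = 2 * (pi * (\<bar>real_of_int n\<bar> * ?y))" by simp
      hence "?v \<ge> 1" using v1 yp3 z by linarith
      hence K: "norm (bessel_K \<nu> ?v) \<le> B * exp (- ?v)" by (rule B(2))
      have "norm (\<rho> n) * norm (bessel_K \<nu> ?v) \<le> exp (- (pi * ?y)) * (\<beta>1 n + \<beta>2 n)"
      proof (cases "?w n < U")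
        case True
        have "norm (bessel_K \<nu> ?v) \<le> B * exp (- (pi * ?y))"
          using K v1 B z by (elim order_trans) (intro mult_left_mono; simp)
        hence "norm (\<rho> n) * norm (bessel_K \<nu> ?v) \<le> norm (\<rho> n) * (B * exp (- (pi * ?y)))" by (intro mult_left_mono) auto
        also have "\<dots> = exp (- (pi * ?y)) * (0 + \<beta>2 n)" using True by (simp add: \<beta>2_def)
        also have "\<dots> \<le> exp (- (pi * ?y)) * (\<beta>1 n + \<beta>2 n)" using B c by (intro mult_left_mono add_right_mono) (auto simp: \<beta>1_def)
        finally show ?thesis .
      next
        case False
        \<comment> \<open>With w the argument at height 1/8, 2 w = pi |n| / 2; as y \<ge> 1/2, the
          difference v - 2 w is at least pi |n| y and hence at least pi y.\<close>
        have "exp (- ?v) = exp (- ?v + 2 * ?w n) * exp (- 2 * ?w n)" unfolding exp_add[symmetric] by simp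
        also have "\<dots> \<le> exp (- (pi * ?y)) * (norm (bessel_K \<nu> (?w n)) / c)"
        proof (rule mult_mono)
          show "exp (- ?v + 2 * ?w n) \<le> exp (- (pi * ?y))"
            unfolding exp_le_cancel_iff using v1 v2 v by linarith
          show "exp (- 2 * ?w n) \<le> norm (bessel_K \<nu> (?w n)) / c" using c(1) c(3)[of "?w n"] False by (simp add: field_simps)
        qed auto
        finally have "B * exp (- ?v) \<le> B * (exp (- (pi * ?y)) * (norm (bessel_K \<nu> (?w n)) / c))"
          using B by (intro mult_left_mono) auto
        hence "norm (\<rho> n) * norm (bessel_K \<nu> ?v) \<le> norm (\<rho> n) * (B * (exp (- (pi * ?y)) * (norm (bessel_K \<nu> (?w n)) / c)))"
          using K by (intro mult_left_mono) auto
        also have "\<dots> = exp (- (pi * ?y)) * (\<beta>1 n + \<beta>2 n)" using False by (simp add: \<beta>1_def \<beta>2_def)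
        finally show ?thesis .
      qed
      hence "norm (?t (Re z) ?y n) \<le> sqrt ?y * (exp (- (pi * ?y)) * (\<beta>1 n + \<beta>2 n))"
        using z by (subst nt) (auto intro!: mult_left_mono)
      also have "\<dots> = (sqrt ?y * exp (- (pi * ?y))) * (\<beta>1 n + \<beta>2 n)" by simp
      also have "\<dots> \<le> 1 * (\<beta>1 n + \<beta>2 n)"
      proof (rule mult_right_mono)
        have "?y \<le> (1 + ?y)\<^sup>2" using z by (simp add: power2_eq_square algebra_simps)
        hence "sqrt ?y \<le> 1 + ?y" using z by (intro real_le_lsqrt) auto
        also have "1 + ?y \<le> exp (pi * ?y)" using exp_ge_add_one_self[of "pi * ?y"] yp by linarith
        finally show "sqrt ?y * exp (- (pi * ?y)) \<le> 1" by (simp add: exp_minus field_simps)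
      qed (use B c in \<open>auto simp: \<beta>1_def \<beta>2_def\<close>)
      finally show "norm (?t (Re z) ?y n) \<le> 1 * (\<beta>1 n + \<beta>2 n)" .
    qed (use z in simp)
    thus ?thesis by (simp add: S_def)
  qed
  have inv: "norm (f (moebius2 a b c d z)) = norm (f z)" if "a * d - b * c = 1" "z \<in> upper_half" for a b c d z
    using f that by (simp add: hecke_maass_cusp_form_SL2_def)
  show ?thesis
    by (rule that, rule SL2Z_invariant_bound[where \<Phi> = "\<lambda>z. norm (f z)", OF inv bd])
qed

text \<open>The window is [U, U + 1] because the lower bound for K is known only from
  \<open>U\<close> on; at smaller arguments K may have zeros.\<close>

lemma maass_exp_sum_bound:
  assumes f: "hecke_maass_cusp_form_SL2 t f" and lam: "normalized_coeffs_maass_SL2 t f lam"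
  obtains C where "C > 0" "\<And>x \<alpha>. x \<ge> 1 \<Longrightarrow>
    norm (\<Sum>n | 1 \<le> n \<and> real n \<le> x. lam n * e2pi (of_nat n * of_real \<alpha>)) \<le> C * sqrt x * (1 + ln x)"
proof -
  let ?\<nu> = "\<i> * t"
  obtain \<rho> where \<rho>: "\<And>x y. y > 0 \<Longrightarrow> ((\<lambda>n. of_real (sqrt y) * \<rho> n * bessel_K ?\<nu> (2 * pi * \<bar>real_of_int n\<bar> * y) *
              e2pi (of_real (real_of_int n * x))) has_sum f (Complex x y)) {n. n \<noteq> 0}"
    and lr: "\<And>n. n \<ge> 1 \<Longrightarrow> lam n = \<rho> (int n)"
    using lam unfolding normalized_coeffs_maass_SL2_def by blast
  obtain M where M: "\<And>z. z \<in> upper_half \<Longrightarrow> norm (f z) \<le> M"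
    using maass_form_SL2_bounded[OF f \<rho>] by blast
  obtain c U where c: "c > 0" "U > 0" "\<And>u. u \<ge> U \<Longrightarrow> c * exp (- 2 * u) \<le> norm (bessel_K ?\<nu> u)"
    using bessel_K_lower[of ?\<nu>] by blast
  \<comment> \<open>The value 0 at index 0 lets the series run over all integers.\<close>
  define rho where "rho n = (if n = 0 then 0 else \<rho> n)" for n
  define g where "g u = bessel_K ?\<nu> (2 * pi * u)" for u
  have F: "\<exists>F. \<forall>x::real. ((\<lambda>n. of_real (sqrt y) * rho n * g (\<bar>real_of_int n\<bar> * y) * e2pi (of_int n * of_real x)) has_sum F x) UNIV
      \<and> norm (F x) \<le> M" if y: "y > 0" for y
  proof (intro exI[of _ "\<lambda>x. f (Complex x y)"] allI conjI)
    fix x :: real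
    show "((\<lambda>n. of_real (sqrt y) * rho n * g (\<bar>real_of_int n\<bar> * y) * e2pi (of_int n * of_real x)) has_sum f (Complex x y)) UNIV"
      by (rule has_sum_cong_neutral[THEN iffD1, OF _ _ _ \<rho>[OF y, of x]]) (auto simp: rho_def g_def mult.assoc)
    show "norm (f (Complex x y)) \<le> M" using y by (intro M) (simp add: upper_half_def)
  qed
  let ?L = "2 / U * exp ((norm ?\<nu> + 1)\<^sup>2 / (U / 2))"
  have U: "U \<le> 2 * pi * u" if "u \<in> {U..U + 1}" for u
  proof -
    have "1 * u \<le> 2 * pi * u" using that c(2) pi_gt3 by (intro mult_right_mono) auto
    thus ?thesis using that by simp
  qed
  obtain C where C: "C > 0" "\<And>x \<alpha>. x \<ge> 1 \<Longrightarrow>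
    norm (\<Sum>n | 1 \<le> n \<and> real n \<le> x. rho (int n) * e2pi (of_nat n * of_real \<alpha>)) \<le> C * sqrt x * (1 + ln x)"
  proof (rule exp_sum_bound_of_bounded_series[where rho = rho and g = g and M = M and ?u0.0 = U and ?u1.0 = "U + 1"
        and \<gamma> = "c * exp (- 2 * (2 * pi * (U + 1)))" and \<Lambda> = "?L * (2 * pi)"])
    fix u assume u: "u \<in> {U..U + 1}"
    have "c * exp (- 2 * (2 * pi * (U + 1))) \<le> c * exp (- 2 * (2 * pi * u))" using u c by simp
    also have "\<dots> \<le> norm (g u)" unfolding g_def by (rule c(3)[OF U[OF u]])
    finally show "c * exp (- 2 * (2 * pi * (U + 1))) \<le> norm (g u)" .
    fix v assume v: "v \<in> {U..U + 1}"
    have "norm (g u - g v) \<le> ?L * \<bar>2 * pi * u - 2 * pi * v\<bar>"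
      unfolding g_def by (rule bessel_K_lipschitz[OF c(2) U[OF u] U[OF v]])
    also have "\<bar>2 * pi * u - 2 * pi * v\<bar> = 2 * pi * \<bar>u - v\<bar>" by (simp add: abs_mult flip: right_diff_distrib)
    finally show "norm (g u - g v) \<le> ?L * (2 * pi) * \<bar>u - v\<bar>" by (simp only: mult.assoc)
  qed (use F c in auto)
  show ?thesis
  proof (rule that[OF C(1)])
    fix x \<alpha> :: real assume "x \<ge> 1"
    have "(\<Sum>n | 1 \<le> n \<and> real n \<le> x. rho (int n) * e2pi (of_nat n * of_real \<alpha>)) =
      (\<Sum>n | 1 \<le> n \<and> real n \<le> x. lam n * e2pi (of_nat n * of_real \<alpha>))"
      by (intro sum.cong refl) (simp add: rho_def lr)
    thus "norm (\<Sum>n | 1 \<le> n \<and> real n \<le> x. lam n * e2pi (of_nat n * of_real \<alpha>)) \<le> C * sqrt x * (1 + ln x)"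
      using C(2)[OF \<open>x \<ge> 1\<close>, of \<alpha>] by simp
  qed
qed

lemma SL2_exp_sum_bound:
  assumes "normalized_coeffs_SL2 f lam"
  obtains C where "C > 0" "\<And>x \<alpha>. x \<ge> 1 \<Longrightarrow>
    norm (\<Sum>n | 1 \<le> n \<and> real n \<le> x. lam n * e2pi (of_nat n * of_real \<alpha>)) \<le> C * sqrt x * (1 + ln x)"
proof -
  consider k where "holomorphic_cusp_form k f" "normalized_coeffs_holomorphic k f lam"
    | t where "hecke_maass_cusp_form_SL2 t f" "normalized_coeffs_maass_SL2 t f lam"
    using assms unfolding normalized_coeffs_SL2_def by blast
  thus ?thesis
  proof cases
    case 1
    show ?thesis by (rule holomorphic_exp_sum_bound[OF 1]) (rule that)
  next
    case 2
    show ?thesis by (rule maass_exp_sum_bound[OF 2]) (rule that)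
  qed
qed

section \<open>The averaged shifted convolution sum\<close>

text \<open>The derivative is continuous and vanishes outside a bounded interval, hence is bounded;
  this gives a Lipschitz constant on the whole line.\<close>

lemma test_function_bounds:
  assumes "test_function W"
  obtains c V L where "c \<ge> 1" "V \<ge> 0" "L \<ge> 0" "\<And>u. c < \<bar>u\<bar> \<Longrightarrow> W u = 0" "\<And>u. norm (W u) \<le> V"
    "\<And>u v. norm (W u - W v) \<le> L * \<bar>u - v\<bar>"
proof -
  have sm: "smooth_on UNIV W" and cp: "compact (closure {x. W x \<noteq> 0})"
    using assms by (auto simp: test_function_def)
  have "Ck_on (Suc 0) UNIV W" using sm unfolding smooth_on_def by blast
  hence d: "\<And>x. W differentiable (at x)" and cd: "continuous_on UNIV (\<lambda>x. frechet_derivative W (at x) 1)" by auto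
  have der: "(W has_vector_derivative frechet_derivative W (at x) 1) (at x)" for x
  proof -
    have "frechet_derivative W (at x) = (\<lambda>h. h *\<^sub>R frechet_derivative W (at x) 1)"
    proof
      fix h
      show "frechet_derivative W (at x) h = h *\<^sub>R frechet_derivative W (at x) 1"
        unfolding linear_scale[OF linear_frechet_derivative[OF d[of x]], symmetric] by simp
    qed
    from this[symmetric] show ?thesis
      using frechet_derivative_works[THEN iffD1, OF d[of x]] by (simp only: has_vector_derivative_def)
  qed
  from compact_imp_bounded[OF cp] obtain c0 where c0: "\<forall>x\<in>closure {x. W x \<noteq> 0}. norm x \<le> c0"
    unfolding bounded_iff by blast
  define c where "c = max 1 c0"
  have c: "W u = 0" if "c < \<bar>u\<bar>" for u
  proof (rule ccontr)
    assume "W u \<noteq> 0"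
    hence "u \<in> closure {x. W x \<noteq> 0}" using closure_subset[of "{x. W x \<noteq> 0}"] by blast
    thus False using c0 that unfolding c_def by force
  qed
  have c1: "c \<ge> 1" unfolding c_def by simp
  have cW: "continuous_on UNIV W"
    using d by (intro continuous_at_imp_continuous_on ballI differentiable_imp_continuous_within)
  let ?D = "\<lambda>x. frechet_derivative W (at x) 1"
  have bd: "\<exists>B. (\<forall>u. u \<in> {-c..c} \<longrightarrow> norm (G u) \<le> B) \<and> B > 0" if "continuous_on UNIV G" for G :: "real \<Rightarrow> complex"
  proof -
    have "bounded (G ` {-c..c})"
      by (intro compact_imp_bounded compact_continuous_image continuous_on_subset[OF that]) auto
    then obtain B where "B > 0" "\<forall>w\<in>G ` {-c..c}. norm w \<le> B" unfolding bounded_pos by blast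
    thus ?thesis by (intro exI[of _ B]) blast
  qed
  obtain V where V: "\<And>u. u \<in> {-c..c} \<Longrightarrow> norm (W u) \<le> V" "V > 0" using bd[OF cW] by blast
  obtain L where L: "\<And>u. u \<in> {-c..c} \<Longrightarrow> norm (?D u) \<le> L" "L > 0" using bd[OF cd] by blast
  have D0: "?D u = 0" if "c < \<bar>u\<bar>" for u
  proof -
    have "(W has_vector_derivative 0) (at u)"
    proof (rule has_vector_derivative_transform_within_open[where f = "\<lambda>_. 0"])
      show "open {u::real. c < \<bar>u\<bar>}" by (intro open_Collect_less continuous_intros)
    qed (use that c in auto)
    thus ?thesis using vector_derivative_unique_at[OF der[of u]] by simp
  qed
  have nD: "norm (?D u) \<le> L" for u
    using L(1)[of u] L(2) D0[of u] by (cases "c < \<bar>u\<bar>") (auto simp: not_less abs_le_iff minus_le_iff)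
  have lip: "norm (W u - W v) \<le> L * norm (u - v)" for u v
  proof (rule differentiable_bound[where S = UNIV and f' = "\<lambda>x h. h *\<^sub>R ?D x"])
    show "(W has_derivative (\<lambda>h. h *\<^sub>R ?D x)) (at x within UNIV)" for x
      using der[of x] by (simp add: has_vector_derivative_def)
    show "onorm (\<lambda>h. h *\<^sub>R ?D x) \<le> L" for x
    proof (rule onorm_le)
      show "norm (h *\<^sub>R ?D x) \<le> L * norm h" for h
        using mult_right_mono[OF nD[of x], of "norm h"] by (simp add: mult.commute)
    qed
  qed auto
  show ?thesis
  proof (rule that[OF c1])
    show "norm (W u) \<le> V" for u using V c[of u] by (cases "c < \<bar>u\<bar>") (auto simp: not_less abs_le_iff minus_le_iff)
    show "norm (W u - W v) \<le> L * \<bar>u - v\<bar>" for u v using lip[of u v] by simp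
  qed (use V L c in auto)
qed

text \<open>Partial summation against n -> W (n / H): at most c H steps of size at most L / H, so
  the variation is at most c L. The logarithms are separated by 1 + ln (c H) \<le> (1 + ln c) (1 +
  ln H).\<close>

lemma weighted_exp_sum_bound:
  fixes lam :: "nat \<Rightarrow> complex"
  assumes C: "C > 0" "\<And>x \<alpha>. x \<ge> 1 \<Longrightarrow>
      norm (\<Sum>n | 1 \<le> n \<and> real n \<le> x. lam n * e2pi (of_nat n * of_real \<alpha>)) \<le> C * sqrt x * (1 + ln x)"
    and c: "c \<ge> 1" and V: "V \<ge> 0" "\<And>u. norm (W u) \<le> V"
    and L: "L \<ge> 0" "\<And>u v. norm (W u - W v) \<le> L * \<bar>u - v\<bar>" and H: "H \<ge> 1"
  shows "norm (\<Sum>n | 1 \<le> n \<and> real n \<le> c * H. lam n * W (real n / H) * e2pi (of_nat n * of_real \<alpha>))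
     \<le> C * (V + c * L) * (sqrt c * (1 + ln c)) * (sqrt H * (1 + ln H))"
proof -
  define k where "k = nat \<lfloor>c * H\<rfloor>"
  have cH: "c * H \<ge> 1" using c H mult_mono[of 1 c 1 H] by simp
  have k: "real k \<le> c * H" using cH unfolding k_def by linarith
  define t where "t j = lam (Suc j) * e2pi (of_nat (Suc j) * of_real \<alpha>)" for j
  define v where "v j = W (real (Suc j) / H)" for j
  have set: "{n. 1 \<le> n \<and> real n \<le> x} = Suc ` {..<m}" if "m = nat \<lfloor>x\<rfloor>" for m x
  proof -
    have "real n \<le> x \<longleftrightarrow> n \<le> m" if "1 \<le> n" for n using that \<open>m = nat \<lfloor>x\<rfloor>\<close> by linarith
    hence "{n. 1 \<le> n \<and> real n \<le> x} = {1..m}" by auto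
    thus ?thesis by (simp add: image_Suc_lessThan)
  qed
  have "(\<Sum>n | 1 \<le> n \<and> real n \<le> c * H. lam n * W (real n / H) * e2pi (of_nat n * of_real \<alpha>)) = (\<Sum>j<k. t j * v j)"
    unfolding set[OF k_def] by (subst sum.reindex) (simp_all add: t_def v_def mult_ac)
  also have "norm \<dots> \<le> C * sqrt (c * H) * (1 + ln (c * H)) * (V + real k * (L / H))"
  proof (rule abel_summation_bound)
    fix m assume m: "m \<le> k"
    show "norm (\<Sum>j<m. t j) \<le> C * sqrt (c * H) * (1 + ln (c * H))"
    proof (cases "m = 0")
      case False
      have "(\<Sum>j<m. t j) = (\<Sum>n | 1 \<le> n \<and> real n \<le> real m. lam n * e2pi (of_nat n * of_real \<alpha>))"
        unfolding set[of m "real m", unfolded floor_of_nat nat_int, OF refl] by (subst sum.reindex) (simp_all add: t_def)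
      hence "norm (\<Sum>j<m. t j) \<le> C * sqrt (real m) * (1 + ln (real m))" using C(2)[of "real m" \<alpha>] False by simp
      also have "\<dots> \<le> C * sqrt (c * H) * (1 + ln (c * H))"
        using m k False cH C(1) by (intro mult_mono add_left_mono) auto
      finally show ?thesis .
    qed (use C(1) cH in simp)
  next
    fix j show "norm (v j) \<le> V" unfolding v_def by (rule V)
    have "norm (v j - v (Suc j)) \<le> L * \<bar>real (Suc j) / H - real (Suc (Suc j)) / H\<bar>" unfolding v_def by (rule L)
    also have "\<bar>real (Suc j) / H - real (Suc (Suc j)) / H\<bar> = 1 / H" using H by (simp add: field_simps)
    finally show "norm (v j - v (Suc j)) \<le> L / H" by simp
  qed (use V L H in auto)
  also have "\<dots> \<le> C * sqrt (c * H) * ((1 + ln c) * (1 + ln H)) * (V + c * L)"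
  proof (rule mult_mono)
    have "0 \<le> ln c * ln H" using c H by simp
    hence "1 + ln (c * H) \<le> (1 + ln c) * (1 + ln H)" using c H by (simp add: ln_mult algebra_simps)
    thus "C * sqrt (c * H) * (1 + ln (c * H)) \<le> C * sqrt (c * H) * ((1 + ln c) * (1 + ln H))"
      using C(1) c H by (intro mult_left_mono) auto
    have "real k * (L / H) \<le> c * H * (L / H)" using k L H by (intro mult_right_mono) auto
    thus "V + real k * (L / H) \<le> V + c * L" using H by simp
  qed (use C(1) c H L V cH in auto)
  also have "\<dots> = C * (V + c * L) * (sqrt c * (1 + ln c)) * (sqrt H * (1 + ln H))"
    by (simp add: real_sqrt_mult)
  finally show ?thesis .
qed

lemma parseval_finite:
  fixes b :: "nat \<Rightarrow> complex"
  assumes N: "finite N"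
  shows "integral {0..1::real} (\<lambda>\<alpha>. (norm (\<Sum>n\<in>N. b n * e2pi (of_nat n * of_real \<alpha>)))\<^sup>2) = (\<Sum>n\<in>N. (norm (b n))\<^sup>2)"
proof -
  let ?S = "\<lambda>\<alpha>::real. \<Sum>n\<in>N. b n * e2pi (of_nat n * of_real \<alpha>)"
  have "complex_of_real (integral {0..1} (\<lambda>\<alpha>. (norm (?S \<alpha>))\<^sup>2)) = integral {0..1} (\<lambda>\<alpha>. complex_of_real ((norm (?S \<alpha>))\<^sup>2))"
    using integral_linear[OF _ bounded_linear_of_real, of "\<lambda>\<alpha>. (norm (?S \<alpha>))\<^sup>2" "{0..1}", symmetric]
    by (simp add: o_def integrable_continuous_real continuous_intros)
  also have "\<dots> = integral {0..1} (\<lambda>\<alpha>. \<Sum>n\<in>N. \<Sum>m\<in>N. b n * cnj (b m) * e2pi (of_int (int n - int m) * of_real \<alpha>))"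
  proof (rule arg_cong[where f = "integral {0..1}"], rule ext)
    fix \<alpha> :: real
    have "complex_of_real ((norm (?S \<alpha>))\<^sup>2) = ?S \<alpha> * cnj (?S \<alpha>)" by (rule complex_norm_square)
    also have "cnj (?S \<alpha>) = (\<Sum>m\<in>N. cnj (b m) * e2pi (- (of_nat m * of_real \<alpha>)))"
      unfolding cnj_sum
    proof (intro sum.cong refl)
      fix m show "cnj (b m * e2pi (of_nat m * of_real \<alpha>)) = cnj (b m) * e2pi (- (of_nat m * of_real \<alpha>))"
        using cnj_e2pi_of_real[of "real m * \<alpha>"] by simp
    qed
    finally show "complex_of_real ((norm (?S \<alpha>))\<^sup>2) =
      (\<Sum>n\<in>N. \<Sum>m\<in>N. b n * cnj (b m) * e2pi (of_int (int n - int m) * of_real \<alpha>))"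
      unfolding sum_product by (simp add: algebra_simps e2pi_add flip: e2pi_add cong: sum.cong)
  qed
  also have "\<dots> = (\<Sum>n\<in>N. \<Sum>m\<in>N. b n * cnj (b m) * (if n = m then 1 else 0))"
  proof -
    have "integral {0..1} (\<lambda>\<alpha>::real. \<Sum>n\<in>N. \<Sum>m\<in>N. b n * cnj (b m) * e2pi (of_int (int n - int m) * of_real \<alpha>))
      = (\<Sum>n\<in>N. \<Sum>m\<in>N. integral {0..1} (\<lambda>\<alpha>::real. b n * cnj (b m) * e2pi (of_int (int n - int m) * of_real \<alpha>)))"
      using N by (subst integral_sum, assumption,
        (intro integrable_continuous_real continuous_intros)[1],
        intro sum.cong refl integral_sum integrable_continuous_real continuous_intros)
    also have "\<dots> = (\<Sum>n\<in>N. \<Sum>m\<in>N. b n * cnj (b m) * (if int n - int m = 0 then 1 else 0))"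
      by (simp only: integral_mult_right integral_e2pi)
    finally show ?thesis by simp
  qed
  also have "\<dots> = complex_of_real (\<Sum>n\<in>N. (norm (b n))\<^sup>2)"
    unfolding of_real_sum
  proof (intro sum.cong refl)
    fix n assume n: "n \<in> N"
    have "(\<Sum>m\<in>N. b n * cnj (b m) * (if n = m then 1 else 0)) = (\<Sum>m\<in>N. if n = m then b n * cnj (b m) else 0)"
      by (intro sum.cong refl) auto
    also have "\<dots> = b n * cnj (b n)" using N n by simp
    finally show "(\<Sum>m\<in>N. b n * cnj (b m) * (if n = m then 1 else 0)) = complex_of_real ((norm (b n))\<^sup>2)"
      unfolding complex_norm_square .
  qed
  finally show ?thesis by (simp only: of_real_eq_iff)
qed

text \<open>By orthogonality of the exponentials, the sum is the integral over the unit interval of a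
  product of three exponential sums.\<close>

lemma trilinear_sum_bound:
  fixes a b d :: "nat \<Rightarrow> complex"
  assumes fin: "finite Hs" "finite Ns" "finite Ms"
    and sub: "\<And>h n. h \<in> Hs \<Longrightarrow> n \<in> Ns \<Longrightarrow> n + h \<in> Ms"
    and K: "\<And>\<alpha>::real. norm (\<Sum>h\<in>Hs. a h * e2pi (of_nat h * of_real \<alpha>)) \<le> K"
  shows "norm (\<Sum>h\<in>Hs. a h * (\<Sum>n\<in>Ns. b n * d (n + h)))
    \<le> K * (((\<Sum>n\<in>Ns. (norm (b n))\<^sup>2) + (\<Sum>m\<in>Ms. (norm (d m))\<^sup>2)) / 2)"
proof -
  let ?A = "\<lambda>\<alpha>::real. \<Sum>h\<in>Hs. a h * e2pi (of_nat h * of_real \<alpha>)"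
  let ?B = "\<lambda>\<alpha>::real. \<Sum>n\<in>Ns. b n * e2pi (of_nat n * of_real \<alpha>)"
  \<comment> \<open>The coefficients are conjugated so that \<open>cnj (?D \<alpha>)\<close> carries
    \<open>d m\<close> with frequency -m.\<close>
  let ?D = "\<lambda>\<alpha>::real. \<Sum>m\<in>Ms. cnj (d m) * e2pi (of_nat m * of_real \<alpha>)"
  have K0: "K \<ge> 0" using K[of 0] norm_ge_zero order_trans by blast
  have D: "cnj (?D \<alpha>) = (\<Sum>m\<in>Ms. d m * e2pi (- (of_nat m * of_real \<alpha>)))" for \<alpha>
    unfolding cnj_sum
  proof (intro sum.cong refl)
    fix m show "cnj (cnj (d m) * e2pi (of_nat m * of_real \<alpha>)) = d m * e2pi (- (of_nat m * of_real \<alpha>))"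
      using cnj_e2pi_of_real[of "real m * \<alpha>"] by simp
  qed
  have ce: "(\<lambda>\<alpha>. c * e2pi (of_int k * of_real \<alpha>)) integrable_on {0..1::real}" for c k
    by (intro integrable_continuous_real continuous_intros)
  have ex: "?A \<alpha> * ?B \<alpha> * cnj (?D \<alpha>) =
      (\<Sum>h\<in>Hs. \<Sum>n\<in>Ns. \<Sum>m\<in>Ms. a h * b n * d m * e2pi (of_int (int n + int h - int m) * of_real \<alpha>))" for \<alpha> :: real
  proof -
    have e: "e2pi (of_nat h * of_real \<alpha>) * e2pi (of_nat n * of_real \<alpha>) * e2pi (- (of_nat m * of_real \<alpha>))
      = e2pi (of_int (int n + int h - int m) * of_real \<alpha>)" for h n m
      by (simp add: algebra_simps flip: e2pi_add)
    have "?A \<alpha> * ?B \<alpha> * cnj (?D \<alpha>) = (\<Sum>h\<in>Hs. \<Sum>n\<in>Ns. \<Sum>m\<in>Ms.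
      (a h * e2pi (of_nat h * of_real \<alpha>)) * (b n * e2pi (of_nat n * of_real \<alpha>)) * (d m * e2pi (- (of_nat m * of_real \<alpha>))))"
      unfolding D by (simp only: sum_distrib_left[symmetric] sum_distrib_right[symmetric])
    also have "\<dots> = (\<Sum>h\<in>Hs. \<Sum>n\<in>Ns. \<Sum>m\<in>Ms. a h * b n * d m *
      (e2pi (of_nat h * of_real \<alpha>) * e2pi (of_nat n * of_real \<alpha>) * e2pi (- (of_nat m * of_real \<alpha>))))"
      by (intro sum.cong refl) (simp only: mult_ac)
    finally show ?thesis unfolding e .
  qed
  have "integral {0..1} (\<lambda>\<alpha>. ?A \<alpha> * ?B \<alpha> * cnj (?D \<alpha>)) =
    (\<Sum>h\<in>Hs. \<Sum>n\<in>Ns. \<Sum>m\<in>Ms. a h * b n * d m * (if int n + int h - int m = 0 then 1 else 0))"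
  proof -
    have "integral {0..1} (\<lambda>\<alpha>. ?A \<alpha> * ?B \<alpha> * cnj (?D \<alpha>)) = (\<Sum>h\<in>Hs. \<Sum>n\<in>Ns. \<Sum>m\<in>Ms.
      integral {0..1} (\<lambda>\<alpha>::real. a h * b n * d m * e2pi (of_int (int n + int h - int m) * of_real \<alpha>)))"
      unfolding ex using fin
      by (simp only: integral_sum integrable_sum ce)
    thus ?thesis by (simp only: integral_mult_right integral_e2pi)
  qed
  also have "\<dots> = (\<Sum>h\<in>Hs. a h * (\<Sum>n\<in>Ns. b n * d (n + h)))"
    unfolding sum_distrib_left
  proof (intro sum.cong refl)
    fix h n assume hn: "h \<in> Hs" "n \<in> Ns"
    have "(\<Sum>m\<in>Ms. a h * b n * d m * (if int n + int h - int m = 0 then 1 else 0))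
      = (\<Sum>m\<in>Ms. if m = n + h then a h * b n * d m else 0)"
      by (intro sum.cong refl) auto
    also have "\<dots> = a h * (b n * d (n + h))" using fin(3) sub[OF hn] by simp
    finally show "(\<Sum>m\<in>Ms. a h * b n * d m * (if int n + int h - int m = 0 then 1 else 0)) = a h * (b n * d (n + h))" .
  qed
  finally have "norm (\<Sum>h\<in>Hs. a h * (\<Sum>n\<in>Ns. b n * d (n + h))) = norm (integral {0..1} (\<lambda>\<alpha>. ?A \<alpha> * ?B \<alpha> * cnj (?D \<alpha>)))"
    by simp
  also have "\<dots> \<le> integral {0..1} (\<lambda>\<alpha>. K * (((norm (?B \<alpha>))\<^sup>2 + (norm (?D \<alpha>))\<^sup>2) / 2))"
  proof (rule integral_norm_bound_integral)
    show "(\<lambda>\<alpha>. ?A \<alpha> * ?B \<alpha> * cnj (?D \<alpha>)) integrable_on {0..1}"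
      by (intro integrable_continuous_real continuous_intros)
    show "(\<lambda>\<alpha>. K * (((norm (?B \<alpha>))\<^sup>2 + (norm (?D \<alpha>))\<^sup>2) / 2)) integrable_on {0..1}"
      by (intro integrable_continuous_real continuous_intros) auto
    fix \<alpha> :: real
    have "norm (?A \<alpha> * ?B \<alpha> * cnj (?D \<alpha>)) = norm (?A \<alpha>) * (norm (?B \<alpha>) * norm (?D \<alpha>))"
      by (simp only: norm_mult complex_mod_cnj mult.assoc)
    also have "\<dots> \<le> K * (((norm (?B \<alpha>))\<^sup>2 + (norm (?D \<alpha>))\<^sup>2) / 2)"
    proof (rule mult_mono[OF K _ K0])
      \<comment> \<open>The arithmetic mean stands in for the Cauchy-Schwarz inequality; in the
        application both mean squares are O(X), so the order of the bound is not affected.\<close>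
      have "p * q \<le> (p\<^sup>2 + q\<^sup>2) / 2" for p q :: real using sum_squares_bound[of p q] by simp
      thus "norm (?B \<alpha>) * norm (?D \<alpha>) \<le> ((norm (?B \<alpha>))\<^sup>2 + (norm (?D \<alpha>))\<^sup>2) / 2" .
    qed simp
    finally show "norm (?A \<alpha> * ?B \<alpha> * cnj (?D \<alpha>)) \<le> K * (((norm (?B \<alpha>))\<^sup>2 + (norm (?D \<alpha>))\<^sup>2) / 2)" .
  qed
  also have "\<dots> = K * ((integral {0..1} (\<lambda>\<alpha>. (norm (?B \<alpha>))\<^sup>2) + integral {0..1} (\<lambda>\<alpha>. (norm (?D \<alpha>))\<^sup>2)) / 2)"
  proof -
    have "integral {0..1} (\<lambda>\<alpha>. (norm (?B \<alpha>))\<^sup>2 + (norm (?D \<alpha>))\<^sup>2) =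
      integral {0..1} (\<lambda>\<alpha>. (norm (?B \<alpha>))\<^sup>2) + integral {0..1} (\<lambda>\<alpha>. (norm (?D \<alpha>))\<^sup>2)"
      by (intro Henstock_Kurzweil_Integration.integral_add integrable_continuous_real continuous_intros)
    thus ?thesis by (simp only: integral_mult_right integral_divide)
  qed
  finally show ?thesis unfolding parseval_finite[OF fin(2)] parseval_finite[OF fin(3)] by simp
qed

section \<open>Finite sums and the two ranges of X\<close>

lemma finite_le_real: "finite {n::nat. 1 \<le> n \<and> real n \<le> x}"
  by (rule finite_subset[of _ "{..nat \<lfloor>x\<rfloor>}"]) (auto simp: le_nat_floor)

lemma shifted_conv_avg_finite:
  assumes W: "\<And>u. c < \<bar>u\<bar> \<Longrightarrow> W1 u = 0" "\<And>u. c < \<bar>u\<bar> \<Longrightarrow> W2 u = 0" and HX: "H > 0" "X > 0"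
  shows "shifted_conv_avg lam A1 A2 W1 W2 H X = (1 / of_real H) *
     (\<Sum>h | 1 \<le> h \<and> real h \<le> c * H. lam h * W1 (real h / H) *
        (\<Sum>n | 1 \<le> n \<and> real n \<le> c * X. A1 1 n * W2 (real n / X) * A2 1 (n + h)))"
proof -
  have 1: "(\<Sum>\<^sub>\<infinity>n\<in>{1..}. g n) = (\<Sum>n | 1 \<le> n \<and> real n \<le> x. g n)"
    if "\<And>n. n \<ge> 1 \<Longrightarrow> x < real n \<Longrightarrow> g n = 0" for g :: "nat \<Rightarrow> complex" and x
  proof -
    have "(\<Sum>\<^sub>\<infinity>n\<in>{1..}. g n) = (\<Sum>\<^sub>\<infinity>n\<in>{n. 1 \<le> n \<and> real n \<le> x}. g n)"
      by (rule infsum_cong_neutral) (auto intro!: that)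
    thus ?thesis using finite_le_real by simp
  qed
  have big: "c < \<bar>real n / Y\<bar>" if "c * Y < real n" "Y > 0" for n Y
    using that by (simp add: pos_less_divide_eq)
  have "(\<Sum>\<^sub>\<infinity>n\<in>{1..}. A1 1 n * A2 1 (n + h) * W2 (real n / X)) =
      (\<Sum>n | 1 \<le> n \<and> real n \<le> c * X. A1 1 n * A2 1 (n + h) * W2 (real n / X))" for h
    by (rule 1) (simp add: W(2)[OF big] HX)
  hence "(\<Sum>\<^sub>\<infinity>n\<in>{1..}. A1 1 n * A2 1 (n + h) * W2 (real n / X)) =
      (\<Sum>n | 1 \<le> n \<and> real n \<le> c * X. A1 1 n * W2 (real n / X) * A2 1 (n + h))" for h
    by (simp only: mult_ac)
  moreover have "(\<Sum>\<^sub>\<infinity>h\<in>{1..}. lam h * W1 (real h / H) * g h) =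
      (\<Sum>h | 1 \<le> h \<and> real h \<le> c * H. lam h * W1 (real h / H) * g h)" for g :: "nat \<Rightarrow> complex"
    by (rule 1) (simp add: W(1)[OF big] HX)
  ultimately show ?thesis unfolding shifted_conv_avg_def by (simp only:)
qed

lemma ln_le_powr:
  fixes x \<epsilon> :: real
  assumes "x \<ge> 1" "\<epsilon> > 0"
  shows "1 + ln x \<le> (1 + 1 / \<epsilon>) * x powr \<epsilon>"
proof -
  have "\<epsilon> * ln x = ln (x powr \<epsilon>)" using assms by (simp add: ln_powr)
  also have "\<dots> \<le> x powr \<epsilon>" using ln_less_self[of "x powr \<epsilon>"] assms by simp
  finally have "ln x \<le> x powr \<epsilon> / \<epsilon>" using assms by (simp add: field_simps)
  moreover have "1 \<le> x powr \<epsilon>" using assms by (simp add: ge_one_powr_ge_zero)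
  ultimately show ?thesis by (simp add: algebra_simps)
qed

text \<open>Here 1 \<le> H \<le> X, so n + h stays below 2 c X. Division by H leaves X (1 + ln H)
  sqrt H / H; the bounds sqrt H \<le> sqrt X and H \<ge> X^(1/2+\<delta>) turn this into
  X^(1-\<delta>) (1 + ln H), and the logarithm costs X^\<epsilon>.\<close>

lemma shifted_conv_avg_bound_large:
  fixes lam :: "nat \<Rightarrow> complex"
  assumes C: "C > 0" "\<And>x \<alpha>. x \<ge> 1 \<Longrightarrow>
      norm (\<Sum>n | 1 \<le> n \<and> real n \<le> x. lam n * e2pi (of_nat n * of_real \<alpha>)) \<le> C * sqrt x * (1 + ln x)"
    and B: "B1 > 0" "B2 > 0" "\<And>x. x \<ge> 1 \<Longrightarrow> (\<Sum>n | 1 \<le> n \<and> real n \<le> x. (norm (A1 1 n))\<^sup>2) \<le> B1 * x"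
      "\<And>x. x \<ge> 1 \<Longrightarrow> (\<Sum>n | 1 \<le> n \<and> real n \<le> x. (norm (A2 1 n))\<^sup>2) \<le> B2 * x"
    and c: "c \<ge> 1" and W: "\<And>u. c < \<bar>u\<bar> \<Longrightarrow> W1 u = 0" "\<And>u. c < \<bar>u\<bar> \<Longrightarrow> W2 u = 0"
    and V: "V \<ge> 0" "\<And>u. norm (W1 u) \<le> V" "\<And>u. norm (W2 u) \<le> V"
    and L: "L \<ge> 0" "\<And>u v. norm (W1 u - W1 v) \<le> L * \<bar>u - v\<bar>"
    and \<epsilon>: "\<epsilon> > 0" and \<delta>: "\<delta> > 0" and X: "X \<ge> 1" and H: "X powr (1/2 + \<delta>) \<le> H" "H < X powr (1 - \<epsilon>)"
  shows "norm (shifted_conv_avg lam A1 A2 W1 W2 H X) \<le>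
     C * (V + c * L) * (sqrt c * (1 + ln c)) * ((V\<^sup>2 * B1 * c + B2 * (2 * c)) / 2) * (1 + 1 / \<epsilon>) * X powr (1 - \<delta> + \<epsilon>)"
proof -
  have H1: "H \<ge> 1" using H(1) ge_one_powr_ge_zero[OF X, of "1/2 + \<delta>"] \<delta> by linarith
  have HX: "H \<le> X" using H(2) powr_mono[of "1 - \<epsilon>" 1 X] X \<epsilon> by simp
  have cX: "c * X \<ge> 1" using c X mult_mono[of 1 c 1 X] by simp
  define K where "K = C * (V + c * L) * (sqrt c * (1 + ln c))"
  have K: "K \<ge> 0" unfolding K_def using C V c L by simp
  let ?Hs = "{h. 1 \<le> h \<and> real h \<le> c * H}" and ?Ns = "{n. 1 \<le> n \<and> real n \<le> c * X}"
    and ?Ms = "{n. 1 \<le> n \<and> real n \<le> 2 * c * X}"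
  let ?b = "\<lambda>n. A1 1 n * W2 (real n / X)"
  have b: "(\<Sum>n\<in>?Ns. (norm (?b n))\<^sup>2) \<le> V\<^sup>2 * B1 * c * X"
  proof -
    have "(\<Sum>n\<in>?Ns. (norm (?b n))\<^sup>2) \<le> (\<Sum>n\<in>?Ns. V\<^sup>2 * (norm (A1 1 n))\<^sup>2)"
    proof (rule sum_mono)
      fix n
      have "(norm (W2 (real n / X)))\<^sup>2 \<le> V\<^sup>2" by (intro power_mono V) auto
      hence "(norm (W2 (real n / X)))\<^sup>2 * (norm (A1 1 n))\<^sup>2 \<le> V\<^sup>2 * (norm (A1 1 n))\<^sup>2"
        by (rule mult_right_mono) simp
      thus "(norm (?b n))\<^sup>2 \<le> V\<^sup>2 * (norm (A1 1 n))\<^sup>2" by (simp only: norm_mult power_mult_distrib mult.commute)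
    qed
    also have "\<dots> = V\<^sup>2 * (\<Sum>n\<in>?Ns. (norm (A1 1 n))\<^sup>2)" by (simp only: sum_distrib_left)
    also have "\<dots> \<le> V\<^sup>2 * (B1 * (c * X))" by (intro mult_left_mono B cX) simp
    finally show ?thesis by (simp only: mult.assoc)
  qed
  have d: "(\<Sum>n\<in>?Ms. (norm (A2 1 n))\<^sup>2) \<le> B2 * (2 * c) * X"
    using B(4)[of "2 * c * X"] cX by (simp add: mult_ac)
  have "norm (\<Sum>h\<in>?Hs. lam h * W1 (real h / H) * (\<Sum>n\<in>?Ns. ?b n * A2 1 (n + h)))
    \<le> K * (sqrt H * (1 + ln H)) * (((\<Sum>n\<in>?Ns. (norm (?b n))\<^sup>2) + (\<Sum>m\<in>?Ms. (norm (A2 1 m))\<^sup>2)) / 2)"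
  proof (rule trilinear_sum_bound[OF finite_le_real finite_le_real finite_le_real])
    fix h n assume hn: "h \<in> ?Hs" "n \<in> ?Ns"
    have "c * H \<le> c * X" using HX c by (intro mult_left_mono) auto
    thus "n + h \<in> ?Ms" using hn by auto
  next
    fix \<alpha> show "norm (\<Sum>h\<in>?Hs. lam h * W1 (real h / H) * e2pi (of_nat h * of_real \<alpha>)) \<le> K * (sqrt H * (1 + ln H))"
      unfolding K_def by (rule weighted_exp_sum_bound[OF C c V(1,2) L H1])
  qed
  also have "\<dots> \<le> K * (sqrt H * (1 + ln H)) * (((V\<^sup>2 * B1 * c * X) + B2 * (2 * c) * X) / 2)"
    using b d K H1 by (intro mult_left_mono divide_right_mono add_mono) auto
  also have "\<dots> = K * ((V\<^sup>2 * B1 * c + B2 * (2 * c)) / 2) * (sqrt H * (1 + ln H) * X)" by (simp add: field_simps)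
  finally have S: "norm (\<Sum>h\<in>?Hs. lam h * W1 (real h / H) * (\<Sum>n\<in>?Ns. ?b n * A2 1 (n + h)))
    \<le> K * ((V\<^sup>2 * B1 * c + B2 * (2 * c)) / 2) * (sqrt H * (1 + ln H) * X)" .
  have "norm (shifted_conv_avg lam A1 A2 W1 W2 H X) =
    1 / H * norm (\<Sum>h\<in>?Hs. lam h * W1 (real h / H) * (\<Sum>n\<in>?Ns. ?b n * A2 1 (n + h)))"
    by (subst shifted_conv_avg_finite[OF W]) (use H1 X in \<open>simp_all add: norm_mult norm_divide\<close>)
  also have "\<dots> \<le> 1 / H * (K * ((V\<^sup>2 * B1 * c + B2 * (2 * c)) / 2) * (sqrt H * (1 + ln H) * X))"
    using H1 by (intro mult_left_mono[OF S]) simp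
  also have "\<dots> = K * ((V\<^sup>2 * B1 * c + B2 * (2 * c)) / 2) * (sqrt H / H * (1 + ln H) * X)" by simp
  also have "\<dots> \<le> K * ((V\<^sup>2 * B1 * c + B2 * (2 * c)) / 2) * (X powr (- \<delta>) * ((1 + 1 / \<epsilon>) * X powr \<epsilon>) * X)"
  proof (intro mult_left_mono mult_right_mono)
    have "sqrt H / H \<le> sqrt X / X powr (1/2 + \<delta>)"
      using H HX X H1 by (intro frac_le) auto
    also have "\<dots> = X powr (- \<delta>)" using X by (simp add: powr_half_sqrt[symmetric] powr_diff[symmetric])
    finally have 1: "sqrt H / H \<le> X powr (- \<delta>)" .
    have "1 + ln H \<le> 1 + ln X" using HX H1 by simp
    also have "\<dots> \<le> (1 + 1 / \<epsilon>) * X powr \<epsilon>" by (rule ln_le_powr[OF X \<epsilon>])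
    finally have 2: "1 + ln H \<le> (1 + 1 / \<epsilon>) * X powr \<epsilon>" .
    show "sqrt H / H * (1 + ln H) \<le> X powr (- \<delta>) * ((1 + 1 / \<epsilon>) * X powr \<epsilon>)"
      using H1 by (intro mult_mono 1 2) auto
  qed (use K B c X in auto)
  also have "X powr (- \<delta>) * ((1 + 1 / \<epsilon>) * X powr \<epsilon>) * X = (1 + 1 / \<epsilon>) * (X powr 1 * X powr (- \<delta>) * X powr \<epsilon>)"
    using X by simp
  also have "X powr 1 * X powr (- \<delta>) * X powr \<epsilon> = X powr (1 - \<delta> + \<epsilon>)"
    by (simp only: powr_add[symmetric]) simp
  finally show ?thesis unfolding K_def by (simp only: mult.assoc)
qed

text \<open>Unless one of the sums is empty, X and H are at least 1 / c, so a fixed finite set of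
  coefficients is involved and a trivial estimate suffices. It is uniform in \<delta> because X < 1
  gives X^(1-\<delta>+\<epsilon>) \<ge> X^(1+\<epsilon>).\<close>

lemma shifted_conv_avg_bound_small:
  assumes c: "c \<ge> 1" and W: "\<And>u. c < \<bar>u\<bar> \<Longrightarrow> W1 u = 0" "\<And>u. c < \<bar>u\<bar> \<Longrightarrow> W2 u = 0"
    and V: "V \<ge> 0" "\<And>u. norm (W1 u) \<le> V" "\<And>u. norm (W2 u) \<le> V"
    and \<epsilon>: "\<epsilon> > 0" and \<delta>: "\<delta> > 0" and X: "X > 0" "X < 1" and H: "H > 0" "H < X powr (1 - \<epsilon>)"
  shows "norm (shifted_conv_avg lam A1 A2 W1 W2 H X) \<le> c *
     (\<Sum>h | 1 \<le> h \<and> real h \<le> c * c powr \<epsilon>. norm (lam h) * V *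
        (\<Sum>n | 1 \<le> n \<and> real n \<le> c. norm (A1 1 n) * V * norm (A2 1 (n + h)))) * c powr (1 + \<epsilon>) * X powr (1 - \<delta> + \<epsilon>)"
    (is "_ \<le> c * ?S * _ * _")
proof -
  have E: "shifted_conv_avg lam A1 A2 W1 W2 H X = (1 / of_real H) *
     (\<Sum>h | 1 \<le> h \<and> real h \<le> c * H. lam h * W1 (real h / H) *
        (\<Sum>n | 1 \<le> n \<and> real n \<le> c * X. A1 1 n * W2 (real n / X) * A2 1 (n + h)))"
    by (rule shifted_conv_avg_finite[OF W H(1) X(1)])
  show ?thesis
  proof (cases "c * X < 1 \<or> c * H < 1")
    case True
    have emp: "{n. 1 \<le> n \<and> real n \<le> y} = {}" if "y < 1" for y using that by auto
    have "shifted_conv_avg lam A1 A2 W1 W2 H X = 0"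
    proof (cases "c * X < 1")
      case True
      show ?thesis
        unfolding E emp[OF True] by simp
    next
      case False
      hence h: "c * H < 1" using True by simp
      show ?thesis
        unfolding E emp[OF h] by simp
    qed
    moreover have "0 \<le> c * ?S * c powr (1 + \<epsilon>) * X powr (1 - \<delta> + \<epsilon>)"
      using c V by (intro mult_nonneg_nonneg sum_nonneg) auto
    ultimately show ?thesis by simp
  next
    case False
    hence cX: "1 / X \<le> c" and cH: "1 / H \<le> c" using X H by (auto simp: field_simps)
    have S: "?S \<ge> 0" using c V by (intro mult_nonneg_nonneg sum_nonneg) auto
    have inv: "X powr (- a) \<le> c powr a" if "a \<ge> 0" for a
    proof -
      have "X powr (- a) = (1 / X) powr a" using X by (simp add: powr_minus powr_divide inverse_eq_divide)
      thus ?thesis using powr_mono2[OF that _ cX] X by simp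
    qed
    \<comment> \<open>If \<epsilon> > 1, the range of H extends beyond 1; then X \<ge> 1 / c still
      bounds H by c^\<epsilon>, which fixes the range of h.\<close>
    have "X powr (1 - \<epsilon>) = X * X powr (- \<epsilon>)" using X by (simp add: powr_diff powr_minus_divide)
    also have "\<dots> \<le> 1 * c powr \<epsilon>" using X \<epsilon> by (intro mult_mono inv) auto
    finally have Hc: "c * H \<le> c * c powr \<epsilon>" using H c by (intro mult_left_mono) auto
    have "norm (shifted_conv_avg lam A1 A2 W1 W2 H X) = 1 / H *
      norm (\<Sum>h | 1 \<le> h \<and> real h \<le> c * H. lam h * W1 (real h / H) *
          (\<Sum>n | 1 \<le> n \<and> real n \<le> c * X. A1 1 n * W2 (real n / X) * A2 1 (n + h)))"
      unfolding E using H by (simp add: norm_mult norm_divide)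
    also have "\<dots> \<le> c * ?S"
    proof (rule mult_mono[OF cH])
      have "norm (\<Sum>h | 1 \<le> h \<and> real h \<le> c * H. lam h * W1 (real h / H) *
          (\<Sum>n | 1 \<le> n \<and> real n \<le> c * X. A1 1 n * W2 (real n / X) * A2 1 (n + h)))
        \<le> (\<Sum>h | 1 \<le> h \<and> real h \<le> c * H. norm (lam h) * V *
          (\<Sum>n | 1 \<le> n \<and> real n \<le> c. norm (A1 1 n) * V * norm (A2 1 (n + h))))"
      proof (rule sum_norm_le)
        fix h
        have "norm (\<Sum>n | 1 \<le> n \<and> real n \<le> c * X. A1 1 n * W2 (real n / X) * A2 1 (n + h))
          \<le> (\<Sum>n | 1 \<le> n \<and> real n \<le> c * X. norm (A1 1 n) * V * norm (A2 1 (n + h)))"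
          unfolding norm_mult by (intro sum_norm_le) (simp only: norm_mult, intro mult_right_mono mult_left_mono V norm_ge_zero)
        also have "\<dots> \<le> (\<Sum>n | 1 \<le> n \<and> real n \<le> c. norm (A1 1 n) * V * norm (A2 1 (n + h)))"
        proof (rule sum_mono2[OF finite_le_real])
          have "c * X \<le> c" using c X by simp
          thus "{n. 1 \<le> n \<and> real n \<le> c * X} \<subseteq> {n. 1 \<le> n \<and> real n \<le> c}" by auto
        qed (use V in auto)
        finally show "norm (lam h * W1 (real h / H) *
          (\<Sum>n | 1 \<le> n \<and> real n \<le> c * X. A1 1 n * W2 (real n / X) * A2 1 (n + h))) \<le> norm (lam h) * V *
          (\<Sum>n | 1 \<le> n \<and> real n \<le> c. norm (A1 1 n) * V * norm (A2 1 (n + h)))"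
          unfolding norm_mult by (intro mult_mono mult_left_mono V) (use V in auto)
      qed
      also have "\<dots> \<le> ?S"
        by (rule sum_mono2[OF finite_le_real]) (use Hc V in \<open>auto intro!: mult_nonneg_nonneg sum_nonneg\<close>)
      finally show "norm (\<Sum>h | 1 \<le> h \<and> real h \<le> c * H. lam h * W1 (real h / H) *
          (\<Sum>n | 1 \<le> n \<and> real n \<le> c * X. A1 1 n * W2 (real n / X) * A2 1 (n + h))) \<le> ?S" .
    qed (use c in auto)
    also have "\<dots> = c * ?S * 1" by simp
    also have "\<dots> \<le> c * ?S * (c powr (1 + \<epsilon>) * X powr (1 - \<delta> + \<epsilon>))"
    proof (rule mult_left_mono)
      have "1 = X powr (- (1 + \<epsilon>)) * X powr (1 + \<epsilon>)" using X by (simp flip: powr_add)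
      also have "\<dots> \<le> c powr (1 + \<epsilon>) * X powr (1 - \<delta> + \<epsilon>)"
        using X \<epsilon> \<delta> by (intro mult_mono inv powr_mono') auto
      finally show "1 \<le> c powr (1 + \<epsilon>) * X powr (1 - \<delta> + \<epsilon>)" .
    qed (use c S in simp)
    finally show ?thesis by (simp only: mult.assoc)
  qed
qed

theorem theorem1:
  fixes \<phi>1 \<phi>2 :: "mat3 \<Rightarrow> complex" and A1 A2 :: "nat \<Rightarrow> nat \<Rightarrow> complex"
    and f :: "complex \<Rightarrow> complex" and lam :: "nat \<Rightarrow> complex"
    and W1 W2 :: "real \<Rightarrow> complex" and \<epsilon> :: real
  assumes "hecke_maass_cusp_form_SL3 \<phi>1" and "normalized_coeffs_SL3 \<phi>1 A1"
    and "hecke_maass_cusp_form_SL3 \<phi>2" and "normalized_coeffs_SL3 \<phi>2 A2"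
    and "normalized_coeffs_SL2 f lam"
    and "test_function W1" and "test_function W2"
    and "\<epsilon> > 0"
  shows "\<exists>C::real. \<forall>\<delta>>0. \<forall>X>0. \<forall>H>0. X powr (1/2 + \<delta>) \<le> H \<and> H < X powr (1 - \<epsilon>) \<longrightarrow>
           norm (shifted_conv_avg lam A1 A2 W1 W2 H X) \<le> C * X powr (1 - \<delta> + \<epsilon>)"
proof -
  obtain B1 where B1: "B1 > 0" "\<And>x. x \<ge> 1 \<Longrightarrow> (\<Sum>n | 1 \<le> n \<and> real n \<le> x. (norm (A1 1 n))\<^sup>2) \<le> B1 * x"
    using mean_square_coeffs_SL3[OF _ assms(2)] assms(1) unfolding hecke_maass_cusp_form_SL3_def by blast
  obtain B2 where B2: "B2 > 0" "\<And>x. x \<ge> 1 \<Longrightarrow> (\<Sum>n | 1 \<le> n \<and> real n \<le> x. (norm (A2 1 n))\<^sup>2) \<le> B2 * x"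
    using mean_square_coeffs_SL3[OF _ assms(4)] assms(3) unfolding hecke_maass_cusp_form_SL3_def by blast
  obtain C where C: "C > 0" "\<And>x \<alpha>. x \<ge> 1 \<Longrightarrow>
    norm (\<Sum>n | 1 \<le> n \<and> real n \<le> x. lam n * e2pi (of_nat n * of_real \<alpha>)) \<le> C * sqrt x * (1 + ln x)"
    using SL2_exp_sum_bound[OF assms(5)] by blast
  obtain c1 V1 L where W1: "c1 \<ge> 1" "V1 \<ge> 0" "L \<ge> 0" "\<And>u. c1 < \<bar>u\<bar> \<Longrightarrow> W1 u = 0" "\<And>u. norm (W1 u) \<le> V1"
    "\<And>u v. norm (W1 u - W1 v) \<le> L * \<bar>u - v\<bar>"
    using test_function_bounds[OF assms(6)] by blast
  obtain c2 V2 L2 where W2: "c2 \<ge> 1" "V2 \<ge> 0" "L2 \<ge> 0" "\<And>u. c2 < \<bar>u\<bar> \<Longrightarrow> W2 u = 0" "\<And>u. norm (W2 u) \<le> V2"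
    "\<And>u v. norm (W2 u - W2 v) \<le> L2 * \<bar>u - v\<bar>"
    using test_function_bounds[OF assms(7)] by blast
  define c where "c = max c1 c2"
  define V where "V = max V1 V2"
  have c: "c \<ge> 1" "\<And>u. c < \<bar>u\<bar> \<Longrightarrow> W1 u = 0" "\<And>u. c < \<bar>u\<bar> \<Longrightarrow> W2 u = 0"
    using W1(1,4) W2(1,4) by (auto simp: c_def)
  have V: "V \<ge> 0" "\<And>u. norm (W1 u) \<le> V" "\<And>u. norm (W2 u) \<le> V"
    using W1(2,5) W2(2,5) by (auto simp: V_def le_max_iff_disj)
  \<comment> \<open>Neither \<open>K1\<close> nor \<open>K2\<close> involves \<delta>, X or H, as
    the order of the quantifiers requires.\<close>
  define K1 where "K1 = C * (V + c * L) * (sqrt c * (1 + ln c)) * ((V\<^sup>2 * B1 * c + B2 * (2 * c)) / 2) * (1 + 1 / \<epsilon>)"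
  define K2 where "K2 = c * (\<Sum>h | 1 \<le> h \<and> real h \<le> c * c powr \<epsilon>. norm (lam h) * V *
        (\<Sum>n | 1 \<le> n \<and> real n \<le> c. norm (A1 1 n) * V * norm (A2 1 (n + h)))) * c powr (1 + \<epsilon>)"
  have "norm (shifted_conv_avg lam A1 A2 W1 W2 H X) \<le> max K1 K2 * X powr (1 - \<delta> + \<epsilon>)"
    if "\<delta> > 0" "X > 0" "H > 0" "X powr (1/2 + \<delta>) \<le> H" "H < X powr (1 - \<epsilon>)" for \<delta> X H
  proof (cases "X \<ge> 1")
    case True
    have "norm (shifted_conv_avg lam A1 A2 W1 W2 H X) \<le> K1 * X powr (1 - \<delta> + \<epsilon>)"
      unfolding K1_def
      by (rule shifted_conv_avg_bound_large) (fact C B1 B2 c V W1 assms that True)+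
    also have "\<dots> \<le> max K1 K2 * X powr (1 - \<delta> + \<epsilon>)" by (intro mult_right_mono) auto
    finally show ?thesis .
  next
    case False
    hence X: "X < 1" by simp
    have "norm (shifted_conv_avg lam A1 A2 W1 W2 H X) \<le> K2 * X powr (1 - \<delta> + \<epsilon>)"
      unfolding K2_def
      by (rule shifted_conv_avg_bound_small) (fact c V assms that X)+
    also have "\<dots> \<le> max K1 K2 * X powr (1 - \<delta> + \<epsilon>)" by (intro mult_right_mono) auto
    finally show ?thesis .
  qed
  thus ?thesis by blast
qed

end
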